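(* Assume (H1)–(H3) as written out in the context, let $\lambda_*=\lambda_j(k_* )$ be a point lying on an isolated arc of homoclinic essential spectrum (as defined in the context), and suppose that $D^0_1$ and $D^0_2$ both have zeros of degree exactly $m$ at $\lambda_*$. Write $\gamma=e^{ikX^\varepsilon}$, $k\in\mathbb R$. Then there exist $C_1>0$ and $\eta>0$ such that for any $C>0$ and any $0<\tilde\eta<\eta$, for $X^\varepsilon$ sufficiently large, the $\gamma$-eigenvalues in $B(\lambda_*,C/X^\varepsilon)$ (i.e. the zeros of $E^\varepsilon(\cdot,\gamma)$ there, counted with multiplicity) consist of points lying within $C_1/X^\varepsilon$ of $$\{\lambda_j(\kappa):\ \kappa\equiv k\bmod 2\pi/X^\varepsilon\},$$ plus $m$ points lying within $C_1e^{-\tilde\eta X^\varepsilon/(2(m+1))}$ of $\lambda_*$.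
   Context: Setting. For $\varepsilon\ge 0$ in a one-parameter family, consider first-order $N\times N$ systems $W'=A^\varepsilon(x,\lambda)W$, $\lambda\in\mathbb C$ (the eigenvalue equations of linearizations about periodic waves $\bar u^\varepsilon$, $\varepsilon>0$, and a limiting homoclinic wave, $\varepsilon=0$), where $A^\varepsilon$ is analytic in $\lambda$, $C^1$ in $x$, continuous in $\varepsilon$ for $\varepsilon>0$, and, for $\varepsilon>0$, periodic in $x$ with period $X^\varepsilon>0$. Hypotheses (for each $M>0$, with $C(M)>0$ and $\nu,\bar\theta>0$ independent of $\varepsilon$): (H1) $X^\varepsilon\to\infty$ as $\varepsilon\to0$. (H2) There is a matrix $A^0_\infty(\lambda)$, independent of $x$, with $|A^0(x,\lambda)-A^0_\infty(\lambda)|\le C(M)e^{-\nu|x|}$ for all $x\in\mathbb R$, $|\lambda|\le M$. (H3) $|A^\varepsilon(x,\lambda)-A^0(x,\lambda)|\le C(M)e^{-\bar\theta X^\varepsilon/2}$ for $|\lambda|\le M$, $|x|\le X^\varepsilon/2$. Periodic Evans function. For $\varepsilon>0$ let $\Psi^\varepsilon(x,\lambda)$ be the solution operator of $W'=A^\varepsilon W$ with $\Psi^\varepsilon(0,\lambda)=\mathrm{Id}$. For $|\gamma|=1$, $E^\varepsilon(\lambda,\gamma)=\det(\Psi^\varepsilon(X^\varepsilon,\lambda)-\gamma\,\mathrm{Id})$; its zeros $\lambda$ are the $\gamma$-eigenvalues of $\bar u^\varepsilon$. Domains of hyperbolicity. The set of $\lambda$ for which $A^0_\infty(\lambda)$ has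 a purely imaginary eigenvalue $ik$, $k\in\mathbb R$, is a finite union of curves $\lambda_j(k)$ (the homoclinic essential spectrum); the open connected components $\Lambda_r$ of its complement are the domains of hyperbolicity. Isolated arc. $\lambda_*=\lambda_j(k_* )$ lies on an isolated arc if it lies on a single curve $\lambda_j$ and $k_*$ is a nondegenerate root and the unique solution of $\lambda_j(k)=\lambda_*$: that is, $ik_*$ is a simple eigenvalue of $A^0_\infty(\lambda_* )$, all other eigenvalues of $A^0_\infty(\lambda_* )$ have nonzero real part, and, with $\mu_c(\lambda)$ the analytic eigenvalue of $A^0_\infty(\lambda)$ near $\lambda_*$ with $\mu_c(\lambda_* )=ik_*$, one has $\mu_c'(\lambda_* )\ne0$, the curve $\lambda_j$ near $k_*$ being given by $\mu_c(\lambda_j(k))=ik$. Near $\lambda_*$, $\lambda_j$ separates two domains of hyperbolicity $\Lambda_1$ and $\Lambda_2$, labelled so that $\Re\mu_c>0$ on $\Lambda_1$ and $\Re\mu_c<0$ on $\Lambda_2$ (near $\lambda_*$). Let $\Pi_c,\Pi_{ss},\Pi_{su}$ be the spectral projections of $A^0_\infty(\lambda)$, analytic near $\lambda_*$, which at $\lambda_*$ are the center, stable and unstable projections. Conjugators. $P^0_\pm(x,\lambda)$ ($x\ge0$, resp. $x\le 0$) denote bounded, uniformly invertible matrix functions, analytic in $\lambda$ near $\lambda_*$, with $(P^0_\pm)'=A^0P^0_\pm-P^0_\pm A^0_\infty$ and $P^0_\pm-\mathrm{Id}=O(e^{-\bar\eta|x|})$ for some (any) $0<\bar\eta<\min(\bar\theta,\nu)$.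 (Such $P^0_\pm$ exist.) Homoclinic Evans functions. On a domain $\Lambda_r$, $D^0_r(\lambda)=\det(P^0_-R^-_\infty,P^0_+R^+_\infty)|_{x=0}/\det(R^-_\infty,R^+_\infty)$, where the columns of $R^-_\infty$, $R^+_\infty$ are any bases of the unstable and stable subspaces of $A^0_\infty(\lambda)$. Both $D^0_1$ and $D^0_2$ extend analytically to a neighborhood of $\lambda_*$: with $R^{su},R^c,R^{ss}$ bases of the ranges of $\Pi_{su},\Pi_c,\Pi_{ss}$, $$D^0_1=\frac{\det(P^0_-R^{su},P^0_-R^c,P^0_+R^{ss})|_{x=0}}{\det(R^{su},R^c,R^{ss})},\qquad D^0_2=\frac{\det(P^0_-R^{su},P^0_+R^c,P^0_+R^{ss})|_{x=0}}{\det(R^{su},R^c,R^{ss})}.$$ Here $m\ge1$ is an integer. $B(\lambda_*,\rho)$ is the open disk of radius $\rho$ about $\lambda_*$ in $\mathbb C$. *)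

theory Defs
  imports
    "HOL-Complex_Analysis.Complex_Analysis"
    "HOL-Computational_Algebra.Polynomial"
    "HOL-Library.Multiset"
    "HOL-Library.Real_Mod"
begin

section \<open>Linear algebra over the complex numbers\<close>

definition eigenvalue :: "complex^'n^'n \<Rightarrow> complex \<Rightarrow> bool" where
  "eigenvalue A \<mu> \<longleftrightarrow> (\<exists>v. v \<noteq> 0 \<and> A *v v = \<mu> *s v)"

definition charpoly :: "complex^'n^'n \<Rightarrow> complex poly" where
  "charpoly A = det (mat [:0, 1:] - map_matrix (\<lambda>c. [:c:]) A)"

definition simple_eigenvalue :: "complex^'n^'n \<Rightarrow> complex \<Rightarrow> bool" where
  "simple_eigenvalue A \<mu> \<longleftrightarrow> order \<mu> (charpoly A) = 1"

definition gen_eigenspace :: "complex^'n^'n \<Rightarrow> complex \<Rightarrow> (complex^'n) set" where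
  "gen_eigenspace A \<mu> = {v. \<exists>p. (((*v) (A - mat \<mu>)) ^^ p) v = 0}"

definition spectral_subspace :: "complex^'n^'n \<Rightarrow> complex set \<Rightarrow> (complex^'n) set" where
  "spectral_subspace A \<Sigma> = vec.span (\<Union>\<mu>\<in>\<Sigma>. gen_eigenspace A \<mu>)"

abbreviation stable_subspace :: "complex^'n^'n \<Rightarrow> (complex^'n) set" where
  "stable_subspace A \<equiv> spectral_subspace A {\<mu>. Re \<mu> < 0}"

abbreviation unstable_subspace :: "complex^'n^'n \<Rightarrow> (complex^'n) set" where
  "unstable_subspace A \<equiv> spectral_subspace A {\<mu>. Re \<mu> > 0}"

definition spectral_projection ::
  "complex^'n^'n \<Rightarrow> complex set \<Rightarrow> complex^'n^'n \<Rightarrow> bool" where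
  "spectral_projection A \<Sigma> Q \<longleftrightarrow>
     Q ** Q = Q \<and> range ((*v) Q) = spectral_subspace A \<Sigma> \<and>
     {v. Q *v v = 0} = spectral_subspace A (- \<Sigma>)"

definition matrix_analytic_on ::
  "(complex \<Rightarrow> complex^'n^'n) \<Rightarrow> complex set \<Rightarrow> bool" where
  "matrix_analytic_on F S \<longleftrightarrow> (\<forall>i j. (\<lambda>z. F z $ i $ j) analytic_on S)"

text \<open>The second conjunct excludes functions vanishing identically near \<open>z\<close>, for which
  \<open>zorder\<close> is meaningless. Degree \<open>0\<close> means \<open>f z \<noteq> 0\<close>.\<close>

definition zero_of_degree :: "(complex \<Rightarrow> complex) \<Rightarrow> complex \<Rightarrow> nat \<Rightarrow> bool" where
  "zero_of_degree f z d \<longleftrightarrow>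
     f analytic_on {z} \<and> (\<forall>\<^sub>F w in at z. f w \<noteq> 0) \<and> zorder f z = int d"


section \<open>The family of systems and the periodic Evans function\<close>

text \<open>The systems are \<open>W' = A \<epsilon> x \<zeta> *v W\<close>, with \<open>\<epsilon> = 0\<close> the homoclinic limit and
  \<open>X \<epsilon>\<close> the period for \<open>\<epsilon> > 0\<close>.\<close>

definition wave_family ::
  "(real \<Rightarrow> real \<Rightarrow> complex \<Rightarrow> complex^'n^'n) \<Rightarrow> (real \<Rightarrow> real) \<Rightarrow> bool" where
  "wave_family A X \<longleftrightarrow>
     (\<forall>\<epsilon>\<ge>0. \<forall>x. matrix_analytic_on (A \<epsilon> x) UNIV) \<and>
     (\<forall>\<epsilon>\<ge>0. \<forall>\<zeta>. (\<lambda>x. A \<epsilon> x \<zeta>) C1_differentiable_on UNIV) \<and>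
     (\<forall>x \<zeta>. continuous_on {0<..} (\<lambda>\<epsilon>. A \<epsilon> x \<zeta>)) \<and>
     (\<forall>\<epsilon>>0. X \<epsilon> > 0 \<and> (\<forall>x \<zeta>. A \<epsilon> (x + X \<epsilon>) \<zeta> = A \<epsilon> x \<zeta>))"

definition solution_operator ::
  "(real \<Rightarrow> complex \<Rightarrow> complex^'n^'n) \<Rightarrow> (real \<Rightarrow> complex \<Rightarrow> complex^'n^'n) \<Rightarrow> bool" where
  "solution_operator B \<Psi> \<longleftrightarrow>
     (\<forall>\<zeta>. \<Psi> 0 \<zeta> = mat 1 \<and>
        (\<forall>x. ((\<lambda>y. \<Psi> y \<zeta>) has_vector_derivative B x \<zeta> ** \<Psi> x \<zeta>) (at x)))"

definition periodic_evans ::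
  "(real \<Rightarrow> complex \<Rightarrow> complex^'n^'n) \<Rightarrow> real \<Rightarrow> complex \<Rightarrow> complex \<Rightarrow> complex" where
  "periodic_evans \<Psi> L \<gamma> \<zeta> = det (\<Psi> L \<zeta> - mat \<gamma>)"


section \<open>Homoclinic essential spectrum and isolated arcs\<close>

definition hom_ess_spectrum :: "(complex \<Rightarrow> complex^'n^'n) \<Rightarrow> complex set" where
  "hom_ess_spectrum Ainf = {\<zeta>. \<exists>k::real. eigenvalue (Ainf \<zeta>) (\<i> * of_real k)}"

definition domains_of_hyperbolicity :: "(complex \<Rightarrow> complex^'n^'n) \<Rightarrow> complex set set" where
  "domains_of_hyperbolicity Ainf = components (- hom_ess_spectrum Ainf)"

definition ess_spectrum_curves ::
  "(complex \<Rightarrow> complex^'n^'n) \<Rightarrow> nat \<Rightarrow> (nat \<Rightarrow> real \<Rightarrow> complex) \<Rightarrow> bool" where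
  "ess_spectrum_curves Ainf J lam \<longleftrightarrow>
     (\<forall>j<J. continuous_on UNIV (lam j)) \<and>
     (\<forall>j<J. \<forall>k. eigenvalue (Ainf (lam j k)) (\<i> * of_real k)) \<and>
     hom_ess_spectrum Ainf = (\<Union>j<J. range (lam j))"

text \<open>The point \<open>lam j k0\<close> lies on an isolated arc; \<open>muc\<close> is the analytic continuation
  of its critical eigenvalue \<open>\<i> k0\<close>.\<close>

definition isolated_arc ::
  "(complex \<Rightarrow> complex^'n^'n) \<Rightarrow> nat \<Rightarrow> (nat \<Rightarrow> real \<Rightarrow> complex) \<Rightarrow> nat \<Rightarrow> real \<Rightarrow>
   (complex \<Rightarrow> complex) \<Rightarrow> bool" where
  "isolated_arc Ainf J lam j k0 muc \<longleftrightarrow>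
     j < J \<and>
     (\<forall>i<J. lam j k0 \<in> range (lam i) \<longrightarrow> i = j) \<and>
     (\<forall>k. lam j k = lam j k0 \<longrightarrow> k = k0) \<and>
     simple_eigenvalue (Ainf (lam j k0)) (\<i> * of_real k0) \<and>
     (\<forall>\<mu>. eigenvalue (Ainf (lam j k0)) \<mu> \<and> \<mu> \<noteq> \<i> * of_real k0 \<longrightarrow> Re \<mu> \<noteq> 0) \<and>
     muc analytic_on {lam j k0} \<and>
     (\<forall>\<^sub>F \<zeta> in nhds (lam j k0). eigenvalue (Ainf \<zeta>) (muc \<zeta>)) \<and>
     muc (lam j k0) = \<i> * of_real k0 \<and>
     deriv muc (lam j k0) \<noteq> 0 \<and>
     (\<forall>\<^sub>F k in nhds k0. muc (lam j k) = \<i> * of_real k)"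

text \<open>At the point \<open>\<zeta>\<^sub>0\<close> of an isolated arc \<open>muc \<zeta>\<^sub>0\<close> is the only imaginary eigenvalue, so
  there the three projections are the center, stable and unstable ones. Near \<open>\<zeta>\<^sub>0\<close> the other
  eigenvalues stay off the imaginary axis, so that these three spectral sets continue the
  ones at \<open>\<zeta>\<^sub>0\<close>; \<open>muc \<zeta>\<close> has to be removed from the half planes because it can enter either.\<close>

definition critical_projections ::
  "(complex \<Rightarrow> complex^'n^'n) \<Rightarrow> (complex \<Rightarrow> complex) \<Rightarrow> complex \<Rightarrow>
   (complex \<Rightarrow> complex^'n^'n) \<Rightarrow> (complex \<Rightarrow> complex^'n^'n) \<Rightarrow> (complex \<Rightarrow> complex^'n^'n) \<Rightarrow> bool" where
  "critical_projections Ainf muc \<zeta>\<^sub>0 \<Pi>c \<Pi>ss \<Pi>su \<longleftrightarrow>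
     matrix_analytic_on \<Pi>c {\<zeta>\<^sub>0} \<and> matrix_analytic_on \<Pi>ss {\<zeta>\<^sub>0} \<and> matrix_analytic_on \<Pi>su {\<zeta>\<^sub>0} \<and>
     (\<forall>\<^sub>F \<zeta> in nhds \<zeta>\<^sub>0.
        spectral_projection (Ainf \<zeta>) {muc \<zeta>} (\<Pi>c \<zeta>) \<and>
        spectral_projection (Ainf \<zeta>) ({\<mu>. Re \<mu> < 0} - {muc \<zeta>}) (\<Pi>ss \<zeta>) \<and>
        spectral_projection (Ainf \<zeta>) ({\<mu>. Re \<mu> > 0} - {muc \<zeta>}) (\<Pi>su \<zeta>))"


section \<open>Conjugators and homoclinic Evans functions\<close>

text \<open>A conjugator on the half line \<open>H\<close>, which is \<open>{0..}\<close> for \<open>P\<^sub>+\<close> and \<open>{..0}\<close> for \<open>P\<^sub>-\<close>.\<close>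

definition conjugator ::
  "(real \<Rightarrow> complex \<Rightarrow> complex^'n^'n) \<Rightarrow> (complex \<Rightarrow> complex^'n^'n) \<Rightarrow> complex \<Rightarrow> real \<Rightarrow>
   real set \<Rightarrow> (real \<Rightarrow> complex \<Rightarrow> complex^'n^'n) \<Rightarrow> bool" where
  "conjugator A0 Ainf \<zeta>\<^sub>0 \<beta> H P \<longleftrightarrow>
     (\<exists>r>0. \<exists>K. 
        (\<forall>x\<in>H. matrix_analytic_on (P x) (ball \<zeta>\<^sub>0 r)) \<and>
        (\<forall>x\<in>H. \<forall>\<zeta>\<in>ball \<zeta>\<^sub>0 r.
           ((\<lambda>y. P y \<zeta>) has_vector_derivative A0 x \<zeta> ** P x \<zeta> - P x \<zeta> ** Ainf \<zeta>) (at x within H) \<and>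
           norm (P x \<zeta>) \<le> K \<and>
           invertible (P x \<zeta>) \<and> norm (matrix_inv (P x \<zeta>)) \<le> K \<and>
           norm (P x \<zeta> - mat 1) \<le> K * exp (- \<beta> * \<bar>x\<bar>)))"

text \<open>The columns of \<open>R\<close> with index in \<open>S\<close> form a basis of \<open>V\<close>, the others a basis of \<open>W\<close>,
  where \<open>V\<close> and \<open>W\<close> are complementary.\<close>

definition adapted_basis ::
  "complex^'n^'n \<Rightarrow> 'n set \<Rightarrow> (complex^'n) set \<Rightarrow> (complex^'n) set \<Rightarrow> bool" where
  "adapted_basis R S V W \<longleftrightarrow>
     invertible R \<and>
     vec.span ((\<lambda>j. column j R) ` S) = V \<and> vec.span ((\<lambda>j. column j R) ` (- S)) = W"

text \<open>\<open>glued_columns S M M'\<close> is the matrix with the columns of \<open>M\<close> indexed by \<open>S\<close> and the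
  columns of \<open>M'\<close> indexed by \<open>- S\<close>. Keeping the position of each column makes the quotient below
  independent of the ordering of the basis vectors.\<close>

definition glued_columns :: "'n set \<Rightarrow> complex^'n^'n \<Rightarrow> complex^'n^'n \<Rightarrow> complex^'n^'n" where
  "glued_columns S M M' = (\<chi> i j. if j \<in> S then M $ i $ j else M' $ i $ j)"

text \<open>\<open>det (Pm R\<^sup>-, Pp R\<^sup>+) / det (R\<^sup>-, R\<^sup>+)\<close> for any bases \<open>R\<^sup>-\<close> of \<open>V\<close> and \<open>R\<^sup>+\<close> of \<open>W\<close>;
  see \<open>evans_quotient_eq\<close>.\<close>

definition evans_quotient ::
  "complex^'n^'n \<Rightarrow> complex^'n^'n \<Rightarrow> (complex^'n) set \<Rightarrow> (complex^'n) set \<Rightarrow> complex" where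
  "evans_quotient Pm Pp V W =
     (THE d. \<exists>R S. adapted_basis R S V W \<and>
        d = det (glued_columns S (Pm ** R) (Pp ** R)) / det R)"

definition hom_evans ::
  "(complex \<Rightarrow> complex^'n^'n) \<Rightarrow> (real \<Rightarrow> complex \<Rightarrow> complex^'n^'n) \<Rightarrow>
   (real \<Rightarrow> complex \<Rightarrow> complex^'n^'n) \<Rightarrow> complex \<Rightarrow> complex" where
  "hom_evans Ainf Pm Pp \<zeta> =
     evans_quotient (Pm 0 \<zeta>) (Pp 0 \<zeta>) (unstable_subspace (Ainf \<zeta>)) (stable_subspace (Ainf \<zeta>))"

text \<open>The analytic extensions through an isolated arc of \<open>hom_evans\<close> from the side where
  \<open>Re muc > 0\<close> and from the side where \<open>Re muc < 0\<close>. A basis of the span of the ranges of two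
  projections is obtained by joining bases of the ranges; see \<open>hom_evans_1_blocks\<close>,
  \<open>hom_evans_2_blocks\<close>.\<close>

definition hom_evans_1 ::
  "(real \<Rightarrow> complex \<Rightarrow> complex^'n^'n) \<Rightarrow> (real \<Rightarrow> complex \<Rightarrow> complex^'n^'n) \<Rightarrow>
   (complex \<Rightarrow> complex^'n^'n) \<Rightarrow> (complex \<Rightarrow> complex^'n^'n) \<Rightarrow> (complex \<Rightarrow> complex^'n^'n) \<Rightarrow>
   complex \<Rightarrow> complex" where
  "hom_evans_1 Pm Pp \<Pi>c \<Pi>ss \<Pi>su \<zeta> =
     evans_quotient (Pm 0 \<zeta>) (Pp 0 \<zeta>)
       (vec.span (range ((*v) (\<Pi>su \<zeta>)) \<union> range ((*v) (\<Pi>c \<zeta>)))) (range ((*v) (\<Pi>ss \<zeta>)))"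

definition hom_evans_2 ::
  "(real \<Rightarrow> complex \<Rightarrow> complex^'n^'n) \<Rightarrow> (real \<Rightarrow> complex \<Rightarrow> complex^'n^'n) \<Rightarrow>
   (complex \<Rightarrow> complex^'n^'n) \<Rightarrow> (complex \<Rightarrow> complex^'n^'n) \<Rightarrow> (complex \<Rightarrow> complex^'n^'n) \<Rightarrow>
   complex \<Rightarrow> complex" where
  "hom_evans_2 Pm Pp \<Pi>c \<Pi>ss \<Pi>su \<zeta> =
     evans_quotient (Pm 0 \<zeta>) (Pp 0 \<zeta>)
       (range ((*v) (\<Pi>su \<zeta>))) (vec.span (range ((*v) (\<Pi>c \<zeta>)) \<union> range ((*v) (\<Pi>ss \<zeta>))))"


subsection \<open>Independence of the bases, and agreement on the domains of hyperbolicity\<close>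

lemma column_matrix_mult: "column j (M ** R) = M *v column j R"
  by (simp add: column_def matrix_matrix_mult_def matrix_vector_mult_def vec_eq_iff)

lemma column_glued_columns:
  "column j (glued_columns S M M') = (if j \<in> S then column j M else column j M')"
  by (simp add: glued_columns_def column_def vec_eq_iff)

lemma matrix_eq_on_span:
  fixes M M' :: "complex^'n^'n"
  assumes "\<And>v. v \<in> B \<Longrightarrow> M *v v = M' *v v" and "u \<in> vec.span B"
  shows "M *v u = M' *v u"
  by (rule vec.linear_eq_on[OF matrix_vector_mul_linear_gen matrix_vector_mul_linear_gen assms(2)])
    (rule assms(1))

lemma adapted_basis_quotient_unique:
  fixes R R' Pm Pp :: "complex^'n^'n"
  assumes R: "adapted_basis R S V W" and R': "adapted_basis R' S' V W"
  shows "det (glued_columns S (Pm ** R) (Pp ** R)) / det R =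
         det (glued_columns S' (Pm ** R') (Pp ** R')) / det R'"
proof -
  have inv: "invertible R" "invertible R'"
    using R R' by (auto simp: adapted_basis_def)
  then obtain T where T: "T ** R = mat 1"
    by (auto simp: invertible_def)
  define Q where "Q = glued_columns S (Pm ** R) (Pp ** R) ** T"
  have QR: "Q ** R = glued_columns S (Pm ** R) (Pp ** R)"
    unfolding Q_def using matrix_mul_assoc[of _ T R] T by (metis matrix_mul_rid)
  have Qc: "Q *v column j R = (if j \<in> S then Pm *v column j R else Pp *v column j R)" for j
    using arg_cong[OF QR, of "column j"] by (simp add: column_matrix_mult column_glued_columns)
  have QV: "Q *v u = Pm *v u" if "u \<in> V" for u
  proof (rule matrix_eq_on_span)
    show "u \<in> vec.span ((\<lambda>j. column j R) ` S)" using that R by (simp add: adapted_basis_def)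
  qed (auto simp: Qc)
  have QW: "Q *v u = Pp *v u" if "u \<in> W" for u
  proof (rule matrix_eq_on_span)
    show "u \<in> vec.span ((\<lambda>j. column j R) ` (- S))" using that R by (simp add: adapted_basis_def)
  qed (auto simp: Qc)
  have "column j R' \<in> V" if "j \<in> S'" for j
    using R' that by (auto simp: adapted_basis_def intro!: vec.span_base)
  moreover have "column j R' \<in> W" if "j \<notin> S'" for j
    using R' that by (auto simp: adapted_basis_def intro!: vec.span_base)
  ultimately have col: "column j (Q ** R') = column j (glued_columns S' (Pm ** R') (Pp ** R'))" for j
    by (simp add: column_matrix_mult column_glued_columns QV QW)
  have QR': "Q ** R' = glued_columns S' (Pm ** R') (Pp ** R')"
    using col by (simp add: vec_eq_iff column_def)
  have "det R \<noteq> 0" "det R' \<noteq> 0"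
    using inv by (auto simp: invertible_det_nz)
  then show ?thesis
    unfolding QR[symmetric] QR'[symmetric] by (simp add: det_mul)
qed

lemma evans_quotient_eq:
  assumes "adapted_basis R S V W"
  shows "evans_quotient Pm Pp V W = det (glued_columns S (Pm ** R) (Pp ** R)) / det R"
  unfolding evans_quotient_def
proof (rule the_equality)
  show "\<exists>R' S'. adapted_basis R' S' V W \<and>
    det (glued_columns S (Pm ** R) (Pp ** R)) / det R =
    det (glued_columns S' (Pm ** R') (Pp ** R')) / det R'"
    using assms by blast
next
  fix d
  assume "\<exists>R' S'. adapted_basis R' S' V W \<and>
    d = det (glued_columns S' (Pm ** R') (Pp ** R')) / det R'"
  then show "d = det (glued_columns S (Pm ** R) (Pp ** R)) / det R"
    using adapted_basis_quotient_unique[OF _ assms] by blast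
qed

lemma span_span_Un: "vec.span (vec.span B \<union> vec.span C) = vec.span (B \<union> C)"
proof (rule antisym)
  show "vec.span (vec.span B \<union> vec.span C) \<subseteq> vec.span (B \<union> C)"
    by (simp add: vec.span_minimal vec.span_mono)
  show "vec.span (B \<union> C) \<subseteq> vec.span (vec.span B \<union> vec.span C)"
    by (rule vec.span_mono) (meson Un_mono vec.span_superset)
qed

lemma hom_evans_1_blocks:
  assumes "invertible R"
    and "Ssu \<union> Sc \<union> Sss = UNIV" "Ssu \<inter> Sss = {}" "Sc \<inter> Sss = {}"
    and "vec.span ((\<lambda>j. column j R) ` Ssu) = range ((*v) (\<Pi>su \<zeta>))"
    and "vec.span ((\<lambda>j. column j R) ` Sc) = range ((*v) (\<Pi>c \<zeta>))"
    and "vec.span ((\<lambda>j. column j R) ` Sss) = range ((*v) (\<Pi>ss \<zeta>))"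
  shows "hom_evans_1 Pm Pp \<Pi>c \<Pi>ss \<Pi>su \<zeta> =
    det (glued_columns (Ssu \<union> Sc) (Pm 0 \<zeta> ** R) (Pp 0 \<zeta> ** R)) / det R"
proof -
  have "- (Ssu \<union> Sc) = Sss" using assms(2-4) by auto
  then have "adapted_basis R (Ssu \<union> Sc)
      (vec.span (range ((*v) (\<Pi>su \<zeta>)) \<union> range ((*v) (\<Pi>c \<zeta>)))) (range ((*v) (\<Pi>ss \<zeta>)))"
    unfolding adapted_basis_def assms(5-7)[symmetric] span_span_Un
    using assms(1) by (simp add: image_Un)
  then show ?thesis unfolding hom_evans_1_def by (rule evans_quotient_eq)
qed

lemma hom_evans_2_blocks:
  assumes "invertible R"
    and "Ssu \<union> Sc \<union> Sss = UNIV" "Ssu \<inter> Sc = {}" "Ssu \<inter> Sss = {}"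
    and "vec.span ((\<lambda>j. column j R) ` Ssu) = range ((*v) (\<Pi>su \<zeta>))"
    and "vec.span ((\<lambda>j. column j R) ` Sc) = range ((*v) (\<Pi>c \<zeta>))"
    and "vec.span ((\<lambda>j. column j R) ` Sss) = range ((*v) (\<Pi>ss \<zeta>))"
  shows "hom_evans_2 Pm Pp \<Pi>c \<Pi>ss \<Pi>su \<zeta> =
    det (glued_columns Ssu (Pm 0 \<zeta> ** R) (Pp 0 \<zeta> ** R)) / det R"
proof -
  have "- Ssu = Sc \<union> Sss" using assms(2-4) by auto
  then have "adapted_basis R Ssu
      (range ((*v) (\<Pi>su \<zeta>))) (vec.span (range ((*v) (\<Pi>c \<zeta>)) \<union> range ((*v) (\<Pi>ss \<zeta>))))"
    unfolding adapted_basis_def assms(5-7)[symmetric] span_span_Un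
    using assms(1) by (simp add: image_Un)
  then show ?thesis unfolding hom_evans_2_def by (rule evans_quotient_eq)
qed

lemma spectral_subspace_Un:
  "spectral_subspace A (\<Sigma> \<union> \<Sigma>') = vec.span (spectral_subspace A \<Sigma> \<union> spectral_subspace A \<Sigma>')"
  unfolding spectral_subspace_def span_span_Un by (simp add: UN_Un)

lemma hom_evans_1_extends:
  assumes "critical_projections Ainf muc \<zeta>\<^sub>0 \<Pi>c \<Pi>ss \<Pi>su"
    and "\<Lambda>\<^sub>1 \<in> domains_of_hyperbolicity Ainf"
    and "\<forall>\<^sub>F \<zeta> in nhds \<zeta>\<^sub>0. \<zeta> \<in> \<Lambda>\<^sub>1 \<longrightarrow> Re (muc \<zeta>) > 0"
  shows "\<forall>\<^sub>F \<zeta> in nhds \<zeta>\<^sub>0. \<zeta> \<in> \<Lambda>\<^sub>1 \<longrightarrow> hom_evans_1 Pm Pp \<Pi>c \<Pi>ss \<Pi>su \<zeta> = hom_evans Ainf Pm Pp \<zeta>"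
proof -
  have "\<forall>\<^sub>F \<zeta> in nhds \<zeta>\<^sub>0.
        spectral_projection (Ainf \<zeta>) {muc \<zeta>} (\<Pi>c \<zeta>) \<and>
        spectral_projection (Ainf \<zeta>) ({\<mu>. Re \<mu> < 0} - {muc \<zeta>}) (\<Pi>ss \<zeta>) \<and>
        spectral_projection (Ainf \<zeta>) ({\<mu>. Re \<mu> > 0} - {muc \<zeta>}) (\<Pi>su \<zeta>)"
    using assms(1) by (simp add: critical_projections_def)
  with assms(3) show ?thesis
  proof eventually_elim
    case (elim \<zeta>)
    show ?case
    proof
      assume "\<zeta> \<in> \<Lambda>\<^sub>1"
      with elim have pos: "Re (muc \<zeta>) > 0" by simp
      have "({\<mu>. Re \<mu> > 0} - {muc \<zeta>}) \<union> {muc \<zeta>} = {\<mu>. Re \<mu> > 0}"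
        and "{\<mu>. Re \<mu> < 0} - {muc \<zeta>} = {\<mu>. Re \<mu> < 0}"
        using pos by auto
      with elim show "hom_evans_1 Pm Pp \<Pi>c \<Pi>ss \<Pi>su \<zeta> = hom_evans Ainf Pm Pp \<zeta>"
        unfolding hom_evans_1_def hom_evans_def spectral_projection_def
        by (simp add: spectral_subspace_Un[symmetric])
    qed
  qed
qed

lemma hom_evans_2_extends:
  assumes "critical_projections Ainf muc \<zeta>\<^sub>0 \<Pi>c \<Pi>ss \<Pi>su"
    and "\<Lambda>\<^sub>2 \<in> domains_of_hyperbolicity Ainf"
    and "\<forall>\<^sub>F \<zeta> in nhds \<zeta>\<^sub>0. \<zeta> \<in> \<Lambda>\<^sub>2 \<longrightarrow> Re (muc \<zeta>) < 0"
  shows "\<forall>\<^sub>F \<zeta> in nhds \<zeta>\<^sub>0. \<zeta> \<in> \<Lambda>\<^sub>2 \<longrightarrow> hom_evans_2 Pm Pp \<Pi>c \<Pi>ss \<Pi>su \<zeta> = hom_evans Ainf Pm Pp \<zeta>"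
proof -
  have "\<forall>\<^sub>F \<zeta> in nhds \<zeta>\<^sub>0.
        spectral_projection (Ainf \<zeta>) {muc \<zeta>} (\<Pi>c \<zeta>) \<and>
        spectral_projection (Ainf \<zeta>) ({\<mu>. Re \<mu> < 0} - {muc \<zeta>}) (\<Pi>ss \<zeta>) \<and>
        spectral_projection (Ainf \<zeta>) ({\<mu>. Re \<mu> > 0} - {muc \<zeta>}) (\<Pi>su \<zeta>)"
    using assms(1) by (simp add: critical_projections_def)
  with assms(3) show ?thesis
  proof eventually_elim
    case (elim \<zeta>)
    show ?case
    proof
      assume "\<zeta> \<in> \<Lambda>\<^sub>2"
      with elim have neg: "Re (muc \<zeta>) < 0" by simp
      have "{muc \<zeta>} \<union> ({\<mu>. Re \<mu> < 0} - {muc \<zeta>}) = {\<mu>. Re \<mu> < 0}"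
        and "{\<mu>. Re \<mu> > 0} - {muc \<zeta>} = {\<mu>. Re \<mu> > 0}"
        using neg by auto
      with elim show "hom_evans_2 Pm Pp \<Pi>c \<Pi>ss \<Pi>su \<zeta> = hom_evans Ainf Pm Pp \<zeta>"
        unfolding hom_evans_2_def hom_evans_def spectral_projection_def
        by (simp add: spectral_subspace_Un[symmetric])
    qed
  qed
qed

end

theory Submission
  imports Defs "HOL-Real_Asymp.Real_Asymp"
begin

text \<open>On a half period the conjugators reduce the periodic system to the constant coefficient one up to
  an exponentially small error, so that \<open>\<Psi> (\<plusminus> X / 2)\<close> factors into block triangular matrices with
  respect to the unstable, critical and stable subspaces. The two half periods are glued in the
  determinant of \<open>\<Psi> (X / 2) - \<gamma> \<Psi> (- X / 2)\<close>; dividing out the nonvanishing growth factors leaves,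
  because the critical subspace is one-dimensional, \<open>exp (\<mu> X) D1 - \<gamma> D2\<close> plus an exponentially
  small error, uniformly for \<open>\<bar>\<zeta> - \<zeta>\<^sub>0\<bar> \<le> 1 / sqrt X\<close>. The zeros of \<open>exp (\<mu> X) = \<gamma> D2 / D1\<close> are within
  \<open>O(1 / X)\<close> of the points with \<open>exp (\<mu> X) = \<gamma>\<close>, which are those of the arc with \<open>\<kappa> \<equiv> k\<close>, and the
  common zero of order \<open>m\<close> of \<open>D1\<close> and \<open>D2\<close> accounts for the remaining ones, both by Rouche's
  theorem.\<close>

section \<open>Exponentially small and subexponential families\<close>

text \<open>Uniformity is carried by a filter on triples of \<open>\<epsilon>\<close>,
  \<open>\<zeta>\<close> and \<open>\<gamma>\<close>: the period grows, \<open>\<zeta>\<close>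
  ranges over the disc of radius \<open>1 / sqrt X\<close> and \<open>\<gamma>\<close> over the unit
  circle, so one \<open>small\<close> statement is a uniform bound. The radius is a compromise: it
  exceeds \<open>C / X\<close> eventually for every \<open>C\<close>, and
  \<open>Re \<mu> = O(1 / sqrt X)\<close> keeps the critical growth subexponential, hence harmless
  against every small term. The perturbation \<open>exp (- \<theta> X / 2)\<close> may be far weaker
  than the growth of the hyperbolic modes over a half period, so one perturbation step is not
  enough. A fixed number of pieces is used, and the triangular form is restored after each; only the
  order unstable, critical, stable matters, not the ratio of the rates. In the count the error
  \<open>exp (- \<eta>0 X)\<close> has to stay below \<open>(\<rho> / 4) ^ m * \<rho>\<close> on a
  circle of radius \<open>\<rho>\<close> or \<open>\<rho> / 4\<close>. With
  \<open>\<rho> = exp (- e X)\<close> and \<open>e = \<eta>' / (2 (m + 1))\<close> this comes down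
  to \<open>\<eta>' / 2 < \<eta>0\<close>, which explains the exponent in the statement.\<close>

locale growth_scale =
  fixes F :: "'t filter" and L :: "'t \<Rightarrow> real"
  assumes scale: "filterlim L at_top F"
begin

text \<open>The rate may depend on the family. This is what makes the class stable under finite sums
  and under multiplication by \<open>subexp\<close> families, each of which costs part of the
  rate.\<close>

definition small :: "('t \<Rightarrow> 'a::real_normed_vector) \<Rightarrow> bool" where
  "small f \<longleftrightarrow> (\<exists>\<eta>>0. \<forall>\<^sub>F t in F. norm (f t) \<le> exp (- \<eta> * L t))"

text \<open>Asking for all rates at once makes the class closed under products; it contains
  constants, \<open>L\<close> itself and exponentials of multiples of \<open>sqrt L\<close>.\<close>

definition subexp :: "('t \<Rightarrow> 'a::real_normed_vector) \<Rightarrow> bool" where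
  "subexp f \<longleftrightarrow> (\<forall>\<eta>>0. \<forall>\<^sub>F t in F. norm (f t) \<le> exp (\<eta> * L t))"

lemma eventually_L_ge: "\<forall>\<^sub>F t in F. K \<le> L t"
  using scale by (simp add: filterlim_at_top)

lemma eventually_le_exp:
  assumes "\<eta> > 0" shows "\<forall>\<^sub>F t in F. K \<le> exp (\<eta> * L t)"
proof -
  have "\<forall>\<^sub>F t in F. ln (max K 1) / \<eta> \<le> L t" by (rule eventually_L_ge)
  then show ?thesis
  proof eventually_elim
    case (elim t)
    then have "ln (max K 1) \<le> \<eta> * L t" using assms by (simp add: field_simps)
    then have "exp (ln (max K 1)) \<le> exp (\<eta> * L t)" by (simp only: exp_le_cancel_iff)
    then show ?case by simp
  qed
qed

lemma subexp_bounded: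
  assumes "\<forall>\<^sub>F t in F. norm (f t) \<le> K" shows "subexp f"
  unfolding subexp_def
proof (intro allI impI)
  fix \<eta> :: real assume "\<eta> > 0"
  from assms eventually_le_exp[OF this, of K]
  show "\<forall>\<^sub>F t in F. norm (f t) \<le> exp (\<eta> * L t)" by eventually_elim simp
qed

lemma subexp_const [simp]: "subexp (\<lambda>t. k)"
  by (rule subexp_bounded[of _ "norm k"]) simp

lemma small_zero [simp]: "small (\<lambda>t. 0)"
  unfolding small_def by (rule exI[of _ 1]) simp

lemma small_mono:
  assumes "small f" "\<forall>\<^sub>F t in F. norm (g t) \<le> norm (f t)" shows "small g"
proof -
  from assms(1) obtain \<eta> where \<eta>: "\<eta> > 0" "\<forall>\<^sub>F t in F. norm (f t) \<le> exp (- \<eta> * L t)"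
    by (auto simp: small_def)
  from \<eta>(2) assms(2) have "\<forall>\<^sub>F t in F. norm (g t) \<le> exp (- \<eta> * L t)"
    by eventually_elim simp
  then show ?thesis using \<eta>(1) by (auto simp: small_def)
qed

lemma small_cong:
  assumes "small f" "\<forall>\<^sub>F t in F. g t = f t" shows "small g"
  by (rule small_mono[OF assms(1)]) (use assms(2) in eventually_elim, simp)

lemma subexp_mono:
  assumes "subexp f" "\<forall>\<^sub>F t in F. norm (g t) \<le> norm (f t)" shows "subexp g"
  unfolding subexp_def
proof (intro allI impI)
  fix \<eta> :: real assume "\<eta> > 0"
  then have "\<forall>\<^sub>F t in F. norm (f t) \<le> exp (\<eta> * L t)" using assms(1) by (auto simp: subexp_def)
  with assms(2) show "\<forall>\<^sub>F t in F. norm (g t) \<le> exp (\<eta> * L t)" by eventually_elim simp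
qed

lemma subexp_cong:
  assumes "subexp f" "\<forall>\<^sub>F t in F. g t = f t" shows "subexp g"
  by (rule subexp_mono[OF assms(1)]) (use assms(2) in eventually_elim, simp)

lemma small_imp_subexp:
  assumes "small f" shows "subexp f"
proof -
  from assms obtain \<eta> where \<eta>: "\<eta> > 0" "\<forall>\<^sub>F t in F. norm (f t) \<le> exp (- \<eta> * L t)"
    by (auto simp: small_def)
  show ?thesis
  proof (rule subexp_bounded[of _ 1])
    from \<eta>(2) eventually_L_ge[of 0] show "\<forall>\<^sub>F t in F. norm (f t) \<le> 1"
    proof eventually_elim
      case (elim t)
      have "exp (- \<eta> * L t) \<le> 1" using elim(2) \<eta>(1) by simp
      with elim(1) show ?case by linarith
    qed
  qed
qed

text \<open>Half of the rate absorbs the constant, which is eventually below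
  \<open>exp (\<eta> / 2 * L t)\<close>.\<close>

lemma small_bound_K:
  assumes "\<eta> > 0" "\<forall>\<^sub>F t in F. norm (f t) \<le> K * exp (- \<eta> * L t)" shows "small f"
proof -
  have e: "\<forall>\<^sub>F t in F. K \<le> exp (\<eta>/2 * L t)" by (rule eventually_le_exp) (use assms in simp)
  from assms(2) e have "\<forall>\<^sub>F t in F. norm (f t) \<le> exp (- (\<eta>/2) * L t)"
  proof eventually_elim
    case (elim t)
    have "K * exp (- \<eta> * L t) \<le> exp (\<eta>/2 * L t) * exp (- \<eta> * L t)"
      using elim(2) by (intro mult_right_mono) auto
    also have "\<dots> = exp (- (\<eta>/2) * L t)" by (simp add: exp_add[symmetric] algebra_simps)
    finally show ?case using elim(1) by linarith
  qed
  then show ?thesis unfolding small_def using assms(1) by (intro exI[of _ "\<eta>/2"]) auto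
qed

lemma small_minus [simp]: "small (\<lambda>t. - f t) = small f"
  by (simp add: small_def)

lemma small_add:
  assumes "small f" "small g" shows "small (\<lambda>t. f t + g t)"
proof -
  obtain \<eta> where \<eta>: "\<eta> > 0" "\<forall>\<^sub>F t in F. norm (f t) \<le> exp (- \<eta> * L t)"
    using assms(1) by (auto simp: small_def)
  obtain \<theta> where \<theta>: "\<theta> > 0" "\<forall>\<^sub>F t in F. norm (g t) \<le> exp (- \<theta> * L t)"
    using assms(2) by (auto simp: small_def)
  show ?thesis
  proof (rule small_bound_K[of "min \<eta> \<theta>" _ 2])
    from \<eta>(2) \<theta>(2) eventually_L_ge[of 0]
    show "\<forall>\<^sub>F t in F. norm (f t + g t) \<le> 2 * exp (- min \<eta> \<theta> * L t)"
    proof eventually_elim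
      case (elim t)
      have "exp (- \<eta> * L t) \<le> exp (- min \<eta> \<theta> * L t)" "exp (- \<theta> * L t) \<le> exp (- min \<eta> \<theta> * L t)"
        using elim(3) by (auto simp: mult_right_mono)
      then show ?case using elim(1,2) norm_triangle_ineq[of "f t" "g t"] by linarith
    qed
  qed (use \<eta> \<theta> in simp)
qed

lemma small_diff: "small f \<Longrightarrow> small g \<Longrightarrow> small (\<lambda>t. f t - g t)"
  using small_add[of f "\<lambda>t. - g t"] by simp

lemma subexp_minus [simp]: "subexp (\<lambda>t. - f t) = subexp f"
  by (simp add: subexp_def)

lemma subexp_add:
  assumes "subexp f" "subexp g" shows "subexp (\<lambda>t. f t + g t)"
  unfolding subexp_def
proof (intro allI impI)
  fix \<eta> :: real assume \<eta>: "\<eta> > 0"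
  have "\<forall>\<^sub>F t in F. norm (f t) \<le> exp (\<eta>/2 * L t)" "\<forall>\<^sub>F t in F. norm (g t) \<le> exp (\<eta>/2 * L t)"
    "\<forall>\<^sub>F t in F. 2 \<le> exp (\<eta>/2 * L t)"
    using assms \<eta> eventually_le_exp[of "\<eta>/2" 2] unfolding subexp_def
    by (auto simp del: divide_const_simps dest!: spec[of _ "\<eta>/2"])
  then show "\<forall>\<^sub>F t in F. norm (f t + g t) \<le> exp (\<eta> * L t)"
  proof eventually_elim
    case (elim t)
    have "norm (f t + g t) \<le> 2 * exp (\<eta>/2 * L t)"
      using elim(1,2) norm_triangle_ineq[of "f t" "g t"] by linarith
    also have "\<dots> \<le> exp (\<eta>/2 * L t) * exp (\<eta>/2 * L t)" using elim(3) by (intro mult_right_mono) auto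
    also have "\<dots> = exp (\<eta> * L t)" by (simp add: exp_add[symmetric])
    finally show ?case .
  qed
qed

lemma subexp_diff: "subexp f \<Longrightarrow> subexp g \<Longrightarrow> subexp (\<lambda>t. f t - g t)"
  using subexp_add[of f "\<lambda>t. - g t"] by simp

lemma subexp_mult:
  fixes f g :: "'t \<Rightarrow> 'a::real_normed_algebra"
  assumes "subexp f" "subexp g" shows "subexp (\<lambda>t. f t * g t)"
  unfolding subexp_def
proof (intro allI impI)
  fix \<eta> :: real assume \<eta>: "\<eta> > 0"
  have "\<forall>\<^sub>F t in F. norm (f t) \<le> exp (\<eta>/2 * L t)" "\<forall>\<^sub>F t in F. norm (g t) \<le> exp (\<eta>/2 * L t)"
    using assms \<eta> unfolding subexp_def by (auto simp del: divide_const_simps dest!: spec[of _ "\<eta>/2"])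
  then show "\<forall>\<^sub>F t in F. norm (f t * g t) \<le> exp (\<eta> * L t)"
  proof eventually_elim
    case (elim t)
    have "norm (f t * g t) \<le> norm (f t) * norm (g t)" by (rule norm_mult_ineq)
    also have "\<dots> \<le> exp (\<eta>/2 * L t) * exp (\<eta>/2 * L t)" using elim by (intro mult_mono) auto
    also have "\<dots> = exp (\<eta> * L t)" by (simp add: exp_add[symmetric])
    finally show ?case .
  qed
qed

text \<open>Half of the rate of \<open>g\<close> pays for \<open>f\<close>. The hypothesis speaks of
  norms only, so the factors may have different types, such as a real number and a matrix.\<close>

lemma small_mult_norm:
  assumes "subexp f" "small g" "\<forall>\<^sub>F t in F. norm (h t) \<le> norm (f t) * norm (g t)"
  shows "small h"
proof -
  obtain \<eta> where \<eta>: "\<eta> > 0" "\<forall>\<^sub>F t in F. norm (g t) \<le> exp (- \<eta> * L t)"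
    using assms(2) by (auto simp: small_def)
  have f: "\<forall>\<^sub>F t in F. norm (f t) \<le> exp (\<eta>/2 * L t)"
    using assms(1) \<eta>(1) unfolding subexp_def by (auto simp del: divide_const_simps dest!: spec[of _ "\<eta>/2"])
  from f \<eta>(2) assms(3) have "\<forall>\<^sub>F t in F. norm (h t) \<le> exp (- (\<eta>/2) * L t)"
  proof eventually_elim
    case (elim t)
    have "norm (f t) * norm (g t) \<le> exp (\<eta>/2 * L t) * exp (- \<eta> * L t)"
      using elim by (intro mult_mono) auto
    also have "\<dots> = exp (- (\<eta>/2) * L t)" by (simp add: exp_add[symmetric] algebra_simps)
    finally show ?case using elim(3) by linarith
  qed
  then show ?thesis unfolding small_def using \<eta>(1) by (intro exI[of _ "\<eta>/2"]) auto
qed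

lemma small_mult_left:
  fixes f g :: "'t \<Rightarrow> 'a::real_normed_algebra"
  assumes "subexp f" "small g" shows "small (\<lambda>t. f t * g t)"
  by (rule small_mult_norm[OF assms]) (simp add: norm_mult_ineq)

lemma small_mult_right:
  fixes f g :: "'t \<Rightarrow> 'a::real_normed_algebra"
  assumes "small f" "subexp g" shows "small (\<lambda>t. f t * g t)"
  by (rule small_mult_norm[OF assms(2,1)]) (simp add: norm_mult_ineq mult.commute[of "norm (g _)"])

lemma small_eventually_less:
  assumes "small f" "\<delta> > 0" shows "\<forall>\<^sub>F t in F. norm (f t) < \<delta>"
proof -
  obtain \<eta> where \<eta>: "\<eta> > 0" "\<forall>\<^sub>F t in F. norm (f t) \<le> exp (- \<eta> * L t)"
    using assms(1) by (auto simp: small_def)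
  from \<eta>(2) eventually_le_exp[OF \<eta>(1), of "2/\<delta>"] show ?thesis
  proof eventually_elim
    case (elim t)
    have "exp (- \<eta> * L t) = 1 / exp (\<eta> * L t)" by (simp add: exp_minus field_simps)
    also have "\<dots> \<le> \<delta>/2" using elim(2) assms(2) by (simp add: field_simps)
    finally show ?case using elim(1) assms(2) by linarith
  qed
qed

lemma subexp_norm [simp]: "subexp (\<lambda>t. norm (f t)) = subexp f"
  by (simp add: subexp_def)

end

section \<open>Inverses near the identity\<close>

text \<open>The Neumann series for the inverse of \<open>1 + E\<close>; the argument is the
  deviation from the identity.\<close>

definition ninv :: "'a::{real_normed_algebra_1,banach} \<Rightarrow> 'a" where
  "ninv E = (\<Sum>n. (- E) ^ n)"

lemma
  fixes E :: "'a::{real_normed_algebra_1,banach}"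
  assumes "norm E < 1"
  shows ninv_left: "ninv E * (1 + E) = 1" and ninv_right: "(1 + E) * ninv E = 1"
proof -
  have s: "summable (\<lambda>n. (- E) ^ n)"
    by (rule complete_algebra_summable_geometric) (use assms in simp)
  have t: "ninv E = 1 + (\<Sum>n. (- E) ^ Suc n)"
    unfolding ninv_def using suminf_split_head[OF s] by (simp add: algebra_simps)
  have "(\<Sum>n. (- E) ^ Suc n) = - E * ninv E"
    unfolding ninv_def power_Suc by (rule suminf_mult[OF s])
  with t show "(1 + E) * ninv E = 1" by (simp add: algebra_simps)
  have "(\<Sum>n. (- E) ^ Suc n) = ninv E * - E"
    unfolding ninv_def power_Suc2 by (rule suminf_mult2[OF s, symmetric])
  with t show "ninv E * (1 + E) = 1" by (simp add: algebra_simps)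
qed

lemma norm_ninv_minus_one:
  fixes E :: "'a::{real_normed_algebra_1,banach}"
  assumes "norm E \<le> 1/2"
  shows "norm (ninv E - 1) \<le> 2 * norm E"
proof -
  let ?I = "ninv E"
  have "norm E < 1" using assms by simp
  from ninv_right[OF this] have e: "?I - 1 = - (E * ?I)" by (simp add: algebra_simps)
  have "norm ?I \<le> norm (?I - 1) + 1" by (metis diff_add_cancel norm_one norm_triangle_ineq)
  also have "norm (?I - 1) \<le> norm E * norm ?I" unfolding e norm_minus_cancel by (rule norm_mult_ineq)
  also have "\<dots> \<le> 1/2 * norm ?I" using assms by (intro mult_right_mono) auto
  finally have "norm ?I \<le> 2" by simp
  have "norm (?I - 1) \<le> norm E * norm ?I" unfolding e norm_minus_cancel by (rule norm_mult_ineq)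
  also have "\<dots> \<le> norm E * 2" using \<open>norm ?I \<le> 2\<close> by (intro mult_left_mono) auto
  finally show ?thesis by simp
qed

lemma ninv_commute:
  fixes E :: "'a::{real_normed_algebra_1,banach}"
  assumes "norm E < 1" "x * E = E * x"
  shows "x * ninv E = ninv E * x"
proof -
  have "x * ninv E = ninv E * (1 + E) * x * ninv E" by (simp add: ninv_left[OF assms(1)])
  also have "\<dots> = ninv E * x * ((1 + E) * ninv E)"
    using assms(2) by (simp add: algebra_simps flip: mult.assoc) (simp add: mult.assoc)
  finally show ?thesis by (simp add: ninv_right[OF assms(1)])
qed

context growth_scale
begin

lemma small_ninv:
  fixes E :: "'t \<Rightarrow> 'a::{real_normed_algebra_1,banach}"
  assumes "small E" shows "small (\<lambda>t. ninv (E t) - 1)"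
proof (rule small_mult_norm[OF _ assms])
  show "subexp (\<lambda>t. 2::real)" by simp
  show "\<forall>\<^sub>F t in F. norm (ninv (E t) - 1) \<le> norm (2::real) * norm (E t)"
    using small_eventually_less[OF assms, of "1/2"]
    by (auto elim!: eventually_mono simp: norm_ninv_minus_one)
qed

lemma subexp_ninv:
  fixes E :: "'t \<Rightarrow> 'a::{real_normed_algebra_1,banach}"
  assumes "small E" shows "subexp (\<lambda>t. ninv (E t))"
  using subexp_add[OF small_imp_subexp[OF small_ninv[OF assms]], of "\<lambda>t. 1"] by simp

end

section \<open>Block triangular factorizations\<close>

lemma mult_rewrite_assoc:
  fixes x :: "'a::semigroup_mult"
  assumes "x * y = z" shows "x * (y * w) = z * w"
  using assms by (simp flip: mult.assoc)

text \<open>With \<open>ldu_upper\<close> and \<open>ldu_diag\<close> this is the Schur complement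
  factorization of \<open>1 + E\<close> for the blocks \<open>r\<close> and \<open>1 - r\<close>.
  The element \<open>1 + r * E * r\<close> is the identity off the range of \<open>r\<close>, so it
  can be inverted in the whole algebra instead of a corner.\<close>

definition ldu_lower :: "'a::{real_normed_algebra_1,banach} \<Rightarrow> 'a \<Rightarrow> 'a" where
  "ldu_lower r E = (1 - r) * E * ninv (r * E * r) * r"

definition ldu_upper :: "'a::{real_normed_algebra_1,banach} \<Rightarrow> 'a \<Rightarrow> 'a" where
  "ldu_upper r E = r * ninv (r * E * r) * E * (1 - r)"

definition ldu_diag :: "'a::{real_normed_algebra_1,banach} \<Rightarrow> 'a \<Rightarrow> 'a" where
  "ldu_diag r E = r * E * r + (1 - r) * E * (1 - r) - (1 - r) * E * ninv (r * E * r) * r * E * (1 - r)"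

lemma block_ldu:
  fixes r E :: "'a::{real_normed_algebra_1,banach}"
  assumes r: "r * r = r" and E: "norm (r * E * r) < 1"
  shows "1 + E = (1 + ldu_lower r E) * (1 + ldu_diag r E) * (1 + ldu_upper r E)"
proof -
  define I where "I = ninv (r * E * r)"
  define l where "l = ldu_lower r E"
  define u where "u = ldu_upper r E"
  define d where "d = ldu_diag r E"
  note defs = l_def u_def d_def
  note l_def = l_def[unfolded ldu_lower_def, folded I_def]
  note u_def = u_def[unfolded ldu_upper_def, folded I_def]
  note d_def = d_def[unfolded ldu_diag_def, folded I_def]
  define s where "s = 1 - r"
  have rs: "r * s = 0" "s * r = 0" "s * s = s" "r + s = 1" using r by (auto simp: s_def algebra_simps)
  have I: "I * (1 + r * E * r) = 1" "(1 + r * E * r) * I = 1"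
    using ninv_left[OF E] ninv_right[OF E] by (auto simp: I_def)
  have Ir: "r * I = I * r"
    unfolding I_def by (rule ninv_commute[OF E]) (metis mult.assoc r)
  \<comment> \<open>\<open>a\<close>, \<open>b\<close>, \<open>c\<close>, \<open>w\<close> are the
    four blocks of \<open>1 + E\<close>. On the range of \<open>r\<close> the block \<open>a\<close>
    is inverted by \<open>I\<close>, and \<open>1 + d\<close> consists of \<open>a\<close> and the
    Schur complement \<open>w - c * I * b\<close>.\<close>
  define a where "a = r + r * E * r"
  define b where "b = r * E * s"
  define c where "c = s * E * r"
  define w where "w = s + s * E * s"
  have ra: "r * a = a" "a * r = a" using r mult_rewrite_assoc[OF r] by (auto simp: a_def algebra_simps)
  have Ia: "I * a = r" "a * I = r"
  proof -
    have "a = (1 + r * E * r) * r" "a = r * (1 + r * E * r)"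
      using r mult_rewrite_assoc[OF r] by (auto simp: a_def algebra_simps)
    then show "I * a = r" "a * I = r" using I by (metis mult.assoc mult_1 mult_1_right)+
  qed
  have ls: "l = c * I" unfolding l_def c_def s_def using Ir by (simp add: mult.assoc)
  have us: "u = I * b" unfolding u_def b_def s_def using Ir by (simp add: mult.assoc)
  have ds: "1 + d = a + w - c * I * b"
  proof -
    have "c * I * b = s * E * r * I * r * E * s" by (simp add: c_def b_def mult.assoc)
    also have "\<dots> = s * E * I * r * E * s" using Ir r by (metis mult.assoc)
    finally show ?thesis using rs(4) unfolding d_def s_def[symmetric] a_def w_def
      by (simp add: algebra_simps)
  qed
  have z: "c * w = 0" "w * b = 0" "c * c = 0" "b * b = 0" 
    using rs rs(1-3)[THEN mult_rewrite_assoc] by (auto simp: c_def w_def b_def algebra_simps)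
  have cIz: "c * I * w = 0" "c * I * c = 0" "w * I * b = 0" "b * I * b = 0"
  proof -
    have "r * I * s = 0" "s * I * r = 0" using Ir rs by (metis mult.assoc mult_zero_right mult_zero_left)+
    then have k: "r * (I * (s * x)) = 0" "s * (I * (r * x)) = 0" for x
      by (metis mult.assoc mult_zero_left)+
    show "c * I * w = 0" "c * I * c = 0" "w * I * b = 0" "b * I * b = 0" using k k[of 1]
      by (auto simp: c_def w_def b_def algebra_simps)
  qed
  have la: "l * (1 + d) = c"
  proof -
    have "l * (1 + d) = c * (I * a) + c * I * w - (c * I * c) * (I * b)"
      unfolding ls ds by (simp add: algebra_simps)
    also have "\<dots> = c * r" by (simp only: Ia cIz) simp
    finally show ?thesis by (simp add: c_def mult.assoc r)
  qed
  have au: "(1 + d) * u = b"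
  proof -
    have "(1 + d) * u = (a * I) * b + w * I * b - c * I * (b * I * b)"
      unfolding us ds by (simp add: algebra_simps)
    also have "\<dots> = r * b" by (simp only: Ia cIz) simp
    finally show ?thesis by (simp add: b_def r flip: mult.assoc)
  qed
  have "(1 + l) * (1 + d) * (1 + u) = (1 + d) + l * (1 + d) + (1 + d) * u + l * (1 + d) * u"
    by (simp add: algebra_simps)
  also have "\<dots> = (a + w - c * I * b) + c + b + c * (I * b)"
    by (simp only: la au) (simp only: ds us mult.assoc)
  also have "\<dots> = (r + s) * E * (r + s) + (r + s)"
    unfolding a_def b_def c_def w_def by (simp add: algebra_simps)
  finally show ?thesis unfolding rs defs by (simp add: add.commute)
qed

text \<open>Used with the unstable, critical and stable projections in this order for the forward
  half period. For the backward one the outer two change places, which is what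
  \<open>splitting_sym\<close> is for.\<close>

definition splitting :: "'a::ring_1 \<Rightarrow> 'a \<Rightarrow> 'a \<Rightarrow> bool" where
  "splitting p c q \<longleftrightarrow> p * p = p \<and> c * c = c \<and> q * q = q \<and> p * c = 0 \<and> c * p = 0 \<and>
     p * q = 0 \<and> q * p = 0 \<and> c * q = 0 \<and> q * c = 0 \<and> p + c + q = 1"

lemma splitting_sym: "splitting p c q \<longleftrightarrow> splitting q c p"
  by (auto simp: splitting_def add_ac)

lemma ldu_diag_commute:
  fixes r E :: "'a::{real_normed_algebra_1,banach}"
  assumes r: "r * r = r"
  shows "ldu_diag r E * r = r * ldu_diag r E"
  using r mult_rewrite_assoc[OF r] by (simp add: ldu_diag_def algebra_simps)

text \<open>Needed when a second elimination follows: a projection already split off commutes with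
  both inputs, hence with each factor of the formula, and so stays split off.\<close>

lemma ldu_diag_commute_other:
  fixes r E x :: "'a::{real_normed_algebra_1,banach}"
  assumes "norm (r * E * r) < 1" "x * r = r * x" "x * E = E * x"
  shows "ldu_diag r E * x = x * ldu_diag r E"
proof -
  have "x * (r * E * r) = r * E * r * x" using assms(2,3) by (metis mult.assoc)
  then have I: "ninv (r * E * r) * x = x * ninv (r * E * r)" using ninv_commute[OF assms(1)] by simp
  have s: "(1 - r) * x = x * (1 - r)" using assms(2) by (simp add: algebra_simps)
  have "y * x = x * y \<Longrightarrow> z * x = x * z \<Longrightarrow> (y * z) * x = x * (y * z)" for y z :: 'a
    by (metis mult.assoc)
  moreover have "y * x = x * y \<Longrightarrow> z * x = x * z \<Longrightarrow> (y + z) * x = x * (y + z)"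
    "y * x = x * y \<Longrightarrow> z * x = x * z \<Longrightarrow> (y - z) * x = x * (y - z)" for y z :: 'a
    by (simp_all add: algebra_simps)
  ultimately show ?thesis unfolding ldu_diag_def using assms(2,3)[symmetric] I s by presburger
qed

context growth_scale
begin

lemma small_ldu:
  fixes r E :: "'t \<Rightarrow> 'a::{real_normed_algebra_1,banach}"
  assumes "subexp r" "small E"
  shows "small (\<lambda>t. ldu_lower (r t) (E t))" "small (\<lambda>t. ldu_upper (r t) (E t))"
    "small (\<lambda>t. ldu_diag (r t) (E t))"
proof -
  have s: "subexp (\<lambda>t. 1 - r t)" by (intro subexp_diff assms) simp
  have I: "subexp (\<lambda>t. ninv (r t * E t * r t))"
    by (intro subexp_ninv small_mult_right small_mult_left assms)
  show "small (\<lambda>t. ldu_lower (r t) (E t))" unfolding ldu_lower_def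
    by (intro small_mult_right[OF small_mult_right[OF small_mult_left]] s I assms)
  show "small (\<lambda>t. ldu_upper (r t) (E t))" unfolding ldu_upper_def
    by (intro small_mult_right[OF small_mult_left] subexp_mult s I assms)
  show "small (\<lambda>t. ldu_diag (r t) (E t))" unfolding ldu_diag_def
    by (intro small_diff small_add small_mult_right[OF small_mult_left] 
      small_mult_right[OF small_mult_right[OF small_mult_left]] subexp_mult s I assms
      small_mult_right[OF small_mult_left[OF _ assms(2)]] small_imp_subexp[OF assms(2)])
qed

text \<open>Two eliminations: \<open>p\<close> against the rest, and then, inside the diagonal
  factor so obtained, \<open>p + c\<close> against \<open>q\<close>. Products of the two lower
  factors and of the two upper ones keep the vanishing blocks that are recorded, and those are all
  that \<open>factored_step\<close> exploits.\<close>

lemma three_block_ldu: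
  fixes p c q E :: "'t \<Rightarrow> 'a::{real_normed_algebra_1,banach}"
  assumes sp: "\<forall>\<^sub>F t in F. splitting (p t) (c t) (q t)"
    and sub: "subexp p" "subexp c" "subexp q" and E: "small E"
  obtains l d u where "small l" "small d" "small u"
    "\<forall>\<^sub>F t in F. 1 + E t = (1 + l t) * (1 + d t) * (1 + u t) \<and>
       p t * l t = 0 \<and> l t * q t = 0 \<and> u t * p t = 0 \<and> q t * u t = 0 \<and>
       d t * p t = p t * d t \<and> d t * c t = c t * d t \<and> d t * q t = q t * d t"
proof -
  define r where "r t = p t + c t" for t
  define l1 where "l1 t = ldu_lower (p t) (E t)" for t
  define d1 where "d1 t = ldu_diag (p t) (E t)" for t
  define u1 where "u1 t = ldu_upper (p t) (E t)" for t
  define l2 where "l2 t = ldu_lower (r t) (d1 t)" for t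
  define d2 where "d2 t = ldu_diag (r t) (d1 t)" for t
  define u2 where "u2 t = ldu_upper (r t) (d1 t)" for t
  have r: "subexp r" unfolding r_def by (intro subexp_add sub)
  have s1: "small l1" "small d1" "small u1"
    unfolding l1_def d1_def u1_def by (intro small_ldu sub E)+
  have s2: "small l2" "small d2" "small u2"
    unfolding l2_def d2_def u2_def by (intro small_ldu r s1)+
  have e1: "\<forall>\<^sub>F t in F. norm (p t * E t * p t) < 1"
    by (intro small_eventually_less small_mult_right small_mult_left sub E) simp
  have e2: "\<forall>\<^sub>F t in F. norm (r t * d1 t * r t) < 1"
    by (intro small_eventually_less small_mult_right small_mult_left r s1) simp
  show ?thesis
  proof
    show "small (\<lambda>t. l1 t + l2 t + l1 t * l2 t)" "small d2" "small (\<lambda>t. u2 t + u1 t + u2 t * u1 t)"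
      by (intro small_add small_mult_right s1 s2 small_imp_subexp)+
    show "\<forall>\<^sub>F t in F. 1 + E t = (1 + (l1 t + l2 t + l1 t * l2 t)) * (1 + d2 t) * (1 + (u2 t + u1 t + u2 t * u1 t)) \<and>
       p t * (l1 t + l2 t + l1 t * l2 t) = 0 \<and> (l1 t + l2 t + l1 t * l2 t) * q t = 0 \<and>
       (u2 t + u1 t + u2 t * u1 t) * p t = 0 \<and> q t * (u2 t + u1 t + u2 t * u1 t) = 0 \<and>
       d2 t * p t = p t * d2 t \<and> d2 t * c t = c t * d2 t \<and> d2 t * q t = q t * d2 t"
      using sp e1 e2
    proof eventually_elim
      case (elim t)
      have P: "p t * p t = p t" "c t * c t = c t" "q t * q t = q t" "p t * c t = 0" "c t * p t = 0"
        "p t * q t = 0" "q t * p t = 0" "c t * q t = 0" "q t * c t = 0"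
        using elim(1) by (auto simp: splitting_def)
      have one: "p t + c t + q t = 1" using elim(1) by (simp add: splitting_def)
      have rr: "r t * r t = r t" "r t * p t = p t * r t" "1 - r t = q t"
        using P one by (auto simp: r_def algebra_simps)
      have f1: "1 + E t = (1 + l1 t) * (1 + d1 t) * (1 + u1 t)"
        unfolding l1_def d1_def u1_def by (rule block_ldu[OF P(1) elim(2)])
      have f2: "1 + d1 t = (1 + l2 t) * (1 + d2 t) * (1 + u2 t)"
        unfolding l2_def d2_def u2_def by (rule block_ldu[OF rr(1) elim(3)])
      have "1 + E t = (1 + l1 t) * (1 + l2 t) * (1 + d2 t) * ((1 + u2 t) * (1 + u1 t))"
        unfolding f1 f2 by (simp only: mult.assoc)
      then have A: "1 + E t = (1 + (l1 t + l2 t + l1 t * l2 t)) * (1 + d2 t) * (1 + (u2 t + u1 t + u2 t * u1 t))"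
        by (simp add: algebra_simps)
      have lo: "p t * l1 t = 0" "l1 t * q t = 0" "p t * l2 t = 0" "l2 t * q t = 0"
        unfolding l1_def l2_def ldu_lower_def rr
        using P P[THEN mult_rewrite_assoc] by (auto simp: r_def algebra_simps)
      have up: "u1 t * p t = 0" "q t * u1 t = 0" "u2 t * p t = 0" "q t * u2 t = 0"
        unfolding u1_def u2_def ldu_upper_def rr
        using P P[THEN mult_rewrite_assoc] by (auto simp: r_def algebra_simps)
      have "d1 t * p t = p t * d1 t" unfolding d1_def by (rule ldu_diag_commute[OF P(1)])
      then have dp: "d2 t * p t = p t * d2 t"
        unfolding d2_def by (intro ldu_diag_commute_other elim rr(2)[symmetric]) simp
      have "d2 t * r t = r t * d2 t" unfolding d2_def by (rule ldu_diag_commute[OF rr(1)])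
      then have dc: "d2 t * c t = c t * d2 t" using dp by (simp add: r_def algebra_simps)
      have q: "q t = 1 - p t - c t" unfolding one[symmetric] by simp
      have dq: "d2 t * q t = q t * d2 t" unfolding q by (simp add: algebra_simps dp dc)
      have B: "p t * (l1 t + l2 t + l1 t * l2 t) = 0" "(l1 t + l2 t + l1 t * l2 t) * q t = 0"
        "(u2 t + u1 t + u2 t * u1 t) * p t = 0" "q t * (u2 t + u1 t + u2 t * u1 t) = 0"
        using lo[THEN mult_rewrite_assoc] up[THEN mult_rewrite_assoc]
        by (simp_all only: distrib_left distrib_right mult.assoc lo up) simp_all
      show ?case by (intro conjI A B dp dc dq)
    qed
  qed
qed

text \<open>The diagonal factor \<open>D\<close> is required to be invertible only on the ranges of \<open>p\<close> and \<open>c\<close>,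
  with inverses \<open>D1\<close> and \<open>D2\<close> there, and to agree on the range of \<open>c\<close> with \<open>S\<close> up to a small error.\<close>

definition factored where
  "factored p c q V S l D D1 D2 u \<longleftrightarrow>
     small l \<and> small u \<and> subexp D1 \<and> subexp D2 \<and> subexp (\<lambda>t. D t * q t) \<and>
     small (\<lambda>t. D t * c t - S t) \<and>
     (\<forall>\<^sub>F t in F. V t = (1 + l t) * D t * (1 + u t) \<and> u t * p t = 0 \<and>
        D t * p t = p t * D t \<and> D t * c t = c t * D t \<and> D t * q t = q t * D t \<and>
        D1 t * D t = p t \<and> D t * D1 t = p t \<and> p t * D1 t = D1 t \<and> D1 t * p t = D1 t \<and>
        D2 t * D t = c t \<and> D t * D2 t = c t \<and> c t * D2 t = D2 t \<and> D2 t * c t = D2 t)"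

lemma factored_step:
  fixes p c q E G Gi V S :: "'t \<Rightarrow> 'a::{real_normed_algebra_1,banach}"
  assumes sp: "\<forall>\<^sub>F t in F. splitting (p t) (c t) (q t)"
    and sub: "subexp p" "subexp c" "subexp q" and E: "small E"
    and G: "\<forall>\<^sub>F t in F. G t * Gi t = 1 \<and> Gi t * G t = 1 \<and> G t * p t = p t * G t \<and>
        G t * c t = c t * G t \<and> G t * q t = q t * G t"
    and Gs: "small (\<lambda>t. Gi t * p t)" "small (\<lambda>t. G t * q t)"
      "subexp (\<lambda>t. G t * c t)" "subexp (\<lambda>t. Gi t * c t)"
    and S: "subexp S" "\<forall>\<^sub>F t in F. c t * S t = S t"
    and V: "factored p c q V S l0 D0 D10 D20 u0"
  obtains l D D1 D2 u where "factored p c q (\<lambda>t. G t * (1 + E t) * V t) (\<lambda>t. G t * S t) l D D1 D2 u"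
    "small D1" "small (\<lambda>t. D t * q t)"
proof -
  note V = V[unfolded factored_def]
  have V': "\<forall>\<^sub>F t in F. V t = (1 + l0 t) * D0 t * (1 + u0 t) \<and> u0 t * p t = 0 \<and>
        D0 t * p t = p t * D0 t \<and> D0 t * c t = c t * D0 t \<and> D0 t * q t = q t * D0 t \<and>
        D10 t * D0 t = p t \<and> D0 t * D10 t = p t \<and> p t * D10 t = D10 t \<and> D10 t * p t = D10 t \<and>
        D20 t * D0 t = c t \<and> D0 t * D20 t = c t \<and> c t * D20 t = D20 t \<and> D20 t * c t = D20 t"
    using V by blast
  have Vs: "small l0" "small u0" "subexp D10" "subexp D20" "subexp (\<lambda>t. D0 t * q t)"
     "small (\<lambda>t. D0 t * c t - S t)" using V by blast+
  define E' where "E' t = E t + l0 t + E t * l0 t" for t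
  have E': "small E'" unfolding E'_def by (intro small_add small_mult_right E Vs small_imp_subexp)
  obtain l d u where ldu: "small l" "small d" "small u"
    "\<forall>\<^sub>F t in F. 1 + E' t = (1 + l t) * (1 + d t) * (1 + u t) \<and>
       p t * l t = 0 \<and> l t * q t = 0 \<and> u t * p t = 0 \<and> q t * u t = 0 \<and>
       d t * p t = p t * d t \<and> d t * c t = c t * d t \<and> d t * q t = q t * d t"
    using three_block_ldu[OF sp sub E'] by blast
  \<comment> \<open>\<open>l'\<close> is \<open>G * l * Gi\<close>, and \<open>w\<close> is
    \<open>u\<close> conjugated by \<open>D0\<close>, both written without the blocks that vanish.
    In this form every factor is subexponential.\<close>
  define w where "w t = (D10 t + D20 t) * u t * (D0 t * c t + D0 t * q t)" for t
  define l' where "l' t = (G t * c t + G t * q t) * l t * (Gi t * p t + Gi t * c t)" for t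
  define D where "D t = G t * (1 + d t) * D0 t" for t
  define D1 where "D1 t = D10 t * ninv (d t) * (Gi t * p t)" for t
  define D2 where "D2 t = D20 t * ninv (d t) * (Gi t * c t)" for t
  define u' where "u' t = w t + u0 t + w t * u0 t" for t
  have D0c: "subexp (\<lambda>t. D0 t * c t)"
    using subexp_add[OF small_imp_subexp[OF Vs(6)] S(1)] by simp
  have w: "small w" unfolding w_def
    by (intro small_mult_right small_mult_left subexp_add ldu Vs D0c)
  have l': "small l'" unfolding l'_def
    by (intro small_mult_right small_mult_left subexp_add ldu Gs small_imp_subexp[OF Gs(1)] small_imp_subexp[OF Gs(2)])
  have u': "small u'" unfolding u'_def by (intro small_add small_mult_right w Vs small_imp_subexp)
  have I: "subexp (\<lambda>t. ninv (d t))" by (intro subexp_ninv ldu)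
  have D1: "small D1" unfolding D1_def by (intro small_mult_left subexp_mult Vs I Gs)
  have D2: "subexp D2" unfolding D2_def by (intro subexp_mult Vs I Gs)
  have d1: "subexp (\<lambda>t. 1 + d t)" by (intro subexp_add[OF subexp_const] small_imp_subexp ldu)
  have ed: "\<forall>\<^sub>F t in F. norm (d t) < 1" by (intro small_eventually_less ldu) simp
  have all: "\<forall>\<^sub>F t in F. G t * (1 + E t) * V t = (1 + l' t) * D t * (1 + u' t) \<and> u' t * p t = 0 \<and>
        D t * p t = p t * D t \<and> D t * c t = c t * D t \<and> D t * q t = q t * D t \<and>
        D1 t * D t = p t \<and> D t * D1 t = p t \<and> p t * D1 t = D1 t \<and> D1 t * p t = D1 t \<and>
        D2 t * D t = c t \<and> D t * D2 t = c t \<and> c t * D2 t = D2 t \<and> D2 t * c t = D2 t \<and>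
        D t * q t = G t * q t * (1 + d t) * (D0 t * q t) \<and>
        D t * c t - G t * S t = G t * c t * ((D0 t * c t - S t) + d t * (D0 t * c t))"
    using sp V' ldu(4) G ed S(2)
  proof eventually_elim
    case (elim t)
    have P: "p t * p t = p t" "c t * c t = c t" "q t * q t = q t" "p t * c t = 0" "c t * p t = 0"
        "p t * q t = 0" "q t * p t = 0" "c t * q t = 0" "q t * c t = 0"
      using elim(1) by (auto simp: splitting_def)
    note PA = P P[THEN mult_rewrite_assoc]
    have one: "p t + c t + q t = 1" using elim(1) by (simp add: splitting_def)
    have Dcom: "D0 t * p t = p t * D0 t" "D0 t * c t = c t * D0 t" "D0 t * q t = q t * D0 t"
      using elim(2) by auto
    have dcom: "d t * p t = p t * d t" "d t * c t = c t * d t" "d t * q t = q t * d t"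
      using elim(3) by auto
    have Gcom: "G t * p t = p t * G t" "G t * c t = c t * G t" "G t * q t = q t * G t"
      using elim(4) by auto
    have GG: "G t * Gi t = 1" "Gi t * G t = 1" using elim(4) by auto
    have Gicom: "Gi t * x = x * Gi t" if "G t * x = x * G t" for x
    proof -
      have "Gi t * x = Gi t * (x * G t) * Gi t" using GG by (simp add: mult.assoc)
      also have "\<dots> = (Gi t * G t) * x * Gi t" using that by (simp add: mult.assoc)
      finally show ?thesis using GG by simp
    qed
    have Gic: "Gi t * p t = p t * Gi t" "Gi t * c t = c t * Gi t" "Gi t * q t = q t * Gi t"
      using Gcom Gicom by auto
    define I where "I = ninv (d t)"
    have II: "I * (1 + d t) = 1" "(1 + d t) * I = 1"
      using ninv_left[OF elim(5)] ninv_right[OF elim(5)] by (auto simp: I_def)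
    have Icom: "I * p t = p t * I" "I * c t = c t * I"
      unfolding I_def using ninv_commute[OF elim(5)] dcom by metis+
    have lz: "p t * l t = 0" "l t * q t = 0" "u t * p t = 0" "q t * u t = 0" using elim(3) by auto
    have "l' t = (G t * (p t + c t + q t)) * l t * (Gi t * (p t + c t + q t))"
    proof -
      have "G t * p t * l t = 0" "l t * (Gi t * q t) = 0" "G t * c t * l t * (Gi t * q t) = 0"
        "G t * q t * l t * (Gi t * q t) = 0"
        unfolding Gic using lz lz[THEN mult_rewrite_assoc] by (auto simp: mult.assoc)
      then show ?thesis unfolding l'_def by (simp add: distrib_left distrib_right)
    qed
    then have l'eq: "l' t = G t * l t * Gi t" unfolding one by simp
    have "w t = (D10 t + D20 t) * u t * (D0 t * (p t + c t + q t))"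
    proof -
      have "u t * (D0 t * p t) = 0" unfolding Dcom using lz[THEN mult_rewrite_assoc] by simp
      then show ?thesis unfolding w_def by (simp add: distrib_left mult.assoc)
    qed
    then have weq: "w t = (D10 t + D20 t) * u t * D0 t" unfolding one by simp
    \<comment> \<open>\<open>D0 * (D10 + D20)\<close> is \<open>p + c\<close>, which acts as the
      identity on the range of \<open>u\<close> because \<open>q * u = 0\<close>.\<close>
    have Dw: "D0 t * w t = u t * D0 t"
    proof -
      have "D0 t * w t = (D0 t * D10 t + D0 t * D20 t) * u t * D0 t"
        unfolding weq by (simp add: distrib_left distrib_right mult.assoc)
      also have "\<dots> = (p t + c t + q t) * u t * D0 t - q t * u t * D0 t"
        using elim(2) by (simp add: algebra_simps)
      also have "\<dots> = u t * D0 t" unfolding one using lz by simp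
      finally show ?thesis .
    qed
    have wp: "w t * p t = 0"
    proof -
      have "w t * p t = (D10 t + D20 t) * (u t * p t * D0 t)" unfolding weq by (simp add: mult.assoc Dcom)
      then show ?thesis using lz by simp
    qed
    have 1: "G t * (1 + E t) * V t = (1 + l' t) * D t * (1 + u' t)"
    proof -
      have "G t * (1 + E t) * V t = G t * ((1 + E t) * (1 + l0 t)) * D0 t * (1 + u0 t)"
        using elim(2) by (simp add: mult.assoc)
      also have "(1 + E t) * (1 + l0 t) = 1 + E' t" by (simp add: E'_def algebra_simps)
      also have "\<dots> = (1 + l t) * (1 + d t) * (1 + u t)" using elim(3) by simp
      also have "G t * \<dots> * D0 t * (1 + u0 t) =
          (G t * (1 + l t) * 1) * (1 + d t) * ((1 + u t) * D0 t) * (1 + u0 t)"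
        by (simp add: mult.assoc)
      also have "G t * (1 + l t) * 1 = (1 + l' t) * G t"
        unfolding l'eq using GG by (simp add: distrib_left distrib_right mult.assoc)
      also have "(1 + u t) * D0 t = D0 t * (1 + w t)" using Dw by (simp add: algebra_simps)
      also have "(1 + l' t) * G t * (1 + d t) * (D0 t * (1 + w t)) * (1 + u0 t) =
          (1 + l' t) * D t * ((1 + w t) * (1 + u0 t))" by (simp add: D_def mult.assoc)
      also have "(1 + w t) * (1 + u0 t) = 1 + u' t" by (simp add: u'_def algebra_simps)
      finally show ?thesis .
    qed
    have 2: "u' t * p t = 0" using elim(2) wp by (simp add: u'_def distrib_right mult.assoc)
    have com: "D t * x = x * D t" if "G t * x = x * G t" "d t * x = x * d t" "D0 t * x = x * D0 t" for x
    proof -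
      have "(1 + d t) * x = x * (1 + d t)" using that by (simp add: algebra_simps)
      then have "D t * x = G t * (1 + d t) * (x * D0 t)" using that by (simp add: D_def mult.assoc)
      also have "\<dots> = G t * ((1 + d t) * x) * D0 t" by (simp only: mult.assoc)
      also have "\<dots> = (G t * x) * (1 + d t) * D0 t" using \<open>(1 + d t) * x = x * (1 + d t)\<close> by (simp only: mult.assoc)
      finally show ?thesis using that by (simp add: D_def mult.assoc)
    qed
    have 3: "D t * p t = p t * D t" "D t * c t = c t * D t" "D t * q t = q t * D t"
      using com Gcom dcom Dcom by auto
    \<comment> \<open>One computation for both partial inverses: \<open>z\<close> will be
      \<open>p\<close> or \<open>c\<close>, and \<open>X\<close> the partial inverse of
      \<open>D0\<close> there.\<close>
    have inv: "X * I * (Gi t * z) * D t = z \<and> D t * (X * I * (Gi t * z)) = z \<and>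
          z * (X * I * (Gi t * z)) = X * I * (Gi t * z) \<and> X * I * (Gi t * z) * z = X * I * (Gi t * z)"
      if "X * D0 t = z" "D0 t * X = z" "z * X = X" "z * z = z" "G t * z = z * G t" "I * z = z * I"
        "D0 t * z = z * D0 t" "d t * z = z * d t" for X z
    proof (intro conjI)
      have Giz: "Gi t * z = z * Gi t" by (rule Gicom) fact
      have Dz: "D t * z = z * D t" by (rule com) fact+
      have "X * I * (Gi t * z) * D t = X * I * (Gi t * G t) * (1 + d t) * D0 t * z"
        using Dz unfolding D_def by (simp add: mult.assoc)
      also have "\<dots> = X * (I * (1 + d t)) * D0 t * z" using GG by (simp add: mult.assoc)
      also have "\<dots> = z" using II that by simp
      finally show "X * I * (Gi t * z) * D t = z" .
      have "D t * (X * I * (Gi t * z)) = G t * (1 + d t) * (D0 t * X) * I * (Gi t * z)"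
        unfolding D_def by (simp add: mult.assoc)
      also have "\<dots> = G t * (1 + d t) * (z * I) * (z * Gi t)" unfolding that(2) Giz by (simp only: mult.assoc)
      also have "\<dots> = G t * (1 + d t) * I * z * z * Gi t" unfolding that(6)[symmetric] by (simp only: mult.assoc)
      also have "\<dots> = G t * ((1 + d t) * I) * z * Gi t" using that(4) by (simp add: mult.assoc)
      also have "\<dots> = G t * Gi t * z" using II Giz by (simp add: mult.assoc)
      finally show "D t * (X * I * (Gi t * z)) = z" using GG by simp
      show "z * (X * I * (Gi t * z)) = X * I * (Gi t * z)" using that(3) by (simp flip: mult.assoc)
      show "X * I * (Gi t * z) * z = X * I * (Gi t * z)" using that(4) by (simp add: mult.assoc)
    qed
    have 4: "D1 t * D t = p t \<and> D t * D1 t = p t \<and> p t * D1 t = D1 t \<and> D1 t * p t = D1 t"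
      unfolding D1_def I_def[symmetric] by (intro inv) (use elim(2) P Gcom Dcom dcom Icom in auto)
    have 5: "D2 t * D t = c t \<and> D t * D2 t = c t \<and> c t * D2 t = D2 t \<and> D2 t * c t = D2 t"
      unfolding D2_def I_def[symmetric] by (intro inv) (use elim(2) P Gcom Dcom dcom Icom in auto)
    have 6: "D t * q t = G t * q t * (1 + d t) * (D0 t * q t)"
    proof -
      have q1: "(1 + d t) * q t = q t * (1 + d t)" using dcom by (simp add: algebra_simps)
      have "D t * q t = G t * (1 + d t) * (D0 t * (q t * q t))" using P by (simp add: D_def mult.assoc)
      also have "D0 t * (q t * q t) = q t * (D0 t * q t)" using Dcom by (metis mult.assoc)
      also have "G t * (1 + d t) * (q t * (D0 t * q t)) = G t * ((1 + d t) * q t) * (D0 t * q t)" by (simp only: mult.assoc)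
      finally show ?thesis unfolding q1 by (simp add: mult.assoc)
    qed
    have 7: "D t * c t - G t * S t = G t * c t * ((D0 t * c t - S t) + d t * (D0 t * c t))"
    proof -
      have c1: "(1 + d t) * c t = c t * (1 + d t)" using dcom by (simp add: algebra_simps)
      have "D t * c t = G t * (1 + d t) * (D0 t * (c t * c t))" using P by (simp add: D_def mult.assoc)
      also have "D0 t * (c t * c t) = c t * (D0 t * c t)" using Dcom by (metis mult.assoc)
      also have "G t * (1 + d t) * (c t * (D0 t * c t)) = G t * ((1 + d t) * c t) * (D0 t * c t)" by (simp only: mult.assoc)
      also have "\<dots> = G t * c t * ((1 + d t) * (D0 t * c t))" unfolding c1 by (simp add: mult.assoc)
      finally have "D t * c t = G t * c t * ((1 + d t) * (D0 t * c t))" .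
      moreover have "G t * S t = G t * c t * S t" using elim(6) by (simp add: mult.assoc)
      ultimately show ?thesis by (simp add: algebra_simps)
    qed
    show ?case by (intro conjI 1 2 3 6 7 4[THEN conjunct1] 4[THEN conjunct2, THEN conjunct1]
        4[THEN conjunct2, THEN conjunct2, THEN conjunct1] 4[THEN conjunct2, THEN conjunct2, THEN conjunct2]
        5[THEN conjunct1] 5[THEN conjunct2, THEN conjunct1]
        5[THEN conjunct2, THEN conjunct2, THEN conjunct1] 5[THEN conjunct2, THEN conjunct2, THEN conjunct2])
  qed
  have Dq: "small (\<lambda>t. D t * q t)"
  proof (rule small_cong)
    show "small (\<lambda>t. G t * q t * (1 + d t) * (D0 t * q t))"
      by (intro small_mult_right Gs d1 Vs)
  qed (use all in eventually_elim, blast)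
  have Dc: "small (\<lambda>t. D t * c t - G t * S t)"
  proof (rule small_cong)
    show "small (\<lambda>t. G t * c t * ((D0 t * c t - S t) + d t * (D0 t * c t)))"
      by (intro small_mult_left small_add small_mult_right ldu Gs Vs D0c)
  qed (use all in eventually_elim, blast)
  have "factored p c q (\<lambda>t. G t * (1 + E t) * V t) (\<lambda>t. G t * S t) l' D D1 D2 u'"
    unfolding factored_def
    by (intro conjI l' u' D2 Dc small_imp_subexp[OF D1] small_imp_subexp[OF Dq])
      (use all in eventually_elim, blast)
  then show ?thesis using that D1 Dq by blast
qed

end

section \<open>Linear differential equations in a Banach algebra\<close>

lemma vector_derivative_bound:
  fixes f :: "real \<Rightarrow> 'a::real_normed_vector"
  assumes "convex S" "\<And>x. x \<in> S \<Longrightarrow> (f has_vector_derivative f' x) (at x within S)"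
    and "\<And>x. x \<in> S \<Longrightarrow> norm (f' x) \<le> B" and "x \<in> S" "y \<in> S"
  shows "norm (f x - f y) \<le> B * \<bar>x - y\<bar>"
proof -
  have "norm (f x - f y) \<le> B * norm (x - y)"
  proof (rule differentiable_bound[OF assms(1) _ _ assms(4,5)])
    fix z assume "z \<in> S"
    show "(f has_derivative (\<lambda>h. h *\<^sub>R f' z)) (at z within S)"
      using assms(2)[OF \<open>z \<in> S\<close>] by (simp add: has_vector_derivative_def)
    show "onorm (\<lambda>h. h *\<^sub>R f' z) \<le> B"
      using assms(3)[OF \<open>z \<in> S\<close>] by (intro onorm_le) (metis mult.commute mult_right_mono norm_ge_zero norm_scaleR real_norm_def abs_ge_zero)
  qed
  then show ?thesis by simp
qed

text \<open>The maximum \<open>S\<close> of \<open>norm (Y x)\<close> satisfies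
  \<open>S \<le> norm (Y a) + S / 2\<close> by the mean value inequality, hence
  \<open>S \<le> 2 * norm (Y a)\<close>. This takes the place of Gronwall's inequality on short
  intervals.\<close>

lemma short_time_bound:
  fixes Y :: "real \<Rightarrow> 'a::real_normed_algebra"
  assumes "a \<le> b" and Y: "\<And>x. x \<in> {a..b} \<Longrightarrow> (Y has_vector_derivative T x * Y x) (at x within {a..b})"
    and T: "\<And>x. x \<in> {a..b} \<Longrightarrow> norm (T x) \<le> d" and d: "d * (b - a) \<le> 1/2" and x: "x \<in> {a..b}"
  shows "norm (Y x - Y a) \<le> 2 * d * (b - a) * norm (Y a)"
proof -
  have "continuous_on {a..b} Y"
    using Y by (meson continuous_on_eq_continuous_within has_vector_derivative_continuous)
  then have "continuous_on {a..b} (\<lambda>x. norm (Y x))" by (rule continuous_on_norm)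
  then obtain x0 where x0: "x0 \<in> {a..b}" "\<And>y. y \<in> {a..b} \<Longrightarrow> norm (Y y) \<le> norm (Y x0)"
    using continuous_attains_sup[of "{a..b}" "\<lambda>x. norm (Y x)"] \<open>a \<le> b\<close> by auto
  define S where "S = norm (Y x0)"
  have d0: "d \<ge> 0" using T[OF x] norm_ge_zero order_trans by blast
  have bd: "norm (Y y - Y a) \<le> d * S * (b - a)" if "y \<in> {a..b}" for y
  proof -
    have "norm (Y y - Y a) \<le> d * S * \<bar>y - a\<bar>"
    proof (rule vector_derivative_bound[OF _ Y])
      fix z assume z: "z \<in> {a..b}"
      have "norm (T z * Y z) \<le> norm (T z) * norm (Y z)" by (rule norm_mult_ineq)
      also have "\<dots> \<le> d * S" unfolding S_def using T[OF z] x0(2)[OF z] d0 by (intro mult_mono) auto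
      finally show "norm (T z * Y z) \<le> d * S" .
    qed (use that \<open>a \<le> b\<close> in auto)
    also have "\<dots> \<le> d * S * (b - a)" using that d0 by (intro mult_left_mono) (auto simp: S_def)
    finally show ?thesis .
  qed
  have "S \<le> norm (Y a) + norm (Y x0 - Y a)" unfolding S_def
    by (metis add.commute diff_add_cancel norm_triangle_ineq)
  also have "\<dots> \<le> norm (Y a) + (d * (b - a)) * S" using bd[OF x0(1)] by (simp add: algebra_simps)
  also have "\<dots> \<le> norm (Y a) + 1/2 * S" using d by (intro add_left_mono mult_right_mono) (auto simp: S_def)
  finally have "S \<le> 2 * norm (Y a)" by simp
  then have "d * S * (b - a) \<le> d * (2 * norm (Y a)) * (b - a)"
    using d0 \<open>a \<le> b\<close> by (intro mult_right_mono mult_left_mono) auto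
  with bd[OF x] show ?thesis by (simp add: algebra_simps)
qed

lemma has_vector_derivative_iff_tendsto:
  fixes f :: "real \<Rightarrow> 'a::real_normed_vector"
  shows "(f has_vector_derivative v) (at x within S) \<longleftrightarrow>
    ((\<lambda>y. (f y - f x) /\<^sub>R (y - x)) \<longlongrightarrow> v) (at x within S)"
proof -
  have eq: "norm (f y - f x - (y - x) *\<^sub>R v) / norm (y - x) = norm ((f y - f x) /\<^sub>R (y - x) - v)"
    if "y \<noteq> x" for y
  proof -
    have "(f y - f x) /\<^sub>R (y - x) - v = (f y - f x - (y - x) *\<^sub>R v) /\<^sub>R (y - x)"
      using that by (simp add: scaleR_diff_right)
    then show ?thesis by (simp add: divide_inverse mult.commute)
  qed
  have "(f has_vector_derivative v) (at x within S) \<longleftrightarrow>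
      ((\<lambda>y. norm (f y - f x - (y - x) *\<^sub>R v) / norm (y - x)) \<longlongrightarrow> 0) (at x within S)"
    unfolding has_vector_derivative_def has_derivative_iff_norm by (simp add: bounded_linear_scaleR_left)
  also have "\<dots> \<longleftrightarrow> ((\<lambda>y. norm ((f y - f x) /\<^sub>R (y - x) - v)) \<longlongrightarrow> 0) (at x within S)"
    by (intro filterlim_cong refl) (auto simp: eventually_at_filter eq[simplified])
  also have "\<dots> \<longleftrightarrow> ((\<lambda>y. (f y - f x) /\<^sub>R (y - x)) \<longlongrightarrow> v) (at x within S)"
    unfolding tendsto_norm_zero_iff LIM_zero_iff ..
  finally show ?thesis .
qed

text \<open>Continuity of \<open>g\<close> comes first, from the Neumann series for
  \<open>f y * g x = 1 + E y\<close>. The derivative then follows from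
  \<open>g y - g x = - (g y * (f y - f x) * g x)\<close>.\<close>

lemma has_vector_derivative_inverse_algebra:
  fixes f g :: "real \<Rightarrow> 'a::{real_normed_algebra_1,banach}"
  assumes f: "(f has_vector_derivative f') (at x within S)" and x: "x \<in> S"
    and inv: "\<And>y. y \<in> S \<Longrightarrow> g y * f y = 1" "\<And>y. y \<in> S \<Longrightarrow> f y * g y = 1"
  shows "(g has_vector_derivative - (g x * f' * g x)) (at x within S)"
proof -
  define E where "E y = (f y - f x) * g x" for y
  have fc: "(f \<longlongrightarrow> f x) (at x within S)"
    using has_vector_derivative_continuous[OF f] by (simp add: continuous_within)
  have E0: "(E \<longlongrightarrow> 0) (at x within S)"
  proof -
    have "((\<lambda>y. (f y - f x) * g x) \<longlongrightarrow> (f x - f x) * g x) (at x within S)"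
      by (intro tendsto_intros fc)
    then show ?thesis by (simp add: E_def[abs_def])
  qed
  have inS: "\<forall>\<^sub>F y in at x within S. y \<in> S" by (simp add: eventually_at_topological) blast
  have "\<forall>\<^sub>F y in at x within S. norm (E y) < 1/2"
    using E0[unfolded tendsto_iff, rule_format, of "1/2"] by (simp add: dist_norm)
  with inS have gb: "\<forall>\<^sub>F y in at x within S. norm (g y - g x) \<le> norm (g x) * (2 * norm (E y))"
  proof eventually_elim
    case (elim y)
    have "f y * g x = 1 + E y" using inv(2)[OF x] by (simp add: E_def algebra_simps)
    moreover have "norm (E y) < 1" using elim by simp
    ultimately have "f y * g x * ninv (E y) = 1" using ninv_right by simp
    then have "g y = g y * (f y * g x * ninv (E y))" by simp
    also have "\<dots> = g x * ninv (E y)" using inv(1)[OF elim(1)] by (simp flip: mult.assoc)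
    finally have "g y - g x = g x * (ninv (E y) - 1)" by (simp add: algebra_simps)
    then have "norm (g y - g x) \<le> norm (g x) * norm (ninv (E y) - 1)" by (simp only: norm_mult_ineq)
    also have "\<dots> \<le> norm (g x) * (2 * norm (E y))"
      using norm_ninv_minus_one[of "E y"] elim by (intro mult_left_mono) auto
    finally show ?case .
  qed
  have "((\<lambda>y. norm (g x) * (2 * norm (E y))) \<longlongrightarrow> norm (g x) * (2 * norm (0::'a))) (at x within S)"
    by (intro tendsto_intros E0)
  then have "((\<lambda>y. g y - g x) \<longlongrightarrow> 0) (at x within S)"
    using gb by (intro Lim_null_comparison[OF gb]) simp
  then have gc: "(g \<longlongrightarrow> g x) (at x within S)" by (rule LIM_zero_cancel)
  have "((\<lambda>y. (f y - f x) /\<^sub>R (y - x)) \<longlongrightarrow> f') (at x within S)"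
    using f by (simp only: has_vector_derivative_iff_tendsto)
  then have "((\<lambda>y. - (g y * ((f y - f x) /\<^sub>R (y - x)) * g x)) \<longlongrightarrow> - (g x * f' * g x)) (at x within S)"
    by (intro tendsto_intros gc)
  moreover have "\<forall>\<^sub>F y in at x within S. - (g y * ((f y - f x) /\<^sub>R (y - x)) * g x) = (g y - g x) /\<^sub>R (y - x)"
    using inS
  proof eventually_elim
    case (elim y)
    have "- (g y * (f y - f x) * g x) = g y * (f x * g x) - (g y * f y) * g x" by (simp add: algebra_simps)
    also have "\<dots> = g y - g x" using inv elim x by simp
    finally have "(- (g y * (f y - f x) * g x)) /\<^sub>R (y - x) = (g y - g x) /\<^sub>R (y - x)" by (rule arg_cong)
    then show ?case by simp
  qed
  ultimately have "((\<lambda>y. (g y - g x) /\<^sub>R (y - x)) \<longlongrightarrow> - (g x * f' * g x)) (at x within S)"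
    by (rule Lim_transform_eventually)
  then show ?thesis by (simp only: has_vector_derivative_iff_tendsto)
qed

lemma exp_commute:
  fixes x A :: "'a::{real_normed_algebra_1,banach}"
  assumes "x * A = A * x" shows "x * exp A = exp A * x"
proof -
  have "x * A ^ n = A ^ n * x" for n by (metis assms power_commuting_commutes)
  then have "(\<Sum>n. x * (A ^ n /\<^sub>R fact n)) = (\<Sum>n. A ^ n /\<^sub>R fact n * x)" by simp
  then show ?thesis unfolding exp_def
    by (simp only: suminf_mult[OF summable_exp_generic] suminf_mult2[OF summable_exp_generic])
qed

lemma norm_exp_scaleR:
  fixes A :: "'a::{real_normed_algebra_1,banach}"
  assumes "norm A \<le> a" "\<bar>x\<bar> \<le> y" shows "norm (exp (x *\<^sub>R A)) \<le> exp (a * y)"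
proof -
  have "norm (exp (x *\<^sub>R A)) \<le> exp (norm (x *\<^sub>R A))" by (rule norm_exp)
  also have "norm (x *\<^sub>R A) \<le> y * a" using assms by (auto intro!: mult_mono order_trans[of 0 "norm A" a])
  finally show ?thesis by (simp add: mult.commute)
qed

lemma exp_scaleR_inverse:
  fixes A :: "'a::{real_normed_algebra_1,banach}"
  shows "exp (x *\<^sub>R A) * exp ((- x) *\<^sub>R A) = 1" "exp ((- x) *\<^sub>R A) * exp (x *\<^sub>R A) = 1"
  using exp_minus_inverse[of "x *\<^sub>R A"] exp_minus_inverse[of "- (x *\<^sub>R A)"] by simp_all

definition has_inverse :: "'a::monoid_mult \<Rightarrow> bool" where
  "has_inverse y \<longleftrightarrow> (\<exists>z. z * y = 1 \<and> y * z = 1)"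

lemma has_inverse_near_one:
  fixes y :: "'a::{real_normed_algebra_1,banach}"
  assumes "norm (y - 1) < 1" shows "has_inverse y"
  using ninv_left[OF assms] ninv_right[OF assms] by (auto simp: has_inverse_def)

lemma has_inverse_mult: "has_inverse x \<Longrightarrow> has_inverse y \<Longrightarrow> has_inverse (x * y)"
proof -
  assume "has_inverse x" "has_inverse y"
  then obtain u v where "u * x = 1" "x * u = 1" "v * y = 1" "y * v = 1" by (auto simp: has_inverse_def)
  then have "v * (u * x) * y = 1" "x * (y * v) * u = 1" by simp_all
  then show ?thesis unfolding has_inverse_def by (intro exI[of _ "v * u"]) (simp add: mult.assoc)
qed

text \<open>Invertibility propagates in steps of length \<open>h\<close>: if \<open>z\<close>
  inverts \<open>Y s\<close>, then \<open>Y x * z\<close> stays within distance 1 of the identity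
  for \<open>s \<le> x \<le> s + h\<close>.\<close>

lemma solution_has_inverse:
  fixes Y :: "real \<Rightarrow> 'a::{real_normed_algebra_1,banach}"
  assumes Y: "\<And>x. x \<in> {0..b} \<Longrightarrow> (Y has_vector_derivative T x * Y x) (at x within {0..b})"
    and T: "\<And>x. x \<in> {0..b} \<Longrightarrow> norm (T x) \<le> d" and Y0: "Y 0 = 1" and x: "x \<in> {0..b}"
  shows "has_inverse (Y x)"
proof -
  define h where "h = 1 / (4 * (\<bar>d\<bar> + 1))"
  have h: "h > 0" by (simp add: h_def)
  have "\<forall>x\<in>{0..b}. x \<le> real n * h \<longrightarrow> has_inverse (Y x)" for n
  proof (induction n)
    case 0
    then show ?case using Y0 by (auto simp: has_inverse_def)
  next
    case (Suc n)
    show ?case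
    proof (intro ballI impI)
      fix x assume x: "x \<in> {0..b}" "x \<le> real (Suc n) * h"
      define s where "s = max 0 (x - h)"
      have s: "s \<in> {0..b}" "s \<le> x" "x - s \<le> h" "s \<le> real n * h"
        using x h by (auto simp: s_def algebra_simps max_def)
      then obtain z where z: "z * Y s = 1" "Y s * z = 1" using Suc by (auto simp: has_inverse_def)
      have "norm (Y x * z - Y s * z) \<le> 2 * (\<bar>d\<bar>) * (x - s) * norm (Y s * z)"
      proof (rule short_time_bound[where Y = "\<lambda>x. Y x * z" and T = T])
        fix y assume y: "y \<in> {s..x}"
        then have y': "y \<in> {0..b}" using s x by auto
        have "(Y has_vector_derivative T y * Y y) (at y within {s..x})"
          by (rule has_vector_derivative_within_subset[OF Y[OF y']]) (use s x in auto)
        then show "((\<lambda>x. Y x * z) has_vector_derivative T y * (Y y * z)) (at y within {s..x})"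
          by (auto intro!: derivative_eq_intros simp: mult.assoc)
        show "norm (T y) \<le> \<bar>d\<bar>" using T[OF y'] by simp
      next
        have "\<bar>d\<bar> * (x - s) \<le> \<bar>d\<bar> * h" using s by (intro mult_left_mono) auto
        also have "\<dots> \<le> 1/2" by (simp add: h_def field_simps)
        finally show "\<bar>d\<bar> * (x - s) \<le> 1/2" .
      qed (use s in auto)
      also have "\<dots> \<le> 2 * \<bar>d\<bar> * h" using s z by (auto intro!: mult_left_mono)
      also have "\<dots> < 1" by (simp add: h_def field_simps)
      finally have "has_inverse (Y x * z)" using has_inverse_near_one[of "Y x * z"] z by simp
      moreover have "has_inverse (Y s)" using z by (auto simp: has_inverse_def)
      ultimately have "has_inverse (Y x * z * Y s)" by (rule has_inverse_mult)
      then show "has_inverse (Y x)" using z by (simp add: mult.assoc)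
    qed
  qed
  moreover obtain n where "x \<le> real n * h" using h by (metis ex_less_of_nat_mult less_imp_le)
  ultimately show ?thesis using x by blast
qed

lemma norm_mult3:
  fixes x :: "'a::real_normed_algebra"
  shows "norm (x * y * z) \<le> norm x * norm y * norm z"
  by (rule order_trans[OF norm_mult_ineq]) (simp add: mult_right_mono norm_mult_ineq)

text \<open>In the conjugated variable \<open>exp (- (x - s) A) P\<inverse> Y\<close> only the perturbation \<open>B - A0\<close> is
  left, at the price of the factor \<open>exp (2 a (b - s))\<close>.\<close>

lemma conjugated_step:
  fixes Y P Pi A0 B :: "real \<Rightarrow> 'a::{real_normed_algebra_1,banach}"
  assumes "s \<le> b"
    and Y: "\<And>x. x \<in> {s..b} \<Longrightarrow> (Y has_vector_derivative B x * Y x) (at x within {s..b})"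
    and P: "\<And>x. x \<in> {s..b} \<Longrightarrow> (P has_vector_derivative A0 x * P x - P x * A) (at x within {s..b})"
    and Pi: "\<And>x. x \<in> {s..b} \<Longrightarrow> Pi x * P x = 1" "\<And>x. x \<in> {s..b} \<Longrightarrow> P x * Pi x = 1"
    and K: "\<And>x. x \<in> {s..b} \<Longrightarrow> norm (P x) \<le> K" "\<And>x. x \<in> {s..b} \<Longrightarrow> norm (Pi x) \<le> K"
    and \<delta>: "\<And>x. x \<in> {s..b} \<Longrightarrow> norm (B x - A0 x) \<le> \<delta>"
    and z: "has_inverse (Y s)" and a: "norm A \<le> a"
    and d: "d = K * K * \<delta> * exp (2 * a * (b - s))" "d * (b - s) \<le> 1/2"
  shows "\<exists>E. Pi b * Y b = exp ((b - s) *\<^sub>R A) * (1 + E) * (Pi s * Y s) \<and> norm E \<le> 2 * d * (b - s)"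
proof -
  obtain z where z: "z * Y s = 1" "Y s * z = 1" using z by (auto simp: has_inverse_def)
  define em where "em x = exp ((x - s) *\<^sub>R (- A))" for x
  define ep where "ep x = exp ((x - s) *\<^sub>R A)" for x
  have ee: "em x * ep x = 1" "ep x * em x = 1" for x
    using exp_minus_inverse[of "(x - s) *\<^sub>R A"] exp_minus_inverse[of "- ((x - s) *\<^sub>R A)"]
    by (simp_all add: em_def ep_def)
  \<comment> \<open>\<open>z * P s\<close> is the inverse of \<open>Pi s * Y s\<close>, so
    \<open>Z\<close> starts at the identity, and its generator \<open>T\<close> contains only the
    perturbation, conjugated by \<open>P\<close> and by the exponentials.\<close>
  define Z where "Z x = em x * Pi x * Y x * (z * P s)" for x
  define T where "T x = em x * (Pi x * (B x - A0 x) * P x) * ep x" for x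
  have s: "s \<in> {s..b}" using \<open>s \<le> b\<close> by simp
  have K0: "K \<ge> 0" using norm_ge_zero K(1)[OF s] by (rule order_trans)
  have \<delta>0: "\<delta> \<ge> 0" using norm_ge_zero \<delta>[OF s] by (rule order_trans)
  have "norm (Z b - Z s) \<le> 2 * d * (b - s) * norm (Z s)"
  proof (rule short_time_bound[where T = T and Y = Z])
    fix x assume x: "x \<in> {s..b}"
    have "((\<lambda>t. exp (t *\<^sub>R (- A))) \<circ> (\<lambda>x. x - s) has_vector_derivative (1 *\<^sub>R (exp ((x - s) *\<^sub>R (- A)) * (- A)))) (at x within {s..b})"
    proof (rule vector_diff_chain_within)
      show "((\<lambda>x. x - s) has_vector_derivative 1) (at x within {s..b})"
        by (auto intro!: derivative_eq_intros)
    qed (rule exp_scaleR_has_vector_derivative_right)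
    then have em': "(em has_vector_derivative em x * (- A)) (at x within {s..b})"
      by (simp add: em_def[abs_def] o_def)
    have Pi': "(Pi has_vector_derivative - (Pi x * (A0 x * P x - P x * A) * Pi x)) (at x within {s..b})"
      by (rule has_vector_derivative_inverse_algebra[OF P[OF x] x Pi])
    have Z': "(Z has_vector_derivative
        (em x * Pi x * (B x * Y x) + (em x * - (Pi x * (A0 x * P x - P x * A) * Pi x) + em x * (- A) * Pi x) * Y x) * (z * P s))
        (at x within {s..b})"
      unfolding Z_def by (intro has_vector_derivative_mult_left has_vector_derivative_mult em' Pi' Y x)
    have eq: "(em x * Pi x * (B x * Y x) + (em x * - (Pi x * (A0 x * P x - P x * A) * Pi x) + em x * (- A) * Pi x) * Y x) * (z * P s)
        = T x * Z x"
    proof -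
      have "Pi x * (A0 x * P x - P x * A) * Pi x = Pi x * A0 x * (P x * Pi x) - (Pi x * P x) * A * Pi x"
        by (simp only: right_diff_distrib left_diff_distrib mult.assoc)
      then have e: "Pi x * (A0 x * P x - P x * A) * Pi x = Pi x * A0 x - A * Pi x" using Pi x by simp
      have "T x * Z x = em x * (Pi x * (B x - A0 x) * P x) * (ep x * em x) * Pi x * Y x * (z * P s)"
        by (simp only: T_def Z_def mult.assoc)
      also have "\<dots> = em x * Pi x * (B x - A0 x) * (P x * Pi x) * Y x * (z * P s)"
        unfolding ee by (simp add: mult.assoc)
      also have "\<dots> = em x * Pi x * (B x - A0 x) * Y x * (z * P s)" using Pi x by simp
      finally show ?thesis unfolding e by (simp add: algebra_simps)
    qed
    show "(Z has_vector_derivative T x * Z x) (at x within {s..b})" using Z' unfolding eq .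
    have n: "norm (em x) \<le> exp (a * (b - s))" "norm (ep x) \<le> exp (a * (b - s))"
      unfolding em_def ep_def by (rule norm_exp_scaleR; use x a in simp)+
    have "norm (Pi x * (B x - A0 x) * P x) \<le> norm (Pi x) * norm (B x - A0 x) * norm (P x)"
      by (rule norm_mult3)
    also have "\<dots> \<le> K * \<delta> * K" using K \<delta> x K0 \<delta>0 by (intro mult_mono) auto
    finally have m: "norm (Pi x * (B x - A0 x) * P x) \<le> K * \<delta> * K" .
    have "norm (T x) \<le> norm (em x) * norm (Pi x * (B x - A0 x) * P x) * norm (ep x)"
      unfolding T_def by (rule norm_mult3)
    also have "\<dots> \<le> exp (a * (b - s)) * (K * \<delta> * K) * exp (a * (b - s))"
      using n m K0 \<delta>0 by (intro mult_mono) auto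
    also have "\<dots> = d" unfolding d by (simp add: mult_exp_exp algebra_simps)
    finally show "norm (T x) \<le> d" .
  qed (use d \<open>s \<le> b\<close> in auto)
  moreover have Zs: "Z s = 1"
  proof -
    have "Z s = Pi s * (Y s * z) * P s" by (simp add: Z_def em_def mult.assoc)
    then show ?thesis using z Pi \<open>s \<le> b\<close> by simp
  qed
  ultimately have n: "norm (Z b - 1) \<le> 2 * d * (b - s)" by simp
  have "ep b * Z b * (Pi s * Y s) = (ep b * em b) * Pi b * Y b * (z * (P s * Pi s) * Y s)"
    by (simp only: Z_def mult.assoc)
  also have "\<dots> = Pi b * Y b" using ee Pi z \<open>s \<le> b\<close> by simp
  finally show ?thesis using n by (intro exI[of _ "Z b - 1"]) (simp add: ep_def)
qed

context growth_scale
begin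

lemma subexp_L: "subexp L"
  unfolding subexp_def
proof (intro allI impI)
  fix \<eta> :: real assume \<eta>: "\<eta> > 0"
  have "\<forall>\<^sub>F t in F. 2/\<eta> \<le> exp (\<eta>/2 * L t)" by (rule eventually_le_exp) (use \<eta> in simp)
  with eventually_L_ge[of 0]
  show "\<forall>\<^sub>F t in F. norm (L t) \<le> exp (\<eta> * L t)"
  proof eventually_elim
    case (elim t)
    have "\<eta>/2 * L t \<le> exp (\<eta>/2 * L t)" using exp_ge_add_one_self[of "\<eta>/2 * L t"] by linarith
    then have "L t \<le> 2/\<eta> * exp (\<eta>/2 * L t)" using \<eta> by (simp add: field_simps)
    also have "\<dots> \<le> exp (\<eta>/2 * L t) * exp (\<eta>/2 * L t)" using elim \<eta> by (intro mult_right_mono) auto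
    also have "\<dots> = exp (\<eta> * L t)" by (simp add: mult_exp_exp)
    finally show ?case using elim by simp
  qed
qed

text \<open>Over one of \<open>n\<close> equal pieces of the half period the growth \<open>exp (2 a (L / 2n))\<close> is at most
  \<open>exp (\<theta> L / 4)\<close>, which the perturbation \<open>exp (- \<theta> L / 2)\<close> outweighs; so each piece is a
  small relative perturbation of \<open>exp ((L / 2n) A)\<close>.\<close>

lemma half_line_factored:
  fixes A p c q :: "'t \<Rightarrow> 'a::{real_normed_algebra_1,banach}"
    and B A0 Y P Pi :: "'t \<Rightarrow> real \<Rightarrow> 'a" and \<sigma> :: "'t \<Rightarrow> real"
  assumes pos: "\<theta> > 0" "\<alpha> > 0"
    and sp: "\<forall>\<^sub>F t in F. splitting (p t) (c t) (q t)"
    and com: "\<forall>\<^sub>F t in F. A t * p t = p t * A t \<and> A t * c t = c t * A t \<and> A t * q t = q t * A t"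
    and sub: "subexp p" "subexp c" "subexp q" "subexp \<sigma>"
    and A: "\<forall>\<^sub>F t in F. norm (A t) \<le> a"
    and decay: "\<forall>\<^sub>F t in F. \<forall>x\<in>{0..L t / 2}.
        norm (exp ((- x) *\<^sub>R A t) * p t) \<le> K * exp (- \<alpha> * x) \<and>
        norm (exp (x *\<^sub>R A t) * q t) \<le> K * exp (- \<alpha> * x) \<and>
        norm (exp (x *\<^sub>R A t) * c t) \<le> \<sigma> t \<and> norm (exp ((- x) *\<^sub>R A t) * c t) \<le> \<sigma> t"
    and ode: "\<forall>\<^sub>F t in F. Y t 0 = 1 \<and> (\<forall>x\<in>{0..L t / 2}.
        (Y t has_vector_derivative B t x * Y t x) (at x within {0..L t / 2}) \<and>
        (P t has_vector_derivative A0 t x * P t x - P t x * A t) (at x within {0..L t / 2}) \<and>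
        has_inverse (Y t x) \<and> Pi t x * P t x = 1 \<and> P t x * Pi t x = 1 \<and>
        norm (P t x) \<le> K \<and> norm (Pi t x) \<le> K \<and> norm (B t x - A0 t x) \<le> K * exp (- \<theta> * L t / 2))"
    and P: "small (\<lambda>t. P t (L t / 2) - 1)"
  obtains l D D1 D2 u where
    "factored p c q (\<lambda>t. Y t (L t / 2) * P t 0) (\<lambda>t. exp ((L t / 2) *\<^sub>R A t) * c t) l D D1 D2 u"
    "small D1" "small (\<lambda>t. D t * q t)"
proof -
  \<comment> \<open>Pieces of length \<open>L / (2 * n)\<close> cost a factor
    \<open>exp (\<bar>a\<bar> * L / n)\<close>, which is at most
    \<open>exp (\<theta> * L / 4)\<close> once \<open>n \<ge> 4 * \<bar>a\<bar> / \<theta>\<close>.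
    The added 1 keeps \<open>n\<close> positive. It is essential that \<open>n\<close> does not
    depend on \<open>t\<close>.\<close>
  define n where "n = nat \<lceil>4 * \<bar>a\<bar> / \<theta>\<rceil> + 1"
  have n0: "n > 0" by (simp add: n_def)
  have "4 * \<bar>a\<bar> / \<theta> \<le> real n" unfolding n_def by linarith
  then have na: "4 * \<bar>a\<bar> \<le> real n * \<theta>" using pos by (simp add: field_simps)
  define l where "l t = L t / (2 * real n)" for t
  define s where "s i t = real i * l t" for i t
  have sl: "s (Suc i) t - s i t = l t" "s n t = L t / 2" "s 0 t = 0" for i t
    using n0 by (auto simp: s_def l_def field_simps)
  define G where "G t = exp (l t *\<^sub>R A t)" for t
  define Gi where "Gi t = exp ((- l t) *\<^sub>R A t)" for t
  define d where "d t = K * K * (K * exp (- \<theta> * L t / 2)) * exp (2 * \<bar>a\<bar> * l t)" for t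
  define V where "V i t = Pi t (s i t) * Y t (s i t) * P t 0" for i t
  define S where "S i t = exp (s i t *\<^sub>R A t) * c t" for i t
  \<comment> \<open>The error of each piece is only known to exist, for one late \<open>t\<close> at
    a time; the choice makes it a family over the filter.\<close>
  define E where "E i t = (SOME E. V (Suc i) t = G t * (1 + E) * V i t \<and> norm E \<le> 2 * d t * l t)" for i t
  have lpos: "\<forall>\<^sub>F t in F. l t \<ge> 0"
    using eventually_L_ge[of 0] by eventually_elim (simp add: l_def)
  have K: "\<forall>\<^sub>F t in F. K \<ge> 0"
  proof (rule eventually_mono)
    show "\<forall>\<^sub>F t in F. norm (P t 0) \<le> K" using ode eventually_L_ge[of 0] by eventually_elim auto
  qed (rule order_trans[OF norm_ge_zero])
  have sd: "small d"
  proof (rule small_bound_K[of "\<theta>/4" _ "K * K * K"])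
    show "\<forall>\<^sub>F t in F. norm (d t) \<le> K * K * K * exp (- (\<theta>/4) * L t)"
      using eventually_L_ge[of 0] K
    proof eventually_elim
      case (elim t)
      have "2 * \<bar>a\<bar> * l t = (4 * \<bar>a\<bar>) * L t / (4 * real n)" using n0 by (simp add: l_def field_simps)
      also have "\<dots> \<le> (real n * \<theta>) * L t / (4 * real n)"
        using na elim by (intro divide_right_mono mult_right_mono) auto
      also have "\<dots> = \<theta>/4 * L t" using n0 by (simp add: field_simps)
      finally have "exp (2 * \<bar>a\<bar> * l t) \<le> exp (\<theta>/4 * L t)" by (simp only: exp_le_cancel_iff)
      then have "d t \<le> K * K * (K * exp (- \<theta> * L t / 2)) * exp (\<theta>/4 * L t)"
        unfolding d_def using elim by (intro mult_left_mono) auto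
      also have "\<dots> = K * K * K * (exp (- \<theta> * L t / 2) * exp (\<theta>/4 * L t))" by simp
      also have "exp (- \<theta> * L t / 2) * exp (\<theta>/4 * L t) = exp (- (\<theta>/4) * L t)"
        by (simp add: mult_exp_exp)
      finally show ?case using elim by (simp add: d_def)
    qed
  qed (use pos in simp)
  have sdl: "small (\<lambda>t. 2 * d t * l t)"
  proof -
    have "small (\<lambda>t. (d t * L t) * (1 / real n))"
      by (intro small_mult_right sd subexp_L subexp_const)
    then show ?thesis by (rule small_cong) (simp add: l_def)
  qed
  have EV: "\<forall>\<^sub>F t in F. V (Suc i) t = G t * (1 + E i t) * V i t \<and> norm (E i t) \<le> 2 * d t * l t"
    if "i < n" for i
    using ode A lpos small_eventually_less[OF sdl zero_less_one]
  proof eventually_elim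
    case (elim t)
    have sub: "{s i t..s (Suc i) t} \<subseteq> {0..L t / 2}"
    proof -
      have "s (Suc i) t \<le> s n t" using that elim(3) by (simp add: s_def mult_right_mono)
      moreover have "0 \<le> s i t" using elim(3) by (simp add: s_def)
      ultimately show ?thesis using sl by auto
    qed
    have le: "s i t \<le> s (Suc i) t" using sl(1)[of i t] elim(3) by simp
    have "\<exists>E. Pi t (s (Suc i) t) * Y t (s (Suc i) t) =
        exp ((s (Suc i) t - s i t) *\<^sub>R A t) * (1 + E) * (Pi t (s i t) * Y t (s i t)) \<and>
        norm E \<le> 2 * d t * (s (Suc i) t - s i t)"
    proof (rule conjugated_step[where B = "B t" and ?A0.0 = "A0 t" and P = "P t" and a = "\<bar>a\<bar>" and d = "d t"
          and \<delta> = "K * exp (- \<theta> * L t / 2)" and K = K, OF le])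
      show "norm (A t) \<le> \<bar>a\<bar>" using elim by simp
      show "d t = K * K * (K * exp (- \<theta> * L t / 2)) * exp (2 * \<bar>a\<bar> * (s (Suc i) t - s i t))"
        by (simp only: sl d_def)
      show "d t * (s (Suc i) t - s i t) \<le> 1/2" unfolding sl using elim(4) by simp
      show "has_inverse (Y t (s i t))" using elim(1) sub le by auto
      fix x assume "x \<in> {s i t..s (Suc i) t}"
      then have x: "x \<in> {0..L t / 2}" using sub by blast
      then show "Pi t x * P t x = 1" "P t x * Pi t x = 1" "norm (P t x) \<le> K" "norm (Pi t x) \<le> K"
        "norm (B t x - A0 t x) \<le> K * exp (- \<theta> * L t / 2)" using elim(1) by blast+
      show "(Y t has_vector_derivative B t x * Y t x) (at x within {s i t..s (Suc i) t})"
        "(P t has_vector_derivative A0 t x * P t x - P t x * A t) (at x within {s i t..s (Suc i) t})"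
        using elim(1) x sub by (blast intro: has_vector_derivative_within_subset)+
    qed
    then have "\<exists>E. V (Suc i) t = G t * (1 + E) * V i t \<and> norm E \<le> 2 * d t * l t"
      unfolding sl V_def G_def by (metis mult.assoc)
    then show ?case unfolding E_def by (rule someI_ex)
  qed
  have sE: "small (E i)" if "i < n" for i
    by (rule small_mono[OF sdl]) (use EV[OF that] in eventually_elim, auto)
  have G: "\<forall>\<^sub>F t in F. G t * Gi t = 1 \<and> Gi t * G t = 1 \<and> G t * p t = p t * G t \<and>
        G t * c t = c t * G t \<and> G t * q t = q t * G t"
    using com
  proof eventually_elim
    case (elim t)
    have "x * G t = G t * x" if "A t * x = x * A t" for x
      unfolding G_def using that by (intro exp_commute) simp
    then show ?case using elim exp_scaleR_inverse[of "l t" "A t"] by (auto simp: G_def Gi_def)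
  qed
  have lin: "\<forall>\<^sub>F t in F. l t \<in> {0..L t / 2}"
    using eventually_L_ge[of 0]
  proof eventually_elim
    case (elim t)
    have "L t / (2 * real n) \<le> L t / 2" using elim n0 by (intro divide_left_mono) auto
    then show ?case using elim by (simp add: l_def)
  qed
  have Gs: "small (\<lambda>t. Gi t * p t)" "small (\<lambda>t. G t * q t)"
  proof -
    have e: "- \<alpha> * l t = - (\<alpha> / (2 * real n)) * L t" for t by (simp add: l_def)
    have "\<forall>\<^sub>F t in F. norm (Gi t * p t) \<le> K * exp (- (\<alpha> / (2 * real n)) * L t)"
      "\<forall>\<^sub>F t in F. norm (G t * q t) \<le> K * exp (- (\<alpha> / (2 * real n)) * L t)"
    proof -
      show "\<forall>\<^sub>F t in F. norm (Gi t * p t) \<le> K * exp (- (\<alpha> / (2 * real n)) * L t)"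
        using decay lin by eventually_elim (unfold Gi_def e[symmetric], blast)
      show "\<forall>\<^sub>F t in F. norm (G t * q t) \<le> K * exp (- (\<alpha> / (2 * real n)) * L t)"
        using decay lin by eventually_elim (unfold G_def e[symmetric], blast)
    qed
    then show "small (\<lambda>t. Gi t * p t)" "small (\<lambda>t. G t * q t)"
      using pos n0 by (auto intro!: small_bound_K[of "\<alpha> / (2 * real n)"])
  qed
  have Gc: "subexp (\<lambda>t. G t * c t)" "subexp (\<lambda>t. Gi t * c t)"
  proof -
    have "\<forall>\<^sub>F t in F. norm (G t * c t) \<le> norm (\<sigma> t)"
      using decay lin by eventually_elim (unfold G_def, force)
    then show "subexp (\<lambda>t. G t * c t)" by (rule subexp_mono[OF sub(4)])
    have "\<forall>\<^sub>F t in F. norm (Gi t * c t) \<le> norm (\<sigma> t)"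
      using decay lin by eventually_elim (unfold Gi_def, force)
    then show "subexp (\<lambda>t. Gi t * c t)" by (rule subexp_mono[OF sub(4)])
  qed
  have Ssub: "subexp (S i)" if "i \<le> n" for i
  proof (rule subexp_mono[OF sub(4)])
    show "\<forall>\<^sub>F t in F. norm (S i t) \<le> norm (\<sigma> t)" using decay lpos
    proof eventually_elim
      case (elim t)
      have "s i t \<le> s n t" using that elim(2) by (simp add: s_def mult_right_mono)
      then have "s i t \<in> {0..L t / 2}" unfolding sl using elim by (simp add: s_def)
      then show ?case using elim by (force simp: S_def)
    qed
  qed
  have Sc: "\<forall>\<^sub>F t in F. c t * S i t = S i t" for i
    using com sp
  proof eventually_elim
    case (elim t)
    have "c t * exp (s i t *\<^sub>R A t) = exp (s i t *\<^sub>R A t) * c t" using elim by (intro exp_commute) simp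
    then show ?case using elim by (simp add: S_def splitting_def mult.assoc flip: mult.assoc[of "c t"])
  qed
  have SS: "G t * S i t = S (Suc i) t" for i t
  proof -
    have "exp (l t *\<^sub>R A t + s i t *\<^sub>R A t) = G t * exp (s i t *\<^sub>R A t)"
      unfolding G_def by (rule exp_add_commuting) simp
    moreover have "l t *\<^sub>R A t + s i t *\<^sub>R A t = s (Suc i) t *\<^sub>R A t"
      by (simp add: s_def algebra_simps flip: scaleR_add_left)
    ultimately show ?thesis by (simp add: S_def mult.assoc)
  qed
  have fac_cong: "factored p c q V' S' l D D1 D2 u"
    if "factored p c q V S' l D D1 D2 u" "\<forall>\<^sub>F t in F. V' t = V t" for V V' S' l D D1 D2 u
  proof -
    have "\<forall>\<^sub>F t in F. V t = (1 + l t) * D t * (1 + u t) \<and> u t * p t = 0 \<and>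
        D t * p t = p t * D t \<and> D t * c t = c t * D t \<and> D t * q t = q t * D t \<and>
        D1 t * D t = p t \<and> D t * D1 t = p t \<and> p t * D1 t = D1 t \<and> D1 t * p t = D1 t \<and>
        D2 t * D t = c t \<and> D t * D2 t = c t \<and> c t * D2 t = D2 t \<and> D2 t * c t = D2 t"
      using that(1) unfolding factored_def by blast
    with that(2) have "\<forall>\<^sub>F t in F. V' t = (1 + l t) * D t * (1 + u t) \<and> u t * p t = 0 \<and>
        D t * p t = p t * D t \<and> D t * c t = c t * D t \<and> D t * q t = q t * D t \<and>
        D1 t * D t = p t \<and> D t * D1 t = p t \<and> p t * D1 t = D1 t \<and> D1 t * p t = D1 t \<and>
        D2 t * D t = c t \<and> D t * D2 t = c t \<and> c t * D2 t = D2 t \<and> D2 t * c t = D2 t"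
      by eventually_elim simp
    then show ?thesis using that(1) unfolding factored_def by blast
  qed
  \<comment> \<open>At \<open>i = 0\<close> the diagonal factor is the identity, so decay of
    \<open>D1\<close> and of \<open>D * q\<close> can be claimed only after a first step.\<close>
  have "\<exists>l D D1 D2 u. factored p c q (V i) (S i) l D D1 D2 u \<and> (i > 0 \<longrightarrow> small D1 \<and> small (\<lambda>t. D t * q t))"
    if "i \<le> n" for i
    using that
  proof (induction i)
    case 0
    have "\<forall>\<^sub>F t in F. V 0 t = 1 \<and> S 0 t = c t" using ode eventually_L_ge[of 0]
      by eventually_elim (simp add: V_def S_def sl)
    moreover have "factored p c q (V 0) (S 0) (\<lambda>t. 0) (\<lambda>t. 1) p c (\<lambda>t. 0)"
      unfolding factored_def
    proof (intro conjI)
      show "small (\<lambda>t. 1 * c t - S 0 t)" by (rule small_cong[OF small_zero]) (use calculation in eventually_elim, simp)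
    qed (use sub in simp_all, use calculation sp in eventually_elim, simp add: splitting_def)
    ultimately show ?case by blast
  next
    case (Suc i)
    then obtain l D D1 D2 u where f: "factored p c q (V i) (S i) l D D1 D2 u" by auto
    have i: "i < n" "i \<le> n" using Suc by auto
    obtain l' D' D1' D2' u' where
      f': "factored p c q (\<lambda>t. G t * (1 + E i t) * V i t) (\<lambda>t. G t * S i t) l' D' D1' D2' u'"
      and sm: "small D1'" "small (\<lambda>t. D' t * q t)"
      using factored_step[OF sp sub(1-3) sE[OF i(1)] G Gs Gc Ssub[OF i(2)] Sc f] by blast
    have "\<forall>\<^sub>F t in F. V (Suc i) t = G t * (1 + E i t) * V i t"
      using EV[OF i(1)] by eventually_elim simp
    from fac_cong[OF f' this] show ?case using sm unfolding SS by blast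
  qed
  from this[of n] n0 obtain l D D1 D2 u where f: "factored p c q (V n) (S n) l D D1 D2 u"
    and sm: "small D1" "small (\<lambda>t. D t * q t)" by auto
  \<comment> \<open>\<open>factored\<close> asks nothing of the left factor but smallness, so
    \<open>P (L / 2)\<close>, which is close to the identity, can be absorbed there. This removes
    \<open>Pi (L / 2)\<close> from \<open>V n\<close>.\<close>
  define l' where "l' t = (P t (L t / 2) - 1) + l t + (P t (L t / 2) - 1) * l t" for t
  have sl': "small l" using f unfolding factored_def by blast
  have "small l'" unfolding l'_def by (intro small_add P sl' small_mult_right small_imp_subexp)
  have ev: "\<forall>\<^sub>F t in F. V n t = (1 + l t) * D t * (1 + u t) \<and> u t * p t = 0 \<and>
        D t * p t = p t * D t \<and> D t * c t = c t * D t \<and> D t * q t = q t * D t \<and>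
        D1 t * D t = p t \<and> D t * D1 t = p t \<and> p t * D1 t = D1 t \<and> D1 t * p t = D1 t \<and>
        D2 t * D t = c t \<and> D t * D2 t = c t \<and> c t * D2 t = D2 t \<and> D2 t * c t = D2 t"
    using f unfolding factored_def by blast
  have ev2: "\<forall>\<^sub>F t in F. Y t (L t / 2) * P t 0 = (1 + l' t) * D t * (1 + u t)"
    using ev ode eventually_L_ge[of 0]
  proof eventually_elim
    case (elim t)
    have PP: "P t (L t / 2) * Pi t (L t / 2) = 1" using elim by auto
    have "1 + l' t = P t (L t / 2) * (1 + l t)" by (simp add: l'_def algebra_simps)
    then have "(1 + l' t) * D t * (1 + u t) = P t (L t / 2) * V n t" using elim by (simp add: mult.assoc)
    also have "\<dots> = (P t (L t / 2) * Pi t (L t / 2)) * Y t (L t / 2) * P t 0"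
      unfolding V_def sl by (simp only: mult.assoc)
    finally show ?case unfolding PP by simp
  qed
  have "factored p c q (\<lambda>t. Y t (L t / 2) * P t 0) (S n) l' D D1 D2 u"
    unfolding factored_def
  proof (intro conjI)
    show "\<forall>\<^sub>F t in F. Y t (L t / 2) * P t 0 = (1 + l' t) * D t * (1 + u t) \<and> u t * p t = 0 \<and>
        D t * p t = p t * D t \<and> D t * c t = c t * D t \<and> D t * q t = q t * D t \<and>
        D1 t * D t = p t \<and> D t * D1 t = p t \<and> p t * D1 t = D1 t \<and> D1 t * p t = D1 t \<and>
        D2 t * D t = c t \<and> D t * D2 t = c t \<and> c t * D2 t = D2 t \<and> D2 t * c t = D2 t"
      using ev ev2 by eventually_elim blast
  qed (use f \<open>small l'\<close> in \<open>auto simp: factored_def\<close>)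
  then show ?thesis using that sm unfolding S_def sl by blast
qed

end

section \<open>The Banach algebra of complex matrices\<close>

text \<open>A separate type lets the matrix product and the operator norm be the class operations,
  so that the general results on Banach algebras above apply to matrices.\<close>

typedef 'n cmat = "UNIV :: (complex^'n^'n) set" morphisms mat_of cmat
  by simp

setup_lifting type_definition_cmat

lemma matrix_scaleR_mult:
  fixes A B :: "complex^'n^'n"
  shows "(r *\<^sub>R A) ** B = r *\<^sub>R (A ** B)" "A ** (r *\<^sub>R B) = r *\<^sub>R (A ** B)"
  by (simp_all add: vec_eq_iff matrix_matrix_mult_def scaleR_sum_right)

lemma matrix_scaleR_vector: "(r *\<^sub>R A) *v x = r *\<^sub>R (A *v x)" for A :: "complex^'n^'n"
  by (simp add: vec_eq_iff matrix_vector_mult_def scaleR_sum_right)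

instantiation cmat :: (finite) real_algebra_1
begin

lift_definition zero_cmat :: "'a cmat" is 0 .
lift_definition one_cmat :: "'a cmat" is "mat 1" .
lift_definition plus_cmat :: "'a cmat \<Rightarrow> 'a cmat \<Rightarrow> 'a cmat" is "(+)" .
lift_definition minus_cmat :: "'a cmat \<Rightarrow> 'a cmat \<Rightarrow> 'a cmat" is "(-)" .
lift_definition uminus_cmat :: "'a cmat \<Rightarrow> 'a cmat" is uminus .
lift_definition times_cmat :: "'a cmat \<Rightarrow> 'a cmat \<Rightarrow> 'a cmat" is "(**)" .
lift_definition scaleR_cmat :: "real \<Rightarrow> 'a cmat \<Rightarrow> 'a cmat" is scaleR .

instance
proof
  fix a b c :: "'a cmat" and r s :: real
  show "a * b * c = a * (b * c)" by transfer (simp add: matrix_mul_assoc)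
  show "(a + b) * c = a * c + b * c"
    by transfer (simp add: vec_eq_iff matrix_matrix_mult_def algebra_simps sum.distrib)
  show "a * (b + c) = a * b + a * c" by transfer (rule matrix_add_ldistrib)
  show "(0::'a cmat) \<noteq> 1" by transfer (simp add: vec_eq_iff mat_def)
  show "r *\<^sub>R a * b = r *\<^sub>R (a * b)" "a * r *\<^sub>R b = r *\<^sub>R (a * b)"
    by (transfer, rule matrix_scaleR_mult)+
qed (transfer, simp add: algebra_simps)+

end

instantiation cmat :: (finite) real_normed_algebra_1
begin

lift_definition norm_cmat :: "'a cmat \<Rightarrow> real" is "\<lambda>A. onorm ((*v) A)" .
definition dist_cmat :: "'a cmat \<Rightarrow> 'a cmat \<Rightarrow> real" where "dist_cmat a b = norm (a - b)"
definition sgn_cmat :: "'a cmat \<Rightarrow> 'a cmat" where "sgn_cmat x = x /\<^sub>R norm x"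
definition uniformity_cmat :: "('a cmat \<times> 'a cmat) filter" where
  "uniformity_cmat = (INF e\<in>{0<..}. principal {(x, y). dist x y < e})"
definition open_cmat :: "'a cmat set \<Rightarrow> bool" where
  "open_cmat U = (\<forall>x\<in>U. \<forall>\<^sub>F (x', y) in uniformity. x' = x \<longrightarrow> y \<in> U)"

instance
proof
  fix a b :: "'a cmat" and r :: real
  show "dist a b = norm (a - b)" "sgn a = a /\<^sub>R norm a"
    by (simp_all add: dist_cmat_def sgn_cmat_def)
  show "(uniformity :: ('a cmat \<times> 'a cmat) filter) = (INF e\<in>{0<..}. principal {(x, y). dist x y < e})"
    by (rule uniformity_cmat_def)
  show "open U = (\<forall>x\<in>U. \<forall>\<^sub>F (x', y) in uniformity. x' = x \<longrightarrow> y \<in> U)" for U :: "'a cmat set"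
    by (rule open_cmat_def)
  show "norm a = 0 \<longleftrightarrow> a = 0"
    by transfer (simp add: onorm_eq_0[OF matrix_vector_mul_bounded_linear] matrix_eq)
  show "norm (a + b) \<le> norm a + norm b"
  proof transfer
    fix A B :: "complex^'a^'a"
    have "(*v) (A + B) = (\<lambda>x. A *v x + B *v x)" by (simp add: fun_eq_iff matrix_vector_mult_add_rdistrib)
    then show "onorm ((*v) (A + B)) \<le> onorm ((*v) A) + onorm ((*v) B)"
      by (simp add: onorm_triangle[OF matrix_vector_mul_bounded_linear matrix_vector_mul_bounded_linear])
  qed
  show "norm (r *\<^sub>R a) = \<bar>r\<bar> * norm a"
  proof transfer
    fix r and A :: "complex^'a^'a"
    have "(*v) (r *\<^sub>R A) = (\<lambda>x. r *\<^sub>R (A *v x))" by (simp add: fun_eq_iff matrix_scaleR_vector)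
    then show "onorm ((*v) (r *\<^sub>R A)) = \<bar>r\<bar> * onorm ((*v) A)"
      by (simp add: onorm_scaleR[OF matrix_vector_mul_bounded_linear])
  qed
  show "norm (a * b) \<le> norm a * norm b"
  proof transfer
    fix A B :: "complex^'a^'a"
    have "(*v) (A ** B) = (*v) A \<circ> (*v) B" by (simp add: fun_eq_iff matrix_vector_mul_assoc)
    then show "onorm ((*v) (A ** B)) \<le> onorm ((*v) A) * onorm ((*v) B)"
      by (simp add: onorm_compose[OF matrix_vector_mul_bounded_linear matrix_vector_mul_bounded_linear])
  qed
  have "(*v) (mat 1 :: complex^'a^'a) = (\<lambda>x. x)" by (simp add: fun_eq_iff)
  then show "norm (1::'a cmat) = 1" by transfer (simp add: onorm_id)
qed

end

lift_definition ent :: "'n::finite cmat \<Rightarrow> 'n \<Rightarrow> 'n \<Rightarrow> complex" is "\<lambda>A i j. vec_nth (vec_nth A i) j" .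
lift_definition cdet :: "'n::finite cmat \<Rightarrow> complex" is det .
lift_definition sc :: "complex \<Rightarrow> 'n::finite cmat" is mat .
lift_definition act :: "'n::finite cmat \<Rightarrow> complex^'n \<Rightarrow> complex^'n" is "(*v)" .

lemma cmat_eqI: "(\<And>i j. ent a i j = ent b i j) \<Longrightarrow> a = b"
  by transfer (simp add: vec_eq_iff)

lemma ent_simps [simp]:
  "ent (a + b) i j = ent a i j + ent b i j" "ent (a - b) i j = ent a i j - ent b i j"
  "ent (- a) i j = - ent a i j" "ent 0 i j = 0" "ent (r *\<^sub>R a) i j = r *\<^sub>R ent a i j"
  "ent 1 i j = (if i = j then 1 else 0)" "ent (sc z) i j = (if i = j then z else 0)"
  by (transfer, simp add: mat_def)+

lemma ent_mult: "ent (a * b) i j = (\<Sum>k\<in>UNIV. ent a i k * ent b k j)"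
  by transfer (simp add: matrix_matrix_mult_def)

lemma ent_sc_mult [simp]: "ent (sc z * a) i j = z * ent a i j"
  by (simp add: ent_mult if_distrib[of "\<lambda>x. x * _"] cong: if_cong)

lemma sc_commute: "sc z * a = a * sc z"
  by (rule cmat_eqI) (simp add: ent_mult if_distrib[of "\<lambda>x. x * _"] if_distrib[of "\<lambda>x. _ * x"] cong: if_cong)

lemma sc_simps: "sc (z * w) = sc z * sc w" "sc (z + w) = sc z + sc w" "sc (z - w) = sc z - sc w"
  "sc (- z) = - sc z" "sc 0 = 0" "sc 1 = 1"
  by (rule cmat_eqI, simp)+

lemma norm_sc [simp]: "norm (sc z :: 'n::finite cmat) = norm z"
proof transfer
  fix z
  have e: "(*v) (mat z :: complex^'n^'n) = (\<lambda>x. z *s x)"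
    by (auto simp: fun_eq_iff vec_eq_iff matrix_vector_mult_def mat_def if_distrib[of "\<lambda>x. x * _"] cong: if_cong)
  have n: "norm (z *s x) = norm z * norm x" for x :: "complex^'n"
    by (simp add: norm_vec_def norm_mult L2_set_right_distrib)
  have bl: "bounded_linear (\<lambda>x::complex^'n. z *s x)"
    using matrix_vector_mul_bounded_linear[of "mat z :: complex^'n^'n"] unfolding e .
  show "onorm ((*v) (mat z :: complex^'n^'n)) = norm z" unfolding e
  proof (rule antisym)
    show "onorm (\<lambda>x::complex^'n. z *s x) \<le> norm z" by (rule onorm_le) (simp add: n)
    have "norm (z *s axis undefined 1 :: complex^'n) \<le> onorm (\<lambda>x::complex^'n. z *s x) * norm (axis undefined 1 :: complex^'n)"
      by (rule onorm[OF bl])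
    then show "norm z \<le> onorm (\<lambda>x::complex^'n. z *s x)" by (simp add: n)
  qed
qed

lemma norm_ent_le: "norm (ent a i j) \<le> norm a"
proof transfer
  fix A :: "complex^'a^'a" and i j :: 'a
  have "norm (A *v axis j 1) \<le> onorm ((*v) A) * norm (axis j 1 :: complex^'a)"
    by (rule onorm) simp
  moreover have "(A *v axis j 1) $ i = A $ i $ j"
    by (simp add: matrix_vector_mult_def axis_def if_distrib[of "\<lambda>x. _ * x"] cong: if_cong)
  ultimately show "norm (A $ i $ j) \<le> onorm ((*v) A)"
    using Finite_Cartesian_Product.norm_nth_le[of "A *v axis j 1" i] by simp
qed

text \<open>Together with \<open>norm_ent_le\<close> this identifies convergence in the operator
  norm with convergence of all entries, from which completeness follows.\<close>

lemma norm_cmat_le_sum: "norm a \<le> (\<Sum>i\<in>UNIV. \<Sum>j\<in>UNIV. norm (ent a i j))"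
proof transfer
  fix A :: "complex^'a^'a"
  show "onorm ((*v) A) \<le> (\<Sum>i\<in>UNIV. \<Sum>j\<in>UNIV. norm (A $ i $ j))"
  proof (rule onorm_le)
    fix x :: "complex^'a"
    have "norm (A *v x) \<le> (\<Sum>i\<in>UNIV. norm ((A *v x) $ i))"
      unfolding norm_vec_def by (rule L2_set_le_sum) simp
    also have "\<dots> \<le> (\<Sum>i\<in>UNIV. (\<Sum>j\<in>UNIV. norm (A $ i $ j)) * norm x)"
    proof (rule sum_mono)
      fix i :: 'a
      have "norm ((A *v x) $ i) \<le> (\<Sum>j\<in>UNIV. norm (A $ i $ j * x $ j))"
        unfolding matrix_vector_mult_def by (simp add: norm_sum)
      also have "\<dots> \<le> (\<Sum>j\<in>UNIV. norm (A $ i $ j) * norm x)"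
        by (intro sum_mono) (simp add: norm_mult mult_left_mono Finite_Cartesian_Product.norm_nth_le)
      finally show "norm ((A *v x) $ i) \<le> (\<Sum>j\<in>UNIV. norm (A $ i $ j)) * norm x"
        by (simp add: sum_distrib_right)
    qed
    finally show "norm (A *v x) \<le> (\<Sum>i\<in>UNIV. \<Sum>j\<in>UNIV. norm (A $ i $ j)) * norm x"
      by (simp add: sum_distrib_right)
  qed
qed

lemma tendsto_cmatI:
  assumes "\<And>i j. ((\<lambda>x. ent (f x) i j) \<longlongrightarrow> ent l i j) F"
  shows "(f \<longlongrightarrow> l) F"
proof -
  have "((\<lambda>x. \<Sum>i\<in>UNIV. \<Sum>j\<in>UNIV. norm (ent (f x - l) i j)) \<longlongrightarrow> (\<Sum>i\<in>UNIV. \<Sum>j\<in>UNIV. norm (ent l i j - ent l i j))) F"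
    unfolding ent_simps by (intro tendsto_intros assms)
  then have lim: "((\<lambda>x. \<Sum>i\<in>UNIV. \<Sum>j\<in>UNIV. norm (ent (f x - l) i j)) \<longlongrightarrow> 0) F" by simp
  have "((\<lambda>x. f x - l) \<longlongrightarrow> 0) F"
    by (rule Lim_null_comparison[OF always_eventually lim]) (blast intro: norm_cmat_le_sum)
  then show ?thesis by (rule LIM_zero_cancel)
qed

instance cmat :: (finite) banach
proof
  fix X :: "nat \<Rightarrow> 'a cmat"
  assume X: "Cauchy X"
  have "Cauchy (\<lambda>n. ent (X n) i j)" for i j
  proof (rule metric_CauchyI)
    fix e :: real assume "e > 0"
    then obtain M where M: "\<forall>m\<ge>M. \<forall>n\<ge>M. dist (X m) (X n) < e" using X by (auto dest: metric_CauchyD)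
    have "dist (ent (X m) i j) (ent (X n) i j) \<le> dist (X m) (X n)" for m n
      using norm_ent_le[of "X m - X n" i j] by (simp add: dist_norm)
    then show "\<exists>M. \<forall>m\<ge>M. \<forall>n\<ge>M. dist (ent (X m) i j) (ent (X n) i j) < e"
      using M le_less_trans by blast
  qed
  then have "\<exists>l. (\<lambda>n. ent (X n) i j) \<longlonglongrightarrow> l" for i j
    by (simp add: Cauchy_convergent_iff convergent_def)
  then obtain l where l: "\<And>i j. (\<lambda>n. ent (X n) i j) \<longlonglongrightarrow> l i j" by metis
  define lm where "lm = cmat (\<chi> i j. l i j)"
  have "ent lm i j = l i j" for i j by (simp add: lm_def ent.rep_eq cmat_inverse)
  then have "X \<longlonglongrightarrow> lm" by (intro tendsto_cmatI) (simp add: l)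
  then show "convergent X" by (auto simp: convergent_def)
qed

lemma bounded_linear_cmat: "bounded_linear (cmat :: complex^'n^'n \<Rightarrow> 'n::finite cmat)"
proof (rule bounded_linear_intro)
  fix A B :: "complex^'n^'n" and r :: real
  show "cmat (A + B) = cmat A + cmat B" by (simp add: plus_cmat.abs_eq)
  show "cmat (r *\<^sub>R A) = r *\<^sub>R cmat A" by (simp add: scaleR_cmat.abs_eq)
  have "norm (cmat A) \<le> (\<Sum>i\<in>UNIV. \<Sum>j\<in>UNIV. norm (ent (cmat A) i j))" by (rule norm_cmat_le_sum)
  also have "\<dots> \<le> (\<Sum>i\<in>(UNIV::'n set). \<Sum>j\<in>(UNIV::'n set). norm A)"
  proof (intro sum_mono)
    fix i j :: 'n
    have "norm (A $ i $ j) \<le> norm (A $ i)" by (rule Finite_Cartesian_Product.norm_nth_le)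
    also have "\<dots> \<le> norm A" by (rule Finite_Cartesian_Product.norm_nth_le)
    finally show "norm (ent (cmat A) i j) \<le> norm A" by (simp add: ent.abs_eq)
  qed
  finally show "norm (cmat A) \<le> norm A * (real CARD('n) * real CARD('n))" by (simp add: mult_ac)
qed

lemma cdet_simps: "cdet (a * b) = cdet a * cdet b" "cdet 1 = 1"
  by (transfer, simp add: det_mul)+

lemma has_inverse_iff_cdet: "has_inverse a \<longleftrightarrow> cdet a \<noteq> 0"
  unfolding has_inverse_def
proof transfer
  fix A :: "complex^'a^'a"
  show "(\<exists>z. z ** A = mat 1 \<and> A ** z = mat 1) \<longleftrightarrow> det A \<noteq> 0"
    unfolding invertible_det_nz[symmetric] invertible_def by blast
qed

lemma cdet_altdef:
  "cdet a = (\<Sum>\<pi> | \<pi> permutes UNIV. of_int (sign \<pi>) * (\<Prod>i\<in>UNIV. ent a i (\<pi> i)))"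
  by transfer (simp add: det_def)

lemma cdet_holomorphic:
  assumes "\<And>i j. (\<lambda>z. ent (f z) i j) holomorphic_on S"
  shows "(\<lambda>z. cdet (f z)) holomorphic_on S"
  unfolding cdet_altdef by (intro holomorphic_intros assms)

context growth_scale
begin

lemma subexp_ent:
  assumes "subexp f" shows "subexp (\<lambda>t. ent (f t) i j)"
  by (rule subexp_mono[OF assms]) (simp add: norm_ent_le)

lemma small_ent:
  assumes "small f" shows "small (\<lambda>t. ent (f t) i j)"
  by (rule small_mono[OF assms]) (simp add: norm_ent_le)

lemma subexp_prod:
  fixes f :: "'i \<Rightarrow> 't \<Rightarrow> complex"
  assumes "\<And>i. i \<in> I \<Longrightarrow> subexp (f i)" shows "subexp (\<lambda>t. \<Prod>i\<in>I. f i t)"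
  using assms by (induction I rule: infinite_finite_induct) (auto intro!: subexp_mult)

lemma small_sum:
  fixes f :: "'i \<Rightarrow> 't \<Rightarrow> complex"
  assumes "\<And>i. i \<in> I \<Longrightarrow> small (f i)" shows "small (\<lambda>t. \<Sum>i\<in>I. f i t)"
  using assms by (induction I rule: infinite_finite_induct) (auto intro!: small_add)

text \<open>Telescoping: one factor is exchanged at a time, and the others stay
  subexponential.\<close>

lemma small_prod_diff:
  fixes f g :: "'i \<Rightarrow> 't \<Rightarrow> complex"
  assumes "\<And>i. i \<in> I \<Longrightarrow> subexp (f i)" "\<And>i. i \<in> I \<Longrightarrow> subexp (g i)"
    "\<And>i. i \<in> I \<Longrightarrow> small (\<lambda>t. f i t - g i t)"
  shows "small (\<lambda>t. (\<Prod>i\<in>I. f i t) - (\<Prod>i\<in>I. g i t))"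
  using assms
proof (induction I rule: infinite_finite_induct)
  case (insert x I)
  have e: "(\<Prod>i\<in>insert x I. f i t) - (\<Prod>i\<in>insert x I. g i t) =
      (f x t - g x t) * (\<Prod>i\<in>I. f i t) + g x t * ((\<Prod>i\<in>I. f i t) - (\<Prod>i\<in>I. g i t))" for t
    using insert by (simp add: algebra_simps)
  show ?case unfolding e
    by (intro small_add small_mult_right small_mult_left subexp_prod insert) (use insert in auto)
qed auto

lemma small_cdet_diff:
  fixes a b :: "'t \<Rightarrow> 'n::finite cmat"
  assumes b: "subexp b" and d: "small (\<lambda>t. a t - b t)"
  shows "small (\<lambda>t. cdet (a t) - cdet (b t))"
proof -
  have a: "subexp a" using subexp_add[OF small_imp_subexp[OF d] b] by simp
  have "small (\<lambda>t. \<Sum>\<pi> | \<pi> permutes (UNIV::'n set). of_int (sign \<pi>) *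
      ((\<Prod>i\<in>UNIV. ent (a t) i (\<pi> i)) - (\<Prod>i\<in>UNIV. ent (b t) i (\<pi> i))))"
  proof (intro small_sum small_mult_left[OF subexp_const] small_prod_diff subexp_ent a b)
    fix i j show "small (\<lambda>t. ent (a t) i j - ent (b t) i j)" using small_ent[OF d, of i j] by simp
  qed
  then show ?thesis by (simp add: cdet_altdef sum_subtractf algebra_simps)
qed

lemma subexp_cdet:
  assumes "subexp a" shows "subexp (\<lambda>t. cdet (a t))"
proof -
  have *: "subexp (\<lambda>t. \<Sum>i\<in>I. f i t)" if "\<And>i. i \<in> I \<Longrightarrow> subexp (f i)" for f :: "'i \<Rightarrow> 't \<Rightarrow> complex" and I
    using that by (induction I rule: infinite_finite_induct) (auto intro!: subexp_add)
  show ?thesis unfolding cdet_altdef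
    by (intro * subexp_mult subexp_const subexp_prod subexp_ent assms)
qed

end

section \<open>Determinant identities\<close>

text \<open>For invertible \<open>x\<close> the two matrices are conjugate. In general
  \<open>x\<close> is replaced by \<open>x + sc t\<close>: its determinant is holomorphic in
  \<open>t\<close> and nonzero at \<open>t0\<close>, which exceeds the norm of \<open>x\<close>, so
  it has no zeros for small \<open>t \<noteq> 0\<close>, and both sides are continuous at 0.\<close>

lemma cdet_one_plus_commute:
  fixes x y :: "'n::finite cmat"
  shows "cdet (1 + x * y) = cdet (1 + y * x)"
proof -
  define X where "X t = x + sc t" for t
  have eq: "cdet (1 + X t * y) = cdet (1 + y * X t)" if nz: "cdet (X t) \<noteq> 0" for t
  proof -
    have "(1 + X t * y) * X t = X t * (1 + y * X t)" by (simp add: algebra_simps)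
    then have "cdet (1 + X t * y) * cdet (X t) = cdet (X t) * cdet (1 + y * X t)"
      by (metis cdet_simps(1))
    then show ?thesis using nz by simp
  qed
  have hX: "(\<lambda>t. ent (X t) i j) holomorphic_on UNIV" for i j
    by (cases "i = j") (auto simp: X_def intro!: holomorphic_intros)
  have h: "(\<lambda>t. cdet (X t)) holomorphic_on UNIV" by (intro cdet_holomorphic hX)
  define t0 where "t0 = complex_of_real (norm x + 1)"
  have "norm (sc (1 / t0) * x) < 1"
  proof -
    have "norm (sc (1 / t0) * x) \<le> norm (sc (1 / t0) :: 'n cmat) * norm x" by (rule norm_mult_ineq)
    also have "\<dots> = norm x / (norm x + 1)" by (simp add: t0_def norm_divide flip: of_real_add)
    also have "\<dots> < 1" by (simp add: add_nonneg_pos)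
    finally show ?thesis .
  qed
  then have "has_inverse (1 + sc (1 / t0) * x)" by (intro has_inverse_near_one) simp
  then have "cdet (1 + sc (1 / t0) * x) \<noteq> 0" by (simp add: has_inverse_iff_cdet)
  moreover have t0: "t0 \<noteq> 0" unfolding t0_def of_real_eq_0_iff using norm_ge_zero[of x] by linarith
  have "X t0 = sc t0 * (1 + sc (1 / t0) * x)"
    using t0 by (simp add: X_def distrib_left add.commute flip: mult.assoc sc_simps(1)) (simp add: sc_simps)
  moreover have "cdet (sc t0 :: 'n cmat) \<noteq> 0"
    unfolding has_inverse_iff_cdet[symmetric] has_inverse_def
    using t0 by (intro exI[of _ "sc (1 / t0)"]) (simp add: sc_simps flip: sc_simps(1))
  ultimately have "cdet (X t0) \<noteq> 0" by (simp add: cdet_simps)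
  then have "\<forall>\<^sub>F t in at 0. cdet (X t) \<noteq> 0"
    using non_zero_neighbour_alt[OF h, of 0 t0] by (auto elim: eventually_mono)
  then have ev: "\<forall>\<^sub>F t in at 0. cdet (1 + X t * y) = cdet (1 + y * X t)"
    by eventually_elim (rule eq)
  have "(\<lambda>t. cdet (1 + X t * y)) holomorphic_on UNIV" "(\<lambda>t. cdet (1 + y * X t)) holomorphic_on UNIV"
    by (intro cdet_holomorphic; unfold ent_simps(1) ent_mult; intro holomorphic_intros hX)+
  then have c: "isCont (\<lambda>t. cdet (1 + X t * y)) 0" "isCont (\<lambda>t. cdet (1 + y * X t)) 0"
    by (auto dest!: holomorphic_on_imp_continuous_on simp: continuous_on_eq_continuous_at)
  have "((\<lambda>t. cdet (1 + X t * y)) \<longlongrightarrow> cdet (1 + y * X 0)) (at 0)"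
    using c(2)[unfolded isCont_def] ev by (subst tendsto_cong[OF ev]) auto
  with c(1)[unfolded isCont_def] have "cdet (1 + X 0 * y) = cdet (1 + y * X 0)"
    by (intro tendsto_unique[of "at 0"]) auto
  then show ?thesis by (simp add: X_def sc_simps)
qed

text \<open>Row operations with the pivot row \<open>i0\<close>, where \<open>u i0 \<noteq> 0\<close>, reduce the rank one matrix \<open>c\<close>
  to its row \<open>i0\<close>; the determinant is linear in that row.\<close>

lemma cdet_rank_one_linear:
  fixes c K :: "'n::finite cmat"
  assumes c: "\<And>i j. ent c i j = u i * w j" "c \<noteq> 0" and K: "c * K = 0"
  shows "cdet (K + c * (sc a * x + sc b * y)) = a * cdet (K + c * x) + b * cdet (K + c * y)"
proof -
  have "\<exists>i. u i \<noteq> 0"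
  proof (rule ccontr)
    assume "\<not> ?thesis"
    then have "c = 0" using c(1) by (intro cmat_eqI) auto
    with c(2) show False ..
  qed
  then obtain i0 where i0: "u i0 \<noteq> 0" by blast
  \<comment> \<open>Multiplication by \<open>1 - N\<close> subtracts \<open>u i / u i0\<close> times
    the pivot row from each other row \<open>i\<close>; it is invertible because
    \<open>N * N = 0\<close>.\<close>
  define N :: "'n cmat" where "N = cmat (\<chi> i j. if j = i0 \<and> i \<noteq> i0 then u i / u i0 else 0)"
  have N: "ent N i j = (if j = i0 \<and> i \<noteq> i0 then u i / u i0 else 0)" for i j
    by (simp add: N_def ent.abs_eq)
  have "N * N = 0"
    by (rule cmat_eqI) (auto simp: ent_mult N intro!: sum.neutral)
  then have "(1 - N) * (1 + N) = 1" "(1 + N) * (1 - N) = 1" by (simp_all add: algebra_simps)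
  then have T: "cdet (1 - N) \<noteq> 0" unfolding has_inverse_iff_cdet[symmetric] has_inverse_def by blast
  define R where "R = (1 - N) * K"
  define r where "r z j = u i0 * (\<Sum>k\<in>UNIV. w k * ent z k j)" for z j
  have ent1: "ent ((1 - N) * (K + c * z)) i j = ent R i j + (if i = i0 then r z j else 0)" for z i j
  proof -
    have cz: "ent (c * z) k j = u k * (\<Sum>k\<in>UNIV. w k * ent z k j)" for k
      by (simp add: ent_mult c(1) sum_distrib_left mult.assoc)
    have Nz: "ent (N * (c * z)) i j = (if i = i0 then 0 else u i * (\<Sum>k\<in>UNIV. w k * ent z k j))"
      by (subst ent_mult) (use i0 in \<open>auto simp: N cz if_distrib[of "\<lambda>x. x * _"] cong: if_cong\<close>)
    have "(1 - N) * (K + c * z) = R + c * z - N * (c * z)" by (simp add: R_def algebra_simps)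
    then show ?thesis by (simp add: cz Nz r_def)
  qed
  define M where "M v = cmat (\<chi> i j. if i = i0 then v j else ent R i j)" for v
  have lin: "cdet (M (\<lambda>j. \<alpha> * v j + \<beta> * v' j)) = \<alpha> * cdet (M v) + \<beta> * cdet (M v')" for \<alpha> \<beta> v v'
  proof -
    define row where "row x = (\<chi> j. x j)" for x :: "'n \<Rightarrow> complex"
    have M: "cdet (M x) = det (\<chi> i. if i = i0 then row x else row (ent R i))" for x
      unfolding M_def cdet.abs_eq by (rule arg_cong[where f = det]) (simp add: vec_eq_iff row_def)
    have "row (\<lambda>j. \<alpha> * v j + \<beta> * v' j) = \<alpha> *s row v + \<beta> *s row v'" by (simp add: vec_eq_iff row_def)
    note r = this
    show ?thesis unfolding M r
      using det_row_add[of i0 "\<lambda>_. \<alpha> *s row v" "\<lambda>_. \<beta> *s row v'" "\<lambda>i. row (ent R i)"]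
        det_row_mul[of i0 \<alpha> "\<lambda>_. row v" "\<lambda>i. row (ent R i)"]
        det_row_mul[of i0 \<beta> "\<lambda>_. row v'" "\<lambda>i. row (ent R i)"]
      by (simp only:)
  qed
  have MM: "(1 - N) * (K + c * z) = M (\<lambda>j. 1 * ent R i0 j + 1 * r z j)" for z
    by (rule cmat_eqI) (simp add: ent1, simp add: M_def ent.abs_eq)
  have d: "cdet (1 - N) * cdet (K + c * z) = cdet (M (ent R i0)) + cdet (M (r z))" for z
  proof -
    have "cdet (1 - N) * cdet (K + c * z) = cdet (M (\<lambda>j. 1 * ent R i0 j + 1 * r z j))"
      by (simp only: MM[symmetric] cdet_simps)
    also have "\<dots> = 1 * cdet (M (ent R i0)) + 1 * cdet (M (r z))" by (rule lin)
    finally show ?thesis by simp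
  qed
  \<comment> \<open>\<open>c * K = 0\<close> with \<open>c \<noteq> 0\<close> forces
    \<open>K\<close> to be singular. Hence the constant term vanishes, and the dependence on the
    pivot row is linear and not merely affine.\<close>
  have "cdet K = 0"
  proof (rule ccontr)
    assume "cdet K \<noteq> 0"
    then obtain k where "K * k = 1" unfolding has_inverse_iff_cdet[symmetric] has_inverse_def by blast
    then have "c = c * K * k" by (simp add: mult.assoc)
    then show False using K c(2) by simp
  qed
  moreover have "M (ent R i0) = R" by (rule cmat_eqI) (simp add: M_def ent.abs_eq)
  ultimately have M0: "cdet (M (ent R i0)) = 0" by (simp add: R_def cdet_simps)
  have "r (sc a * x + sc b * y) = (\<lambda>j. a * r x j + b * r y j)"
    by (simp add: r_def fun_eq_iff sum.distrib sum_distrib_left algebra_simps)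
  then have "cdet (1 - N) * cdet (K + c * (sc a * x + sc b * y)) = a * cdet (M (r x)) + b * cdet (M (r y))"
    unfolding d M0 by (simp add: lin)
  also have "\<dots> = cdet (1 - N) * (a * cdet (K + c * x) + b * cdet (K + c * y))"
    using d[of x] d[of y] M0 by (simp add: algebra_simps)
  finally show ?thesis using T by simp
qed

section \<open>Exponentials of matrices\<close>

lemma act_simps:
  "act (a + b) v = act a v + act b v" "act (a - b) v = act a v - act b v" "act (a * b) v = act a (act b v)"
  "act 1 v = v" "act 0 v = 0" "act a (v + w) = act a v + act a w" "act a (v - w) = act a v - act a w"
  "act a 0 = 0" "act a (k *s v) = k *s act a v" "act (sc k) v = k *s v" "act (cmat A) v = A *v v"
  "act (- a) v = - act a v" "act (r *\<^sub>R a) v = r *\<^sub>R act a v"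
proof -
  show "act (a + b) v = act a v + act b v" by transfer (rule matrix_vector_mult_add_rdistrib)
  show "act (a - b) v = act a v - act b v" by transfer (rule matrix_vector_mult_diff_rdistrib)
  show "act (a * b) v = act a (act b v)" by transfer (simp add: matrix_vector_mul_assoc)
  show "act 1 v = v" by transfer simp
  show zero: "act 0 v = 0" by transfer simp
  show "act a (v + w) = act a v + act a w" by transfer (rule matrix_vector_right_distrib)
  show "act a (v - w) = act a v - act a w" by transfer (rule matrix_vector_mult_diff_distrib)
  show "act a 0 = 0" by transfer simp
  show "act a (k *s v) = k *s act a v" by transfer (simp add: vec.scale)
  show "act (sc k) v = k *s v"
    by transfer (simp add: vec_eq_iff matrix_vector_mult_def mat_def if_distrib[of "\<lambda>x. x * _"] cong: if_cong)
  show "act (cmat A) v = A *v v" by (simp add: act.abs_eq)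
  show "act (r *\<^sub>R a) v = r *\<^sub>R act a v" by transfer (rule matrix_scaleR_vector)
  have "act (a - a) v = act a v - act a v" "act (0 - a) v = act 0 v - act a v"
    by (transfer, rule matrix_vector_mult_diff_rdistrib)+
  then show "act (- a) v = - act a v" using zero by simp
qed

lemma norm_act: "norm (act a v) \<le> norm a * norm v"
  by transfer (rule onorm, simp)

lemma act_axis: "act a (axis j 1) $ i = ent a i j"
  by transfer (simp add: matrix_vector_mult_def axis_def if_distrib[of "\<lambda>x. _ * x"] cong: if_cong)

lemma cmat_eqI_act: "(\<And>v. act a v = act b v) \<Longrightarrow> a = b"
  by transfer (simp add: matrix_eq)

lemma cmat_simps: "cmat (A + B) = cmat A + cmat B" "cmat (A - B) = cmat A - cmat B" "cmat (A ** B) = cmat A * cmat B"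
  "cmat (mat k) = sc k" "cmat (mat 1) = 1" "cdet (cmat A) = det A" "ent (cmat A) i j = A $ i $ j"
  by (simp_all add: plus_cmat.abs_eq minus_cmat.abs_eq times_cmat.abs_eq sc.abs_eq one_cmat.abs_eq cdet.abs_eq ent.abs_eq)

lemma exp_sc: "exp (sc z :: 'n::finite cmat) = sc (exp z)"
proof -
  have bl: "bounded_linear (sc :: complex \<Rightarrow> 'n cmat)"
    by (rule bounded_linear_intro[of _ 1]) (auto simp: sc_simps intro!: cmat_eqI)
  have "sc (z ^ n /\<^sub>R fact n) = (sc z :: 'n cmat) ^ n /\<^sub>R fact n" for n
  proof -
    have "sc (z ^ n) = (sc z :: 'n cmat) ^ n" by (induction n) (simp_all add: sc_simps)
    then show ?thesis using linear_scale[OF bounded_linear.linear[OF bl]] by simp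
  qed
  then show ?thesis unfolding exp_def
    using bounded_linear.suminf[OF bl summable_exp_generic[of z]] by simp
qed

text \<open>\<open>conjugated_step\<close> on the unit interval with the identity as conjugator,
  where \<open>A'\<close> plays the perturbed generator.\<close>

lemma exp_perturbation:
  fixes A A' :: "'a::{real_normed_algebra_1,banach}"
  assumes "norm (A' - A) * exp (2 * norm A) \<le> 1/2"
  shows "norm (exp A' - exp A) \<le> exp (norm A) * (2 * (norm (A' - A) * exp (2 * norm A)))"
proof -
  define d where "d = norm (A' - A) * exp (2 * norm A)"
  have "\<exists>E. 1 * exp (1 *\<^sub>R A') = exp ((1 - 0) *\<^sub>R A) * (1 + E) * (1 * exp (0 *\<^sub>R A')) \<and> norm E \<le> 2 * d * (1 - 0)"
  proof (rule conjugated_step[where P = "\<lambda>_. 1" and K = 1 and ?A0.0 = "\<lambda>_. A" and B = "\<lambda>_. A'" and a = "norm A"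
        and \<delta> = "norm (A' - A)" and d = d and Pi = "\<lambda>_. 1" and Y = "\<lambda>x. exp (x *\<^sub>R A')"])
    fix x :: real
    show "((\<lambda>x. exp (x *\<^sub>R A')) has_vector_derivative A' * exp (x *\<^sub>R A')) (at x within {0..1})"
      by (rule has_vector_derivative_at_within[OF exp_scaleR_has_vector_derivative_left])
  qed (use assms in \<open>auto simp: d_def has_inverse_def\<close>)
  then obtain E where E: "exp A' = exp A * (1 + E)" "norm E \<le> 2 * d" by auto
  have "exp A' - exp A = exp A * E" by (simp add: E(1) algebra_simps)
  then have "norm (exp A' - exp A) \<le> norm (exp A) * norm E" by (simp only: norm_mult_ineq)
  also have "\<dots> \<le> exp (norm A) * (2 * d)" using E(2) norm_exp[of A] by (intro mult_mono) auto
  finally show ?thesis by (simp add: d_def)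
qed

lemma tendsto_exp_algebra:
  fixes f :: "'b \<Rightarrow> 'a::{real_normed_algebra_1,banach}"
  assumes "(f \<longlongrightarrow> l) F" shows "((\<lambda>x. exp (f x)) \<longlongrightarrow> exp l) F"
proof -
  have z: "((\<lambda>x. norm (f x - l) * exp (2 * norm l)) \<longlongrightarrow> 0) F"
    by (rule tendsto_mult_left_zero) (use assms in \<open>simp add: LIM_zero tendsto_norm_zero\<close>)
  then have "\<forall>\<^sub>F x in F. norm (f x - l) * exp (2 * norm l) < 1/2" by (rule order_tendstoD) simp
  then have "\<forall>\<^sub>F x in F. norm (exp (f x) - exp l) \<le> exp (norm l) * (2 * (norm (f x - l) * exp (2 * norm l)))"
    by eventually_elim (intro exp_perturbation, simp)
  moreover have "((\<lambda>x. exp (norm l) * (2 * (norm (f x - l) * exp (2 * norm l)))) \<longlongrightarrow> 0) F"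
    using tendsto_mult_right_zero[OF tendsto_mult_right_zero[OF z]] .
  ultimately have "((\<lambda>x. exp (f x) - exp l) \<longlongrightarrow> 0) F" by (rule Lim_null_comparison)
  then show ?thesis by (rule LIM_zero_cancel)
qed

text \<open>Writing \<open>x = y + k * x0\<close> with \<open>0 \<le> y \<le> x0\<close>, each full
  step contributes a factor \<open>1/2\<close> and the rest at most \<open>exp (a * x0)\<close>. The
  factor 2 compensates for the incomplete step in passing from \<open>k\<close> to
  \<open>x / x0\<close>.\<close>

lemma semigroup_decay:
  fixes A p :: "'a::{real_normed_algebra_1,banach}"
  assumes p: "p * p = p" "A * p = p * A" and a: "norm A \<le> a" and x0: "x0 > 0"
    and half: "norm (exp (x0 *\<^sub>R A) * p) \<le> 1/2" and x: "x \<ge> 0"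
  shows "norm (exp (x *\<^sub>R A) * p) \<le> (2 * exp (a * x0) * norm p) * exp (- (ln 2 / x0) * x)"
proof -
  define g where "g = exp (x0 *\<^sub>R A) * p"
  have com: "p * exp (y *\<^sub>R A) = exp (y *\<^sub>R A) * p" for y
    by (rule exp_commute) (simp add: p)
  have pow: "exp ((real k * x0) *\<^sub>R A) * p = p * g ^ k" for k
  proof (induction k)
    case 0 then show ?case by simp
  next
    case (Suc k)
    have "exp ((real (Suc k) * x0) *\<^sub>R A) = exp ((real k * x0) *\<^sub>R A + x0 *\<^sub>R A)"
      by (simp add: algebra_simps)
    also have "\<dots> = exp ((real k * x0) *\<^sub>R A) * exp (x0 *\<^sub>R A)" by (rule exp_add_commuting) simp
    finally have e: "exp ((real (Suc k) * x0) *\<^sub>R A) = exp ((real k * x0) *\<^sub>R A) * exp (x0 *\<^sub>R A)" .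
    have "exp ((real (Suc k) * x0) *\<^sub>R A) * p = exp ((real k * x0) *\<^sub>R A) * (exp (x0 *\<^sub>R A) * p) * p"
      unfolding e by (simp add: mult.assoc p)
    also have "\<dots> = exp ((real k * x0) *\<^sub>R A) * (exp (x0 *\<^sub>R A) * p * p)" by (simp only: mult.assoc)
    also have "exp (x0 *\<^sub>R A) * p * p = p * (exp (x0 *\<^sub>R A) * p)" using com[of x0] by (metis mult.assoc)
    also have "exp ((real k * x0) *\<^sub>R A) * (p * (exp (x0 *\<^sub>R A) * p)) = exp ((real k * x0) *\<^sub>R A) * p * (exp (x0 *\<^sub>R A) * p)"
      by (simp only: mult.assoc)
    also have "\<dots> = p * g ^ k * g" by (simp add: Suc g_def)
    finally show ?case by (simp only: power_Suc2 mult.assoc)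
  qed
  define k where "k = nat \<lfloor>x / x0\<rfloor>"
  have k: "real k \<le> x / x0" "x / x0 < real k + 1" using x x0 by (auto simp: k_def)
  define y where "y = x - real k * x0"
  have y: "0 \<le> y" "y \<le> x0" using k x0 by (auto simp: y_def field_simps)
  have "exp (x *\<^sub>R A) = exp (y *\<^sub>R A + (real k * x0) *\<^sub>R A)" by (simp add: y_def algebra_simps)
  also have "\<dots> = exp (y *\<^sub>R A) * exp ((real k * x0) *\<^sub>R A)" by (rule exp_add_commuting) simp
  finally have "exp (x *\<^sub>R A) * p = exp (y *\<^sub>R A) * (p * g ^ k)" by (simp add: mult.assoc pow)
  then have "norm (exp (x *\<^sub>R A) * p) \<le> norm (exp (y *\<^sub>R A)) * norm (p * g ^ k)" by (simp only: norm_mult_ineq)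
  also have "\<dots> \<le> exp (a * x0) * (norm p * (1/2) ^ k)"
  proof (intro mult_mono)
    show "norm (exp (y *\<^sub>R A)) \<le> exp (a * x0)" using y by (intro norm_exp_scaleR a) auto
    have "norm (p * g ^ k) \<le> norm p * norm (g ^ k)" by (rule norm_mult_ineq)
    also have "\<dots> \<le> norm p * (1/2) ^ k"
      using half by (intro mult_left_mono order_trans[OF norm_power_ineq] power_mono) (auto simp: g_def)
    finally show "norm (p * g ^ k) \<le> norm p * (1/2) ^ k" .
  qed auto
  finally have fin: "norm (exp (x *\<^sub>R A) * p) \<le> exp (a * x0) * (norm p * (1/2) ^ k)" .
  have "(1/2) ^ k \<le> 2 * exp (- (ln 2 / x0) * x)"
  proof -
    have "(1/2) ^ k = exp (- (real k * ln 2))" by (simp add: exp_minus exp_of_nat_mult power_divide inverse_eq_divide)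
    also have "\<dots> \<le> exp (ln 2 - (x / x0) * ln 2)"
    proof -
      have "(x / x0) * ln 2 \<le> (real k + 1) * ln 2" using k by (intro mult_right_mono) auto
      then show ?thesis by (simp add: algebra_simps)
    qed
    also have "\<dots> = 2 * exp (- (ln 2 / x0) * x)" by (simp add: exp_diff exp_minus field_simps)
    finally show ?thesis .
  qed
  then have "exp (a * x0) * (norm p * (1/2) ^ k) \<le> exp (a * x0) * (norm p * (2 * exp (- (ln 2 / x0) * x)))"
    by (intro mult_left_mono) auto
  with fin have "norm (exp (x *\<^sub>R A) * p) \<le> exp (a * x0) * (norm p * (2 * exp (- (ln 2 / x0) * x)))"
    by (rule order_trans)
  then show ?thesis by (simp only: mult_ac)
qed

section \<open>Spectral subspaces\<close>

lemma span_matrix_invariant: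
  fixes A :: "complex^'n^'n"
  assumes "\<And>v. v \<in> S \<Longrightarrow> A *v v \<in> vec.span T" "v \<in> vec.span S"
  shows "A *v v \<in> vec.span T"
  using assms(2)
proof (induction rule: vec.span_induct_alt)
  case base then show ?case by (simp add: vec.span_zero)
next
  case (step c x y)
  then show ?case using assms(1)[of x]
    by (simp add: matrix_vector_right_distrib vector_scalar_commute vec.span_add vec.span_scale)
qed

lemma matrix_funpow_commute:
  fixes A B :: "complex^'n^'n"
  assumes "B ** A = A ** B"
  shows "(((*v) B) ^^ p) (A *v v) = A *v ((((*v) B) ^^ p) v)"
  by (induction p) (simp_all add: matrix_vector_mul_assoc assms)

lemma gen_eigenspace_invariant:
  assumes "v \<in> gen_eigenspace A \<mu>" shows "A *v v \<in> gen_eigenspace A \<mu>"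
proof -
  obtain p where "(((*v) (A - mat \<mu>)) ^^ p) v = 0" using assms by (auto simp: gen_eigenspace_def)
  moreover have "cmat ((A - mat \<mu>) ** A) = cmat (A ** (A - mat \<mu>))"
    by (simp add: cmat_simps left_diff_distrib right_diff_distrib sc_commute)
  then have "(A - mat \<mu>) ** A = A ** (A - mat \<mu>)" by (simp add: cmat_inject)
  ultimately show ?thesis unfolding gen_eigenspace_def mem_Collect_eq
    by (intro exI[of _ p]) (simp add: matrix_funpow_commute)
qed

lemma spectral_subspace_invariant:
  assumes "v \<in> spectral_subspace A \<Sigma>" shows "A *v v \<in> spectral_subspace A \<Sigma>"
  using assms unfolding spectral_subspace_def
  by (elim span_matrix_invariant[rotated]) (auto intro: vec.span_base gen_eigenspace_invariant)

lemma spectral_subspace_mono: "\<Sigma> \<subseteq> \<Sigma>' \<Longrightarrow> spectral_subspace A \<Sigma> \<subseteq> spectral_subspace A \<Sigma>'"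
  unfolding spectral_subspace_def by (intro vec.span_mono) auto

lemma gen_eigenspace_subset: "\<mu> \<in> \<Sigma> \<Longrightarrow> gen_eigenspace A \<mu> \<subseteq> spectral_subspace A \<Sigma>"
  unfolding spectral_subspace_def by (auto intro: vec.span_base)

lemma spectral_projection_fixes:
  assumes "spectral_projection A \<Sigma> Q" "v \<in> spectral_subspace A \<Sigma>" shows "Q *v v = v"
proof -
  obtain w where "v = Q *v w" using assms by (force simp: spectral_projection_def)
  then show ?thesis using assms(1) by (simp add: spectral_projection_def matrix_vector_mul_assoc)
qed

lemma spectral_projection_kills:
  assumes "spectral_projection A \<Sigma> Q" "v \<in> spectral_subspace A \<Sigma>'" "\<Sigma> \<inter> \<Sigma>' = {}" shows "Q *v v = 0"
proof -
  have "spectral_subspace A \<Sigma>' \<subseteq> spectral_subspace A (- \<Sigma>)" using assms(3) by (intro spectral_subspace_mono) auto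
  then show ?thesis using assms(1,2) by (auto simp: spectral_projection_def)
qed

text \<open>The range and the kernel of \<open>Q\<close> are both spectral subspaces, hence
  invariant under \<open>A\<close>.\<close>

lemma spectral_projection_commute:
  assumes Q: "spectral_projection A \<Sigma> Q" shows "cmat A * cmat Q = cmat Q * cmat A"
proof (rule cmat_eqI_act)
  fix v
  have r: "Q *v v \<in> spectral_subspace A \<Sigma>" using Q by (auto simp: spectral_projection_def)
  have "Q *v (v - Q *v v) = 0"
    using Q by (simp add: spectral_projection_def matrix_vector_mult_diff_distrib matrix_vector_mul_assoc)
  then have "v - Q *v v \<in> spectral_subspace A (- \<Sigma>)" using Q by (auto simp: spectral_projection_def)
  then have "A *v (v - Q *v v) \<in> spectral_subspace A (- \<Sigma>)" by (rule spectral_subspace_invariant)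
  then have "Q *v (A *v (v - Q *v v)) = 0" using Q by (auto simp: spectral_projection_def)
  moreover have "Q *v (A *v (Q *v v)) = A *v (Q *v v)"
    by (rule spectral_projection_fixes[OF Q spectral_subspace_invariant[OF r]])
  ultimately show "act (cmat A * cmat Q) v = act (cmat Q * cmat A) v"
    by (simp add: act_simps matrix_vector_mult_diff_distrib)
qed

lemma spectral_projection_orthogonal:
  assumes "spectral_projection A \<Sigma> Q" "spectral_projection A \<Sigma>' Q'" "\<Sigma> \<inter> \<Sigma>' = {}"
  shows "cmat Q * cmat Q' = 0"
proof (rule cmat_eqI_act)
  fix v
  have "Q' *v v \<in> spectral_subspace A \<Sigma>'" using assms(2) by (auto simp: spectral_projection_def)
  then show "act (cmat Q * cmat Q') v = act 0 v"
    using spectral_projection_kills[OF assms(1) _ assms(3)] by (simp add: act_simps)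
qed

lemma eigenvalue_if_gen_eigenspace:
  assumes "v \<in> gen_eigenspace A \<mu>" "v \<noteq> 0" shows "eigenvalue A \<mu>"
proof -
  obtain p where "(((*v) (A - mat \<mu>)) ^^ p) v = 0" using assms by (auto simp: gen_eigenspace_def)
  then show ?thesis using assms(2)
  proof (induction p arbitrary: v)
    case (Suc p)
    show ?case
    proof (cases "(A - mat \<mu>) *v v = 0")
      case True
      then have "act (cmat (A - mat \<mu>)) v = 0" by (simp add: act_simps)
      then have "A *v v = \<mu> *s v" by (simp add: cmat_simps act_simps)
      then show ?thesis using Suc.prems by (auto simp: eigenvalue_def)
    next
      case False
      then show ?thesis using Suc.IH[of "(A - mat \<mu>) *v v"] Suc.prems by (simp add: funpow_swap1)
    qed
  qed simp
qed

text \<open>Range and kernel of \<open>Q\<close> are spanned by generalized eigenvectors and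
  together make up the whole space. Thus the mere existence of one spectral projection replaces the
  primary decomposition.\<close>

lemma spectral_projection_UNIV:
  assumes "spectral_projection A \<Sigma> Q" shows "spectral_subspace A UNIV = UNIV"
proof -
  have "v \<in> spectral_subspace A UNIV" for v
  proof -
    have "Q *v v \<in> spectral_subspace A \<Sigma>" using assms by (auto simp: spectral_projection_def)
    then have a: "Q *v v \<in> spectral_subspace A UNIV" using spectral_subspace_mono[of \<Sigma> UNIV A] by auto
    have "Q *v (v - Q *v v) = 0"
      using assms by (simp add: spectral_projection_def matrix_vector_mult_diff_distrib matrix_vector_mul_assoc)
    then have "v - Q *v v \<in> spectral_subspace A (- \<Sigma>)" using assms by (auto simp: spectral_projection_def)
    then have b: "v - Q *v v \<in> spectral_subspace A UNIV" using spectral_subspace_mono[of "- \<Sigma>" UNIV A] by auto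
    have "Q *v v + (v - Q *v v) \<in> spectral_subspace A UNIV"
      using a b unfolding spectral_subspace_def by (rule vec.span_add)
    then show ?thesis by simp
  qed
  then show ?thesis by blast
qed

text \<open>It suffices to check generalized eigenvectors, which span by
  \<open>spectral_projection_UNIV\<close>: each is fixed by the projection whose set contains its
  eigenvalue and annihilated by the other two.\<close>

lemma complete_spectral_projections:
  assumes "spectral_projection A \<Sigma>1 Q1" "spectral_projection A \<Sigma>2 Q2" "spectral_projection A \<Sigma>3 Q3"
    and disj: "\<Sigma>1 \<inter> \<Sigma>2 = {}" "\<Sigma>1 \<inter> \<Sigma>3 = {}" "\<Sigma>2 \<inter> \<Sigma>3 = {}"
    and all: "\<And>\<mu>. eigenvalue A \<mu> \<Longrightarrow> \<mu> \<in> \<Sigma>1 \<union> \<Sigma>2 \<union> \<Sigma>3"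
  shows "cmat Q1 + cmat Q2 + cmat Q3 = 1"
proof (rule cmat_eqI_act)
  fix v
  have "(Q1 + Q2 + Q3) *v v = mat 1 *v v"
  proof (rule matrix_eq_on_span)
    show "v \<in> vec.span (\<Union>\<mu>\<in>UNIV. gen_eigenspace A \<mu>)"
      using spectral_projection_UNIV[OF assms(1)] unfolding spectral_subspace_def by blast
    fix w assume "w \<in> (\<Union>\<mu>\<in>UNIV. gen_eigenspace A \<mu>)"
    then obtain \<mu> where \<mu>: "w \<in> gen_eigenspace A \<mu>" by blast
    show "(Q1 + Q2 + Q3) *v w = mat 1 *v w"
    proof (cases "w = 0")
      case False
      then have "\<mu> \<in> \<Sigma>1 \<union> \<Sigma>2 \<union> \<Sigma>3" using all eigenvalue_if_gen_eigenspace[OF \<mu>] by blast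
      moreover have *: "w \<in> spectral_subspace A \<Sigma>" if "\<mu> \<in> \<Sigma>" for \<Sigma> using gen_eigenspace_subset[OF that] \<mu> by blast
      moreover have "Q1 *v w + Q2 *v w + Q3 *v w = w" if "\<mu> \<in> \<Sigma>1"
        using spectral_projection_fixes[OF assms(1) *[OF that]] spectral_projection_kills[OF assms(2) *[OF that]]
          spectral_projection_kills[OF assms(3) *[OF that]] disj by (simp add: Int_commute)
      moreover have "Q1 *v w + Q2 *v w + Q3 *v w = w" if "\<mu> \<in> \<Sigma>2"
        using spectral_projection_fixes[OF assms(2) *[OF that]] spectral_projection_kills[OF assms(1) *[OF that]]
          spectral_projection_kills[OF assms(3) *[OF that]] disj by (simp add: Int_commute)
      moreover have "Q1 *v w + Q2 *v w + Q3 *v w = w" if "\<mu> \<in> \<Sigma>3"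
        using spectral_projection_fixes[OF assms(3) *[OF that]] spectral_projection_kills[OF assms(1) *[OF that]]
          spectral_projection_kills[OF assms(2) *[OF that]] disj by (simp add: Int_commute)
      ultimately show ?thesis by (auto simp: matrix_vector_mult_add_rdistrib)
    qed simp
  qed
  then show "act (cmat Q1 + cmat Q2 + cmat Q3) v = act 1 v"
    by (simp add: act_simps matrix_vector_mult_add_rdistrib)
qed

section \<open>Adapted bases and Evans quotients\<close>

lemma basis_matrix:
  fixes B :: "(complex^'n) set"
  assumes "vec.span B = UNIV" "finite B" "card B \<le> CARD('n)"
  obtains R :: "complex^'n^'n" where "bij_betw (\<lambda>j. column j R) UNIV B" "invertible R"
proof -
  have "vec.dim (UNIV :: (complex^'n) set) \<le> card B" using assms by (intro vec.dim_le_card) auto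
  then have "card (UNIV :: 'n set) = card B" using assms(3) by (simp add: vec_dim_card card_cart_basis)
  then obtain f where f: "bij_betw f (UNIV :: 'n set) B"
    using finite_same_card_bij[OF finite_class.finite_UNIV assms(2)] by blast
  define R :: "complex^'n^'n" where "R = (\<chi> i j. f j $ i)"
  have c: "column j R = f j" for j by (simp add: R_def column_def vec_eq_iff)
  have "columns R = B" using f by (auto simp: columns_def c bij_betw_def)
  then have "\<exists>R'. R ** R' = mat 1" using assms(1) by (simp add: matrix_right_invertible_span_columns)
  then have "invertible R" by (simp add: invertible_right_inverse)
  moreover have "bij_betw (\<lambda>j. column j R) UNIV B" using f by (simp add: c)
  ultimately show ?thesis using that by blast
qed

text \<open>Bases of \<open>V\<close> and \<open>W\<close> together have as many elements as there
  are columns and span everything, so any enumeration of their union gives an invertible matrix;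
  \<open>S\<close> is read off afterwards as the set of columns that come from
  \<open>V\<close>.\<close>

lemma adapted_basis_exists:
  fixes V W :: "(complex^'n) set"
  assumes V: "vec.subspace V" and W: "vec.subspace W" and int: "V \<inter> W = {0}"
    and sum: "\<And>x. \<exists>v\<in>V. \<exists>w\<in>W. x = v + w"
  obtains R S where "adapted_basis R S V W"
proof -
  obtain BV where BV: "BV \<subseteq> V" "vec.independent BV" "V \<subseteq> vec.span BV" "card BV = vec.dim V"
    by (rule vec.basis_exists[of V])
  obtain BW where BW: "BW \<subseteq> W" "vec.independent BW" "W \<subseteq> vec.span BW" "card BW = vec.dim W"
    by (rule vec.basis_exists[of W])
  have fin: "finite BV" "finite BW" using vec.finiteI_independent[OF BV(2)] vec.finiteI_independent[OF BW(2)] by auto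
  have VW: "{x + y |x y. x \<in> V \<and> y \<in> W} = UNIV"
  proof (intro equalityI subset_UNIV subsetI)
    fix x obtain v w where "v \<in> V" "w \<in> W" "x = v + w" using sum[of x] by blast
    then show "x \<in> {x + y |x y. x \<in> V \<and> y \<in> W}" by blast
  qed
  have "vec.dim (UNIV :: (complex^'n) set) + vec.dim ({0} :: (complex^'n) set) = vec.dim V + vec.dim W"
    using vec.dim_sums_Int[OF V W] unfolding VW int .
  then have "card BV + card BW = CARD('n)" unfolding BV(4) BW(4) by (simp add: vec_dim_card card_cart_basis)
  then have card: "card (BV \<union> BW) \<le> CARD('n)" using card_Un_le[of BV BW] by simp
  have VB: "V \<subseteq> vec.span (BV \<union> BW)" by (rule subset_trans[OF BV(3) vec.span_mono]) blast
  have WB: "W \<subseteq> vec.span (BV \<union> BW)" by (rule subset_trans[OF BW(3) vec.span_mono]) blast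
  have "x \<in> vec.span (BV \<union> BW)" for x
  proof -
    obtain v w where vw: "v \<in> V" "w \<in> W" "x = v + w" using sum[of x] by blast
    show ?thesis unfolding vw(3) by (rule vec.span_add[OF subsetD[OF VB vw(1)] subsetD[OF WB vw(2)]])
  qed
  then have sp: "vec.span (BV \<union> BW) = UNIV" by blast
  have fU: "finite (BV \<union> BW)" using fin by simp
  obtain R :: "complex^'n^'n" where R: "bij_betw (\<lambda>j. column j R) UNIV (BV \<union> BW)" "invertible R"
    by (rule basis_matrix[OF sp fU card])
  have disj: "BV \<inter> BW = {}"
  proof -
    have "x = 0" if "x \<in> BV" "x \<in> BW" for x
    proof -
      have "x \<in> V \<inter> W" using that BV(1) BW(1) by blast
      then show ?thesis unfolding int by simp
    qed
    moreover have "0 \<notin> BV" using BV(2) vec.dependent_zero[of BV] by blast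
    ultimately show ?thesis by blast
  qed
  define S where "S = {j. column j R \<in> BV}"
  have rng: "range (\<lambda>j. column j R) = BV \<union> BW" using R(1) by (simp add: bij_betw_def)
  have im: "(\<lambda>j. column j R) ` S = BV" "(\<lambda>j. column j R) ` (- S) = BW"
  proof -
    show "(\<lambda>j. column j R) ` S = BV"
    proof (intro equalityI subsetI)
      fix b assume "b \<in> BV"
      then have "b \<in> range (\<lambda>j. column j R)" unfolding rng by (rule UnI1)
      then obtain j where "b = column j R" by (rule rangeE)
      then show "b \<in> (\<lambda>j. column j R) ` S" using \<open>b \<in> BV\<close> by (simp add: S_def)
    qed (auto simp: S_def)
    show "(\<lambda>j. column j R) ` (- S) = BW"
    proof (intro equalityI subsetI)
      fix b assume b: "b \<in> BW"
      then have "b \<in> range (\<lambda>j. column j R)" unfolding rng by (rule UnI2)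
      then obtain j where j: "b = column j R" by (rule rangeE)
      moreover have "b \<notin> BV" using b disj by blast
      ultimately show "b \<in> (\<lambda>j. column j R) ` (- S)" by (simp add: S_def)
    next
      fix b assume "b \<in> (\<lambda>j. column j R) ` (- S)"
      then obtain j where j: "b = column j R" "column j R \<notin> BV" by (auto simp: S_def)
      have "column j R \<in> BV \<union> BW" unfolding rng[symmetric] by (rule rangeI)
      then show "b \<in> BW" using j by simp
    qed
  qed
  have "vec.span BV = V" by (intro subset_antisym vec.span_minimal BV(1,3) V)
  moreover have "vec.span BW = W" by (intro subset_antisym vec.span_minimal BW(1,3) W)
  ultimately have "adapted_basis R S V W" unfolding adapted_basis_def im using R(2) by simp
  then show ?thesis by (rule that)
qed

lemma subspace_range_matrix: "vec.subspace (range ((*v) p))" for p :: "complex^'n^'n"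
proof -
  have "vec.span (range ((*v) p)) \<subseteq> range ((*v) p)"
  proof
    fix x assume "x \<in> vec.span (range ((*v) p))"
    then show "x \<in> range ((*v) p)"
    proof (induction rule: vec.span_induct_alt)
      case base
      then show ?case by (metis matrix_vector_mult_0_right rangeI)
    next
      case (step c x y)
      then obtain a b where "x = p *v a" "y = p *v b" by blast
      then have "c *s x + y = p *v (c *s a + b)" by (simp add: matrix_vector_right_distrib vector_scalar_commute)
      then show ?case by blast
    qed
  qed
  then show ?thesis by (metis subset_antisym vec.span_superset vec.subspace_span)
qed

text \<open>Each column of an adapted \<open>R\<close> is fixed by one of the projections
  \<open>p\<close>, \<open>mat 1 - p\<close> and annihilated by the other, so the glued matrix is
  \<open>(Pm ** p + Pp ** (mat 1 - p)) ** R\<close> and \<open>det R\<close> cancels. The result no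
  longer mentions a basis.\<close>

lemma evans_quotient_idempotent:
  fixes p Pm Pp :: "complex^'n^'n"
  assumes p: "p ** p = p"
  shows "evans_quotient Pm Pp (range ((*v) p)) (range ((*v) (mat 1 - p))) = det (Pm ** p + Pp ** (mat 1 - p))"
proof -
  define q where "q = mat 1 - p"
  have pp: "p *v (p *v x) = p *v x" for x by (simp add: matrix_vector_mul_assoc p)
  have pq: "p *v (q *v x) = 0" "q *v (p *v x) = 0" "p *v (p *v x) = p *v x" "q *v (q *v x) = q *v x" for x
    by (simp_all add: q_def matrix_vector_mult_diff_rdistrib matrix_vector_mult_diff_distrib pp)
  have sum: "x = p *v x + q *v x" for x by (simp add: q_def matrix_vector_mult_diff_rdistrib)
  obtain R S where RS: "adapted_basis R S (range ((*v) p)) (range ((*v) q))"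
  proof (rule adapted_basis_exists)
    show "vec.subspace (range ((*v) p))" "vec.subspace (range ((*v) q))" by (rule subspace_range_matrix)+
    show "range ((*v) p) \<inter> range ((*v) q) = {0}"
    proof (intro equalityI subsetI)
      fix x assume "x \<in> range ((*v) p) \<inter> range ((*v) q)"
      then obtain a b where "x = p *v a" "x = q *v b" by blast
      then have "x = p *v x" "p *v x = 0" using pq by metis+
      then show "x \<in> {0}" by simp
    next
      fix x :: "complex^'n" assume "x \<in> {0}"
      then have "x = p *v 0" "x = q *v 0" by simp_all
      then show "x \<in> range ((*v) p) \<inter> range ((*v) q)" by blast
    qed
    show "\<exists>v\<in>range ((*v) p). \<exists>w\<in>range ((*v) q). x = v + w" for x using sum[of x] by blast
  qed blast
  have inv: "invertible R" using RS by (simp add: adapted_basis_def)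
  have V: "column j R \<in> range ((*v) p)" if "j \<in> S" for j
    using RS that vec.span_base[of "column j R" "(\<lambda>j. column j R) ` S"] by (auto simp: adapted_basis_def)
  have W: "column j R \<in> range ((*v) q)" if "j \<notin> S" for j
    using RS that vec.span_base[of "column j R" "(\<lambda>j. column j R) ` (- S)"] by (auto simp: adapted_basis_def)
  have "column j (glued_columns S (Pm ** R) (Pp ** R)) = column j ((Pm ** p + Pp ** q) ** R)" for j
  proof (cases "j \<in> S")
    case True
    then obtain a where "column j R = p *v a" using V by blast
    then have "p *v column j R = column j R" "q *v column j R = 0" by (simp_all only: pq)
    then show ?thesis using True
      by (simp add: column_glued_columns column_matrix_mult matrix_vector_mult_add_rdistrib flip: matrix_vector_mul_assoc)
  next
    case False
    then obtain a where "column j R = q *v a" using W by blast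
    then have "q *v column j R = column j R" "p *v column j R = 0" by (simp_all only: pq)
    then show ?thesis using False
      by (simp add: column_glued_columns column_matrix_mult matrix_vector_mult_add_rdistrib flip: matrix_vector_mul_assoc)
  qed
  then have "glued_columns S (Pm ** R) (Pp ** R) = (Pm ** p + Pp ** q) ** R"
    by (simp add: vec_eq_iff column_def)
  then show ?thesis
    unfolding q_def[symmetric] evans_quotient_eq[OF RS] using inv by (simp add: det_mul invertible_det_nz)
qed

section \<open>Simple eigenvalues\<close>

lemma poly_charpoly: "poly (charpoly A) z = det (mat z - A)"
proof -
  have e: "poly ((mat [:0, 1:] - map_matrix (\<lambda>c. [:c:]) A) $ i $ j) z = (mat z - A) $ i $ j" for i j
    by (simp add: mat_def map_matrix_def)
  show ?thesis unfolding charpoly_def det_def by (simp add: poly_sum poly_prod e del: vector_minus_component)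
qed

lemma has_inverse_minus_sc:
  fixes a :: "'n::finite cmat"
  assumes "norm a < norm t" shows "has_inverse (sc t - a)"
proof -
  have t: "t \<noteq> 0" using assms norm_ge_zero[of a] by auto
  have "norm (- (sc (1 / t) * a)) \<le> norm (sc (1 / t) :: 'n cmat) * norm a" by (simp only: norm_minus_cancel norm_mult_ineq)
  also have "\<dots> < 1" using assms t by (simp add: norm_divide field_simps)
  finally have "has_inverse (1 + - (sc (1 / t) * a))" by (intro has_inverse_near_one) simp
  moreover have "has_inverse (sc t :: 'n cmat)"
    unfolding has_inverse_def using t by (intro exI[of _ "sc (1 / t)"]) (simp add: sc_simps flip: sc_simps(1))
  ultimately have "has_inverse (sc t * (1 + - (sc (1 / t) * a)))" by (intro has_inverse_mult)
  also have "sc t * (1 + - (sc (1 / t) * a)) = sc t - (sc t * sc (1 / t)) * a" by (simp add: algebra_simps)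
  also have "\<dots> = sc t - a" using t by (simp add: sc_simps flip: sc_simps(1))
  finally show ?thesis .
qed

text \<open>A second generalized eigenvector would, as a basis vector next to the first, give the
  characteristic polynomial a double root.\<close>

lemma simple_eigenvalue_no_chain:
  fixes A :: "complex^'n^'n"
  assumes simple: "simple_eigenvalue A \<mu>" and v1: "A *v v1 = \<mu> *s v1" "v1 \<noteq> 0"
    and v2: "A *v v2 = \<mu> *s v2 + \<beta> *s v1"
  shows "v2 \<in> vec.span {v1}"
proof (rule ccontr)
  assume n: "v2 \<notin> vec.span {v1}"
  have "vec.independent (insert v2 {v1})"
    using n v1 by (subst vec.independent_insert) (auto simp: vec.independent_insert)
  then have ind: "vec.independent {v1, v2}" by (simp add: insert_commute)
  have ne: "v1 \<noteq> v2" using n vec.span_base[of v1 "{v1}"] by auto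
  define B where "B = vec.extend_basis {v1, v2}"
  have B: "{v1, v2} \<subseteq> B" "vec.independent B" "vec.span B = UNIV"
    unfolding B_def
    by (rule vec.extend_basis_superset[OF ind] vec.independent_extend_basis[OF ind] vec.span_extend_basis[OF ind])+
  have fB: "finite B" by (rule vec.finiteI_independent[OF B(2)])
  have "card B = vec.dim (vec.span B)" by (simp only: vec.dim_span_eq_card_independent[OF B(2)])
  then have cB: "card B \<le> CARD('n)" unfolding B(3) vec_dim_card by simp
  obtain R :: "complex^'n^'n" where R: "bij_betw (\<lambda>j. column j R) UNIV B" "invertible R"
    by (rule basis_matrix[OF B(3) fB cB])
  obtain j1 j2 where j: "column j1 R = v1" "column j2 R = v2"
  proof -
    have "range (\<lambda>j. column j R) = B" using R(1) by (simp add: bij_betw_def)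
    then have "v1 \<in> range (\<lambda>j. column j R)" "v2 \<in> range (\<lambda>j. column j R)" using B(1) by blast+
    then obtain j1 j2 where "v1 = column j1 R" "v2 = column j2 R" by blast
    then show ?thesis using that[of j1 j2] by simp
  qed
  then have jne: "j1 \<noteq> j2" using ne by auto
  define C where "C z k = (mat z - A) *v column k R" for z k
  have Cact: "C z k = z *s column k R - A *v column k R" for z k
  proof -
    have "C z k = act (cmat (mat z - A)) (column k R)" by (simp add: C_def act_simps)
    then show ?thesis by (simp add: cmat_simps act_simps)
  qed
  \<comment> \<open>The columns of \<open>(mat z - A) ** R\<close> turned into rows, with a factor
    \<open>z - \<mu>\<close> removed from each of the two rows of the chain. The term with \<beta>
    disappears because it repeats the row \<open>v1\<close>.\<close>
  define H where "H z = (\<chi> k. if k = j1 then v1 else if k = j2 then v2 else C z k)" for z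
  have det: "det ((mat z - A) ** R) = (z - \<mu>) ^ 2 * det (H z)" for z
  proof -
    have c1: "C z j1 = (z - \<mu>) *s v1" unfolding Cact j v1 by (simp add: vec_eq_iff algebra_simps)
    have c2: "C z j2 = (z - \<mu>) *s v2 + (- \<beta>) *s v1" unfolding Cact j v2 by (simp add: vec_eq_iff algebra_simps)
    have "det ((mat z - A) ** R) = det (transpose ((mat z - A) ** R))" by (simp add: det_transpose)
    also have "transpose ((mat z - A) ** R) = (\<chi> k. C z k)"
      by (simp add: transpose_def C_def vec_eq_iff column_def matrix_matrix_mult_def matrix_vector_mult_def)
    also have "\<dots> = (\<chi> k. if k = j1 then (z - \<mu>) *s v1 else C z k)" using c1 by (simp add: vec_eq_iff)
    also have "det \<dots> = (z - \<mu>) * det (\<chi> k. if k = j1 then v1 else C z k)"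
      by (rule det_row_mul[of j1 "z - \<mu>" "\<lambda>_. v1"])
    also have "(\<chi> k. if k = j1 then v1 else C z k) =
        (\<chi> k. if k = j2 then (z - \<mu>) *s v2 + (- \<beta>) *s v1 else if k = j1 then v1 else C z k)"
      using c2 jne by (simp add: vec_eq_iff)
    also have "det \<dots> = det (\<chi> k. if k = j2 then (z - \<mu>) *s v2 else if k = j1 then v1 else C z k) +
        det (\<chi> k. if k = j2 then (- \<beta>) *s v1 else if k = j1 then v1 else C z k)"
      by (rule det_row_add[of j2 "\<lambda>_. (z - \<mu>) *s v2" "\<lambda>_. (- \<beta>) *s v1"])
    also have "det (\<chi> k. if k = j2 then (- \<beta>) *s v1 else if k = j1 then v1 else C z k) =
        - \<beta> * det (\<chi> k. if k = j2 then v1 else if k = j1 then v1 else C z k)"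
      by (rule det_row_mul[of j2 "- \<beta>" "\<lambda>_. v1"])
    also have "det (\<chi> k. if k = j2 then v1 else if k = j1 then v1 else C z k) = 0"
      by (rule det_identical_rows[OF jne]) (simp add: row_def vec_eq_iff)
    also have "det (\<chi> k. if k = j2 then (z - \<mu>) *s v2 else if k = j1 then v1 else C z k) =
        (z - \<mu>) * det (\<chi> k. if k = j2 then v2 else if k = j1 then v1 else C z k)"
      by (rule det_row_mul[of j2 "z - \<mu>" "\<lambda>_. v2"])
    also have "(\<chi> k. if k = j2 then v2 else if k = j1 then v1 else C z k) = H z"
      using jne by (simp add: H_def vec_eq_iff)
    finally show ?thesis by (simp add: power2_eq_square)
  qed
  define p where "p = charpoly A"
  have pz: "poly p z * det R = (z - \<mu>) ^ 2 * det (H z)" for z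
    using det[of z] by (simp add: p_def poly_charpoly det_mul)
  have p0: "p \<noteq> 0"
  proof
    assume "p = 0"
    define t where "t = complex_of_real (norm (cmat A) + 1)"
    have "norm (cmat A) < norm t" unfolding t_def norm_of_real by linarith
    then have "has_inverse (sc t - cmat A)" by (rule has_inverse_minus_sc)
    then have "det (mat t - A) \<noteq> 0" by (simp add: has_inverse_iff_cdet flip: cmat_simps)
    then show False using \<open>p = 0\<close> by (simp add: p_def flip: poly_charpoly)
  qed
  have o: "order \<mu> p = 1" using simple by (simp add: simple_eigenvalue_def p_def)
  then obtain q where q: "p = [:- \<mu>, 1:] * q" "\<not> [:- \<mu>, 1:] dvd q"
    using order_decomp[OF p0, of \<mu>] by auto
  have qm: "poly q \<mu> \<noteq> 0" using q(2) by (simp add: poly_eq_0_iff_dvd)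
  \<comment> \<open>Since \<open>\<mu>\<close> is a root of order 1, one factor can be cancelled for
    \<open>z \<noteq> \<mu>\<close> while another remains on the right. Letting \<open>z\<close>
    tend to \<open>\<mu>\<close> then contradicts \<open>poly q \<mu> \<noteq> 0\<close>.\<close>
  have eq: "poly q z * det R = (z - \<mu>) * det (H z)" if "z \<noteq> \<mu>" for z
  proof -
    have "(z - \<mu>) * (poly q z * det R) = (z - \<mu>) * ((z - \<mu>) * det (H z))"
      using pz[of z] by (simp add: q(1) power2_eq_square algebra_simps)
    then show ?thesis using that by simp
  qed
  have "(\<lambda>z. cdet (cmat (H z))) holomorphic_on UNIV"
  proof (rule cdet_holomorphic)
    fix i k show "(\<lambda>z. ent (cmat (H z)) i k) holomorphic_on UNIV"
      by (cases "i = j1"; cases "i = j2") (auto simp: cmat_simps H_def Cact intro!: holomorphic_intros)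
  qed
  then have "isCont (\<lambda>z. det (H z)) \<mu>"
    by (auto dest!: holomorphic_on_imp_continuous_on simp: cmat_simps continuous_on_eq_continuous_at)
  then have "((\<lambda>z. (z - \<mu>) * det (H z)) \<longlongrightarrow> (\<mu> - \<mu>) * det (H \<mu>)) (at \<mu>)"
    by (intro tendsto_intros) (auto simp: isCont_def)
  then have "((\<lambda>z. poly q z * det R) \<longlongrightarrow> (\<mu> - \<mu>) * det (H \<mu>)) (at \<mu>)"
    by (rule Lim_transform_eventually) (auto simp: eventually_at_filter eq)
  moreover have "((\<lambda>z. poly q z * det R) \<longlongrightarrow> poly q \<mu> * det R) (at \<mu>)"
    by (intro tendsto_intros)
  ultimately have "poly q \<mu> * det R = (\<mu> - \<mu>) * det (H \<mu>)" by (intro tendsto_unique[of "at \<mu>"]) auto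
  moreover have "det R \<noteq> 0" using R(2) by (simp add: invertible_det_nz)
  ultimately show False using qm by simp
qed

text \<open>Induction on the nilpotency order: the image of \<open>v\<close> under
  \<open>A - mat \<mu>\<close> already lies on the line of \<open>v0\<close>, and then
  \<open>simple_eigenvalue_no_chain\<close> puts \<open>v\<close> there as well.\<close>

lemma simple_eigenvalue_gen_eigenspace:
  fixes A :: "complex^'n^'n"
  assumes simple: "simple_eigenvalue A \<mu>" and v0: "A *v v0 = \<mu> *s v0" "v0 \<noteq> 0"
    and v: "v \<in> gen_eigenspace A \<mu>"
  shows "v \<in> vec.span {v0}"
proof -
  obtain p where "(((*v) (A - mat \<mu>)) ^^ p) v = 0" using v by (auto simp: gen_eigenspace_def)
  then show ?thesis
  proof (induction p arbitrary: v)
    case 0 then show ?case by (simp add: vec.span_zero)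
  next
    case (Suc p)
    have "(A - mat \<mu>) *v v \<in> vec.span {v0}" using Suc by (simp add: funpow_swap1)
    then obtain \<beta> where b: "(A - mat \<mu>) *v v = \<beta> *s v0" by (auto simp: vec.span_singleton)
    have "act (cmat (A - mat \<mu>)) v = \<beta> *s v0" using b by (simp add: act_simps)
    then have "A *v v = \<mu> *s v + \<beta> *s v0" by (simp add: cmat_simps act_simps algebra_simps)
    then show ?case by (rule simple_eigenvalue_no_chain[OF simple v0])
  qed
qed

section \<open>The critical spectral splitting\<close>

text \<open>The derivative of the orbit of \<open>v\<close> is \<open>s\<close> times the orbit of
  its image under \<open>A - mat \<mu>\<close>, whose nilpotency order is one less; the mean value
  inequality then raises the degree of the bound by one. With \<open>s\<close> equal to 1 or -1 the
  estimate serves both directions of time.\<close>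

lemma norm_act_exp_nilpotent:
  fixes A :: "complex^'n^'n" and s :: real
  assumes "(((*v) (A - mat \<mu>)) ^^ p) v = 0" and s: "\<bar>s\<bar> \<le> 1"
  shows "\<exists>K\<ge>0. \<forall>x\<ge>0. norm (act (exp (x *\<^sub>R (s *\<^sub>R (cmat A - sc \<mu>)))) v) \<le> K * (1 + x) ^ p"
  using assms(1)
proof (induction p arbitrary: v)
  case 0
  then show ?case by (intro exI[of _ 0]) (simp add: act_simps)
next
  case (Suc p)
  define m where "m = s *\<^sub>R (cmat A - sc \<mu>)"
  define u where "u = act (cmat A - sc \<mu>) v"
  have u: "u = (A - mat \<mu>) *v v"
    unfolding u_def cmat_simps(4)[symmetric] cmat_simps(2)[symmetric] by (rule act_simps(11))
  have "(((*v) (A - mat \<mu>)) ^^ p) u = 0" using Suc.prems by (simp add: u funpow_swap1)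
  then obtain K where K: "K \<ge> 0" "\<And>x. x \<ge> 0 \<Longrightarrow> norm (act (exp (x *\<^sub>R m)) u) \<le> K * (1 + x) ^ p"
    using Suc.IH[of u] unfolding m_def by blast
  have bl: "bounded_linear (\<lambda>a. act a v)"
    by (rule bounded_linear_intro[of _ "norm v"]) (simp_all add: act_simps norm_act)
  have "norm (act (exp (x *\<^sub>R m)) v) \<le> (norm v + K) * (1 + x) ^ Suc p" if x: "x \<ge> 0" for x
  proof -
    have "norm (act (exp (x *\<^sub>R m)) v - act (exp (0 *\<^sub>R m)) v) \<le> (K * (1 + x) ^ p) * \<bar>x - 0\<bar>"
    proof (rule vector_derivative_bound[where S = "{0..x}" and f = "\<lambda>x. act (exp (x *\<^sub>R m)) v" and f' = "\<lambda>x. s *\<^sub>R act (exp (x *\<^sub>R m)) u"])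
      fix y assume y: "y \<in> {0..x}"
      have "((\<lambda>x. act (exp (x *\<^sub>R m)) v) has_vector_derivative act (exp (y *\<^sub>R m) * m) v) (at y within {0..x})"
        by (rule bounded_linear.has_vector_derivative[OF bl exp_scaleR_has_vector_derivative_right])
      moreover have "act (exp (y *\<^sub>R m) * m) v = s *\<^sub>R act (exp (y *\<^sub>R m)) u"
      proof -
        have "act m v = s *\<^sub>R u" unfolding m_def u_def by (rule act_simps)
        moreover have "act a (s *\<^sub>R w) = s *\<^sub>R act a w" for a :: "'n cmat" and w
          by transfer (simp add: vec_eq_iff matrix_vector_mult_def scaleR_sum_right)
        ultimately show ?thesis by (simp add: act_simps(3))
      qed
      ultimately show "((\<lambda>x. act (exp (x *\<^sub>R m)) v) has_vector_derivative s *\<^sub>R act (exp (y *\<^sub>R m)) u) (at y within {0..x})" by simp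
      have "norm (s *\<^sub>R act (exp (y *\<^sub>R m)) u) \<le> 1 * (K * (1 + y) ^ p)"
        unfolding norm_scaleR using s K y by (intro mult_mono) auto
      also have "\<dots> \<le> K * (1 + x) ^ p" using y K by (auto intro!: mult_left_mono power_mono)
      finally show "norm (s *\<^sub>R act (exp (y *\<^sub>R m)) u) \<le> K * (1 + x) ^ p" .
    qed (use x in auto)
    then have "norm (act (exp (x *\<^sub>R m)) v) \<le> norm v + K * (1 + x) ^ p * x"
      using norm_triangle_sub[of "act (exp (x *\<^sub>R m)) v" v] x by (simp add: act_simps)
    also have "\<dots> \<le> norm v * (1 + x) ^ Suc p + K * (1 + x) ^ p * (1 + x)"
    proof (intro add_mono mult_left_mono)
      have "norm v * 1 \<le> norm v * (1 + x) ^ Suc p" using x by (intro mult_left_mono one_le_power) auto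
      then show "norm v \<le> norm v * (1 + x) ^ Suc p" by simp
    qed (use x K in auto)
    finally show ?thesis by (simp add: algebra_simps)
  qed
  then show ?case unfolding m_def using K(1) by (intro exI[of _ "norm v + K"]) auto
qed

lemma exp_shift:
  fixes a :: "'n::finite cmat"
  shows "exp (x *\<^sub>R (s *\<^sub>R a)) = sc (exp (of_real (x * s) * \<mu>)) * exp (x *\<^sub>R (s *\<^sub>R (a - sc \<mu>)))"
proof -
  have e: "sc (of_real (x * s) * \<mu>) = x *\<^sub>R (s *\<^sub>R (sc \<mu> :: 'n cmat))"
    by (rule cmat_eqI) (simp only: ent_simps, simp add: scaleR_conv_of_real)
  have "x *\<^sub>R (s *\<^sub>R a) = sc (of_real (x * s) * \<mu>) + x *\<^sub>R (s *\<^sub>R (a - sc \<mu>))"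
    unfolding e scaleR_diff_right by simp
  also have "exp \<dots> = exp (sc (of_real (x * s) * \<mu>)) * exp (x *\<^sub>R (s *\<^sub>R (a - sc \<mu>)))"
    by (rule exp_add_commuting) (rule sc_commute)
  finally show ?thesis by (simp only: exp_sc)
qed

lemma tendsto_exp_spectral_subspace:
  fixes A :: "complex^'n^'n" and s :: real
  assumes s: "\<bar>s\<bar> \<le> 1" and neg: "\<And>\<mu>. \<mu> \<in> \<Sigma> \<Longrightarrow> s * Re \<mu> < 0" and v: "v \<in> spectral_subspace A \<Sigma>"
  shows "((\<lambda>x. act (exp (x *\<^sub>R (s *\<^sub>R cmat A))) v) \<longlongrightarrow> 0) at_top"
  using v unfolding spectral_subspace_def
proof (induction rule: vec.span_induct_alt)
  case base then show ?case by (simp add: act_simps)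
next
  case (step c w y)
  obtain \<mu> p where \<mu>: "\<mu> \<in> \<Sigma>" and w: "(((*v) (A - mat \<mu>)) ^^ p) w = 0" using step(1) by (auto simp: gen_eigenspace_def)
  obtain K where K: "\<And>x. x \<ge> 0 \<Longrightarrow> norm (act (exp (x *\<^sub>R (s *\<^sub>R (cmat A - sc \<mu>)))) w) \<le> K * (1 + x) ^ p"
    using norm_act_exp_nilpotent[OF w s] by blast
  define b where "b = - (s * Re \<mu>)"
  have b: "b > 0" using neg[OF \<mu>] by (simp add: b_def)
  have "((\<lambda>x. act (exp (x *\<^sub>R (s *\<^sub>R cmat A))) w) \<longlongrightarrow> 0) at_top"
  proof (rule Lim_null_comparison)
    show "\<forall>\<^sub>F x in at_top. norm (act (exp (x *\<^sub>R (s *\<^sub>R cmat A))) w) \<le> exp (- b * x) * (K * (1 + x) ^ p)"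
    proof (rule eventually_at_top_linorderI[of 0])
      fix x :: real assume x: "x \<ge> 0"
      have n: "norm (z *s y) = norm z * norm y" for z and y :: "complex^'n"
        by (simp add: norm_vec_def norm_mult L2_set_right_distrib)
      have "norm (act (exp (x *\<^sub>R (s *\<^sub>R cmat A))) w) =
          exp (Re (of_real (x * s) * \<mu>)) * norm (act (exp (x *\<^sub>R (s *\<^sub>R (cmat A - sc \<mu>)))) w)"
        unfolding exp_shift[of x s "cmat A" \<mu>] act_simps(3) act_simps(10) n norm_exp_eq_Re ..
      also have "Re (of_real (x * s) * \<mu>) = - b * x" by (simp add: b_def)
      finally show "norm (act (exp (x *\<^sub>R (s *\<^sub>R cmat A))) w) \<le> exp (- b * x) * (K * (1 + x) ^ p)"
        using K[OF x] by (simp add: mult_left_mono)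
    qed
    show "((\<lambda>x. exp (- b * x) * (K * (1 + x) ^ p)) \<longlongrightarrow> 0) at_top" using b by real_asymp
  qed
  note lim = this
  have bl: "bounded_linear (\<lambda>w::complex^'n. c *s w)"
  proof -
    have "(\<lambda>w::complex^'n. c *s w) = (*v) (mat c)"
      by (auto simp: fun_eq_iff vec_eq_iff matrix_vector_mult_def mat_def if_distrib[of "\<lambda>x. x * _"] cong: if_cong)
    then show ?thesis by simp
  qed
  have "((\<lambda>x. c *s act (exp (x *\<^sub>R (s *\<^sub>R cmat A))) w) \<longlongrightarrow> c *s 0) at_top"
    by (rule bounded_linear.tendsto[OF bl lim])
  from tendsto_add[OF this step(2)] show ?case by (simp add: act_simps)
qed

lemma tendsto_exp_spectral_projection:
  fixes A Q :: "complex^'n^'n" and s :: real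
  assumes s: "\<bar>s\<bar> \<le> 1" and neg: "\<And>\<mu>. \<mu> \<in> \<Sigma> \<Longrightarrow> s * Re \<mu> < 0" and Q: "spectral_projection A \<Sigma> Q"
  shows "((\<lambda>x. exp (x *\<^sub>R (s *\<^sub>R cmat A)) * cmat Q) \<longlongrightarrow> 0) at_top"
proof (rule tendsto_cmatI)
  fix i j
  have "Q *v axis j 1 \<in> spectral_subspace A \<Sigma>" using Q by (auto simp: spectral_projection_def)
  from tendsto_exp_spectral_subspace[OF s neg this]
  have "((\<lambda>x. act (exp (x *\<^sub>R (s *\<^sub>R cmat A))) (Q *v axis j 1) $ i) \<longlongrightarrow> 0 $ i) at_top"
    by (rule tendsto_vec_nth)
  moreover have "act (exp (x *\<^sub>R (s *\<^sub>R cmat A))) (Q *v axis j 1) $ i = ent (exp (x *\<^sub>R (s *\<^sub>R cmat A)) * cmat Q) i j" for x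
    by (simp add: act_simps flip: act_axis)
  ultimately show "((\<lambda>x. ent (exp (x *\<^sub>R (s *\<^sub>R cmat A)) * cmat Q) i j) \<longlongrightarrow> ent 0 i j) at_top" by simp
qed

text \<open>Uniformity in the parameter comes from the semigroup property: the bound \<open>1/2\<close> at a single
  time is an open condition.\<close>

lemma uniform_spectral_decay:
  fixes Am Qm :: "complex \<Rightarrow> complex^'n^'n" and s :: real
  assumes s: "\<bar>s\<bar> = 1" and neg: "\<And>\<mu>. \<mu> \<in> \<Sigma> \<Longrightarrow> s * Re \<mu> < 0" and Q: "spectral_projection (Am z0) \<Sigma> (Qm z0)"
    and cA: "((\<lambda>z. cmat (Am z)) \<longlongrightarrow> cmat (Am z0)) (nhds z0)" and cQ: "((\<lambda>z. cmat (Qm z)) \<longlongrightarrow> cmat (Qm z0)) (nhds z0)"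
    and proj: "\<forall>\<^sub>F z in nhds z0. cmat (Qm z) * cmat (Qm z) = cmat (Qm z) \<and> cmat (Am z) * cmat (Qm z) = cmat (Qm z) * cmat (Am z)"
  shows "\<exists>\<alpha>>0. \<exists>K>0. \<forall>\<^sub>F z in nhds z0. \<forall>x\<ge>0. norm (exp (x *\<^sub>R (s *\<^sub>R cmat (Am z))) * cmat (Qm z)) \<le> K * exp (- \<alpha> * x)"
proof -
  have "((\<lambda>x. exp (x *\<^sub>R (s *\<^sub>R cmat (Am z0))) * cmat (Qm z0)) \<longlongrightarrow> 0) at_top"
    by (rule tendsto_exp_spectral_projection[OF _ neg Q]) (use s in simp_all)
  then have "\<forall>\<^sub>F x in at_top. norm (exp (x *\<^sub>R (s *\<^sub>R cmat (Am z0))) * cmat (Qm z0)) < 1/2"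
    by (intro order_tendstoD(2)[OF tendsto_norm_zero]) auto
  then have "\<forall>\<^sub>F x in at_top. norm (exp (x *\<^sub>R (s *\<^sub>R cmat (Am z0))) * cmat (Qm z0)) < 1/2 \<and> x > 0"
    using eventually_gt_at_top[of 0] by eventually_elim simp
  then obtain x0 where x0: "norm (exp (x0 *\<^sub>R (s *\<^sub>R cmat (Am z0))) * cmat (Qm z0)) < 1/2" "x0 > 0"
    using eventually_happens'[OF trivial_limit_at_top_linorder] by blast
  have "((\<lambda>z. exp (x0 *\<^sub>R (s *\<^sub>R cmat (Am z))) * cmat (Qm z)) \<longlongrightarrow> exp (x0 *\<^sub>R (s *\<^sub>R cmat (Am z0))) * cmat (Qm z0)) (nhds z0)"
    by (intro tendsto_mult tendsto_exp_algebra tendsto_scaleR tendsto_const cA cQ)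
  then have "((\<lambda>z. norm (exp (x0 *\<^sub>R (s *\<^sub>R cmat (Am z))) * cmat (Qm z))) \<longlongrightarrow> norm (exp (x0 *\<^sub>R (s *\<^sub>R cmat (Am z0))) * cmat (Qm z0))) (nhds z0)"
    by (rule tendsto_norm)
  then have h: "\<forall>\<^sub>F z in nhds z0. norm (exp (x0 *\<^sub>R (s *\<^sub>R cmat (Am z))) * cmat (Qm z)) < 1/2"
    by (rule order_tendstoD(2)) (rule x0)
  have nA: "\<forall>\<^sub>F z in nhds z0. norm (cmat (Am z)) < norm (cmat (Am z0)) + 1"
    by (rule order_tendstoD(2)[OF tendsto_norm[OF cA]]) simp
  have nQ: "\<forall>\<^sub>F z in nhds z0. norm (cmat (Qm z)) < norm (cmat (Qm z0)) + 1"
    by (rule order_tendstoD(2)[OF tendsto_norm[OF cQ]]) simp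
  define a where "a = norm (cmat (Am z0)) + 1"
  define K where "K = 2 * exp (a * x0) * (norm (cmat (Qm z0)) + 1)"
  have "\<forall>\<^sub>F z in nhds z0. \<forall>x\<ge>0. norm (exp (x *\<^sub>R (s *\<^sub>R cmat (Am z))) * cmat (Qm z)) \<le> K * exp (- (ln 2 / x0) * x)"
    using h nA nQ proj
  proof eventually_elim
    case (elim z)
    show ?case
    proof (intro allI impI)
      fix x :: real assume x: "x \<ge> 0"
      have "norm (exp (x *\<^sub>R (s *\<^sub>R cmat (Am z))) * cmat (Qm z)) \<le> (2 * exp (a * x0) * norm (cmat (Qm z))) * exp (- (ln 2 / x0) * x)"
      proof (rule semigroup_decay)
        show "norm (s *\<^sub>R cmat (Am z)) \<le> a" using elim s by (simp add: a_def)
      qed (use elim x0 x in auto)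
      also have "\<dots> \<le> K * exp (- (ln 2 / x0) * x)"
        unfolding K_def using elim by (intro mult_right_mono mult_left_mono) auto
      finally show "norm (exp (x *\<^sub>R (s *\<^sub>R cmat (Am z))) * cmat (Qm z)) \<le> K * exp (- (ln 2 / x0) * x)" .
    qed
  qed
  moreover have "ln 2 / x0 > 0" using x0 by simp
  moreover have "K > 0" unfolding K_def by (intro mult_pos_pos) (auto intro: add_nonneg_pos)
  ultimately show ?thesis by blast
qed

text \<open>Used to carry completeness of the three projections from the arc point to its
  neighbours: the defect from the identity is an idempotent that depends continuously on the
  parameter.\<close>

lemma norm_idempotent_less_one:
  fixes e :: "'a::real_normed_algebra_1"
  assumes "e * e = e" "norm e < 1" shows "e = 0"
proof -
  have "norm e * norm e \<ge> norm e" using norm_mult_ineq[of e e] assms(1) by simp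
  show ?thesis
  proof (rule ccontr)
    assume "e \<noteq> 0"
    then have "norm e * norm e < norm e * 1" using assms(2) by (intro mult_strict_left_mono) auto
    with \<open>norm e * norm e \<ge> norm e\<close> show False by simp
  qed
qed

lemma matrix_analytic_on_tendsto:
  assumes "matrix_analytic_on Q {z0}" shows "((\<lambda>z. cmat (Q z)) \<longlongrightarrow> cmat (Q z0)) (nhds z0)"
proof (rule tendsto_cmatI)
  fix i j
  have "(\<lambda>z. Q z $ i $ j) analytic_on {z0}" using assms by (simp add: matrix_analytic_on_def)
  then have "isCont (\<lambda>z. Q z $ i $ j) z0" using analytic_at_imp_isCont by blast
  then show "((\<lambda>z. ent (cmat (Q z)) i j) \<longlongrightarrow> ent (cmat (Q z0)) i j) (nhds z0)"
    unfolding cmat_simps using tendsto_at_iff_tendsto_nhds[of "\<lambda>z. Q z $ i $ j" z0] by (simp add: isCont_def)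
qed

text \<open>The location of the whole spectrum is known only at \<open>z0\<close>, and the structure
  nearby is inferred by continuity. The defect of the three projections from the identity is
  idempotent and small, hence zero; \<open>\<Pi>c z0\<close> is injective on the range of
  \<open>\<Pi>c z\<close>, so this range stays a line, and it is spanned by an eigenvector for
  \<open>muc z\<close>.\<close>

theorem critical_splitting:
  fixes Ainf :: "complex \<Rightarrow> complex^'n^'n"
  assumes cont: "((\<lambda>z. cmat (Ainf z)) \<longlongrightarrow> cmat (Ainf z0)) (nhds z0)"
    and z0: "z0 = lam j k0" and arc: "isolated_arc Ainf J lam j k0 muc"
    and proj: "critical_projections Ainf muc z0 \<Pi>c \<Pi>ss \<Pi>su"
  shows "\<exists>\<alpha>>0. \<exists>K>0. \<forall>\<^sub>F z in nhds z0.
      splitting (cmat (\<Pi>su z)) (cmat (\<Pi>c z)) (cmat (\<Pi>ss z)) \<and>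
      cmat (Ainf z) * cmat (\<Pi>su z) = cmat (\<Pi>su z) * cmat (Ainf z) \<and>
      cmat (Ainf z) * cmat (\<Pi>c z) = sc (muc z) * cmat (\<Pi>c z) \<and>
      cmat (Ainf z) * cmat (\<Pi>c z) = cmat (\<Pi>c z) * cmat (Ainf z) \<and>
      cmat (Ainf z) * cmat (\<Pi>ss z) = cmat (\<Pi>ss z) * cmat (Ainf z) \<and>
      (\<exists>u w. \<forall>i j. ent (cmat (\<Pi>c z)) i j = u i * w j) \<and> cmat (\<Pi>c z) \<noteq> 0 \<and>
      norm (cmat (\<Pi>su z)) \<le> K \<and> norm (cmat (\<Pi>c z)) \<le> K \<and> norm (cmat (\<Pi>ss z)) \<le> K \<and> norm (cmat (Ainf z)) \<le> K \<and>
      (\<forall>x\<ge>0. norm (exp ((- x) *\<^sub>R cmat (Ainf z)) * cmat (\<Pi>su z)) \<le> K * exp (- \<alpha> * x) \<and>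
             norm (exp (x *\<^sub>R cmat (Ainf z)) * cmat (\<Pi>ss z)) \<le> K * exp (- \<alpha> * x))"
proof -
  let ?p = "\<lambda>z. cmat (\<Pi>su z)" and ?c = "\<lambda>z. cmat (\<Pi>c z)" and ?q = "\<lambda>z. cmat (\<Pi>ss z)" and ?a = "\<lambda>z. cmat (Ainf z)"
  define Sp where "Sp z = {\<mu>. Re \<mu> > 0} - {muc z}" for z
  define Sq where "Sq z = {\<mu>. Re \<mu> < 0} - {muc z}" for z
  have an: "matrix_analytic_on \<Pi>c {z0}" "matrix_analytic_on \<Pi>ss {z0}" "matrix_analytic_on \<Pi>su {z0}"
    using proj by (auto simp: critical_projections_def)
  have cc: "(?c \<longlongrightarrow> ?c z0) (nhds z0)" and cq: "(?q \<longlongrightarrow> ?q z0) (nhds z0)" and cp: "(?p \<longlongrightarrow> ?p z0) (nhds z0)"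
    by (rule matrix_analytic_on_tendsto an)+
  have spe: "\<forall>\<^sub>F z in nhds z0. spectral_projection (Ainf z) {muc z} (\<Pi>c z) \<and>
      spectral_projection (Ainf z) (Sq z) (\<Pi>ss z) \<and> spectral_projection (Ainf z) (Sp z) (\<Pi>su z)"
    using proj by (simp add: critical_projections_def Sp_def Sq_def)
  have sp0: "spectral_projection (Ainf z0) {muc z0} (\<Pi>c z0)" "spectral_projection (Ainf z0) (Sq z0) (\<Pi>ss z0)"
    "spectral_projection (Ainf z0) (Sp z0) (\<Pi>su z0)"
    using eventually_nhds_x_imp_x[OF spe] by auto
  have mu0: "muc z0 = \<i> * of_real k0" and simple: "simple_eigenvalue (Ainf z0) (muc z0)"
    and others: "\<And>\<mu>. eigenvalue (Ainf z0) \<mu> \<Longrightarrow> \<mu> \<noteq> muc z0 \<Longrightarrow> Re \<mu> \<noteq> 0"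
    and eigs: "\<forall>\<^sub>F z in nhds z0. eigenvalue (Ainf z) (muc z)"
    using arc by (auto simp: isolated_arc_def z0)
  have disj: "Sp z \<inter> {muc z} = {}" "Sp z \<inter> Sq z = {}" "{muc z} \<inter> Sq z = {}" for z by (auto simp: Sp_def Sq_def)
  have orth: "\<forall>\<^sub>F z in nhds z0. ?p z * ?p z = ?p z \<and> ?c z * ?c z = ?c z \<and> ?q z * ?q z = ?q z \<and>
      ?p z * ?c z = 0 \<and> ?c z * ?p z = 0 \<and> ?p z * ?q z = 0 \<and> ?q z * ?p z = 0 \<and> ?c z * ?q z = 0 \<and> ?q z * ?c z = 0 \<and>
      ?a z * ?p z = ?p z * ?a z \<and> ?a z * ?c z = ?c z * ?a z \<and> ?a z * ?q z = ?q z * ?a z"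
    using spe
  proof eventually_elim
    case (elim z)
    have "cmat (Q ** Q) = cmat Q" if "spectral_projection (Ainf z) S Q" for S Q
      using that by (simp add: spectral_projection_def)
    then have id: "cmat Q * cmat Q = cmat Q" if "spectral_projection (Ainf z) S Q" for S Q
      using that by (simp add: cmat_simps)
    have P: "spectral_projection (Ainf z) {muc z} (\<Pi>c z)" "spectral_projection (Ainf z) (Sq z) (\<Pi>ss z)"
      "spectral_projection (Ainf z) (Sp z) (\<Pi>su z)" using elim by auto
    have dj: "{muc z} \<inter> Sp z = {}" "Sq z \<inter> Sp z = {}" "Sq z \<inter> {muc z} = {}" using disj by auto
    show ?case
      by (intro conjI id[OF P(1)] id[OF P(2)] id[OF P(3)] spectral_projection_commute[OF P(1)] spectral_projection_commute[OF P(2)]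
        spectral_projection_commute[OF P(3)] spectral_projection_orthogonal[OF P(3,1) disj(1)]
        spectral_projection_orthogonal[OF P(3,2) disj(2)] spectral_projection_orthogonal[OF P(1,2) disj(3)]
        spectral_projection_orthogonal[OF P(1,3) dj(1)] spectral_projection_orthogonal[OF P(2,3) dj(2)]
        spectral_projection_orthogonal[OF P(2,1) dj(3)])
  qed
  have one0: "?p z0 + ?c z0 + ?q z0 = 1"
  proof (rule complete_spectral_projections[OF sp0(3,1,2) disj])
    fix \<mu> assume "eigenvalue (Ainf z0) \<mu>"
    then show "\<mu> \<in> Sp z0 \<union> {muc z0} \<union> Sq z0" using others[of \<mu>] by (auto simp: Sp_def Sq_def)
  qed
  have "((\<lambda>z. 1 - (?p z + ?c z + ?q z)) \<longlongrightarrow> 1 - (?p z0 + ?c z0 + ?q z0)) (nhds z0)"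
    by (intro tendsto_intros cp cc cq)
  then have "((\<lambda>z. norm (1 - (?p z + ?c z + ?q z))) \<longlongrightarrow> 0) (nhds z0)"
    unfolding one0 by (simp add: tendsto_norm_zero)
  then have e1: "\<forall>\<^sub>F z in nhds z0. norm (1 - (?p z + ?c z + ?q z)) < 1" by (rule order_tendstoD) simp
  have split: "\<forall>\<^sub>F z in nhds z0. splitting (?p z) (?c z) (?q z)"
    using orth e1
  proof eventually_elim
    case (elim z)
    have "(1 - (?p z + ?c z + ?q z)) * (1 - (?p z + ?c z + ?q z)) = 1 - (?p z + ?c z + ?q z)"
      using elim(1) by (simp add: algebra_simps)
    then have "1 - (?p z + ?c z + ?q z) = 0" using elim(2) by (rule norm_idempotent_less_one)
    then have "?p z + ?c z + ?q z = 1" by simp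
    then show ?case using elim(1) by (simp add: splitting_def)
  qed
  obtain v0 where v0: "Ainf z0 *v v0 = muc z0 *s v0" "v0 \<noteq> 0"
    using eventually_nhds_x_imp_x[OF eigs] by (auto simp: eigenvalue_def)
  have c0: "\<exists>x. \<Pi>c z0 *v v = x *s v0" for v
  proof -
    have "\<Pi>c z0 *v v \<in> spectral_subspace (Ainf z0) {muc z0}" using sp0(1) by (auto simp: spectral_projection_def)
    moreover have "spectral_subspace (Ainf z0) {muc z0} \<subseteq> vec.span {v0}"
      unfolding spectral_subspace_def
      by (intro vec.span_minimal vec.subspace_span) (use simple_eigenvalue_gen_eigenspace[OF simple v0] in auto)
    ultimately show ?thesis by (auto simp: vec.span_singleton)
  qed
  have "((\<lambda>z. norm (?c z - ?c z0)) \<longlongrightarrow> 0) (nhds z0)"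
    by (rule tendsto_norm_zero[OF LIM_zero[OF cc]])
  then have c1: "\<forall>\<^sub>F z in nhds z0. norm (?c z - ?c z0) < 1" by (rule order_tendstoD) simp
  have rank: "\<forall>\<^sub>F z in nhds z0. (\<exists>u w. \<forall>i j. ent (?c z) i j = u i * w j) \<and> ?c z \<noteq> 0 \<and> ?a z * ?c z = sc (muc z) * ?c z"
    using spe eigs c1
  proof eventually_elim
    case (elim z)
    have P: "spectral_projection (Ainf z) {muc z} (\<Pi>c z)" using elim by blast
    obtain v where v: "Ainf z *v v = muc z *s v" "v \<noteq> 0" using elim(2) by (auto simp: eigenvalue_def)
    have "act (cmat (Ainf z - mat (muc z))) v = 0" using v by (simp add: cmat_simps act_simps)
    then have "(((*v) (Ainf z - mat (muc z))) ^^ 1) v = 0" by (simp add: act_simps)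
    then have "v \<in> gen_eigenspace (Ainf z) (muc z)" unfolding gen_eigenspace_def by blast
    then have "v \<in> spectral_subspace (Ainf z) {muc z}" using gen_eigenspace_subset[of "muc z" "{muc z}"] by blast
    then have cv: "\<Pi>c z *v v = v" by (rule spectral_projection_fixes[OF P])
    \<comment> \<open>A vector fixed by \<open>\<Pi>c z\<close> and annihilated by
      \<open>\<Pi>c z0\<close> is fixed by their difference, whose norm is below 1.\<close>
    have inj: "w = 0" if w: "\<Pi>c z *v w = w" "\<Pi>c z0 *v w = 0" for w
    proof -
      have "act (?c z - ?c z0) w = w" using w by (simp add: act_simps)
      then have le: "norm w \<le> norm (?c z - ?c z0) * norm w" using norm_act[of "?c z - ?c z0" w] by simp
      show ?thesis
      proof (rule ccontr)
        assume "w \<noteq> 0"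
        then have "norm (?c z - ?c z0) * norm w < 1 * norm w" using elim(3) by (intro mult_strict_right_mono) auto
        then show False using le by simp
      qed
    qed
    obtain y where y: "\<Pi>c z0 *v v = y *s v0" using c0 by blast
    have y0: "y \<noteq> 0" using inj[OF cv] v(2) y by auto
    have line: "\<exists>x. \<Pi>c z *v w = x *s v" for w
    proof -
      define w' where "w' = \<Pi>c z *v w"
      have cw: "\<Pi>c z *v w' = w'" using P by (simp add: w'_def spectral_projection_def matrix_vector_mul_assoc)
      obtain x where x: "\<Pi>c z0 *v w' = x *s v0" using c0 by blast
      have "w' - (x / y) *s v = 0"
      proof (rule inj)
        show "\<Pi>c z *v (w' - (x / y) *s v) = w' - (x / y) *s v"
          by (simp add: matrix_vector_mult_diff_distrib vec.scale cw cv)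
        show "\<Pi>c z0 *v (w' - (x / y) *s v) = 0"
          using y0 by (simp add: matrix_vector_mult_diff_distrib vec.scale x y)
      qed
      then show ?thesis by (auto simp: w'_def)
    qed
    then obtain f where f: "\<And>w. \<Pi>c z *v w = f w *s v" by metis
    have "ent (?c z) i j = v $ i * f (axis j 1)" for i j
    proof -
      have "ent (?c z) i j = act (?c z) (axis j 1) $ i" by (simp add: act_axis)
      also have "act (?c z) (axis j 1) = f (axis j 1) *s v" by (simp add: act_simps f)
      finally show ?thesis by simp
    qed
    then have r: "\<exists>u w. \<forall>i j. ent (?c z) i j = u i * w j" by (intro exI[of _ "\<lambda>i. v $ i"] exI[of _ "\<lambda>j. f (axis j 1)"]) blast
    have "?c z \<noteq> 0"
    proof
      assume "?c z = 0"
      then have "act (?c z) v = 0" by (simp add: act_simps)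
      then show False using cv v(2) by (simp add: act_simps)
    qed
    moreover have "?a z * ?c z = sc (muc z) * ?c z"
    proof (rule cmat_eqI_act)
      fix w show "act (?a z * ?c z) w = act (sc (muc z) * ?c z) w"
        by (simp add: act_simps f vec.scale v(1))
    qed
    ultimately show ?case by (intro conjI r)
  qed
  have decp: "\<exists>\<alpha>>0. \<exists>K>0. \<forall>\<^sub>F z in nhds z0. \<forall>x\<ge>0. norm (exp (x *\<^sub>R ((- 1) *\<^sub>R ?a z)) * ?p z) \<le> K * exp (- \<alpha> * x)"
  proof (rule uniform_spectral_decay[OF _ _ sp0(3) cont cp])
    show "\<forall>\<^sub>F z in nhds z0. ?p z * ?p z = ?p z \<and> ?a z * ?p z = ?p z * ?a z" using orth by eventually_elim blast
  qed (simp_all add: Sp_def)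
  have decq: "\<exists>\<alpha>>0. \<exists>K>0. \<forall>\<^sub>F z in nhds z0. \<forall>x\<ge>0. norm (exp (x *\<^sub>R (1 *\<^sub>R ?a z)) * ?q z) \<le> K * exp (- \<alpha> * x)"
  proof (rule uniform_spectral_decay[OF _ _ sp0(2) cont cq])
    show "\<forall>\<^sub>F z in nhds z0. ?q z * ?q z = ?q z \<and> ?a z * ?q z = ?q z * ?a z" using orth by eventually_elim blast
  qed (simp_all add: Sq_def)
  obtain \<alpha>1 K1 where d1: "\<alpha>1 > 0" "K1 > 0" "\<forall>\<^sub>F z in nhds z0. \<forall>x\<ge>0. norm (exp ((- x) *\<^sub>R ?a z) * ?p z) \<le> K1 * exp (- \<alpha>1 * x)"
    using decp by auto
  obtain \<alpha>2 K2 where d2: "\<alpha>2 > 0" "K2 > 0" "\<forall>\<^sub>F z in nhds z0. \<forall>x\<ge>0. norm (exp (x *\<^sub>R ?a z) * ?q z) \<le> K2 * exp (- \<alpha>2 * x)"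
    using decq by auto
  have nb: "\<forall>\<^sub>F z in nhds z0. norm (f z) < norm (f z0) + 1" if "(f \<longlongrightarrow> f z0) (nhds z0)" for f :: "complex \<Rightarrow> 'n cmat"
    by (rule order_tendstoD(2)[OF tendsto_norm[OF that]]) simp
  define K where "K = K1 + K2 + (norm (?p z0) + 1) + (norm (?c z0) + 1) + (norm (?q z0) + 1) + (norm (?a z0) + 1)"
  have Kge: "K1 \<le> K" "K2 \<le> K" "norm (?p z0) + 1 \<le> K" "norm (?c z0) + 1 \<le> K" "norm (?q z0) + 1 \<le> K" "norm (?a z0) + 1 \<le> K"
    unfolding K_def using d1(2) d2(2) norm_ge_zero[of "?p z0"] norm_ge_zero[of "?c z0"] norm_ge_zero[of "?q z0"] norm_ge_zero[of "?a z0"]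
    by linarith+
  have main: "\<forall>\<^sub>F z in nhds z0.
      splitting (?p z) (?c z) (?q z) \<and> ?a z * ?p z = ?p z * ?a z \<and> ?a z * ?c z = sc (muc z) * ?c z \<and>
      ?a z * ?c z = ?c z * ?a z \<and> ?a z * ?q z = ?q z * ?a z \<and>
      (\<exists>u w. \<forall>i j. ent (?c z) i j = u i * w j) \<and> ?c z \<noteq> 0 \<and>
      norm (?p z) \<le> K \<and> norm (?c z) \<le> K \<and> norm (?q z) \<le> K \<and> norm (?a z) \<le> K \<and>
      (\<forall>x\<ge>0. norm (exp ((- x) *\<^sub>R ?a z) * ?p z) \<le> K * exp (- min \<alpha>1 \<alpha>2 * x) \<and>
             norm (exp (x *\<^sub>R ?a z) * ?q z) \<le> K * exp (- min \<alpha>1 \<alpha>2 * x))"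
    using split orth rank nb[OF cp] nb[OF cc] nb[OF cq] nb[OF cont] d1(3) d2(3)
  proof eventually_elim
    case (elim z)
    have "norm (exp ((- x) *\<^sub>R ?a z) * ?p z) \<le> K * exp (- min \<alpha>1 \<alpha>2 * x) \<and>
             norm (exp (x *\<^sub>R ?a z) * ?q z) \<le> K * exp (- min \<alpha>1 \<alpha>2 * x)" if x: "x \<ge> 0" for x
    proof -
      have "K1 * exp (- \<alpha>1 * x) \<le> K * exp (- min \<alpha>1 \<alpha>2 * x)" "K2 * exp (- \<alpha>2 * x) \<le> K * exp (- min \<alpha>1 \<alpha>2 * x)"
        using Kge d1(2) d2(2) x by (auto intro!: mult_mono mult_right_mono)
      then show ?thesis using elim(8,9) x by (meson order_trans)
    qed
    moreover have "norm (?p z) \<le> K" "norm (?c z) \<le> K" "norm (?q z) \<le> K" "norm (?a z) \<le> K"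
      using elim(4-7) Kge by linarith+
    moreover have "?a z * ?p z = ?p z * ?a z" "?a z * ?c z = ?c z * ?a z" "?a z * ?q z = ?q z * ?a z" using elim(2) by blast+
    moreover have "\<exists>u w. \<forall>i j. ent (?c z) i j = u i * w j" "?c z \<noteq> 0" "?a z * ?c z = sc (muc z) * ?c z"
      using elim(3) by blast+
    ultimately show ?case using elim(1) by (intro conjI allI impI) simp_all
  qed
  have pos: "min \<alpha>1 \<alpha>2 > 0" "K > 0" using d1(1,2) d2(1) Kge(1) by auto
  show ?thesis by (rule exI[of _ "min \<alpha>1 \<alpha>2"], intro conjI pos, rule exI[of _ K], intro conjI pos, rule main)
qed

section \<open>Reduction of the periodic determinant\<close>

text \<open>After multiplication by \<open>Pm\<close> on the right the critical direction enters
  only through the rank one factor \<open>c\<close>, so \<open>cdet_rank_one_linear\<close>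
  separates the contributions of \<open>gp\<close> and \<open>gm\<close>. Their coefficients become
  the two Evans determinants once \<open>cdet_one_plus_commute\<close> moves the projections from
  the left to the right of \<open>Ip * Pm\<close>.\<close>

lemma limiting_determinant:
  fixes p c q Pp Pm Ip Im :: "'n::finite cmat"
  assumes sp: "splitting p c q" and inv: "Ip * Pp = 1" "Pp * Ip = 1" "Im * Pm = 1"
    and rank: "\<And>i j. ent c i j = u i * w j" "c \<noteq> 0"
  shows "cdet ((p + sc gp * c) * Ip - sc \<gamma> * (q + sc gm * c) * Im) * cdet Pp * cdet Pm =
    cdet (p + c - sc \<gamma> * q) * (gp * cdet (Pm * (p + c) + Pp * q) - \<gamma> * gm * cdet (Pm * p + Pp * (c + q)))"
proof -
  have P: "p * p = p" "c * c = c" "q * q = q" "p * c = 0" "c * p = 0" "p * q = 0" "q * p = 0" "c * q = 0" "q * c = 0"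
    and one: "p + c + q = 1" using sp by (auto simp: splitting_def)
  note PA = P P[THEN mult_rewrite_assoc]
  have scq: "x * (sc z * y) = sc z * (x * y)" for x y :: "'n cmat" and z
    using sc_commute[of z x] by (simp flip: mult.assoc)
  define R where "R = Ip * Pm"
  define K where "K = p * R - sc \<gamma> * q"
  \<comment> \<open>\<open>S\<close> is the identity on the ranges of \<open>p\<close> and
    \<open>c\<close> and \<open>- \<gamma>\<close> on that of \<open>q\<close>. Taking it out on the
    left leaves matrices in which \<open>\<gamma>\<close> no longer occurs.\<close>
  define S where "S = p + c - sc \<gamma> * q"
  have cK: "c * K = 0" by (simp add: K_def right_diff_distrib scq[of c] PA)
  have q: "q = 1 - (p + c)" and cq: "c + q = 1 - p" using one by (auto simp: algebra_simps)
  have "((p + sc gp * c) * Ip - sc \<gamma> * (q + sc gm * c) * Im) * Pm =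
      (p + sc gp * c) * (Ip * Pm) - sc \<gamma> * (q + sc gm * c) * (Im * Pm)"
    by (simp only: left_diff_distrib mult.assoc)
  also have "\<dots> = K + c * (sc gp * R + sc (- (\<gamma> * gm)) * 1)"
  proof -
    have c2: "c * sc (- (\<gamma> * gm)) = - (sc \<gamma> * (sc gm * c))"
      unfolding sc_commute[symmetric] by (rule cmat_eqI) simp
    have c1: "c * (sc gp * R) = sc gp * c * R" unfolding scq by (simp only: mult.assoc)
    show ?thesis unfolding inv R_def[symmetric] K_def distrib_left[of c] mult_1_right c1 c2
      by (simp add: distrib_right distrib_left)
  qed
  finally have e: "((p + sc gp * c) * Ip - sc \<gamma> * (q + sc gm * c) * Im) * Pm = K + c * (sc gp * R + sc (- (\<gamma> * gm)) * 1)" .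
  have Sp: "S * p = p" "S * c = c" "S * q = - (sc \<gamma> * q)"
    by (simp_all add: S_def distrib_right left_diff_distrib mult.assoc P)
  have f1: "K + c * R = S * ((p + c) * R + q)"
  proof -
    have "S * ((p + c) * R + q) = (S * p) * R + (S * c) * R + S * q" by (simp only: distrib_left distrib_right mult.assoc)
    then show ?thesis unfolding Sp by (simp add: K_def)
  qed
  have f2: "K + c * 1 = S * (p * R + (c + q))"
  proof -
    have "S * (p * R + (c + q)) = (S * p) * R + (S * c + S * q)" by (simp only: distrib_left distrib_right mult.assoc)
    then show ?thesis unfolding Sp by (simp add: K_def)
  qed
  have s1: "cdet ((p + c) * R + q) * cdet Pp = cdet (Pm * (p + c) + Pp * q)"
  proof -
    have "cdet ((p + c) * R + q) = cdet (1 + (p + c) * (R - 1))" unfolding q by (simp add: algebra_simps)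
    also have "\<dots> = cdet (1 + (R - 1) * (p + c))" by (rule cdet_one_plus_commute)
    also have "1 + (R - 1) * (p + c) = R * (p + c) + q" unfolding q by (simp add: algebra_simps)
    finally have "cdet ((p + c) * R + q) * cdet Pp = cdet (Pp * (R * (p + c) + q))" by (simp add: cdet_simps)
    also have "Pp * (R * (p + c) + q) = (Pp * Ip) * Pm * (p + c) + Pp * q"
      by (simp only: R_def distrib_left[of Pp] mult.assoc)
    finally show ?thesis unfolding inv by simp
  qed
  have s2: "cdet (p * R + (c + q)) * cdet Pp = cdet (Pm * p + Pp * (c + q))"
  proof -
    have "cdet (p * R + (c + q)) = cdet (1 + p * (R - 1))" unfolding cq by (simp add: algebra_simps)
    also have "\<dots> = cdet (1 + (R - 1) * p)" by (rule cdet_one_plus_commute)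
    also have "1 + (R - 1) * p = R * p + (c + q)" unfolding cq by (simp add: algebra_simps)
    finally have "cdet (p * R + (c + q)) * cdet Pp = cdet (Pp * (R * p + (c + q)))" by (simp add: cdet_simps)
    also have "Pp * (R * p + (c + q)) = (Pp * Ip) * Pm * p + Pp * (c + q)"
      by (simp only: R_def distrib_left[of Pp] mult.assoc)
    finally show ?thesis unfolding inv by simp
  qed
  have "cdet ((p + sc gp * c) * Ip - sc \<gamma> * (q + sc gm * c) * Im) * cdet Pm = cdet (K + c * (sc gp * R + sc (- (\<gamma> * gm)) * 1))"
    unfolding e[symmetric] cdet_simps ..
  also have "\<dots> = gp * cdet (K + c * R) + - (\<gamma> * gm) * cdet (K + c * 1)"
    by (rule cdet_rank_one_linear[OF rank cK])
  also have "\<dots> = cdet S * (gp * cdet ((p + c) * R + q) - \<gamma> * gm * cdet (p * R + (c + q)))"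
    unfolding f1 f2 cdet_simps by (simp add: algebra_simps)
  finally have "cdet ((p + sc gp * c) * Ip - sc \<gamma> * (q + sc gm * c) * Im) * cdet Pm * cdet Pp =
      cdet S * (gp * cdet ((p + c) * R + q) - \<gamma> * gm * cdet (p * R + (c + q))) * cdet Pp" by simp
  also have "\<dots> = cdet S * (gp * (cdet ((p + c) * R + q) * cdet Pp) - \<gamma> * gm * (cdet (p * R + (c + q)) * cdet Pp))"
    by (simp add: algebra_simps)
  finally have "cdet ((p + sc gp * c) * Ip - sc \<gamma> * (q + sc gm * c) * Im) * cdet Pm * cdet Pp =
      cdet S * (gp * (cdet ((p + c) * R + q) * cdet Pp) - \<gamma> * gm * (cdet (p * R + (c + q)) * cdet Pp))" .
  then show ?thesis unfolding s1 s2 S_def by (simp only: mult_ac)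
qed

context growth_scale
begin

lemma small_divide_one:
  fixes f g :: "'t \<Rightarrow> complex"
  assumes f: "small (\<lambda>t. f t - 1)" and g: "small (\<lambda>t. g t - 1)"
  shows "small (\<lambda>t. f t / g t - 1)" "\<forall>\<^sub>F t in F. g t \<noteq> 0"
proof -
  have "\<forall>\<^sub>F t in F. norm (g t - 1) < 1/2" by (rule small_eventually_less[OF g]) simp
  then have ge: "\<forall>\<^sub>F t in F. norm (g t) \<ge> 1/2"
  proof eventually_elim
    case (elim t)
    have "norm (1::complex) \<le> norm (g t) + norm (g t - 1)" by norm
    then show ?case using elim by simp
  qed
  then show "\<forall>\<^sub>F t in F. g t \<noteq> 0" by eventually_elim auto
  have d: "small (\<lambda>t. (f t - 1) - (g t - 1))" by (rule small_diff[OF f g])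
  show "small (\<lambda>t. f t / g t - 1)"
  proof (rule small_mult_norm[OF _ d])
    show "subexp (\<lambda>t. 2::real)" by simp
    show "\<forall>\<^sub>F t in F. norm (f t / g t - 1) \<le> norm (2::real) * norm ((f t - 1) - (g t - 1))"
      using ge
    proof eventually_elim
      case (elim t)
      then have g0: "g t \<noteq> 0" by auto
      have "f t / g t - 1 = (f t - g t) / g t" using g0 by (simp add: field_simps)
      then have "norm (f t / g t - 1) = norm (f t - g t) / norm (g t)" by (simp add: norm_divide)
      also have "\<dots> \<le> norm (f t - g t) / (1/2)" using elim by (intro divide_left_mono) (auto intro: mult_pos_pos)
      finally show ?case by simp
    qed
  qed
qed

lemma small_cdet_near_one:
  fixes e :: "'t \<Rightarrow> 'n::finite cmat"
  assumes "small e" shows "small (\<lambda>t. cdet (1 + e t) - 1)"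
  using small_cdet_diff[of "\<lambda>t. 1" "\<lambda>t. 1 + e t"] assms by (simp add: cdet_simps)

text \<open>The growing block is \<open>p\<close> on the forward half period and \<open>q\<close> on
  the backward one. Both are collected in a common left factor \<open>(1 + e) * D\<close>; what
  remains is \<open>N\<close>, which is subexponential and close to the limit \<open>N0\<close>. The
  two normalizing determinants have the product \<open>cdet D\<close> up to a factor near 1. They
  are formed from \<open>Up\<close> and \<open>Um\<close> directly because analyticity in the
  spectral parameter can then be verified, whereas \<open>D\<close> rests on arbitrary
  choices.\<close>

lemma reduced_determinant:
  fixes p c q Up Um Ip Im :: "'t \<Rightarrow> 'n::finite cmat" and gp gm \<gamma> :: "'t \<Rightarrow> complex"
  assumes sp: "\<forall>\<^sub>F t in F. splitting (p t) (c t) (q t)"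
    and sub: "subexp p" "subexp c" "subexp q" "subexp Ip" "subexp Im" "subexp gp" "subexp gm"
    and \<gamma>: "\<forall>\<^sub>F t in F. norm (\<gamma> t) = 1"
    and fp: "factored p c q Up (\<lambda>t. sc (gp t) * c t) lp Dp Dp1 Dp2 up" "small (\<lambda>t. Dp t * q t)"
    and fm: "factored q c p Um (\<lambda>t. sc (gm t) * c t) lm Dm Dm1 Dm2 um" "small (\<lambda>t. Dm t * p t)"
  shows "\<forall>\<^sub>F t in F. cdet (p t * Up t * p t + 1 - p t) \<noteq> 0 \<and> cdet (q t * Um t * q t + 1 - q t) \<noteq> 0"
    and "small (\<lambda>t. cdet (Up t * Ip t - sc (\<gamma> t) * Um t * Im t) /
           (cdet (p t * Up t * p t + 1 - p t) * cdet (q t * Um t * q t + 1 - q t)) -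
         cdet ((p t + sc (gp t) * c t) * Ip t - sc (\<gamma> t) * (q t + sc (gm t) * c t) * Im t))"
proof -
  have ep: "\<forall>\<^sub>F t in F. Up t = (1 + lp t) * Dp t * (1 + up t) \<and> up t * p t = 0 \<and>
      Dp t * p t = p t * Dp t \<and> Dp t * c t = c t * Dp t \<and> Dp t * q t = q t * Dp t \<and>
      Dp1 t * Dp t = p t \<and> Dp t * Dp1 t = p t \<and> p t * Dp1 t = Dp1 t \<and> Dp1 t * p t = Dp1 t"
    using fp(1) unfolding factored_def by (auto elim: eventually_mono)
  have em: "\<forall>\<^sub>F t in F. Um t = (1 + lm t) * Dm t * (1 + um t) \<and> um t * q t = 0 \<and>
      Dm t * q t = q t * Dm t \<and> Dm t * c t = c t * Dm t \<and> Dm t * p t = p t * Dm t \<and>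
      Dm1 t * Dm t = q t \<and> Dm t * Dm1 t = q t \<and> q t * Dm1 t = Dm1 t \<and> Dm1 t * q t = Dm1 t"
    using fm(1) unfolding factored_def by (auto elim: eventually_mono)
  have s: "small lp" "small up" "subexp Dp1" "small (\<lambda>t. Dp t * c t - sc (gp t) * c t)"
    "small lm" "small um" "subexp Dm1" "small (\<lambda>t. Dm t * c t - sc (gm t) * c t)"
    using fp(1) fm(1) unfolding factored_def by blast+
  have sc_sub: "subexp (\<lambda>t. sc (f t) :: 'n cmat)" if "subexp f" for f :: "'t \<Rightarrow> complex"
    by (rule subexp_mono[OF that[unfolded subexp_norm[symmetric, of f]]]) simp
  have g\<gamma>: "subexp (\<lambda>t. sc (\<gamma> t) :: 'n cmat)"
    by (rule subexp_bounded[of _ 1]) (use \<gamma> in eventually_elim, simp)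
  \<comment> \<open>\<open>1 + e\<close> agrees with \<open>1 + lp\<close> on the range of
    \<open>p\<close> and with \<open>1 + lm\<close> on that of \<open>q\<close>, so one left factor
    serves both half periods.\<close>
  define e where "e t = lp t * p t + lm t * q t" for t
  have e: "small e" unfolding e_def by (intro small_add small_mult_right s sub)
  define Hi where "Hi t = ninv (e t)" for t
  have Hi: "small (\<lambda>t. Hi t - 1)" unfolding Hi_def by (rule small_ninv[OF e])
  have His: "subexp Hi" unfolding Hi_def by (rule subexp_ninv[OF e])
  \<comment> \<open>\<open>D\<close> contains the growing blocks of both half periods and the
    identity on \<open>c\<close>. Its inverse \<open>Di\<close> uses only the partial inverses on
    those growing blocks and is therefore subexponential.\<close>
  define D where "D t = Dp t * p t + c t + Dm t * q t" for t
  define Di where "Di t = Dp1 t + c t + Dm1 t" for t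
  have Dis: "subexp Di" unfolding Di_def by (intro subexp_add s sub)
  define Qp where "Qp t = (1 + up t) * Ip t" for t
  define Qm where "Qm t = (1 + um t) * Im t" for t
  have Qs: "small (\<lambda>t. Qp t - Ip t)" "small (\<lambda>t. Qm t - Im t)"
    unfolding Qp_def Qm_def using small_mult_right[OF s(2) sub(4)] small_mult_right[OF s(6) sub(5)]
    by (simp_all add: distrib_right)
  have Qsub: "subexp Qp" "subexp Qm"
    using subexp_add[OF small_imp_subexp[OF Qs(1)] sub(4)] subexp_add[OF small_imp_subexp[OF Qs(2)] sub(5)] by simp_all
  define M where "M t = Up t * Ip t - sc (\<gamma> t) * Um t * Im t" for t
  define W0 where "W0 t = sc (gp t) * c t * Ip t - sc (\<gamma> t) * (sc (gm t) * c t * Im t)" for t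
  define W where "W t = (1 + lp t) * (Dp t * c t + Dp t * q t) * Qp t - sc (\<gamma> t) * ((1 + lm t) * (Dm t * c t + Dm t * p t) * Qm t)" for t
  define N0 where "N0 t = p t * Ip t - sc (\<gamma> t) * (q t * Im t) + W0 t" for t
  define N where "N t = p t * Qp t - sc (\<gamma> t) * (q t * Qm t) + Di t * (Hi t * W t)" for t
  have W0s: "subexp W0" unfolding W0_def by (intro subexp_diff subexp_mult sc_sub sub g\<gamma>)
  have part: "small (\<lambda>t. (1 + l t) * (X t + Y t) * Q t - Z t * I t)"
    if "small l" "small (\<lambda>t. X t - Z t)" "small Y" "small (\<lambda>t. Q t - I t)" "subexp Z" "subexp I" for l X Y Q Z I :: "'t \<Rightarrow> 'n cmat"
  proof -
    have XY: "small (\<lambda>t. (X t - Z t) + Y t)" by (intro small_add that)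
    have Q: "subexp Q" using subexp_add[OF small_imp_subexp[OF that(4)] that(6)] by simp
    have V: "subexp (\<lambda>t. X t + Y t)" using subexp_add[OF small_imp_subexp[OF XY] that(5)] by (simp add: algebra_simps)
    have "small (\<lambda>t. l t * (X t + Y t) * Q t + ((X t - Z t) + Y t) * Q t + Z t * (Q t - I t))"
      by (intro small_add small_mult_right[OF small_mult_right] small_mult_right[OF XY] small_mult_left that V Q)
    moreover have "l t * (X t + Y t) * Q t + ((X t - Z t) + Y t) * Q t + Z t * (Q t - I t) =
        (1 + l t) * (X t + Y t) * Q t - Z t * I t" for t by (simp add: algebra_simps)
    ultimately show ?thesis by simp
  qed
  have WW: "small (\<lambda>t. W t - W0 t)"
  proof -
    have "small (\<lambda>t. ((1 + lp t) * (Dp t * c t + Dp t * q t) * Qp t - sc (gp t) * c t * Ip t) -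
        sc (\<gamma> t) * ((1 + lm t) * (Dm t * c t + Dm t * p t) * Qm t - sc (gm t) * c t * Im t))"
      by (intro small_diff small_mult_left[OF g\<gamma>] part s fp(2) fm(2) Qs sub subexp_mult sc_sub)
    then show ?thesis unfolding W_def W0_def by (simp add: algebra_simps)
  qed
  have Ws: "subexp W" using subexp_add[OF small_imp_subexp[OF WW] W0s] by simp
  have NN: "small (\<lambda>t. N t - N0 t)"
  proof (rule small_cong)
    show "small (\<lambda>t. p t * (Qp t - Ip t) - sc (\<gamma> t) * (q t * (Qm t - Im t)) + Di t * ((Hi t - 1) * W t + (W t - W0 t)))"
      by (intro small_add small_diff small_mult_left sub g\<gamma> Qs Dis small_mult_right[OF Hi Ws] WW)
    show "\<forall>\<^sub>F t in F. N t - N0 t = p t * (Qp t - Ip t) - sc (\<gamma> t) * (q t * (Qm t - Im t)) + Di t * ((Hi t - 1) * W t + (W t - W0 t))"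
      using sp ep em
    proof eventually_elim
      case (elim t)
      have P: "c t * c t = c t" "p t * c t = 0" "q t * c t = 0" using elim(1) by (auto simp: splitting_def)
      have "Dp1 t * c t = (Dp1 t * p t) * c t" "Dm1 t * c t = (Dm1 t * q t) * c t" using elim by simp_all
      then have z: "Dp1 t * c t = 0" "Dm1 t * c t = 0" by (simp_all add: mult.assoc P)
      have Dc: "Di t * c t = c t" by (simp add: Di_def distrib_right z P)
      have cW: "W0 t = c t * W0 t"
      proof -
        have "c t * (sc z * (c t * x)) = sc z * (c t * x)" for z x
        proof -
          have "c t * (sc z * (c t * x)) = (c t * sc z) * (c t * x)" by (simp only: mult.assoc)
          also have "\<dots> = sc z * (c t * c t) * x" by (simp only: sc_commute[symmetric] mult.assoc)
          finally show ?thesis by (simp only: P mult.assoc)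
        qed
        note k = this
        have "c t * (sc z * (sc y * (c t * x))) = sc z * (sc y * (c t * x))" for z y x
          using k[of "z * y" x] by (simp add: sc_simps mult.assoc)
        with k show ?thesis unfolding W0_def by (simp add: right_diff_distrib mult.assoc)
      qed
      have "Di t * W0 t = (Di t * c t) * W0 t" by (subst cW) (simp only: mult.assoc)
      then have "Di t * W0 t = W0 t" unfolding Dc using cW by simp
      then show ?case unfolding N_def N0_def by (simp add: algebra_simps)
    qed
  qed
  have N0s: "subexp N0" unfolding N0_def by (intro subexp_add subexp_diff subexp_mult sub g\<gamma> W0s)
  have Ns: "subexp N" using subexp_add[OF small_imp_subexp[OF NN] N0s] by simp
  have en: "\<forall>\<^sub>F t in F. norm (e t) < 1" by (rule small_eventually_less[OF e]) simp
  define k1 where "k1 t = cdet (1 + e t)" for t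
  define k2 where "k2 t = cdet (1 + p t * lp t * p t) * cdet (1 + q t * lm t * q t)" for t
  define hp where "hp t = cdet (p t * Up t * p t + 1 - p t)" for t
  define hm where "hm t = cdet (q t * Um t * q t + 1 - q t)" for t
  have k1: "small (\<lambda>t. k1 t - 1)" unfolding k1_def by (rule small_cdet_near_one[OF e])
  have k2: "small (\<lambda>t. k2 t - 1)"
  proof -
    define a where "a t = cdet (1 + p t * lp t * p t)" for t
    define b where "b t = cdet (1 + q t * lm t * q t)" for t
    have a: "small (\<lambda>t. a t - 1)" and b: "small (\<lambda>t. b t - 1)"
      unfolding a_def b_def by (intro small_cdet_near_one small_mult_right small_mult_left s sub)+
    have bs: "subexp b" using subexp_add[OF small_imp_subexp[OF b], of "\<lambda>t. 1"] by simp
    have "small (\<lambda>t. (a t - 1) * b t + (b t - 1))" by (intro small_add small_mult_right a b bs)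
    then show ?thesis by (simp add: k2_def a_def b_def algebra_simps)
  qed
  have det: "\<forall>\<^sub>F t in F. hp t * hm t \<noteq> 0 \<and> cdet (M t) / (hp t * hm t) = k1 t / k2 t * cdet (N t)"
    using sp ep em en small_divide_one(2)[OF k1 k2]
  proof eventually_elim
    case (elim t)
    have P: "p t * p t = p t" "c t * c t = c t" "q t * q t = q t" "p t * c t = 0" "c t * p t = 0"
      "p t * q t = 0" "q t * p t = 0" "c t * q t = 0" "q t * c t = 0" and one: "p t + c t + q t = 1"
      using elim(1) by (auto simp: splitting_def)
    note PA = P P[THEN mult_rewrite_assoc]
    have Up: "Up t = (1 + lp t) * Dp t * (1 + up t)" "up t * p t = 0" and Dpc: "Dp t * p t = p t * Dp t"
      and Dp1: "Dp1 t * Dp t = p t" "Dp t * Dp1 t = p t" "p t * Dp1 t = Dp1 t" "Dp1 t * p t = Dp1 t"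
      using elim(2) by auto
    have Um: "Um t = (1 + lm t) * Dm t * (1 + um t)" "um t * q t = 0" and Dmc: "Dm t * q t = q t * Dm t"
      and Dm1: "Dm1 t * Dm t = q t" "Dm t * Dm1 t = q t" "q t * Dm1 t = Dm1 t" "Dm1 t * q t = Dm1 t"
      using elim(3) by auto
    \<comment> \<open>Because \<open>u * r = 0\<close>, compressing \<open>U\<close> to the range of
      \<open>r\<close> leaves only \<open>d\<close> and the near-identity factor
      \<open>1 + r * l * r\<close>.\<close>
    have block: "cdet (r * U * r + 1 - r) = cdet (1 + r * l * r) * cdet (d * r + 1 - r) \<and> cdet (d * r + 1 - r) \<noteq> 0"
      if "r * r = r" "U = (1 + l) * d * (1 + u)" "u * r = 0" "d * r = r * d" "d * d1 = r" "r * d1 = d1" for r U l d u d1 :: "'n cmat"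
    proof -
      note rA = that(1) that(1)[THEN mult_rewrite_assoc]
      have "U * r = (1 + l) * d * r" unfolding that(2) by (simp add: distrib_right mult.assoc that(3))
      then have "r * U * r = r * ((1 + l) * (r * d))" unfolding mult.assoc that(4)[symmetric] by simp
      also have "\<dots> = d * r + r * l * r * d" by (simp add: distrib_left distrib_right rA mult.assoc that(4))
      finally have "r * U * r + 1 - r = (1 + r * l * r) * (d * r + 1 - r)"
        by (simp add: algebra_simps rA that(4))
      moreover have "(d * r + 1 - r) * (d1 + 1 - r) = 1"
      proof -
        have "d * (r * d1) = r" using that(5,6) by simp
        then show ?thesis by (simp add: algebra_simps rA that(6))
      qed
      then have "cdet (d * r + 1 - r) * cdet (d1 + 1 - r) = 1" by (metis cdet_simps)
      ultimately show ?thesis by (auto simp: cdet_simps)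
    qed
    have bp: "hp t = cdet (1 + p t * lp t * p t) * cdet (Dp t * p t + 1 - p t)" "cdet (Dp t * p t + 1 - p t) \<noteq> 0"
      unfolding hp_def using block[OF P(1) Up Dpc Dp1(2,3)] by auto
    have bm: "hm t = cdet (1 + q t * lm t * q t) * cdet (Dm t * q t + 1 - q t)" "cdet (Dm t * q t + 1 - q t) \<noteq> 0"
      unfolding hm_def using block[OF P(3) Um Dmc Dm1(2,3)] by auto
    have Dfac: "D t = (Dp t * p t + 1 - p t) * (Dm t * q t + 1 - q t)"
    proof -
      have c: "c t = 1 - p t - q t" unfolding one[symmetric] by simp
      have pDm: "p t * (Dm t * q t) = 0" unfolding Dmc by (simp add: PA)
      show ?thesis unfolding D_def c by (simp add: algebra_simps pDm PA)
    qed
    have DDi: "D t * Di t = 1"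
    proof -
      have "p t * Dm1 t = p t * (q t * Dm1 t)" "c t * Dm1 t = c t * (q t * Dm1 t)"
        "q t * Dp1 t = q t * (p t * Dp1 t)" "c t * Dp1 t = c t * (p t * Dp1 t)" by (simp_all only: Dm1 Dp1)
      then have z: "p t * Dm1 t = 0" "c t * Dm1 t = 0" "q t * Dp1 t = 0" "c t * Dp1 t = 0" by (simp_all add: PA)
      have "D t * Di t = Dp t * (p t * Dp1 t) + c t + Dm t * (q t * Dm1 t)"
        by (simp add: D_def Di_def algebra_simps z PA)
      then show ?thesis by (simp add: Dp1 Dm1 one)
    qed
    have HHi: "(1 + e t) * Hi t = 1" unfolding Hi_def by (rule ninv_right[OF elim(4)])
    have MN: "M t = (1 + e t) * D t * N t"
    proof -
      have ep': "(1 + e t) * p t = (1 + lp t) * p t" "(1 + e t) * q t = (1 + lm t) * q t"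
        by (simp_all add: e_def algebra_simps PA)
      have Dp': "D t * p t = p t * Dp t" "D t * q t = q t * Dm t"
        unfolding Dpc[symmetric] Dmc[symmetric] by (simp_all add: D_def distrib_right mult.assoc PA)
      have A: "(1 + e t) * D t * (p t * x) = (1 + lp t) * (Dp t * p t) * x" for x
      proof -
        have "(1 + e t) * D t * (p t * x) = (1 + e t) * (D t * p t) * x" by (simp only: mult.assoc)
        also have "\<dots> = ((1 + e t) * p t) * Dp t * x" unfolding Dp' by (simp only: mult.assoc)
        finally show ?thesis unfolding ep' by (simp only: mult.assoc Dpc)
      qed
      have B: "(1 + e t) * D t * (q t * x) = (1 + lm t) * (Dm t * q t) * x" for x
      proof -
        have "(1 + e t) * D t * (q t * x) = (1 + e t) * (D t * q t) * x" by (simp only: mult.assoc)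
        also have "\<dots> = ((1 + e t) * q t) * Dm t * x" unfolding Dp' by (simp only: mult.assoc)
        finally show ?thesis unfolding ep' by (simp only: mult.assoc Dmc)
      qed
      have C: "(1 + e t) * D t * (Di t * (Hi t * x)) = x" for x
      proof -
        have "(1 + e t) * D t * (Di t * (Hi t * x)) = (1 + e t) * (D t * Di t) * Hi t * x" by (simp only: mult.assoc)
        then show ?thesis unfolding DDi using HHi by simp
      qed
      have Dsum: "Dp t = Dp t * p t + Dp t * c t + Dp t * q t" "Dm t = Dm t * p t + Dm t * c t + Dm t * q t"
        by (simp_all only: distrib_left[symmetric] one mult_1_right)
      have "(1 + e t) * D t * N t = (1 + e t) * D t * (p t * Qp t) - (1 + e t) * D t * (sc (\<gamma> t) * (q t * Qm t)) + (1 + e t) * D t * (Di t * (Hi t * W t))"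
        unfolding N_def by (simp only: distrib_left right_diff_distrib)
      also have "(1 + e t) * D t * (sc (\<gamma> t) * (q t * Qm t)) = sc (\<gamma> t) * ((1 + e t) * D t * (q t * Qm t))"
        using sc_commute[of "\<gamma> t" "(1 + e t) * D t"] by (simp flip: mult.assoc)
      also have "(1 + e t) * D t * (p t * Qp t) - sc (\<gamma> t) * ((1 + e t) * D t * (q t * Qm t)) + (1 + e t) * D t * (Di t * (Hi t * W t)) =
          (1 + lp t) * (Dp t * p t + Dp t * c t + Dp t * q t) * Qp t - sc (\<gamma> t) * ((1 + lm t) * (Dm t * p t + Dm t * c t + Dm t * q t) * Qm t)"
        unfolding A B C W_def by (simp add: algebra_simps)
      also have "\<dots> = (1 + lp t) * Dp t * Qp t - sc (\<gamma> t) * ((1 + lm t) * Dm t * Qm t)" by (simp only: Dsum[symmetric])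
      also have "\<dots> = M t" unfolding M_def Up(1) Um(1) Qp_def Qm_def by (simp only: mult.assoc)
      finally show ?thesis by simp
    qed
    have k20: "k2 t \<noteq> 0" by (rule elim(5))
    have hh: "hp t * hm t = k2 t * cdet (D t)" unfolding bp(1) bm(1) Dfac k2_def cdet_simps by (simp only: mult_ac)
    have D0: "cdet (D t) \<noteq> 0" unfolding Dfac cdet_simps using bp(2) bm(2) by simp
    have "cdet (M t) = k1 t * cdet (D t) * cdet (N t)" unfolding MN cdet_simps k1_def ..
    then show ?case using hh D0 k20 by (simp add: field_simps)
  qed
  show "\<forall>\<^sub>F t in F. cdet (p t * Up t * p t + 1 - p t) \<noteq> 0 \<and> cdet (q t * Um t * q t + 1 - q t) \<noteq> 0"
    using det unfolding hp_def[symmetric] hm_def[symmetric] by eventually_elim simp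
  have N0eq: "N0 t = (p t + sc (gp t) * c t) * Ip t - sc (\<gamma> t) * (q t + sc (gm t) * c t) * Im t" for t
    by (simp add: N0_def W0_def algebra_simps)
  have "small (\<lambda>t. (k1 t / k2 t - 1) * cdet (N t) + (cdet (N t) - cdet (N0 t)))"
    by (intro small_add small_mult_right small_divide_one(1)[OF k1 k2] subexp_cdet Ns small_cdet_diff[OF N0s NN])
  then have "small (\<lambda>t. cdet (M t) / (hp t * hm t) - cdet (N0 t))"
    by (rule small_cong) (use det in eventually_elim, simp add: algebra_simps)
  then show "small (\<lambda>t. cdet (Up t * Ip t - sc (\<gamma> t) * Um t * Im t) /
           (cdet (p t * Up t * p t + 1 - p t) * cdet (q t * Um t * q t + 1 - q t)) -
         cdet ((p t + sc (gp t) * c t) * Ip t - sc (\<gamma> t) * (q t + sc (gm t) * c t) * Im t))"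
    unfolding M_def hp_def hm_def N0eq .
qed

end

section \<open>Homoclinic Evans functions as determinants\<close>

text \<open>\<open>Y\<inverse> * Z\<close> has derivative zero, so it keeps its initial value
  \<open>Z 0\<close>.\<close>

lemma solution_quotient:
  fixes Y Z :: "real \<Rightarrow> 'a::{real_normed_algebra_1,banach}"
  assumes "b \<ge> 0" and Y: "\<And>x. x \<in> {0..b} \<Longrightarrow> (Y has_vector_derivative T x * Y x) (at x within {0..b})"
    and Z: "\<And>x. x \<in> {0..b} \<Longrightarrow> (Z has_vector_derivative T x * Z x) (at x within {0..b})"
    and Y0: "Y 0 = 1" and inv: "\<And>x. x \<in> {0..b} \<Longrightarrow> has_inverse (Y x)"
  shows "Z b = Y b * Z 0"
proof -
  have "\<exists>\<Phi>. \<forall>x\<in>{0..b}. \<Phi> x * Y x = 1 \<and> Y x * \<Phi> x = 1" using inv unfolding has_inverse_def by metis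
  then obtain \<Phi> where \<Phi>: "\<And>x. x \<in> {0..b} \<Longrightarrow> \<Phi> x * Y x = 1" "\<And>x. x \<in> {0..b} \<Longrightarrow> Y x * \<Phi> x = 1" by metis
  have mem: "b \<in> {0..b}" "0 \<in> {0..b}" using assms(1) by auto
  have "norm (\<Phi> b * Z b - \<Phi> 0 * Z 0) \<le> 0 * \<bar>b - 0\<bar>"
  proof (rule vector_derivative_bound[where S = "{0..b}" and f = "\<lambda>x. \<Phi> x * Z x" and f' = "\<lambda>x. 0"])
    fix x assume x: "x \<in> {0..b}"
    have "((\<lambda>x. \<Phi> x * Z x) has_vector_derivative (\<Phi> x * (T x * Z x) + - (\<Phi> x * (T x * Y x) * \<Phi> x) * Z x)) (at x within {0..b})"
      by (intro has_vector_derivative_mult Z x has_vector_derivative_inverse_algebra[OF Y[OF x] x \<Phi>])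
    moreover have "\<Phi> x * (T x * Y x) * \<Phi> x = \<Phi> x * T x * (Y x * \<Phi> x)" by (simp only: mult.assoc)
    ultimately show "((\<lambda>x. \<Phi> x * Z x) has_vector_derivative 0) (at x within {0..b})"
      using \<Phi>(2)[OF x] by (simp add: mult.assoc)
  qed (use mem in auto)
  moreover have "\<Phi> 0 = 1" using \<Phi>(1)[OF mem(2)] Y0 by simp
  ultimately have "\<Phi> b * Z b = Z 0" by simp
  then have "Y b * Z 0 = (Y b * \<Phi> b) * Z b" by (simp add: mult.assoc)
  then show ?thesis using \<Phi>(2)[OF mem(1)] by simp
qed

lemma exp_mult_annihilated:
  fixes m c :: "'a::{real_normed_algebra_1,banach}"
  assumes "m * c = 0" shows "exp m * c = c"
proof -
  have z: "m ^ n * c = 0" if "n \<noteq> 0" for n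
    using that assms by (cases n) (auto simp: power_Suc2 mult.assoc simp del: power_Suc)
  have "exp m * c = (\<Sum>n. (m ^ n /\<^sub>R fact n) * c)"
    unfolding exp_def by (rule suminf_mult2[OF summable_exp_generic])
  also have "\<dots> = (\<Sum>n\<in>{0}. (m ^ n /\<^sub>R fact n) * c)"
    by (rule suminf_finite) (auto simp: z)
  finally show ?thesis by simp
qed

lemma matrix_add_mult_distrib: "(A + B) ** C = A ** C + B ** C" for A B C :: "complex^'n^'n"
  by (vector matrix_matrix_mult_def sum.distrib distrib_right)

lemma range_sum_idempotents:
  fixes a b :: "complex^'n^'n"
  assumes "a ** a = a" "b ** b = b" "a ** b = 0" "b ** a = 0"
  shows "vec.span (range ((*v) a) \<union> range ((*v) b)) = range ((*v) (a + b))"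
proof (intro subset_antisym vec.span_minimal subspace_range_matrix subsetI)
  fix x assume "x \<in> range ((*v) a) \<union> range ((*v) b)"
  then consider v where "x = a *v v" | v where "x = b *v v" by blast
  then show "x \<in> range ((*v) (a + b))"
  proof cases
    case 1
    then have "x = (a + b) *v x" using assms by (simp add: matrix_vector_mul_assoc matrix_add_mult_distrib)
    then show ?thesis by blast
  next
    case 2
    then have "x = (a + b) *v x" using assms by (simp add: matrix_vector_mul_assoc matrix_add_mult_distrib)
    then show ?thesis by blast
  qed
next
  fix x assume "x \<in> range ((*v) (a + b))"
  then obtain v where "x = a *v v + b *v v" by (auto simp: matrix_vector_mult_add_rdistrib)
  moreover have "a *v v \<in> vec.span (range ((*v) a) \<union> range ((*v) b))" "b *v v \<in> vec.span (range ((*v) a) \<union> range ((*v) b))"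
    by (rule vec.span_base, blast)+
  ultimately show "x \<in> vec.span (range ((*v) a) \<union> range ((*v) b))" using vec.span_add by simp
qed

text \<open>Brings the extended Evans functions into the form in which
  \<open>limiting_determinant\<close> produces them. The ranges of two of the projections span the
  range of their sum, which is an idempotent complementary to the third.\<close>

lemma hom_evans_as_det:
  assumes sp: "splitting (cmat (\<Pi>su z)) (cmat (\<Pi>c z)) (cmat (\<Pi>ss z))"
  shows "hom_evans_1 Pm Pp \<Pi>c \<Pi>ss \<Pi>su z =
      cdet (cmat (Pm 0 z) * (cmat (\<Pi>su z) + cmat (\<Pi>c z)) + cmat (Pp 0 z) * cmat (\<Pi>ss z))"
    and "hom_evans_2 Pm Pp \<Pi>c \<Pi>ss \<Pi>su z =
      cdet (cmat (Pm 0 z) * cmat (\<Pi>su z) + cmat (Pp 0 z) * (cmat (\<Pi>c z) + cmat (\<Pi>ss z)))"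
proof -
  let ?p = "\<Pi>su z" and ?c = "\<Pi>c z" and ?q = "\<Pi>ss z"
  have z: "cmat (0 :: complex^'a^'a) = 0" by (simp add: zero_cmat.abs_eq)
  have inj: "x = y" if "cmat x = cmat y" for x y :: "complex^'a^'a" using that by (simp add: cmat_inject)
  have P: "?p ** ?p = ?p" "?c ** ?c = ?c" "?q ** ?q = ?q" "?p ** ?c = 0" "?c ** ?p = 0" "?c ** ?q = 0" "?q ** ?c = 0"
    by (rule inj; use sp in \<open>simp add: cmat_simps z splitting_def\<close>)+
  have one: "?p + ?c + ?q = mat 1" by (rule inj) (use sp in \<open>simp add: cmat_simps(1,5) splitting_def\<close>)
  have q: "?q = mat 1 - (?p + ?c)" and cq: "?c + ?q = mat 1 - ?p" unfolding one[symmetric] by simp_all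
  have idpc: "(?p + ?c) ** (?p + ?c) = ?p + ?c"
    by (simp add: matrix_add_ldistrib matrix_add_mult_distrib P)
  show "hom_evans_1 Pm Pp \<Pi>c \<Pi>ss \<Pi>su z =
      cdet (cmat (Pm 0 z) * (cmat (\<Pi>su z) + cmat (\<Pi>c z)) + cmat (Pp 0 z) * cmat (\<Pi>ss z))"
    unfolding hom_evans_1_def range_sum_idempotents[OF P(1,2,4,5)]
    using evans_quotient_idempotent[OF idpc, of "Pm 0 z" "Pp 0 z"] unfolding q[symmetric] by (simp flip: cmat_simps)
  show "hom_evans_2 Pm Pp \<Pi>c \<Pi>ss \<Pi>su z =
      cdet (cmat (Pm 0 z) * cmat (\<Pi>su z) + cmat (Pp 0 z) * (cmat (\<Pi>c z) + cmat (\<Pi>ss z)))"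
    unfolding hom_evans_2_def range_sum_idempotents[OF P(2,3,6,7)]
    using evans_quotient_idempotent[OF P(1), of "Pm 0 z" "Pp 0 z"] unfolding cq[symmetric] by (simp flip: cmat_simps)
qed

lemma cdet_analytic:
  assumes "\<And>i j. (\<lambda>z. ent (f z) i j) analytic_on S" shows "(\<lambda>z. cdet (f z)) analytic_on S"
  unfolding cdet_altdef by (intro analytic_intros assms)

lemma ent_mult_analytic:
  assumes "\<And>i j. (\<lambda>z. ent (f z) i j) analytic_on S" "\<And>i j. (\<lambda>z. ent (g z) i j) analytic_on S"
  shows "(\<lambda>z. ent (f z * g z) i j) analytic_on S"
  unfolding ent_mult by (intro analytic_intros assms)

lemma eventually_analytic_at:
  assumes "f analytic_on {z0}" shows "\<forall>\<^sub>F z in nhds z0. f analytic_on {z}"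
proof -
  obtain s where s: "open s" "z0 \<in> s" "f holomorphic_on s" using assms by (auto simp: analytic_at)
  have "\<forall>\<^sub>F z in nhds z0. z \<in> s" by (rule eventually_nhds_in_open[OF s(1,2)])
  then show ?thesis by eventually_elim (use s in \<open>auto simp: analytic_at\<close>)
qed

lemma norm_cmat_le: "norm (cmat A) \<le> (real CARD('n) * real CARD('n)) * norm A" for A :: "complex^'n^'n"
proof -
  have "norm (cmat A) \<le> (\<Sum>i\<in>UNIV. \<Sum>j\<in>UNIV. norm (ent (cmat A) i j))" by (rule norm_cmat_le_sum)
  also have "\<dots> \<le> (\<Sum>i\<in>(UNIV::'n set). \<Sum>j\<in>(UNIV::'n set). norm A)"
  proof (intro sum_mono)
    fix i j :: 'n
    have "norm (A $ i $ j) \<le> norm (A $ i)" by (rule Finite_Cartesian_Product.norm_nth_le)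
    also have "\<dots> \<le> norm A" by (rule Finite_Cartesian_Product.norm_nth_le)
    finally show "norm (ent (cmat A) i j) \<le> norm A" by (simp add: ent.abs_eq)
  qed
  finally show ?thesis by simp
qed

section \<open>Asymptotics of the periodic determinant\<close>

lemma exp_mult_eigen:
  fixes a c :: "'n::finite cmat"
  assumes "a * c = sc \<mu> * c" shows "exp (x *\<^sub>R a) * c = sc (exp (of_real x * \<mu>)) * c"
proof -
  have "(x *\<^sub>R (a - sc \<mu>)) * c = 0" by (simp add: left_diff_distrib assms)
  then have z: "exp (x *\<^sub>R (a - sc \<mu>)) * c = c" by (rule exp_mult_annihilated)
  show ?thesis using exp_shift[of x 1 a \<mu>] by (simp add: mult.assoc z)
qed

context growth_scale
begin

lemma factored_cong:
  assumes "factored p c q V S l D D1 D2 u" "\<forall>\<^sub>F t in F. S' t = S t"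
  shows "factored p c q V S' l D D1 D2 u"
proof -
  have "small (\<lambda>t. D t * c t - S' t)"
  proof (rule small_cong)
    show "small (\<lambda>t. D t * c t - S t)" using assms(1) by (simp add: factored_def)
    show "\<forall>\<^sub>F t in F. D t * c t - S' t = D t * c t - S t" using assms(2) by eventually_elim simp
  qed
  then show ?thesis using assms(1) unfolding factored_def by simp
qed

text \<open>The exponent is at most \<open>K / 2 * sqrt (L t)\<close>, which falls below
  \<open>\<eta> * L t\<close> for every positive \<open>\<eta>\<close>. This is where the radius
  \<open>1 / sqrt L\<close> is admissible for the critical growth.\<close>

lemma subexp_exp_inverse_sqrt:
  assumes "\<forall>\<^sub>F t in F. \<bar>x t\<bar> \<le> K / sqrt (L t)" shows "subexp (\<lambda>t. exp (L t / 2 * \<bar>x t\<bar>) :: real)"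
  unfolding subexp_def
proof (intro allI impI)
  fix \<eta> :: real assume \<eta>: "\<eta> > 0"
  from assms eventually_L_ge[of "max 1 ((K / \<eta>)\<^sup>2)"]
  show "\<forall>\<^sub>F t in F. norm (exp (L t / 2 * \<bar>x t\<bar>)) \<le> exp (\<eta> * L t)"
  proof eventually_elim
    case (elim t)
    have L: "L t \<ge> 1" "(K / \<eta>)\<^sup>2 \<le> L t" using elim(2) by auto
    have "K / \<eta> \<le> sqrt (L t)" using L(2) by (rule real_le_rsqrt)
    then have "K \<le> \<eta> * sqrt (L t)" using \<eta> by (simp add: pos_divide_le_eq mult.commute)
    then have "K / sqrt (L t) \<le> \<eta>" using L(1) by (simp add: pos_divide_le_eq)
    then have "\<bar>x t\<bar> \<le> \<eta>" using elim(1) by linarith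
    then have "L t / 2 * \<bar>x t\<bar> \<le> L t / 2 * \<eta>" using L(1) by (intro mult_left_mono) auto
    also have "\<dots> \<le> \<eta> * L t" using L(1) \<eta> by simp
    finally show ?case by simp
  qed
qed

text \<open>The backward half period is a forward one after reflection of time: the limiting matrix
  becomes \<open>- a\<close> and the stable block is now the growing one, so
  \<open>half_line_factored\<close> applies again with \<open>p\<close> and \<open>q\<close>
  exchanged. The prefactor \<open>exp (L / 2 * \<mu>)\<close> turns the two critical multipliers
  into \<open>exp (\<mu> * L)\<close> and 1.\<close>

theorem asymptotic_determinant:
  fixes a p c q :: "'t \<Rightarrow> 'n::finite cmat" and Bp Bm A0p A0m Yp Ym Pp Pm Ip Im :: "'t \<Rightarrow> real \<Rightarrow> 'n cmat"
    and \<mu> \<gamma> :: "'t \<Rightarrow> complex"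
  assumes pos: "\<theta> > 0" "\<alpha> > 0"
    and sp: "\<forall>\<^sub>F t in F. splitting (p t) (c t) (q t)"
    and com: "\<forall>\<^sub>F t in F. a t * p t = p t * a t \<and> a t * c t = sc (\<mu> t) * c t \<and> a t * c t = c t * a t \<and> a t * q t = q t * a t"
    and bd: "\<forall>\<^sub>F t in F. norm (p t) \<le> K \<and> norm (c t) \<le> K \<and> norm (q t) \<le> K \<and> norm (a t) \<le> K"
    and rank: "\<forall>\<^sub>F t in F. (\<exists>u w. \<forall>i j. ent (c t) i j = u i * w j) \<and> c t \<noteq> 0"
    and mu: "\<forall>\<^sub>F t in F. \<bar>Re (\<mu> t)\<bar> \<le> K / sqrt (L t)"
    and \<gamma>: "\<forall>\<^sub>F t in F. norm (\<gamma> t) = 1"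
    and decay: "\<forall>\<^sub>F t in F. \<forall>x\<ge>0. norm (exp ((- x) *\<^sub>R a t) * p t) \<le> K * exp (- \<alpha> * x) \<and>
        norm (exp (x *\<^sub>R a t) * q t) \<le> K * exp (- \<alpha> * x)"
    and odep: "\<forall>\<^sub>F t in F. Yp t 0 = 1 \<and> (\<forall>x\<in>{0..L t / 2}.
        (Yp t has_vector_derivative Bp t x * Yp t x) (at x within {0..L t / 2}) \<and>
        (Pp t has_vector_derivative A0p t x * Pp t x - Pp t x * a t) (at x within {0..L t / 2}) \<and>
        has_inverse (Yp t x) \<and> Ip t x * Pp t x = 1 \<and> Pp t x * Ip t x = 1 \<and>
        norm (Pp t x) \<le> K \<and> norm (Ip t x) \<le> K \<and> norm (Bp t x - A0p t x) \<le> K * exp (- \<theta> * L t / 2))"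
    and odem: "\<forall>\<^sub>F t in F. Ym t 0 = 1 \<and> (\<forall>x\<in>{0..L t / 2}.
        (Ym t has_vector_derivative Bm t x * Ym t x) (at x within {0..L t / 2}) \<and>
        (Pm t has_vector_derivative A0m t x * Pm t x - Pm t x * (- a t)) (at x within {0..L t / 2}) \<and>
        has_inverse (Ym t x) \<and> Im t x * Pm t x = 1 \<and> Pm t x * Im t x = 1 \<and>
        norm (Pm t x) \<le> K \<and> norm (Im t x) \<le> K \<and> norm (Bm t x - A0m t x) \<le> K * exp (- \<theta> * L t / 2))"
    and P: "small (\<lambda>t. Pp t (L t / 2) - 1)" "small (\<lambda>t. Pm t (L t / 2) - 1)"
  defines "hp \<equiv> \<lambda>t. cdet (p t * (Yp t (L t / 2) * Pp t 0) * p t + 1 - p t)"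
    and "hm \<equiv> \<lambda>t. cdet (q t * (Ym t (L t / 2) * Pm t 0) * q t + 1 - q t)"
    and "S \<equiv> \<lambda>t. cdet (p t + c t - sc (\<gamma> t) * q t)"
  shows "\<forall>\<^sub>F t in F. hp t \<noteq> 0 \<and> hm t \<noteq> 0 \<and> S t \<noteq> 0 \<and> cdet (Pp t 0) \<noteq> 0 \<and> cdet (Pm t 0) \<noteq> 0"
    and "small (\<lambda>t. exp (of_real (L t / 2) * \<mu> t) * cdet (Pp t 0) * cdet (Pm t 0) / (hp t * hm t * S t) *
            cdet (Yp t (L t / 2) - sc (\<gamma> t) * Ym t (L t / 2)) -
          (exp (\<mu> t * of_real (L t)) * cdet (Pm t 0 * (p t + c t) + Pp t 0 * q t) -
           \<gamma> t * cdet (Pm t 0 * p t + Pp t 0 * (c t + q t))))"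
proof -
  define gp where "gp t = exp (of_real (L t / 2) * \<mu> t)" for t
  define gm where "gm t = exp (of_real (- (L t / 2)) * \<mu> t)" for t
  define \<sigma> where "\<sigma> t = K * exp (L t / 2 * \<bar>Re (\<mu> t)\<bar>)" for t
  have sx: "subexp (\<lambda>t. exp (L t / 2 * \<bar>Re (\<mu> t)\<bar>) :: real)" by (rule subexp_exp_inverse_sqrt[OF mu])
  then have s\<sigma>: "subexp \<sigma>" unfolding \<sigma>_def by (intro subexp_mult subexp_const)
  have abs_le: "l * r \<le> l * \<bar>r\<bar>" "(- l) * r \<le> l * \<bar>r\<bar>" if "l \<ge> 0" for l r :: real
  proof -
    show "l * r \<le> l * \<bar>r\<bar>" using that by (intro mult_left_mono) auto
    have "l * (- r) \<le> l * \<bar>r\<bar>" using that by (intro mult_left_mono) auto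
    then show "(- l) * r \<le> l * \<bar>r\<bar>" by simp
  qed
  have sg: "subexp gp" "subexp gm"
    by (rule subexp_mono[OF sx]; use eventually_L_ge[of 0] in eventually_elim; simp only: gp_def gm_def norm_exp_eq_Re norm_exp real_norm_def abs_exp_cancel exp_le_cancel_iff; rule order_trans[OF _ abs_le(1)] order_trans[OF _ abs_le(2)]; simp)+
  have sub: "subexp p" "subexp c" "subexp q"
    by (rule subexp_bounded[of _ K], use bd in eventually_elim, simp)+
  have zero_mem: "\<forall>\<^sub>F t in F. (0::real) \<in> {0..L t / 2}" using eventually_L_ge[of 0] by eventually_elim simp
  have conj0: "\<forall>\<^sub>F t in F. Ip t 0 * Pp t 0 = 1 \<and> Pp t 0 * Ip t 0 = 1 \<and> norm (Pp t 0) \<le> K \<and> norm (Ip t 0) \<le> K \<and>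
      Im t 0 * Pm t 0 = 1 \<and> Pm t 0 * Im t 0 = 1 \<and> norm (Pm t 0) \<le> K \<and> norm (Im t 0) \<le> K"
    using odep odem zero_mem by eventually_elim blast
  have subP: "subexp (\<lambda>t. Pp t 0)" "subexp (\<lambda>t. Pm t 0)" "subexp (\<lambda>t. Ip t 0)" "subexp (\<lambda>t. Im t 0)"
    by (rule subexp_bounded[of _ K], use conj0 in eventually_elim, simp)+
  have cdecay: "norm (exp (y *\<^sub>R a t) * c t) \<le> \<sigma> t"
    if "a t * c t = sc (\<mu> t) * c t" "norm (c t) \<le> K" "\<bar>y\<bar> \<le> L t / 2" for t y
  proof -
    have "exp (y *\<^sub>R a t) * c t = sc (exp (of_real y * \<mu> t)) * c t" by (rule exp_mult_eigen[OF that(1)])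
    then have "norm (exp (y *\<^sub>R a t) * c t) \<le> norm (sc (exp (of_real y * \<mu> t)) :: 'n cmat) * norm (c t)"
      by (simp only: norm_mult_ineq)
    also have "\<dots> \<le> exp (L t / 2 * \<bar>Re (\<mu> t)\<bar>) * K"
    proof (rule mult_mono)
      have "y * Re (\<mu> t) \<le> \<bar>y\<bar> * \<bar>Re (\<mu> t)\<bar>" by (simp flip: abs_mult)
      also have "\<dots> \<le> L t / 2 * \<bar>Re (\<mu> t)\<bar>" using that(3) by (intro mult_right_mono) auto
      finally show "norm (sc (exp (of_real y * \<mu> t)) :: 'n cmat) \<le> exp (L t / 2 * \<bar>Re (\<mu> t)\<bar>)"
        by (simp add: norm_exp_eq_Re)
    qed (use that in auto)
    finally show ?thesis by (simp add: \<sigma>_def mult.commute)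
  qed
  have decp: "\<forall>\<^sub>F t in F. \<forall>x\<in>{0..L t / 2}.
        norm (exp ((- x) *\<^sub>R a t) * p t) \<le> K * exp (- \<alpha> * x) \<and> norm (exp (x *\<^sub>R a t) * q t) \<le> K * exp (- \<alpha> * x) \<and>
        norm (exp (x *\<^sub>R a t) * c t) \<le> \<sigma> t \<and> norm (exp ((- x) *\<^sub>R a t) * c t) \<le> \<sigma> t"
    using decay com bd
  proof eventually_elim
    case (elim t)
    show ?case
    proof
      fix x assume x: "x \<in> {0..L t / 2}"
      have pre: "a t * c t = sc (\<mu> t) * c t" "norm (c t) \<le> K" using elim(2,3) by blast+
      have "norm (exp (x *\<^sub>R a t) * c t) \<le> \<sigma> t" "norm (exp ((- x) *\<^sub>R a t) * c t) \<le> \<sigma> t"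
        using x by (intro cdecay[OF pre]; simp)+
      then show "norm (exp ((- x) *\<^sub>R a t) * p t) \<le> K * exp (- \<alpha> * x) \<and> norm (exp (x *\<^sub>R a t) * q t) \<le> K * exp (- \<alpha> * x) \<and>
        norm (exp (x *\<^sub>R a t) * c t) \<le> \<sigma> t \<and> norm (exp ((- x) *\<^sub>R a t) * c t) \<le> \<sigma> t" using elim(1) x by auto
    qed
  qed
  have decm: "\<forall>\<^sub>F t in F. \<forall>x\<in>{0..L t / 2}.
        norm (exp ((- x) *\<^sub>R (- a t)) * q t) \<le> K * exp (- \<alpha> * x) \<and> norm (exp (x *\<^sub>R (- a t)) * p t) \<le> K * exp (- \<alpha> * x) \<and>
        norm (exp (x *\<^sub>R (- a t)) * c t) \<le> \<sigma> t \<and> norm (exp ((- x) *\<^sub>R (- a t)) * c t) \<le> \<sigma> t"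
    using decp by eventually_elim (simp add: scaleR_minus_left scaleR_minus_right)
  have sp': "\<forall>\<^sub>F t in F. splitting (q t) (c t) (p t)" using sp by eventually_elim (simp add: splitting_sym)
  have comp: "\<forall>\<^sub>F t in F. a t * p t = p t * a t \<and> a t * c t = c t * a t \<and> a t * q t = q t * a t"
    using com by eventually_elim blast
  have comm: "\<forall>\<^sub>F t in F. (- a t) * q t = q t * (- a t) \<and> (- a t) * c t = c t * (- a t) \<and> (- a t) * p t = p t * (- a t)"
    using comp by eventually_elim simp
  have bdp: "\<forall>\<^sub>F t in F. norm (a t) \<le> K" and bdm: "\<forall>\<^sub>F t in F. norm (- a t) \<le> K"
    using bd by (eventually_elim, simp)+
  obtain lp Dp Dp1 Dp2 up where fp: "factored p c q (\<lambda>t. Yp t (L t / 2) * Pp t 0) (\<lambda>t. exp ((L t / 2) *\<^sub>R a t) * c t) lp Dp Dp1 Dp2 up"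
    and smp: "small Dp1" "small (\<lambda>t. Dp t * q t)"
    by (rule half_line_factored[OF pos sp comp sub s\<sigma> bdp decp odep P(1)])
  obtain lm Dm Dm1 Dm2 um where fm: "factored q c p (\<lambda>t. Ym t (L t / 2) * Pm t 0) (\<lambda>t. exp ((L t / 2) *\<^sub>R (- a t)) * c t) lm Dm Dm1 Dm2 um"
    and smm: "small Dm1" "small (\<lambda>t. Dm t * p t)"
    by (rule half_line_factored[OF pos sp' comm sub(3,2,1) s\<sigma> bdm decm odem P(2)])
  have ep: "\<forall>\<^sub>F t in F. sc (gp t) * c t = exp ((L t / 2) *\<^sub>R a t) * c t"
    using com by eventually_elim (simp add: exp_mult_eigen gp_def)
  have em: "\<forall>\<^sub>F t in F. sc (gm t) * c t = exp ((L t / 2) *\<^sub>R (- a t)) * c t"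
    using com
  proof eventually_elim
    case (elim t)
    have "exp ((- (L t / 2)) *\<^sub>R a t) * c t = sc (gm t) * c t" unfolding gm_def by (rule exp_mult_eigen) (use elim in blast)
    then show ?case by simp
  qed
  note red = reduced_determinant[OF sp sub subP(3,4) sg \<gamma> factored_cong[OF fp ep] smp(2) factored_cong[OF fm em] smm(2)]
  \<comment> \<open>The matrix inside \<open>S\<close> is inverted by replacing
    \<open>\<gamma>\<close> with its inverse, so \<open>inverse (S t)\<close> is again the
    determinant of a bounded matrix.\<close>
  have SS: "\<forall>\<^sub>F t in F. S t * cdet (p t + c t - sc (inverse (\<gamma> t)) * q t) = 1"
    using sp \<gamma>
  proof eventually_elim
    case (elim t)
    have P: "p t * p t = p t" "c t * c t = c t" "q t * q t = q t" "p t * c t = 0" "c t * p t = 0"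
      "p t * q t = 0" "q t * p t = 0" "c t * q t = 0" "q t * c t = 0" and one: "p t + c t + q t = 1"
      using elim(1) by (auto simp: splitting_def)
    have g: "\<gamma> t \<noteq> 0" using elim(2) by auto
    have scq: "x * (sc z * y) = sc z * (x * y)" for x y :: "'n cmat" and z
      using sc_commute[of z x] by (simp flip: mult.assoc)
    have Xq: "(p t + c t - sc (\<gamma> t) * q t) * q t = - (sc (\<gamma> t) * q t)"
      by (simp add: left_diff_distrib distrib_right mult.assoc P)
    have "sc (inverse (\<gamma> t)) * sc (\<gamma> t) = (1 :: 'n cmat)"
      unfolding sc_simps(1)[symmetric] using g by (simp add: sc_simps(6))
    then have 1: "(p t + c t - sc (\<gamma> t) * q t) * (sc (inverse (\<gamma> t)) * q t) = - q t"
      unfolding scq Xq by (simp flip: mult.assoc)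
    have 2: "(p t + c t - sc (\<gamma> t) * q t) * (p t + c t) = p t + c t"
      by (simp add: left_diff_distrib distrib_right distrib_left mult.assoc P)
    have "(p t + c t - sc (\<gamma> t) * q t) * (p t + c t - sc (inverse (\<gamma> t)) * q t) = 1"
      unfolding right_diff_distrib 1 2 using one by simp
    then show ?case unfolding S_def cdet_simps(1)[symmetric] by (simp add: cdet_simps)
  qed
  have Ss: "subexp (\<lambda>t. inverse (S t))"
  proof (rule subexp_cong)
    have "subexp (\<lambda>t. sc (inverse (\<gamma> t)) :: 'n cmat)"
      by (rule subexp_bounded[of _ 1], use \<gamma> in eventually_elim, simp add: norm_inverse)
    then show "subexp (\<lambda>t. cdet (p t + c t - sc (inverse (\<gamma> t)) * q t))"
      by (intro subexp_cdet subexp_diff subexp_add subexp_mult sub)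
    show "\<forall>\<^sub>F t in F. inverse (S t) = cdet (p t + c t - sc (inverse (\<gamma> t)) * q t)"
      using SS by eventually_elim (rule inverse_unique)
  qed
  have dP: "\<forall>\<^sub>F t in F. cdet (Pp t 0) \<noteq> 0 \<and> cdet (Pm t 0) \<noteq> 0"
    using conj0
  proof eventually_elim
    case (elim t)
    have "has_inverse (Pp t 0)" "has_inverse (Pm t 0)" using elim unfolding has_inverse_def by blast+
    then show ?case by (simp add: has_inverse_iff_cdet)
  qed
  show nz: "\<forall>\<^sub>F t in F. hp t \<noteq> 0 \<and> hm t \<noteq> 0 \<and> S t \<noteq> 0 \<and> cdet (Pp t 0) \<noteq> 0 \<and> cdet (Pm t 0) \<noteq> 0"
    using red(1) SS dP by eventually_elim (auto simp: hp_def hm_def)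
  define N where "N t = cdet ((p t + sc (gp t) * c t) * Ip t 0 - sc (\<gamma> t) * (q t + sc (gm t) * c t) * Im t 0)" for t
  define V where "V t = cdet (Yp t (L t / 2) - sc (\<gamma> t) * Ym t (L t / 2))" for t
  have dd: "small (\<lambda>t. V t / (hp t * hm t) - N t)"
  proof (rule small_cong[OF red(2)])
    show "\<forall>\<^sub>F t in F. V t / (hp t * hm t) - N t =
      cdet (Yp t (L t / 2) * Pp t 0 * Ip t 0 - sc (\<gamma> t) * (Ym t (L t / 2) * Pm t 0) * Im t 0) /
           (cdet (p t * (Yp t (L t / 2) * Pp t 0) * p t + 1 - p t) * cdet (q t * (Ym t (L t / 2) * Pm t 0) * q t + 1 - q t)) -
         cdet ((p t + sc (gp t) * c t) * Ip t 0 - sc (\<gamma> t) * (q t + sc (gm t) * c t) * Im t 0)"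
      using conj0 by eventually_elim (simp add: V_def N_def hp_def hm_def mult.assoc)
  qed
  have fin: "\<forall>\<^sub>F t in F. gp t * cdet (Pp t 0) * cdet (Pm t 0) / (hp t * hm t * S t) * V t -
          (exp (\<mu> t * of_real (L t)) * cdet (Pm t 0 * (p t + c t) + Pp t 0 * q t) - \<gamma> t * cdet (Pm t 0 * p t + Pp t 0 * (c t + q t))) =
      gp t * cdet (Pp t 0) * cdet (Pm t 0) * inverse (S t) * (V t / (hp t * hm t) - N t)"
    using sp conj0 rank nz
  proof eventually_elim
    case (elim t)
    have I: "Ip t 0 * Pp t 0 = 1" "Pp t 0 * Ip t 0 = 1" "Im t 0 * Pm t 0 = 1" using elim(2) by auto
    obtain u w where r: "\<And>i j. ent (c t) i j = u i * w j" and c0: "c t \<noteq> 0" using elim(3) by blast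
    define D1 where "D1 = cdet (Pm t 0 * (p t + c t) + Pp t 0 * q t)"
    define D2 where "D2 = cdet (Pm t 0 * p t + Pp t 0 * (c t + q t))"
    have lim: "N t * cdet (Pp t 0) * cdet (Pm t 0) = S t * (gp t * D1 - \<gamma> t * gm t * D2)"
      unfolding N_def S_def D1_def D2_def by (rule limiting_determinant[OF elim(1) I r c0])
    have g: "gp t * gm t = 1" "gp t * gp t = exp (\<mu> t * of_real (L t))"
      unfolding gp_def gm_def exp_add[symmetric] by (simp_all add: algebra_simps)
    have S0: "S t \<noteq> 0" using elim(4) by blast
    have "gp t * cdet (Pp t 0) * cdet (Pm t 0) * inverse (S t) * N t = gp t * inverse (S t) * (N t * cdet (Pp t 0) * cdet (Pm t 0))"
      by (simp only: mult_ac)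
    also have "\<dots> = (gp t * gp t) * D1 - \<gamma> t * (gp t * gm t) * D2"
      unfolding lim using S0 by (simp add: field_simps)
    finally have e: "gp t * cdet (Pp t 0) * cdet (Pm t 0) * inverse (S t) * N t = exp (\<mu> t * of_real (L t)) * D1 - \<gamma> t * D2"
      unfolding g by simp
    show ?case unfolding D1_def[symmetric] D2_def[symmetric] right_diff_distrib[of _ "V t / _"] e
      by (simp add: divide_inverse mult_ac)
  qed
  have "small (\<lambda>t. gp t * cdet (Pp t 0) * cdet (Pm t 0) * inverse (S t) * (V t / (hp t * hm t) - N t))"
    by (intro small_mult_left subexp_mult sg subexp_cdet subP Ss dd)
  then have "small (\<lambda>t. gp t * cdet (Pp t 0) * cdet (Pm t 0) / (hp t * hm t * S t) * V t -
          (exp (\<mu> t * of_real (L t)) * cdet (Pm t 0 * (p t + c t) + Pp t 0 * q t) - \<gamma> t * cdet (Pm t 0 * p t + Pp t 0 * (c t + q t))))"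
    by (rule small_cong[OF _ fin])
  then show "small (\<lambda>t. exp (of_real (L t / 2) * \<mu> t) * cdet (Pp t 0) * cdet (Pm t 0) / (hp t * hm t * S t) *
            cdet (Yp t (L t / 2) - sc (\<gamma> t) * Ym t (L t / 2)) -
          (exp (\<mu> t * of_real (L t)) * cdet (Pm t 0 * (p t + c t) + Pp t 0 * q t) -
           \<gamma> t * cdet (Pm t 0 * p t + Pp t 0 * (c t + q t))))"
    unfolding gp_def V_def .
qed

end

section \<open>Analytic dependence of solutions on a parameter\<close>

text \<open>A limit of the difference quotients is found along the real sequence \<open>s n\<close>
  by completeness; the Cauchy estimate then compares all other increments with that
  sequence.\<close>

lemma Cauchy_quotients_imp_differentiable:
  fixes f :: "complex \<Rightarrow> complex"
  assumes r: "r > 0" and q: "\<And>h k. h \<noteq> 0 \<Longrightarrow> k \<noteq> 0 \<Longrightarrow> norm h < r \<Longrightarrow> norm k < r \<Longrightarrow>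
      norm ((f (z + h) - f z) / h - (f (z + k) - f z) / k) \<le> K * (norm h + norm k)"
  shows "f field_differentiable (at z)"
proof -
  define Q where "Q h = (f (z + h) - f z) / h" for h
  have K: "K \<ge> 0"
  proof -
    have "0 \<le> K * (norm (complex_of_real (r/2)) + norm (complex_of_real (r/2)))"
      by (rule order_trans[OF norm_ge_zero q]) (use r in auto)
    then show ?thesis using r by (simp add: zero_le_mult_iff)
  qed
  define s where "s n = complex_of_real (r / real (n + 2))" for n
  have s: "s n \<noteq> 0" "norm (s n) < r" for n
    using r by (auto simp: s_def norm_divide divide_less_eq simp del: of_real_divide of_real_add)
  have sn: "norm (s n) \<le> r / real (Suc n)" for n
    using r by (simp add: s_def norm_divide frac_le del: of_real_divide of_real_add)
  have s0: "(\<lambda>n. norm (s n)) \<longlonglongrightarrow> 0"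
  proof (rule tendsto_sandwich[of "\<lambda>_. 0" _ _ "\<lambda>n. r / real (Suc n)"])
    show "(\<lambda>n. r / real (Suc n)) \<longlonglongrightarrow> 0" by (rule LIMSEQ_Suc[OF lim_const_over_n])
  qed (use sn in auto)
  have "Cauchy (\<lambda>n. Q (s n))"
  proof (rule metric_CauchyI)
    fix e :: real assume e: "e > 0"
    have "(\<lambda>n. K * norm (s n)) \<longlonglongrightarrow> K * 0" by (intro tendsto_intros s0)
    then have "\<forall>\<^sub>F n in sequentially. K * norm (s n) < e / 2"
      using e by (intro order_tendstoD(2)) auto
    then obtain M where M: "\<And>n. n \<ge> M \<Longrightarrow> K * norm (s n) < e / 2" unfolding eventually_sequentially by blast
    have "dist (Q (s m)) (Q (s n)) < e" if "m \<ge> M" "n \<ge> M" for m n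
    proof -
      have "dist (Q (s m)) (Q (s n)) \<le> K * (norm (s m) + norm (s n))"
        unfolding dist_norm Q_def by (rule q) (use s in auto)
      then show ?thesis using M[OF that(1)] M[OF that(2)] by (simp add: distrib_left)
    qed
    then show "\<exists>M. \<forall>m\<ge>M. \<forall>n\<ge>M. dist (Q (s m)) (Q (s n)) < e" by blast
  qed
  then obtain l where l: "(\<lambda>n. Q (s n)) \<longlonglongrightarrow> l" by (auto simp: Cauchy_convergent_iff convergent_def)
  have bound: "norm (Q h - l) \<le> K * norm h" if "h \<noteq> 0" "norm h < r" for h
  proof (rule tendsto_le[OF sequentially_bot])
    show "(\<lambda>n. norm (Q h - Q (s n))) \<longlonglongrightarrow> norm (Q h - l)" by (intro tendsto_intros l)
    have "(\<lambda>n. K * (norm h + norm (s n))) \<longlonglongrightarrow> K * (norm h + 0)" by (intro tendsto_intros s0)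
    then show "(\<lambda>n. K * (norm h + norm (s n))) \<longlonglongrightarrow> K * norm h" by simp
    show "\<forall>\<^sub>F n in sequentially. norm (Q h - Q (s n)) \<le> K * (norm h + norm (s n))"
      unfolding Q_def by (intro always_eventually allI q) (use that s in auto)
  qed
  have "((\<lambda>h. Q h - l) \<longlongrightarrow> 0) (at 0)"
  proof (rule Lim_null_comparison)
    show "\<forall>\<^sub>F h in at 0. norm (Q h - l) \<le> K * norm h"
      unfolding eventually_at using r bound by (intro exI[of _ r]) auto
    show "((\<lambda>h. K * norm h) \<longlongrightarrow> 0) (at (0::complex))"
      by (rule tendsto_mult_right_zero) (rule tendsto_norm_zero, rule tendsto_ident_at)
  qed
  then have "(Q \<longlongrightarrow> l) (at 0)" by (rule LIM_zero_cancel)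
  then have "(f has_field_derivative l) (at z)" unfolding DERIV_def Q_def .
  then show ?thesis by (auto simp: field_differentiable_def)
qed

text \<open>Cauchy's inequality on unit circles about the points of \<open>ball z (1/2)\<close>,
  which fit into \<open>ball z 2\<close>, bounds the first two derivatives by \<open>C\<close> and
  \<open>2 * C\<close>; Taylor's formula does the rest.\<close>

lemma holomorphic_quotient_bounds:
  fixes b :: "complex \<Rightarrow> complex"
  assumes b: "b holomorphic_on ball z 2" and C: "\<And>w. w \<in> ball z 2 \<Longrightarrow> norm (b w) \<le> C"
    and h: "h \<noteq> 0" "norm h < 1/2" 
  shows "norm ((b (z + h) - b z) / h) \<le> 3 * C" "norm ((b (z + h) - b z) / h - deriv b z) \<le> 2 * C * norm h"
proof -
  have "norm (b z) \<le> C" by (intro C) simp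
  then have C0: "C \<ge> 0" by (rule order_trans[OF norm_ge_zero])
  have d2: "norm ((deriv ^^ 2) b w) \<le> 2 * C" and d1: "norm ((deriv ^^ 1) b w) \<le> C" if "w \<in> ball z (1/2)" for w
  proof -
    have sub: "cball w 1 \<subseteq> ball z 2"
    proof
      fix y assume "y \<in> cball w 1"
      then show "y \<in> ball z 2" using that dist_triangle[of z y w] by simp
    qed
    have sub': "ball w 1 \<subseteq> ball z 2" using sub ball_subset_cball by blast
    have "norm ((deriv ^^ n) b w) \<le> fact n * C / 1 ^ n" for n
    proof (rule Cauchy_inequality)
      show "b holomorphic_on ball w 1" by (rule holomorphic_on_subset[OF b sub'])
      show "continuous_on (cball w 1) b" by (rule holomorphic_on_imp_continuous_on[OF holomorphic_on_subset[OF b sub]])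
      show "norm (b x) \<le> C" if "norm (w - x) = 1" for x
      proof -
        have "x \<in> cball w 1" using that by (simp add: dist_norm)
        then show ?thesis using sub C by blast
      qed
    qed simp
    from this[of 2] this[of 1] show "norm ((deriv ^^ 2) b w) \<le> 2 * C" "norm ((deriv ^^ 1) b w) \<le> C" by (auto simp: numeral_2_eq_2)
  qed
  have zh: "z + h \<in> ball z (1/2)" "z \<in> ball z (1/2)" using h by (auto simp: dist_norm)
  have "norm ((deriv ^^ 0) b (z + h) - (\<Sum>i\<le>1. (deriv ^^ i) b z * (z + h - z) ^ i / fact i)) \<le>
      2 * C * norm (z + h - z) ^ Suc 1 / fact 1"
  proof (rule complex_Taylor[of "ball z (1/2)"])
    fix i :: nat and x assume "x \<in> ball z (1/2)" "i \<le> 1"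
    then have "x \<in> ball z 2" by simp
    moreover have "(deriv ^^ i) b holomorphic_on ball z 2" by (rule holomorphic_higher_deriv[OF b open_ball])
    ultimately have "((deriv ^^ i) b has_field_derivative deriv ((deriv ^^ i) b) x) (at x)"
      by (intro holomorphic_derivI) auto
    then show "((deriv ^^ i) b has_field_derivative (deriv ^^ Suc i) b x) (at x within ball z (1/2))"
      by (simp add: has_field_derivative_at_within)
  next
    fix x assume "x \<in> ball z (1/2)"
    then show "norm ((deriv ^^ Suc 1) b x) \<le> 2 * C" using d2[of x] by (simp add: numeral_2_eq_2)
  qed (use zh in auto)
  then have T: "norm (b (z + h) - b z - deriv b z * h) \<le> 2 * C * norm h ^ 2"
    by (simp add: power2_eq_square algebra_simps)
  have "(b (z + h) - b z) / h - deriv b z = (b (z + h) - b z - deriv b z * h) / h"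
    using h by (simp add: field_simps)
  then have "norm ((b (z + h) - b z) / h - deriv b z) = norm (b (z + h) - b z - deriv b z * h) / norm h"
    by (simp add: norm_divide)
  also have "\<dots> \<le> 2 * C * norm h ^ 2 / norm h" using T by (rule divide_right_mono) simp
  also have "\<dots> = 2 * C * norm h" using h by (simp add: power2_eq_square)
  finally show q: "norm ((b (z + h) - b z) / h - deriv b z) \<le> 2 * C * norm h" .
  have "norm ((b (z + h) - b z) / h) \<le> norm ((b (z + h) - b z) / h - deriv b z) + norm (deriv b z)" by norm
  also have "\<dots> \<le> 2 * C * norm h + C" using q d1[OF zh(2)] by simp
  also have "\<dots> \<le> 2 * C * 1 + C" using h C0 by (intro add_right_mono mult_left_mono) auto
  finally show "norm ((b (z + h) - b z) / h) \<le> 3 * C" by simp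
qed

text \<open>Each step of length \<open>1 / (2 * (d + 1))\<close> at most doubles the norm, by
  \<open>short_time_bound\<close>.\<close>

lemma solution_growth:
  fixes Y :: "real \<Rightarrow> 'a::{real_normed_algebra_1,banach}"
  assumes Y: "\<And>x. x \<in> {0..b} \<Longrightarrow> (Y has_vector_derivative T x * Y x) (at x within {0..b})"
    and T: "\<And>x. x \<in> {0..b} \<Longrightarrow> norm (T x) \<le> d" and d: "d \<ge> 0" and Y0: "Y 0 = 1"
    and x: "x \<in> {0..b}" "x \<le> real n * (1 / (2 * (d + 1)))"
  shows "norm (Y x) \<le> 2 ^ n"
  using x
proof (induction n arbitrary: x)
  case 0
  then have "x = 0" by simp
  then show ?case using Y0 by simp
next
  case (Suc n)
  define h where "h = 1 / (2 * (d + 1))"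
  have h: "h > 0" using d by (simp add: h_def)
  define s where "s = max 0 (x - h)"
  have sx: "s \<in> {0..b}" "s \<le> x" "x - s \<le> h" "s \<le> real n * h"
  proof -
    have "x \<le> real (Suc n) * h" using Suc.prems(2) unfolding h_def .
    then show "s \<in> {0..b}" "s \<le> x" "x - s \<le> h" "s \<le> real n * h"
      using Suc.prems(1) h by (auto simp: s_def algebra_simps max_def)
  qed
  have dh: "d * (x - s) \<le> 1/2"
  proof -
    have "d * (x - s) \<le> d * h" using sx d by (intro mult_left_mono) auto
    also have "\<dots> \<le> 1/2" using d by (simp add: h_def divide_simps)
    finally show ?thesis .
  qed
  have "norm (Y x - Y s) \<le> 2 * d * (x - s) * norm (Y s)"
  proof (rule short_time_bound[where Y = Y and T = T])
    fix y assume y: "y \<in> {s..x}"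
    then have y': "y \<in> {0..b}" using sx Suc.prems by auto
    show "(Y has_vector_derivative T y * Y y) (at y within {s..x})"
      by (rule has_vector_derivative_within_subset[OF Y[OF y']]) (use sx Suc.prems in auto)
    show "norm (T y) \<le> d" by (rule T[OF y'])
  qed (use sx dh in auto)
  also have "\<dots> \<le> 1 * norm (Y s)" using dh by (intro mult_right_mono) auto
  finally have "norm (Y x) \<le> 2 * norm (Y s)" using norm_triangle_sub[of "Y x" "Y s"] by simp
  also have "norm (Y s) \<le> 2 ^ n" by (rule Suc.IH) (use sx in \<open>auto simp: h_def\<close>)
  finally show ?case by simp
qed

text \<open>For the fundamental solutions \<open>Y z\<close> and \<open>Y (z + h)\<close> the quotient \<open>h\<inverse> (Y z\<inverse> Y (z + h) - 1)\<close>
  has the derivative \<open>Y z\<inverse> (h\<inverse> (B (z + h) - B z)) Y (z + h)\<close>, which is Cauchy as \<open>h \<rightarrow> 0\<close> uniformly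
  on the interval. This avoids integrating the variational equation.\<close>

lemma solution_holomorphic:
  fixes B Y :: "real \<Rightarrow> complex \<Rightarrow> 'n::finite cmat"
  assumes l: "l \<ge> 0"
    and Y: "\<And>x z. x \<in> {0..l} \<Longrightarrow> ((\<lambda>x. Y x z) has_vector_derivative B x z * Y x z) (at x within {0..l})"
    and Y0: "\<And>z. Y 0 z = 1"
    and B: "\<And>x i j. x \<in> {0..l} \<Longrightarrow> (\<lambda>z. ent (B x z) i j) holomorphic_on UNIV"
    and C: "\<And>x z. x \<in> {0..l} \<Longrightarrow> norm (z - z0) < 3 \<Longrightarrow> norm (B x z) \<le> C"
    and z: "norm (z - z0) < 1"
  shows "(\<lambda>z. ent (Y l z) i j) field_differentiable (at z)"
proof -
  have near: "norm (w - z0) < 3" if "w \<in> ball z 2" for w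
  proof -
    have "norm (w - z) < 2" using that by (simp add: dist_norm norm_minus_commute)
    moreover have "norm (w - z0) \<le> norm (w - z) + norm (z - z0)" by norm
    ultimately show ?thesis using z by linarith
  qed
  have zz: "norm (z + h - z0) < 3" if "norm h < 1/2" for h
    using that near[of "z + h"] by (simp add: dist_norm)
  have "norm (B 0 z) \<le> C" using l z by (intro C) auto
  then have C0: "C \<ge> 0" by (rule order_trans[OF norm_ge_zero])
  have inv: "has_inverse (Y x z)" if "x \<in> {0..l}" for x
    by (rule solution_has_inverse[of l "\<lambda>x. Y x z" "\<lambda>x. B x z" C]) (use Y Y0 C z that in auto)
  then have "\<exists>\<Phi>. \<forall>x\<in>{0..l}. \<Phi> x * Y x z = 1 \<and> Y x z * \<Phi> x = 1" unfolding has_inverse_def by metis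
  then obtain \<Phi> where \<Phi>: "\<And>x. x \<in> {0..l} \<Longrightarrow> \<Phi> x * Y x z = 1" "\<And>x. x \<in> {0..l} \<Longrightarrow> Y x z * \<Phi> x = 1" by metis
  have \<Phi>': "(\<Phi> has_vector_derivative - (\<Phi> x * (B x z * Y x z) * \<Phi> x)) (at x within {0..l})" if "x \<in> {0..l}" for x
    by (rule has_vector_derivative_inverse_algebra[OF Y[OF that] that \<Phi>])
  have "continuous_on {0..l} \<Phi>"
    using \<Phi>' by (meson continuous_on_eq_continuous_within has_vector_derivative_continuous)
  then have "bounded (\<Phi> ` {0..l})" by (intro compact_imp_bounded compact_continuous_image) auto
  then obtain K1 where K1: "\<And>x. x \<in> {0..l} \<Longrightarrow> norm (\<Phi> x) \<le> K1" unfolding bounded_iff by blast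
  have K10: "K1 \<ge> 0" by (rule order_trans[OF norm_ge_zero K1[of 0]]) (use l in simp)
  have "continuous_on {0..l} (\<lambda>x. Y x z)"
    using Y by (meson continuous_on_eq_continuous_within has_vector_derivative_continuous)
  then have "bounded ((\<lambda>x. Y x z) ` {0..l})" by (intro compact_imp_bounded compact_continuous_image) auto
  then obtain K2 where K2: "\<And>x. x \<in> {0..l} \<Longrightarrow> norm (Y x z) \<le> K2" unfolding bounded_iff by blast
  have K20: "K2 \<ge> 0" by (rule order_trans[OF norm_ge_zero K2[of 0]]) (use l in simp)
  define \<Delta> where "\<Delta> h x = sc (1 / h) * (B x (z + h) - B x z)" for h x
  define n where "n = real CARD('n) * real CARD('n)"
  have Bent: "norm (ent (B x w) i j) \<le> C" if "x \<in> {0..l}" "w \<in> ball z 2" for x w i j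
    by (rule order_trans[OF norm_ent_le C[OF that(1) near[OF that(2)]]])
  have Bhol: "(\<lambda>z. ent (B x z) i j) holomorphic_on ball z 2" if "x \<in> {0..l}" for x i j
    using B[OF that] by (rule holomorphic_on_subset) simp
  have \<Delta>ent: "ent (\<Delta> h x) i j = (ent (B x (z + h)) i j - ent (B x z) i j) / h" for h x i j
    by (simp add: \<Delta>_def)
  have \<Delta>1: "norm (\<Delta> h x) \<le> n * (3 * C)" if "x \<in> {0..l}" "h \<noteq> 0" "norm h < 1/2" for h x
  proof -
    have "norm (\<Delta> h x) \<le> (\<Sum>i\<in>UNIV. \<Sum>j\<in>UNIV. norm (ent (\<Delta> h x) i j))" by (rule norm_cmat_le_sum)
    also have "\<dots> \<le> (\<Sum>i\<in>(UNIV::'n set). \<Sum>j\<in>(UNIV::'n set). 3 * C)" unfolding \<Delta>ent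
      by (intro sum_mono holomorphic_quotient_bounds(1)[OF Bhol[OF that(1)] Bent[OF that(1)] that(2,3)])
    finally show ?thesis by (simp add: n_def)
  qed
  have \<Delta>2: "norm (\<Delta> h x - \<Delta> k x) \<le> n * (2 * C * (norm h + norm k))"
    if "x \<in> {0..l}" "h \<noteq> 0" "norm h < 1/2" "k \<noteq> 0" "norm k < 1/2" for h k x
  proof -
    have e: "norm (ent (\<Delta> h x - \<Delta> k x) i j) \<le> 2 * C * (norm h + norm k)" for i j
    proof -
      define D where "D = deriv (\<lambda>z. ent (B x z) i j) z"
      have "norm (ent (\<Delta> h x) i j - D) \<le> 2 * C * norm h" "norm (ent (\<Delta> k x) i j - D) \<le> 2 * C * norm k"
        unfolding \<Delta>ent D_def
        by (rule holomorphic_quotient_bounds(2)[OF Bhol[OF that(1)] Bent[OF that(1)]]; use that in simp)+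
      moreover have "norm (ent (\<Delta> h x - \<Delta> k x) i j) \<le> norm (ent (\<Delta> h x) i j - D) + norm (ent (\<Delta> k x) i j - D)"
        unfolding ent_simps by norm
      ultimately show ?thesis by (simp add: distrib_left)
    qed
    have "norm (\<Delta> h x - \<Delta> k x) \<le> (\<Sum>i\<in>UNIV. \<Sum>j\<in>UNIV. norm (ent (\<Delta> h x - \<Delta> k x) i j))" by (rule norm_cmat_le_sum)
    also have "\<dots> \<le> (\<Sum>i\<in>(UNIV::'n set). \<Sum>j\<in>(UNIV::'n set). 2 * C * (norm h + norm k))" by (intro sum_mono e)
    finally show ?thesis by (simp add: n_def)
  qed
  define Q where "Q h x = sc (1 / h) * (\<Phi> x * Y x (z + h) - 1)" for h x
  have bl: "bounded_linear (\<lambda>a. sc w * a)" for w :: complex by (rule bounded_linear_mult_right)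
  have Q': "(Q h has_vector_derivative \<Phi> x * \<Delta> h x * Y x (z + h)) (at x within {0..l})" if x: "x \<in> {0..l}" for h x
  proof -
    have "((\<lambda>x. sc (1 / h) * (\<Phi> x * Y x (z + h) - 1)) has_vector_derivative
        sc (1 / h) * (\<Phi> x * (B x (z + h) * Y x (z + h)) + - (\<Phi> x * (B x z * Y x z) * \<Phi> x) * Y x (z + h) - 0)) (at x within {0..l})"
      by (intro has_vector_derivative_mult_right has_vector_derivative_diff has_vector_derivative_mult \<Phi>' Y x has_vector_derivative_const)
    moreover have "sc (1 / h) * (\<Phi> x * (B x (z + h) * Y x (z + h)) + - (\<Phi> x * (B x z * Y x z) * \<Phi> x) * Y x (z + h) - 0) =
        \<Phi> x * \<Delta> h x * Y x (z + h)"
    proof -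
      have "\<Phi> x * (B x z * Y x z) * \<Phi> x = \<Phi> x * B x z * (Y x z * \<Phi> x)" by (simp only: mult.assoc)
      also have "\<dots> = \<Phi> x * B x z" using \<Phi>(2)[OF x] by simp
      finally have "\<Phi> x * (B x (z + h) * Y x (z + h)) + - (\<Phi> x * (B x z * Y x z) * \<Phi> x) * Y x (z + h) - 0 =
          \<Phi> x * (B x (z + h) - B x z) * Y x (z + h)" by (simp add: algebra_simps)
      then have "sc (1 / h) * (\<Phi> x * (B x (z + h) * Y x (z + h)) + - (\<Phi> x * (B x z * Y x z) * \<Phi> x) * Y x (z + h) - 0) =
          (sc (1 / h) * \<Phi> x) * ((B x (z + h) - B x z) * Y x (z + h))" by (simp only: mult.assoc)
      also have "sc (1 / h) * \<Phi> x = \<Phi> x * sc (1 / h)" by (rule sc_commute)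
      finally show ?thesis by (simp only: \<Delta>_def mult.assoc)
    qed
    ultimately show ?thesis unfolding Q_def by simp
  qed
  have Q0: "Q h 0 = 0" for h using \<Phi>(1)[of 0] l Y0 by (simp add: Q_def)
  have YQ: "Y x (z + h) - Y x z = sc h * (Y x z * Q h x)" if x: "x \<in> {0..l}" and h: "h \<noteq> 0" for x h
  proof -
    have "sc h * (Y x z * Q h x) = (sc h * Y x z) * (sc (1 / h) * (\<Phi> x * Y x (z + h) - 1))" by (simp only: Q_def mult.assoc)
    also have "\<dots> = Y x z * (sc h * sc (1 / h)) * (\<Phi> x * Y x (z + h) - 1)" by (simp only: sc_commute[of h] mult.assoc)
    also have "sc h * sc (1 / h) = (1 :: 'n cmat)" using h by (simp add: sc_simps flip: sc_simps(1))
    also have "Y x z * 1 * (\<Phi> x * Y x (z + h) - 1) = (Y x z * \<Phi> x) * Y x (z + h) - Y x z" by (simp add: algebra_simps)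
    finally show ?thesis using \<Phi>(2)[OF x] by simp
  qed
  \<comment> \<open>A bound independent of \<open>h\<close>. It comes from the growth estimate,
    because continuity of the solution in the parameter is not known at this point.\<close>
  obtain K3 where K3: "K3 \<ge> 0" "\<And>x h. x \<in> {0..l} \<Longrightarrow> norm h < 1/2 \<Longrightarrow> norm (Y x (z + h)) \<le> K3"
  proof -
    obtain N where N: "l \<le> real N * (1 / (2 * (C + 1)))"
      using C0 ex_less_of_nat_mult[of "1 / (2 * (C + 1))" l] less_imp_le by auto
    have "norm (Y x (z + h)) \<le> 2 ^ N" if x: "x \<in> {0..l}" and h: "norm h < 1/2" for x h
    proof (rule solution_growth[where T = "\<lambda>x. B x (z + h)" and b = l and d = C])
      show "x \<le> real N * (1 / (2 * (C + 1)))" using x N by auto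
    qed (use Y Y0 C zz[OF h] C0 x in auto)
    then show ?thesis using that[of "2 ^ N"] by simp
  qed
  define K4 where "K4 = K1 * (n * (3 * C)) * K3 * l"
  have n0: "n \<ge> 0" by (simp add: n_def)
  have lx: "0 \<in> {0..l}" "l \<in> {0..l}" using l by auto
  have Qb: "norm (Q h x) \<le> K4" if x: "x \<in> {0..l}" and h: "h \<noteq> 0" "norm h < 1/2" for h x
  proof -
    have "norm (Q h x - Q h 0) \<le> (K1 * (n * (3 * C)) * K3) * \<bar>x - 0\<bar>"
    proof (rule vector_derivative_bound[OF _ Q' _ x lx(1)])
      fix y assume y: "y \<in> {0..l}"
      show "norm (\<Phi> y * \<Delta> h y * Y y (z + h)) \<le> K1 * (n * (3 * C)) * K3"
        by (rule order_trans[OF norm_mult3]) (intro mult_mono K1 \<Delta>1 K3(2) y h mult_nonneg_nonneg norm_ge_zero K10 n0; use C0 in simp)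
    qed simp_all
    also have "\<dots> \<le> K4" unfolding K4_def using x K10 K3 n0 C0 by (intro mult_left_mono) auto
    finally show ?thesis by (simp add: Q0)
  qed
  have Yd: "norm (Y x (z + h) - Y x z) \<le> norm h * (K2 * K4)" if x: "x \<in> {0..l}" and h: "h \<noteq> 0" "norm h < 1/2" for h x
  proof -
    have "norm (sc h * (Y x z * Q h x)) \<le> norm (sc h :: 'n cmat) * (norm (Y x z) * norm (Q h x))"
      by (rule order_trans[OF norm_mult_ineq]) (simp add: mult_left_mono norm_mult_ineq)
    also have "\<dots> \<le> norm h * (K2 * K4)" using K2[OF x] Qb[OF x h] K20 by (auto intro!: mult_left_mono mult_mono)
    finally show ?thesis unfolding YQ[OF x h(1)] .
  qed
  define K5 where "K5 = K1 * (n * (2 * C)) * K3 + K1 * (n * (3 * C)) * (2 * (K2 * K4))"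
  have QQ: "norm (Q h l - Q k l) \<le> (K5 * (norm h + norm k)) * l"
    if h: "h \<noteq> 0" "norm h < 1/2" and k: "k \<noteq> 0" "norm k < 1/2" for h k
  proof -
    have "norm ((Q h l - Q k l) - (Q h 0 - Q k 0)) \<le> (K5 * (norm h + norm k)) * \<bar>l - 0\<bar>"
    proof (rule vector_derivative_bound[where S = "{0..l}" and f = "\<lambda>x. Q h x - Q k x"
          and f' = "\<lambda>x. \<Phi> x * \<Delta> h x * Y x (z + h) - \<Phi> x * \<Delta> k x * Y x (z + k)"])
      fix x assume x: "x \<in> {0..l}"
      show "((\<lambda>x. Q h x - Q k x) has_vector_derivative \<Phi> x * \<Delta> h x * Y x (z + h) - \<Phi> x * \<Delta> k x * Y x (z + k)) (at x within {0..l})"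
        by (intro has_vector_derivative_diff Q' x)
      have Ydiff: "norm (Y x (z + h) - Y x (z + k)) \<le> 2 * (K2 * K4) * (norm h + norm k)"
      proof -
        have K4: "K4 \<ge> 0" using K10 K3 n0 C0 l by (simp add: K4_def)
        have "norm (Y x (z + h) - Y x (z + k)) \<le> norm (Y x (z + h) - Y x z) + norm (Y x (z + k) - Y x z)" by norm
        also have "\<dots> \<le> norm h * (K2 * K4) + norm k * (K2 * K4)" by (intro add_mono Yd x h k)
        also have "\<dots> \<le> 2 * (K2 * K4) * (norm h + norm k)"
          using K4 K20 by (simp add: algebra_simps)
        finally show ?thesis .
      qed
      have "\<Phi> x * \<Delta> h x * Y x (z + h) - \<Phi> x * \<Delta> k x * Y x (z + k) =
          \<Phi> x * (\<Delta> h x - \<Delta> k x) * Y x (z + h) + \<Phi> x * \<Delta> k x * (Y x (z + h) - Y x (z + k))"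
        by (simp add: algebra_simps)
      also have "norm \<dots> \<le> norm (\<Phi> x) * norm (\<Delta> h x - \<Delta> k x) * norm (Y x (z + h)) +
          norm (\<Phi> x) * norm (\<Delta> k x) * norm (Y x (z + h) - Y x (z + k))"
        by (rule order_trans[OF norm_triangle_ineq]) (intro add_mono norm_mult3)
      also have "\<dots> \<le> K1 * (n * (2 * C * (norm h + norm k))) * K3 + K1 * (n * (3 * C)) * (2 * (K2 * K4) * (norm h + norm k))"
        by (intro add_mono mult_mono K1 x \<Delta>1 \<Delta>2 h k K3(2) Ydiff mult_nonneg_nonneg norm_ge_zero K10 n0 add_nonneg_nonneg; use C0 in simp)
      also have "\<dots> = K5 * (norm h + norm k)" by (simp add: K5_def algebra_simps)
      finally show "norm (\<Phi> x * \<Delta> h x * Y x (z + h) - \<Phi> x * \<Delta> k x * Y x (z + k)) \<le> K5 * (norm h + norm k)" .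
    qed (use lx in auto)
    then show ?thesis using l by (simp add: Q0)
  qed
  show ?thesis
  proof (rule Cauchy_quotients_imp_differentiable[of "1/2" _ _ "K2 * (K5 * l)"])
    fix h k :: complex assume h: "h \<noteq> 0" and k: "k \<noteq> 0" and hn: "norm h < 1/2" and kn: "norm k < 1/2"
    have e: "(ent (Y l (z + h)) i j - ent (Y l z) i j) / h = ent (Y l z * Q h l) i j" if "h \<noteq> 0" for h
    proof -
      have "ent (Y l (z + h)) i j - ent (Y l z) i j = ent (Y l (z + h) - Y l z) i j" by simp
      also have "\<dots> = h * ent (Y l z * Q h l) i j" unfolding YQ[OF lx(2) that] by simp
      finally show ?thesis using that by simp
    qed
    have "norm (ent (Y l z * Q h l) i j - ent (Y l z * Q k l) i j) = norm (ent (Y l z * (Q h l - Q k l)) i j)"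
      by (simp add: right_diff_distrib)
    also have "\<dots> \<le> norm (Y l z * (Q h l - Q k l))" by (rule norm_ent_le)
    also have "\<dots> \<le> norm (Y l z) * norm (Q h l - Q k l)" by (rule norm_mult_ineq)
    also have "\<dots> \<le> K2 * ((K5 * (norm h + norm k)) * l)"
      by (intro mult_mono K2 lx QQ h k hn kn K20) simp
    also have "\<dots> = K2 * (K5 * l) * (norm h + norm k)" by (simp only: mult_ac)
    finally show "norm ((ent (Y l (z + h)) i j - ent (Y l z) i j) / h - (ent (Y l (z + k)) i j - ent (Y l z) i j) / k)
        \<le> K2 * (K5 * l) * (norm h + norm k)" unfolding e[OF h] e[OF k] .
  qed simp
qed

section \<open>The wave family\<close>

lemma matrix_inv_mult:
  fixes A :: "complex^'n^'n"
  assumes "invertible A" shows "matrix_inv A ** A = mat 1" "A ** matrix_inv A = mat 1"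
proof -
  have "\<exists>A'. A ** A' = mat 1 \<and> A' ** A = mat 1" using assms by (simp add: invertible_def)
  from someI_ex[OF this] show "matrix_inv A ** A = mat 1" "A ** matrix_inv A = mat 1"
    unfolding matrix_inv_def by auto
qed

lemma cmat_has_vector_derivative:
  "(f has_vector_derivative D) G \<Longrightarrow> ((\<lambda>x. cmat (f x)) has_vector_derivative cmat D) G"
  by (rule bounded_linear.has_vector_derivative[OF bounded_linear_cmat])

lemma has_vector_derivative_reflect:
  assumes "(f has_vector_derivative D) (at (a - x) within T)" "\<And>y. y \<in> S \<Longrightarrow> a - y \<in> T"
  shows "((\<lambda>y. f (a - y)) has_vector_derivative - D) (at x within S)"
proof -
  have "((\<lambda>y. a - y) has_vector_derivative -1) (at x within S)" by (auto intro!: derivative_eq_intros)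
  moreover have "(f has_vector_derivative D) (at (a - x) within (\<lambda>y. a - y) ` S)"
    by (rule has_vector_derivative_within_subset[OF assms(1)]) (use assms(2) in auto)
  ultimately show ?thesis using vector_diff_chain_within[of "\<lambda>y. a - y" "-1" x S f D] by (simp add: o_def)
qed

text \<open>Negative times are reached by reflection, with the generator changing sign. A bound on
  the disc of radius 3 leaves room for a disc of radius 2 about every point of the unit disc, as the
  difference quotients require.\<close>

lemma solution_operator_facts:
  fixes B :: "real \<Rightarrow> complex \<Rightarrow> complex^'n^'n"
  assumes sol: "solution_operator B \<Psi>" and an: "\<And>x. matrix_analytic_on (B x) UNIV" and l: "l \<ge> 0"
    and C: "\<forall>x z. \<bar>x\<bar> \<le> l \<longrightarrow> norm (z - z0) < 3 \<longrightarrow> norm (cmat (B x z)) \<le> C"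
  shows solution_operator_zero: "cmat (\<Psi> 0 z) = 1"
    and solution_operator_forward: "((\<lambda>y. cmat (\<Psi> y z)) has_vector_derivative cmat (B x z) * cmat (\<Psi> x z)) (at x within S)"
    and solution_operator_backward: "((\<lambda>y. cmat (\<Psi> (a - y) z)) has_vector_derivative (- cmat (B (a - x) z)) * cmat (\<Psi> (a - x) z)) (at x within S)"
    and solution_operator_inverse: "x \<in> {0..l} \<Longrightarrow> norm (z - z0) < 3 \<Longrightarrow> has_inverse (cmat (\<Psi> x z)) \<and> has_inverse (cmat (\<Psi> (- x) z))"
    and solution_operator_analytic: "(\<lambda>z. ent (cmat (\<Psi> l z)) i j) analytic_on ball z0 1" "(\<lambda>z. ent (cmat (\<Psi> (- l) z)) i j) analytic_on ball z0 1"
proof -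
  have d: "((\<lambda>y. \<Psi> y z) has_vector_derivative B x z ** \<Psi> x z) (at x within S)" for x z S
    using sol by (auto simp: solution_operator_def intro: has_vector_derivative_at_within)
  show zero: "cmat (\<Psi> 0 z) = 1" for z using sol by (simp add: solution_operator_def cmat_simps(5))
  show fw: "((\<lambda>y. cmat (\<Psi> y z)) has_vector_derivative cmat (B x z) * cmat (\<Psi> x z)) (at x within S)" for x z S
    using cmat_has_vector_derivative[OF d] unfolding cmat_simps(3) .
  show bw: "((\<lambda>y. cmat (\<Psi> (a - y) z)) has_vector_derivative (- cmat (B (a - x) z)) * cmat (\<Psi> (a - x) z)) (at x within S)" for a x z S
    using has_vector_derivative_reflect[of "\<lambda>y. cmat (\<Psi> y z)", OF fw[where S = UNIV]] by simp
  have bw0: "((\<lambda>y. cmat (\<Psi> (- y) z)) has_vector_derivative (- cmat (B (- x) z)) * cmat (\<Psi> (- x) z)) (at x within S)" for x z S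
    using bw[of 0] by simp
  show "has_inverse (cmat (\<Psi> x z)) \<and> has_inverse (cmat (\<Psi> (- x) z))" if "x \<in> {0..l}" "norm (z - z0) < 3" for x z
  proof
    show "has_inverse (cmat (\<Psi> x z))"
      by (rule solution_has_inverse[where Y = "\<lambda>x. cmat (\<Psi> x z)" and b = l and d = C, OF fw])
        (use that C zero in auto)
    show "has_inverse (cmat (\<Psi> (- x) z))"
      by (rule solution_has_inverse[where Y = "\<lambda>x. cmat (\<Psi> (- x) z)" and b = l and d = C, OF bw0])
        (use that C zero in auto)
  qed
  have Bh: "(\<lambda>z. ent (cmat (B x z)) i j) holomorphic_on UNIV" for x i j
    unfolding cmat_simps using an[of x] by (simp add: matrix_analytic_on_def analytic_imp_holomorphic)
  have "(\<lambda>z. ent (cmat (\<Psi> l z)) i j) field_differentiable (at z)" if "norm (z - z0) < 1" for z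
    by (rule solution_holomorphic[where B = "\<lambda>x z. cmat (B x z)" and C = C, OF l fw zero Bh _ that]) (use C in auto)
  then show "(\<lambda>z. ent (cmat (\<Psi> l z)) i j) analytic_on ball z0 1"
    by (subst analytic_on_open) (auto simp: holomorphic_on_def dist_norm norm_minus_commute intro: field_differentiable_at_within)
  have Bh': "(\<lambda>z. ent (- cmat (B (- x) z)) i j) holomorphic_on UNIV" for x i j
    unfolding ent_simps by (intro holomorphic_intros Bh)
  have "(\<lambda>z. ent (cmat (\<Psi> (- l) z)) i j) field_differentiable (at z)" if "norm (z - z0) < 1" for z
    by (rule solution_holomorphic[where Y = "\<lambda>x z. cmat (\<Psi> (- x) z)" and B = "\<lambda>x z. - cmat (B (- x) z)" and C = C, OF l bw0 _ Bh' _ that])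
      (use C zero in auto)
  then show "(\<lambda>z. ent (cmat (\<Psi> (- l) z)) i j) analytic_on ball z0 1"
    by (subst analytic_on_open) (auto simp: holomorphic_on_def dist_norm norm_minus_commute intro: field_differentiable_at_within)
qed

text \<open>Both sides of \<open>\<Psi> (L / 2) = \<Psi> (- L / 2) \<Psi> L\<close> solve the reflected system, by periodicity.\<close>

lemma periodic_evans_factor:
  fixes B :: "real \<Rightarrow> complex \<Rightarrow> complex^'n^'n"
  assumes sol: "solution_operator B \<Psi>" and an: "\<And>x. matrix_analytic_on (B x) UNIV" and L: "L / 2 \<ge> 0"
    and C: "\<forall>x z. \<bar>x\<bar> \<le> L / 2 \<longrightarrow> norm (z - z0) < 3 \<longrightarrow> norm (cmat (B x z)) \<le> C"
    and per: "\<And>x. B (x + L) z = B x z" and z: "norm (z - z0) < 3"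
  shows "cdet (cmat (\<Psi> (L / 2) z) - sc \<gamma> * cmat (\<Psi> (- (L / 2)) z)) = cdet (cmat (\<Psi> (- (L / 2)) z)) * periodic_evans \<Psi> L \<gamma> z"
proof -
  note facts = solution_operator_facts[OF sol an L C]
  have p: "B (L - x) z = B (- x) z" for x using per[of "- x"] by simp
  have "cmat (\<Psi> (L - L / 2) z) = cmat (\<Psi> (- (L / 2)) z) * cmat (\<Psi> (L - 0) z)"
  proof (rule solution_quotient[where T = "\<lambda>x. - cmat (B (- x) z)" and Y = "\<lambda>x. cmat (\<Psi> (- x) z)" and Z = "\<lambda>x. cmat (\<Psi> (L - x) z)"])
    show "L / 2 \<ge> 0" by (rule L)
    show "((\<lambda>y. cmat (\<Psi> (- y) z)) has_vector_derivative (- cmat (B (- x) z)) * cmat (\<Psi> (- x) z)) (at x within {0..L / 2})" for x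
      using facts(3)[where a = 0 and z = z and x = x] by simp
    show "((\<lambda>y. cmat (\<Psi> (L - y) z)) has_vector_derivative (- cmat (B (- x) z)) * cmat (\<Psi> (L - x) z)) (at x within {0..L / 2})" for x
      using facts(3)[where a = L and z = z and x = x] unfolding p .
    show "cmat (\<Psi> (- 0) z) = 1" using facts(1) by simp
    show "has_inverse (cmat (\<Psi> (- x) z))" if "x \<in> {0..L / 2}" for x using facts(4)[OF that z] by blast
  qed
  then have "cmat (\<Psi> (L / 2) z) = cmat (\<Psi> (- (L / 2)) z) * cmat (\<Psi> L z)" by simp
  then have "cmat (\<Psi> (L / 2) z) - sc \<gamma> * cmat (\<Psi> (- (L / 2)) z) = cmat (\<Psi> (- (L / 2)) z) * (cmat (\<Psi> L z) - sc \<gamma>)"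
    unfolding sc_commute by (simp only: right_diff_distrib)
  then show ?thesis
    unfolding periodic_evans_def by (simp only: cdet_simps cmat_simps(2,4) flip: cmat_simps(6))
qed

text \<open>Through (H3) and two applications of (H2), at \<open>x\<close> and at 0, the matrix
  \<open>A \<epsilon> x z\<close> stays within a fixed distance of \<open>A 0 0 z\<close>, which is
  continuous in \<open>z\<close> on a compact disc.\<close>

lemma system_bound:
  fixes A :: "real \<Rightarrow> real \<Rightarrow> complex \<Rightarrow> complex^'n^'n"
  assumes family: "wave_family A X" and rates: "\<nu> > 0" "\<theta> > 0"
    and H2: "\<forall>M>0. \<exists>C>0. \<forall>x z. norm z \<le> M \<longrightarrow> norm (A 0 x z - Ainf z) \<le> C * exp (- \<nu> * \<bar>x\<bar>)"
    and H3: "\<forall>M>0. \<exists>C>0. \<forall>\<epsilon>>0. \<forall>x z. norm z \<le> M \<and> \<bar>x\<bar> \<le> X \<epsilon> / 2 \<longrightarrow>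
               norm (A \<epsilon> x z - A 0 x z) \<le> C * exp (- \<theta> * X \<epsilon> / 2)"
  shows "\<exists>C. \<forall>\<epsilon>>0. \<forall>x z. \<bar>x\<bar> \<le> X \<epsilon> / 2 \<longrightarrow> norm (z - z0) < 3 \<longrightarrow> norm (cmat (A \<epsilon> x z)) \<le> C"
proof -
  define M where "M = norm z0 + 3"
  have M: "M > 0" unfolding M_def using norm_ge_zero[of z0] by linarith
  obtain C2 where C2': "C2 > 0 \<and> (\<forall>x z. norm z \<le> M \<longrightarrow> norm (A 0 x z - Ainf z) \<le> C2 * exp (- \<nu> * \<bar>x\<bar>))"
    using H2[rule_format, OF M] by (rule exE)
  obtain C3 where C3': "C3 > 0 \<and> (\<forall>\<epsilon>>0. \<forall>x z. norm z \<le> M \<and> \<bar>x\<bar> \<le> X \<epsilon> / 2 \<longrightarrow>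
      norm (A \<epsilon> x z - A 0 x z) \<le> C3 * exp (- \<theta> * X \<epsilon> / 2))"
    using H3[rule_format, OF M] by (rule exE)
  note C2 = C2'[THEN conjunct1] C2'[THEN conjunct2, rule_format]
  note C3 = C3'[THEN conjunct1] C3'[THEN conjunct2, rule_format]
  have "continuous_on (cball z0 3) (\<lambda>z. A 0 0 z $ i $ j)" for i j
  proof -
    have "(\<lambda>z. A 0 0 z $ i $ j) analytic_on UNIV" using family by (simp add: wave_family_def matrix_analytic_on_def)
    from holomorphic_on_imp_continuous_on[OF analytic_imp_holomorphic[OF this]] show ?thesis
      by (rule continuous_on_subset) simp
  qed
  then have "continuous_on (cball z0 3) (\<lambda>z. \<Sum>i\<in>UNIV. \<Sum>j\<in>UNIV. norm (A 0 0 z $ i $ j))"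
    by (intro continuous_on_sum continuous_on_norm)
  then have "\<exists>w\<in>cball z0 3. \<forall>z\<in>cball z0 3. (\<Sum>i\<in>UNIV. \<Sum>j\<in>UNIV. norm (A 0 0 z $ i $ j)) \<le> (\<Sum>i\<in>UNIV. \<Sum>j\<in>UNIV. norm (A 0 0 w $ i $ j))"
    by (rule continuous_attains_sup[OF compact_cball, rotated]) simp
  then obtain w where w: "\<And>z. z \<in> cball z0 3 \<Longrightarrow> (\<Sum>i\<in>UNIV. \<Sum>j\<in>UNIV. norm (A 0 0 z $ i $ j)) \<le> (\<Sum>i\<in>UNIV. \<Sum>j\<in>UNIV. norm (A 0 0 w $ i $ j))"
    by blast
  define K0 where "K0 = (\<Sum>i\<in>UNIV. \<Sum>j\<in>UNIV. norm (A 0 0 w $ i $ j))"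
  define N where "N = real CARD('n) * real CARD('n)"
  have N: "N \<ge> 0" unfolding N_def by simp
  have "norm (cmat (A \<epsilon> x z)) \<le> N * C3 + N * C2 + N * C2 + K0" if e: "\<epsilon> > 0" and x: "\<bar>x\<bar> \<le> X \<epsilon> / 2" and z: "norm (z - z0) < 3" for \<epsilon> x z
  proof -
    have zM: "norm z \<le> M" using norm_triangle_ineq[of "z - z0" z0] z by (simp add: M_def)
    have "X \<epsilon> > 0" using family e by (simp add: wave_family_def)
    then have "0 \<le> \<theta> * X \<epsilon>" using rates by simp
    then have "C3 * exp (- \<theta> * X \<epsilon> / 2) \<le> C3 * 1" by (intro mult_left_mono less_imp_le[OF C3(1)]) simp
    then have 1: "norm (A \<epsilon> x z - A 0 x z) \<le> C3" using C3(2)[OF e conjI[OF zM x]] by simp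
    have 2: "norm (A 0 y z - Ainf z) \<le> C2" for y
    proof -
      have "0 \<le> \<nu> * \<bar>y\<bar>" using rates by simp
      then have "C2 * exp (- \<nu> * \<bar>y\<bar>) \<le> C2 * 1" by (intro mult_left_mono less_imp_le[OF C2(1)]) simp
      then show ?thesis using C2(2)[OF zM, of y] by simp
    qed
    have c: "norm (cmat D) \<le> N * k" if "norm D \<le> k" for D :: "complex^'n^'n" and k
      by (rule order_trans[OF norm_cmat_le[of D, folded N_def] mult_left_mono[OF that N]])
    have "norm (cmat (A 0 0 z)) \<le> (\<Sum>i\<in>UNIV. \<Sum>j\<in>UNIV. norm (ent (cmat (A 0 0 z)) i j))" by (rule norm_cmat_le_sum)
    also have "\<dots> \<le> K0" unfolding cmat_simps K0_def by (rule w) (use z in \<open>simp add: dist_norm norm_minus_commute\<close>)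
    finally have 4: "norm (cmat (A 0 0 z)) \<le> K0" .
    have n4: "norm (b1 + b2 - b3 + b4) \<le> norm b1 + norm b2 + norm b3 + norm b4" for b1 b2 b3 b4 :: "'n cmat"
      using norm_triangle_ineq[of "b1 + b2 - b3" b4] norm_triangle_ineq4[of "b1 + b2" b3] norm_triangle_ineq[of b1 b2] by linarith
    have "cmat (A \<epsilon> x z) = cmat (A \<epsilon> x z - A 0 x z) + cmat (A 0 x z - Ainf z) - cmat (A 0 0 z - Ainf z) + cmat (A 0 0 z)"
      unfolding cmat_simps(2) by simp
    also have "norm \<dots> \<le> norm (cmat (A \<epsilon> x z - A 0 x z)) + norm (cmat (A 0 x z - Ainf z)) + norm (cmat (A 0 0 z - Ainf z)) + norm (cmat (A 0 0 z))"
      by (rule n4)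
    also have "\<dots> \<le> N * C3 + N * C2 + N * C2 + K0" by (intro add_mono c 1 2 4)
    finally show ?thesis .
  qed
  then show ?thesis by (intro exI[of _ "N * C3 + N * C2 + N * C2 + K0"] allI impI)
qed

text \<open>By (H2) the limit matrix is a locally uniform limit of the analytic matrices
  \<open>A 0 x\<close> as \<open>x\<close> tends to infinity.\<close>

lemma limit_matrix_continuous:
  fixes A :: "real \<Rightarrow> real \<Rightarrow> complex \<Rightarrow> complex^'n^'n"
  assumes family: "wave_family A X" and \<nu>: "\<nu> > 0"
    and H2: "\<forall>M>0. \<exists>C>0. \<forall>x z. norm z \<le> M \<longrightarrow> norm (A 0 x z - Ainf z) \<le> C * exp (- \<nu> * \<bar>x\<bar>)"
  shows "((\<lambda>z. cmat (Ainf z)) \<longlongrightarrow> cmat (Ainf z0)) (nhds z0)"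
proof (rule tendsto_cmatI)
  fix i j
  have "norm z0 + 3 > 0" using norm_ge_zero[of z0] by linarith
  then obtain C where C: "\<And>x z. norm z \<le> norm z0 + 3 \<Longrightarrow> norm (A 0 x z - Ainf z) \<le> C * exp (- \<nu> * \<bar>x\<bar>)" using H2 by blast
  have "continuous_on (ball z0 3) (\<lambda>z. Ainf z $ i $ j)"
  proof (rule uniform_limit_theorem[where F = "at_top :: real filter" and f = "\<lambda>x z. A 0 x z $ i $ j"])
    show "\<forall>\<^sub>F x in at_top. continuous_on (ball z0 3) (\<lambda>z. A 0 x z $ i $ j)"
    proof (rule always_eventually, rule allI)
      fix x
      have "(\<lambda>z. A 0 x z $ i $ j) analytic_on UNIV" using family by (simp add: wave_family_def matrix_analytic_on_def)
      from holomorphic_on_imp_continuous_on[OF analytic_imp_holomorphic[OF this]]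
      show "continuous_on (ball z0 3) (\<lambda>z. A 0 x z $ i $ j)" by (rule continuous_on_subset) simp
    qed
    show "uniform_limit (ball z0 3) (\<lambda>x z. A 0 x z $ i $ j) (\<lambda>z. Ainf z $ i $ j) (at_top :: real filter)"
    proof (rule uniform_limitI)
      fix e :: real assume e: "e > 0"
      have "((\<lambda>x. C * exp (- \<nu> * x)) \<longlongrightarrow> 0) at_top" using \<nu> by real_asymp
      then have "\<forall>\<^sub>F x in at_top. C * exp (- \<nu> * x) < e" using e by (rule order_tendstoD(2))
      then show "\<forall>\<^sub>F x in at_top. \<forall>z\<in>ball z0 3. dist (A 0 x z $ i $ j) (Ainf z $ i $ j) < e"
        using eventually_ge_at_top[of 0]
      proof eventually_elim
        case (elim x)
        show ?case
        proof
          fix z assume "z \<in> ball z0 3"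
          then have z: "norm z \<le> norm z0 + 3" using norm_triangle_ineq[of "z - z0" z0] by (simp add: dist_norm norm_minus_commute)
          have "norm ((A 0 x z - Ainf z) $ i $ j) \<le> norm ((A 0 x z - Ainf z) $ i)" by (rule Finite_Cartesian_Product.norm_nth_le)
          also have "\<dots> \<le> norm (A 0 x z - Ainf z)" by (rule Finite_Cartesian_Product.norm_nth_le)
          also have "\<dots> < e" using C[OF z, of x] elim by simp
          finally show "dist (A 0 x z $ i $ j) (Ainf z $ i $ j) < e" by (simp add: dist_norm)
        qed
      qed
    qed
  qed simp
  then have "isCont (\<lambda>z. Ainf z $ i $ j) z0" by (simp add: continuous_on_eq_continuous_at)
  then show "((\<lambda>z. ent (cmat (Ainf z)) i j) \<longlongrightarrow> ent (cmat (Ainf z0)) i j) (nhds z0)"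
    unfolding cmat_simps using tendsto_at_iff_tendsto_nhds[of "\<lambda>z. Ainf z $ i $ j" z0] by (simp add: isCont_def)
qed

text \<open>The real part vanishes at the arc point, so differentiability makes it
  \<open>O(1 / sqrt L)\<close> on the disc of radius \<open>1 / sqrt L\<close>.\<close>

lemma Re_critical_eigenvalue_bound:
  assumes "\<mu> analytic_on {z0}" "Re (\<mu> z0) = 0"
  shows "\<exists>K\<ge>0. \<forall>\<^sub>F z in nhds z0. \<bar>Re (\<mu> z)\<bar> \<le> K * norm (z - z0)"
proof -
  have "\<mu> field_differentiable (at z0)" using assms(1) by (simp add: analytic_on_imp_differentiable_at)
  then obtain D where "(\<mu> has_field_derivative D) (at z0)" by (auto simp: field_differentiable_def)
  then have "((\<lambda>z. norm ((\<mu> z - \<mu> z0) / (z - z0))) \<longlongrightarrow> norm D) (at z0)"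
    unfolding has_field_derivative_iff by (rule tendsto_norm)
  then have "\<forall>\<^sub>F z in at z0. norm ((\<mu> z - \<mu> z0) / (z - z0)) < norm D + 1" by (rule order_tendstoD(2)) simp
  then have "\<forall>\<^sub>F z in nhds z0. z \<noteq> z0 \<longrightarrow> norm ((\<mu> z - \<mu> z0) / (z - z0)) < norm D + 1" by (simp add: eventually_at_filter)
  then have "\<forall>\<^sub>F z in nhds z0. \<bar>Re (\<mu> z)\<bar> \<le> (norm D + 1) * norm (z - z0)"
  proof eventually_elim
    case (elim z)
    show ?case
    proof (cases "z = z0")
      case False
      then have "norm (\<mu> z - \<mu> z0) \<le> (norm D + 1) * norm (z - z0)" using elim by (simp add: norm_divide pos_divide_less_eq)
      moreover have "\<bar>Re (\<mu> z - \<mu> z0)\<bar> \<le> norm (\<mu> z - \<mu> z0)" by (rule abs_Re_le_cmod)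
      ultimately show ?thesis using assms(2) by simp
    qed (use assms(2) in simp)
  qed
  then show ?thesis by (intro exI[of _ "norm D + 1"]) simp
qed

section \<open>Counting zeros\<close>

lemma holomorphic_zeros_isolated:
  assumes F: "F holomorphic_on ball z0 R" and w0: "w0 \<in> ball z0 R" "F w0 \<noteq> 0"
  shows "\<And>z. z \<in> ball z0 R \<Longrightarrow> \<forall>\<^sub>F w in at z. F w \<noteq> 0"
    and "\<And>r. r < R \<Longrightarrow> finite {z \<in> cball z0 r. F z = 0}"
proof -
  fix z assume z: "z \<in> ball z0 R"
  have "\<forall>\<^sub>F w in at z. F w \<noteq> 0 \<and> w \<in> ball z0 R"
    by (rule non_zero_neighbour_alt[OF F open_ball connected_ball z w0])
  then show "\<forall>\<^sub>F w in at z. F w \<noteq> 0" by (rule eventually_mono) blast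
next
  fix r assume r: "r < R"
  then have sub: "cball z0 r \<subseteq> ball z0 R" by auto
  show "finite {z \<in> cball z0 r. F z = 0}"
  proof (cases "F constant_on ball z0 R")
    case True
    then obtain c where c: "\<And>x. x \<in> ball z0 R \<Longrightarrow> F x = c" unfolding constant_on_def by blast
    have "F z \<noteq> 0" if "z \<in> cball z0 r" for z
      using c[OF w0(1)] w0(2) c[OF subsetD[OF sub that]] by simp
    then have "{z \<in> cball z0 r. F z = 0} = {}" by blast
    then show ?thesis by (simp only: finite.emptyI)
  next
    case False
    then show ?thesis by (rule holomorphic_compact_finite_zeros[OF F open_ball connected_ball compact_cball sub])
  qed
qed

text \<open>By Rouche's theorem \<open>F\<close> has as many zeros in the disc as
  \<open>(z - z0) ^ m * g z\<close>. Only a lower bound is claimed, since \<open>g\<close> may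
  contribute zeros of its own.\<close>

lemma rouche_count:
  assumes r: "0 < r" "r < R" and F: "F holomorphic_on ball z0 R" and g: "g holomorphic_on ball z0 R"
    and m: "m \<ge> 1"
    and less: "\<And>z. z \<in> sphere z0 r \<Longrightarrow> norm (F z - (z - z0) ^ m * g z) < norm ((z - z0) ^ m * g z)"
  shows "m \<le> (\<Sum>z | z \<in> ball z0 r \<and> F z = 0. nat (zorder F z))"
proof -
  \<comment> \<open>An intermediate disc: it contains the closed disc of radius \<open>r\<close>,
    and its own closure stays inside \<open>ball z0 R\<close>, so both functions have finitely many
    zeros in it.\<close>
  define R' where "R' = (r + R) / 2"
  have R': "r < R'" "R' < R" using r by (auto simp: R'_def)
  define s where "s = ball z0 R'"
  have sub: "s \<subseteq> ball z0 R" "cball z0 r \<subseteq> s" using R' by (auto simp: s_def)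
  define h where "h z = (z - z0) ^ m * g z" for z
  have h: "h holomorphic_on ball z0 R" unfolding h_def by (intro holomorphic_intros g)
  have hs: "h holomorphic_on s" and Fs: "F holomorphic_on s" using h F sub by (auto intro: holomorphic_on_subset)
  define w0 where "w0 = z0 + of_real r"
  have w0: "w0 \<in> sphere z0 r" using r by (simp add: w0_def dist_norm)
  have nz: "h z \<noteq> 0" "F z \<noteq> 0" if "z \<in> sphere z0 r" for z
  proof -
    have "norm (F z - h z) < norm (h z)" using less[OF that] by (simp add: h_def)
    then show "h z \<noteq> 0" "F z \<noteq> 0" by auto
  qed
  have w0R: "w0 \<in> ball z0 R" using w0 r by auto
  note Fz = holomorphic_zeros_isolated[OF F w0R nz(2)[OF w0]]
  note hz = holomorphic_zeros_isolated[OF h w0R nz(1)[OF w0]]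
  have finF: "finite {z \<in> s. F z = 0}" by (rule finite_subset[OF _ Fz(2)[OF R'(2)]]) (auto simp: s_def)
  have finh: "finite {z \<in> s. h z = 0}" by (rule finite_subset[OF _ hz(2)[OF R'(2)]]) (auto simp: s_def)
  define \<gamma> where "\<gamma> = circlepath z0 r"
  have pi: "path_image \<gamma> = sphere z0 r" using r by (simp add: \<gamma>_def)
  have R: "(\<Sum>p | p \<in> s \<and> h p + (F p - h p) = 0. winding_number \<gamma> p * zorder (\<lambda>p. h p + (F p - h p)) p)
      = (\<Sum>p | p \<in> s \<and> h p = 0. winding_number \<gamma> p * zorder h p)"
  proof (rule Rouche_theorem)
    show "path_image \<gamma> \<subseteq> s" unfolding pi using sub by auto
    show "\<forall>z\<in>path_image \<gamma>. norm (F z - h z) < norm (h z)" unfolding pi using less by (simp add: h_def)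
    show "\<forall>z. z \<notin> s \<longrightarrow> winding_number \<gamma> z = 0"
      using sub r by (auto intro!: winding_number_zero_outside[of _ "cball z0 r"] simp: \<gamma>_def pi[unfolded \<gamma>_def])
  qed (use finF finh hs Fs in \<open>auto simp: s_def \<gamma>_def intro!: holomorphic_intros\<close>)
  have wn: "winding_number \<gamma> p = (if p \<in> ball z0 r then 1 else 0)" if "p \<in> s" "p \<notin> sphere z0 r" for p
  proof (cases "p \<in> ball z0 r")
    case True
    then show ?thesis using winding_number_circlepath[of p z0 r] by (simp add: \<gamma>_def dist_norm norm_minus_commute)
  next
    case False
    then show ?thesis
      using that r by (auto intro!: winding_number_zero_outside[of _ "cball z0 r"] simp: \<gamma>_def pi[unfolded \<gamma>_def])
  qed
  have count: "(\<Sum>p | p \<in> s \<and> f p = 0. winding_number \<gamma> p * zorder f p) =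
      of_nat (\<Sum>p | p \<in> ball z0 r \<and> f p = 0. nat (zorder f p))"
    if f: "f holomorphic_on ball z0 R" "\<And>z. z \<in> ball z0 R \<Longrightarrow> \<forall>\<^sub>F w in at z. f w \<noteq> 0"
      "\<And>z. z \<in> sphere z0 r \<Longrightarrow> f z \<noteq> 0" "finite {z \<in> s. f z = 0}" for f
  proof -
    have "(\<Sum>p | p \<in> s \<and> f p = 0. winding_number \<gamma> p * zorder f p) =
        (\<Sum>p | p \<in> ball z0 r \<and> f p = 0. complex_of_int (zorder f p))"
    proof (rule sum.mono_neutral_cong_right)
      have rs: "p \<in> s" if "p \<in> ball z0 r" for p using that R' by (auto simp: s_def)
      have ns: "p \<notin> sphere z0 r" if "f p = 0" for p using f(3) that by blast
      show "finite {p. p \<in> s \<and> f p = 0}" by (rule f(4))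
      show "{p. p \<in> ball z0 r \<and> f p = 0} \<subseteq> {p. p \<in> s \<and> f p = 0}" using rs by blast
      show "\<forall>p\<in>{p. p \<in> s \<and> f p = 0} - {p. p \<in> ball z0 r \<and> f p = 0}. winding_number \<gamma> p * zorder f p = 0"
        using wn[OF _ ns] by auto
      show "winding_number \<gamma> p * zorder f p = complex_of_int (zorder f p)"
        if "p \<in> {p. p \<in> ball z0 r \<and> f p = 0}" for p
        using wn[OF rs ns] that by auto
    qed
    also have "\<dots> = (\<Sum>p | p \<in> ball z0 r \<and> f p = 0. of_nat (nat (zorder f p)))"
    proof (intro sum.cong refl)
      fix p assume "p \<in> {p \<in> ball z0 r. f p = 0}"
      then have p: "p \<in> ball z0 R" using r by auto
      have "zorder f p \<ge> 0"
        using f(1) p f(2)[OF p] by (intro zorder_ge_0 eventually_frequently holomorphic_on_imp_analytic_at) auto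
      then show "complex_of_int (zorder f p) = of_nat (nat (zorder f p))" by simp
    qed
    finally show ?thesis by simp
  qed
  have "of_nat (\<Sum>p | p \<in> ball z0 r \<and> F p = 0. nat (zorder F p)) =
      (of_nat (\<Sum>p | p \<in> ball z0 r \<and> h p = 0. nat (zorder h p)) :: complex)"
    using R count[OF F Fz(1) nz(2) finF] count[OF h hz(1) nz(1) finh] by simp
  then have eq: "(\<Sum>p | p \<in> ball z0 r \<and> F p = 0. nat (zorder F p)) = (\<Sum>p | p \<in> ball z0 r \<and> h p = 0. nat (zorder h p))"
    by (simp only: of_nat_eq_iff)
  have z0: "z0 \<in> ball z0 R" using r by simp
  have ghol: "g analytic_on {z0}" using g z0 by (intro holomorphic_on_imp_analytic_at[of g "ball z0 R"]) auto
  have gnz: "\<forall>\<^sub>F w in at z0. g w \<noteq> 0" using hz(1)[OF z0] by eventually_elim (auto simp: h_def)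
  have pw: "zorder (\<lambda>z. (z - z0) ^ m) z0 = int m"
    by (rule zorder_eqI[of UNIV _ "\<lambda>_. 1"]) auto
  have "zorder h z0 = zorder (\<lambda>z. (z - z0) ^ m) z0 + zorder g z0"
    unfolding h_def
  proof (rule zorder_times_analytic)
    show "(\<lambda>z. (z - z0) ^ m) analytic_on {z0}" by (intro analytic_intros)
    show "\<forall>\<^sub>F z in at z0. (z - z0) ^ m * g z \<noteq> 0" using hz(1)[OF z0] by (simp add: h_def)
  qed (rule ghol)
  moreover have "zorder g z0 \<ge> 0" using ghol gnz by (intro zorder_ge_0 eventually_frequently) auto
  ultimately have "m \<le> nat (zorder h z0)" using pw by simp
  also have "\<dots> \<le> (\<Sum>p | p \<in> ball z0 r \<and> h p = 0. nat (zorder h p))"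
  proof (rule member_le_sum)
    show "z0 \<in> {p. p \<in> ball z0 r \<and> h p = 0}" using r m by (simp add: h_def)
    show "finite {p. p \<in> ball z0 r \<and> h p = 0}"
      by (rule finite_subset[OF _ finh]) (use sub in auto)
  qed auto
  finally show ?thesis using eq by simp
qed

text \<open>The first two estimates are Taylor bounds at the centre. The last one linearizes between
  two arbitrary points with an error slope \<open>e\<close> of choice; for the critical eigenvalue
  it acts as quantitative injectivity.\<close>

lemma holomorphic_local_bounds:
  assumes g: "g analytic_on {z0}" and e: "e > 0"
  obtains r K where "r > 0" "K > 0" "g holomorphic_on ball z0 r"
    "\<And>w. w \<in> ball z0 r \<Longrightarrow> norm (g w - g z0) \<le> K * norm (w - z0)"
    "\<And>w. w \<in> ball z0 r \<Longrightarrow> norm (g w - g z0 - deriv g z0 * (w - z0)) \<le> K * norm (w - z0) ^ 2"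
    "\<And>w v. w \<in> ball z0 r \<Longrightarrow> v \<in> ball z0 r \<Longrightarrow> norm (g w - g v - deriv g z0 * (w - v)) \<le> e * norm (w - v)"
proof -
  obtain r0 where r0: "r0 > 0" "g holomorphic_on ball z0 r0" using g by (auto simp: analytic_on_def)
  have h1: "deriv g holomorphic_on ball z0 r0" and h2: "deriv (deriv g) holomorphic_on ball z0 r0"
    using r0 by (auto intro!: holomorphic_deriv)
  have "continuous_on (cball z0 (r0/2)) (deriv (deriv g))"
    using r0(1) by (intro holomorphic_on_imp_continuous_on holomorphic_on_subset[OF h2]) auto
  then have "bounded (deriv (deriv g) ` cball z0 (r0/2))" by (intro compact_imp_bounded compact_continuous_image) auto
  then obtain B where B: "\<And>w. w \<in> cball z0 (r0/2) \<Longrightarrow> norm (deriv (deriv g) w) \<le> B"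
    unfolding bounded_iff by blast
  define B' where "B' = max B 1"
  have B': "B' > 0" "\<And>w. w \<in> cball z0 (r0/2) \<Longrightarrow> norm (deriv (deriv g) w) \<le> B'"
    using B by (auto simp: B'_def intro: max.coboundedI1)
  \<comment> \<open>The bound \<open>e / B'\<close> keeps the oscillation of \<open>deriv g\<close>
    below \<open>e\<close>; the bound 1 lets quadratic terms be estimated by linear ones.\<close>
  define r where "r = min (r0/2) (min 1 (e / B'))"
  have r: "r > 0" "r \<le> r0/2" "r \<le> 1" "B' * r \<le> e"
  proof -
    show "r > 0" using r0 e B' by (simp add: r_def)
    show "r \<le> r0/2" unfolding r_def by (rule min.cobounded1)
    show "r \<le> 1" unfolding r_def by (rule order_trans[OF min.cobounded2 min.cobounded1])
    have "r \<le> e / B'" by (simp add: r_def)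
    then show "B' * r \<le> e" using B' by (simp add: field_simps)
  qed
  have sub: "ball z0 r \<subseteq> ball z0 r0" "ball z0 r \<subseteq> cball z0 (r0/2)" using r r0(1) by auto
  have d1: "(g has_field_derivative deriv g w) (at w within S)"
    and d2: "(deriv g has_field_derivative deriv (deriv g) w) (at w within S)" if "w \<in> ball z0 r" for w S
    using subsetD[OF sub(1) that]
    by (auto intro: has_field_derivative_at_within[OF holomorphic_derivI[OF r0(2) open_ball]]
      has_field_derivative_at_within[OF holomorphic_derivI[OF h1 open_ball]])
  have z0: "z0 \<in> ball z0 r" using r by simp
  have dd: "norm (deriv g w - deriv g z0) \<le> B' * norm (w - z0)" if "w \<in> ball z0 r" for w
    by (rule field_differentiable_bound[of "ball z0 r" "deriv g" "deriv (deriv g)"])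
      (use d2 B'(2) sub that z0 in auto)
  have T: "norm (g w - g z0 - deriv g z0 * (w - z0)) \<le> B' * norm (w - z0) ^ 2" if w: "w \<in> ball z0 r" for w
  proof -
    define f where "f i = (if i = 0 then g else if i = 1 then deriv g else deriv (deriv g))" for i :: nat
    have "norm (f 0 w - (\<Sum>i\<le>1. f i z0 * (w - z0) ^ i / fact i)) \<le> B' * norm (w - z0) ^ Suc 1 / fact 1"
    proof (rule complex_Taylor[of "ball z0 r"])
      fix i :: nat and x assume "x \<in> ball z0 r" "i \<le> 1"
      then show "(f i has_field_derivative f (Suc i) x) (at x within ball z0 r)"
        using d1 d2 by (cases i) (auto simp: f_def)
    qed (use w z0 B'(2) sub in \<open>auto simp: f_def\<close>)
    then show ?thesis by (simp add: f_def power2_eq_square algebra_simps)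
  qed
  define K where "K = B' + norm (deriv g z0)"
  show ?thesis
  proof (rule that[of r K])
    show "K > 0" using B' by (simp add: K_def add_pos_nonneg)
    show "g holomorphic_on ball z0 r" by (rule holomorphic_on_subset[OF r0(2) sub(1)])
    fix w assume w: "w \<in> ball z0 r"
    then have n: "norm (w - z0) \<le> 1" using r by (simp add: dist_norm norm_minus_commute)
    have "norm (g w - g z0) \<le> norm (g w - g z0 - deriv g z0 * (w - z0)) + norm (deriv g z0 * (w - z0))"
      by norm
    also have "\<dots> \<le> B' * norm (w - z0) ^ 2 + norm (deriv g z0) * norm (w - z0)"
      using T[OF w] by (simp add: norm_mult)
    also have "B' * norm (w - z0) ^ 2 \<le> B' * norm (w - z0)"
      using B' n by (intro mult_left_mono) (auto simp: power2_eq_square mult_left_le)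
    finally show "norm (g w - g z0) \<le> K * norm (w - z0)" by (simp add: K_def algebra_simps)
    show "norm (g w - g z0 - deriv g z0 * (w - z0)) \<le> K * norm (w - z0) ^ 2"
      by (rule order_trans[OF T[OF w]]) (simp add: K_def mult_right_mono)
  next
    fix w v assume wv: "w \<in> ball z0 r" "v \<in> ball z0 r"
    have "norm ((g w - deriv g z0 * w) - (g v - deriv g z0 * v)) \<le> e * norm (w - v)"
    proof (rule field_differentiable_bound[of "ball z0 r" _ "\<lambda>w. deriv g w - deriv g z0"])
      fix z assume z: "z \<in> ball z0 r"
      show "((\<lambda>w. g w - deriv g z0 * w) has_field_derivative deriv g z - deriv g z0) (at z within ball z0 r)"
        by (auto intro!: derivative_eq_intros d1[OF z])
      have "norm (deriv g z - deriv g z0) \<le> B' * norm (z - z0)" by (rule dd[OF z])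
      also have "\<dots> \<le> B' * r" using z B' by (intro mult_left_mono) (auto simp: dist_norm norm_minus_commute)
      finally show "norm (deriv g z - deriv g z0) \<le> e" using r by simp
    qed (use wv in auto)
    then show "norm (g w - g v - deriv g z0 * (w - v)) \<le> e * norm (w - v)" by (simp add: algebra_simps)
  qed (use r in auto)
qed

lemma zero_factorization:
  assumes "f analytic_on {z0}" "\<forall>\<^sub>F w in at z0. f w \<noteq> 0" "zorder f z0 = int m"
  obtains r g where "r > 0" "g holomorphic_on ball z0 r" "g z0 \<noteq> 0"
    "\<And>w. w \<in> ball z0 r \<Longrightarrow> f w = (w - z0) ^ m * g w"
proof -
  obtain r0 where r0: "r0 > 0" "f holomorphic_on ball z0 r0" using assms(1) by (auto simp: analytic_on_def)
  have "\<forall>\<^sub>F w in at z0. w \<in> ball z0 r0" using r0 by (intro eventually_at_in_open') auto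
  with assms(2) have "\<exists>\<^sub>F w in at z0. f w \<noteq> 0 \<and> w \<in> ball z0 r0"
    by (intro eventually_frequently eventually_conj) auto
  then obtain w where "w \<in> ball z0 r0" "f w \<noteq> 0" by (auto dest: frequently_ex)
  then have "\<exists>w\<in>ball z0 r0. f w \<noteq> 0" by blast
  from zorder_exist_zero[OF r0(2) open_ball connected_ball _ this] r0(1) obtain r where r: "r > 0"
      "zor_poly f z0 holomorphic_on cball z0 r"
      "\<forall>w\<in>cball z0 r. f w = zor_poly f z0 w * (w - z0) ^ nat (zorder f z0) \<and> zor_poly f z0 w \<noteq> 0"
    using centre_in_ball[of z0 r0] by blast
  show ?thesis
    by (rule that[of r "zor_poly f z0"])
      (use r assms(3) in \<open>auto intro: holomorphic_on_subset simp: mult.commute\<close>)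
qed

lemma submultiset_of_size:
  assumes "m \<le> size M" obtains N where "N \<subseteq># M" "size N = m"
proof -
  obtain xs where xs: "mset xs = M" using ex_mset by blast
  have "M = mset (take m xs) + mset (drop m xs)" unfolding xs[symmetric] by (simp flip: mset_append)
  then have "mset (take m xs) \<subseteq># M" by simp
  moreover have "size (mset (take m xs)) = m" using assms xs by (metis length_take min.absorb2 size_mset)
  ultimately show ?thesis using that by blast
qed

lemma size_zero_multiset:
  assumes "finite S"
  shows "count (\<Sum>z\<in>S. replicate_mset (n z) z) w = (if w \<in> S then n w else 0)"
    and "size (\<Sum>z\<in>S. replicate_mset (n z) z) = (\<Sum>z\<in>S. n z)"
  using assms by (induction S rule: finite_induct) auto

lemma nearest_congruent:
  assumes "h > 0" obtains \<kappa> :: real where "[\<kappa> = k] (rmod h)" "\<bar>\<kappa> - x\<bar> \<le> h / 2"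
proof -
  define n where "n = round ((x - k) / h)"
  have "\<bar>of_int n - (x - k) / h\<bar> \<le> 1/2" unfolding n_def by (rule of_int_round_abs_le)
  then have "\<bar>of_int n - (x - k) / h\<bar> * h \<le> 1/2 * h" using assms by (intro mult_right_mono) auto
  then have "\<bar>(of_int n - (x - k) / h) * h\<bar> \<le> h / 2" using assms by (simp add: abs_mult)
  moreover have "(of_int n - (x - k) / h) * h = (k + of_int n * h) - x" using assms by (simp add: field_simps)
  ultimately have "\<bar>(k + of_int n * h) - x\<bar> \<le> h / 2" by simp
  moreover have "[k + of_int n * h = k + 0] (rmod h)"
    by (intro rcong_intros)
  ultimately show ?thesis using that by simp
qed

text \<open>Writing \<open>D1 = (z - z0)^m ga\<close> and \<open>D2 = (z - z0)^m gb\<close>, the model is \<open>(z - z0)^m g\<close> with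
  \<open>g = exp (\<mu> L) ga - \<gamma> gb\<close>. On the scale \<open>\<rho> \<lless> 1 / L\<close> the function \<open>g\<close> is affine with slope of
  order \<open>L\<close> up to \<open>O(\<rho>)\<close>, so it is at least \<open>\<rho>\<close> on one of the circles of radius \<open>\<rho>\<close> and \<open>\<rho> / 4\<close>.
  A zero outside that circle nearly solves \<open>g = 0\<close>, which bounds \<open>L Re \<mu>\<close>.\<close>

lemma affine_lower_bound:
  fixes g :: "complex \<Rightarrow> complex"
  assumes "\<rho> > 0" and G: "G / 4 \<ge> K + 1" "norm B = G"
    and aff: "\<And>z. norm (z - z0) \<le> \<rho> \<Longrightarrow> norm (g z - g z0 - B * (z - z0)) \<le> K * \<rho>"
  obtains r where "r = \<rho> \<or> r = \<rho> / 4" "\<And>z. norm (z - z0) = r \<Longrightarrow> \<rho> \<le> norm (g z)"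
proof (cases "norm (g z0) \<ge> G * \<rho> / 2")
  \<comment> \<open>A large value at the centre beats the linear term on the small circle; otherwise
    the linear term wins on the large circle. In both cases \<open>G / 4 \<ge> K + 1\<close> pays
    for the remainder and leaves \<open>\<rho>\<close>.\<close>
  case True
  show ?thesis
  proof (rule that[of "\<rho> / 4"])
    fix z assume z: "norm (z - z0) = \<rho> / 4"
    have "norm (g z0) \<le> norm (g z) + norm (B * (z - z0)) + norm (g z - g z0 - B * (z - z0))"
      by norm
    moreover have "norm (B * (z - z0)) = G * \<rho> / 4" using G z by (simp add: norm_mult)
    moreover have "norm (g z - g z0 - B * (z - z0)) \<le> K * \<rho>" using z assms(1) by (intro aff) simp
    ultimately have "norm (g z) \<ge> (G / 4 - K) * \<rho>" using True by (simp add: algebra_simps)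
    moreover have "(G / 4 - K) * \<rho> \<ge> 1 * \<rho>" using G assms(1) by (intro mult_right_mono) auto
    ultimately show "\<rho> \<le> norm (g z)" by simp
  qed simp
next
  case False
  show ?thesis
  proof (rule that[of "\<rho>"])
    fix z assume z: "norm (z - z0) = \<rho>"
    have "norm (B * (z - z0)) \<le> norm (g z) + norm (g z0) + norm (g z - g z0 - B * (z - z0))"
      by norm
    moreover have "norm (B * (z - z0)) = G * \<rho>" using G z by (simp add: norm_mult)
    moreover have "norm (g z - g z0 - B * (z - z0)) \<le> K * \<rho>" using z by (intro aff) simp
    ultimately have "norm (g z) \<ge> (G / 2 - K) * \<rho>" using False by (simp add: algebra_simps)
    moreover have "0 \<le> G" using G(2) norm_ge_zero by metis
    then have "(G / 2 - K) * \<rho> \<ge> 1 * \<rho>" using G(1) assms(1) by (intro mult_right_mono) auto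
    ultimately show "\<rho> \<le> norm (g z)" by simp
  qed simp
qed

lemma exp_linearization:
  fixes w :: complex assumes "norm w \<le> 1"
  shows "norm (exp w - 1 - w) \<le> 3 * norm w ^ 2"
proof -
  have "norm (exp w - (\<Sum>k\<le>1. w ^ k / fact k)) \<le> exp \<bar>Re w\<bar> * norm w ^ Suc 1 / fact 1"
    by (rule Taylor_exp)
  also have "\<dots> \<le> 3 * norm w ^ 2"
  proof -
    have "\<bar>Re w\<bar> \<le> 1" using abs_Re_le_cmod[of w] assms by linarith
    then have "exp \<bar>Re w\<bar> \<le> exp 1" by simp
    also have "\<dots> \<le> 3" using exp_le by simp
    finally show ?thesis by (simp add: power2_eq_square mult_right_mono)
  qed
  finally show ?thesis by (simp add: algebra_simps)
qed

text \<open>The condition \<open>L ^ 2 * \<rho> \<le> 1\<close> reduces the quadratic part of the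
  exponential, of size \<open>(L * \<rho>) ^ 2\<close>, to \<open>O(\<rho>)\<close>. The four terms
  of the constant stem from this remainder, the variation of \<open>ga\<close>, the curvature of
  \<open>\<mu>\<close> and the variation of \<open>gb\<close>.\<close>

lemma model_affine:
  fixes \<mu> ga gb :: "complex \<Rightarrow> complex"
  assumes mu0: "\<mu> z0 = \<i> * of_real k0" and d: "norm (z - z0) \<le> \<rho>"
    and mu: "norm (\<mu> z - \<mu> z0) \<le> K1 * norm (z - z0)"
      "norm (\<mu> z - \<mu> z0 - \<mu>' * (z - z0)) \<le> K1 * norm (z - z0) ^ 2"
    and ga: "norm (ga z - ga z0) \<le> Ka * norm (z - z0)" "norm (ga z) \<le> 2 * norm (ga z0)"
    and gb: "norm (gb z - gb z0) \<le> Kb * norm (z - z0)"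
    and K: "K1 > 0" "Ka > 0" "Kb > 0" and L: "L \<ge> 1" "L ^ 2 * \<rho> \<le> 1" "K1 * \<rho> * L \<le> 1" "\<rho> > 0"
    and \<gamma>: "norm \<gamma> = 1"
  shows "norm ((exp (\<mu> z * of_real L) * ga z - \<gamma> * gb z) - (exp (\<mu> z0 * of_real L) * ga z0 - \<gamma> * gb z0)
      - exp (\<mu> z0 * of_real L) * ga z0 * \<mu>' * of_real L * (z - z0))
    \<le> (6 * norm (ga z0) * K1 ^ 2 + 2 * Ka + norm (ga z0) * K1 + Kb) * \<rho>" (is "norm ?\<Delta> \<le> _")
proof -
  define U where "U = exp (\<mu> z0 * of_real L)"
  have U: "norm U = 1" by (simp add: U_def mu0)
  define w where "w = (\<mu> z - \<mu> z0) * of_real L"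
  have e: "exp (\<mu> z * of_real L) = U * exp w"
    unfolding U_def w_def exp_add[symmetric] by (simp add: algebra_simps)
  have L\<rho>: "L * \<rho> \<le> 1"
  proof -
    have "L * \<rho> \<le> L * (L * \<rho>)" using L by (simp add: mult_left_mono)
    then show ?thesis using L(2) by (simp add: power2_eq_square mult.assoc)
  qed
  have wK: "norm w \<le> K1 * \<rho> * L"
  proof -
    have "norm w = norm (\<mu> z - \<mu> z0) * L" using L by (simp add: w_def norm_mult)
    also have "\<dots> \<le> (K1 * norm (z - z0)) * L" using mu L by (intro mult_right_mono) auto
    also have "\<dots> \<le> (K1 * \<rho>) * L" using d K L by (intro mult_right_mono mult_left_mono) auto
    finally show ?thesis .
  qed
  then have w1: "norm w \<le> 1" using L by linarith
  have t1: "norm ((exp w - 1 - w) * ga z) \<le> 6 * norm (ga z0) * K1 ^ 2 * \<rho>"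
  proof -
    have "norm ((exp w - 1 - w) * ga z) \<le> (3 * norm w ^ 2) * (2 * norm (ga z0))"
      unfolding norm_mult using exp_linearization[OF w1] ga(2) by (intro mult_mono) auto
    also have "\<dots> \<le> (3 * (K1 * \<rho> * L) ^ 2) * (2 * norm (ga z0))"
      using wK by (intro mult_right_mono mult_left_mono power_mono) auto
    also have "\<dots> = 6 * norm (ga z0) * K1 ^ 2 * (\<rho> * (L ^ 2 * \<rho>))" by (simp add: power2_eq_square)
    also have "\<dots> \<le> 6 * norm (ga z0) * K1 ^ 2 * (\<rho> * 1)" using L by (intro mult_left_mono) auto
    finally show ?thesis by simp
  qed
  have t2: "norm ((1 + w) * (ga z - ga z0)) \<le> 2 * Ka * \<rho>"
  proof -
    have "norm (1 + w) \<le> 2" using norm_triangle_ineq[of 1 w] w1 by simp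
    moreover have "norm (ga z - ga z0) \<le> Ka * \<rho>"
      by (rule order_trans[OF ga(1)]) (use d K in \<open>simp add: mult_left_mono\<close>)
    ultimately have "norm ((1 + w) * (ga z - ga z0)) \<le> 2 * (Ka * \<rho>)"
      unfolding norm_mult by (intro mult_mono) auto
    then show ?thesis by simp
  qed
  have t3: "norm (ga z0 * (w - \<mu>' * of_real L * (z - z0))) \<le> norm (ga z0) * K1 * \<rho>"
  proof -
    have "w - \<mu>' * of_real L * (z - z0) = (\<mu> z - \<mu> z0 - \<mu>' * (z - z0)) * of_real L"
      by (simp add: w_def algebra_simps)
    then have "norm (w - \<mu>' * of_real L * (z - z0)) = norm (\<mu> z - \<mu> z0 - \<mu>' * (z - z0)) * L"
      using L by (simp add: norm_mult)
    also have "\<dots> \<le> (K1 * norm (z - z0) ^ 2) * L" using mu(2) L by (intro mult_right_mono) auto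
    also have "\<dots> \<le> (K1 * \<rho> ^ 2) * L" using d K L by (intro mult_right_mono mult_left_mono power_mono) auto
    also have "\<dots> = K1 * \<rho> * (L * \<rho>)" by (simp add: power2_eq_square)
    also have "\<dots> \<le> K1 * \<rho> * 1" using L\<rho> K L by (intro mult_left_mono) auto
    finally show ?thesis by (simp add: norm_mult mult.assoc mult_left_mono)
  qed
  have t4: "norm (\<gamma> * (gb z - gb z0)) \<le> Kb * \<rho>"
    unfolding norm_mult \<gamma> using order_trans[OF gb, of "Kb * \<rho>"] d K by (simp add: mult_left_mono)
  have "?\<Delta> = U * ((exp w - 1 - w) * ga z + (1 + w) * (ga z - ga z0) + ga z0 * (w - \<mu>' * of_real L * (z - z0)))
      - \<gamma> * (gb z - gb z0)"
    unfolding e U_def[symmetric] by (simp add: algebra_simps)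
  also have "norm \<dots> \<le> norm (U * ((exp w - 1 - w) * ga z + (1 + w) * (ga z - ga z0) + ga z0 * (w - \<mu>' * of_real L * (z - z0))))
      + norm (\<gamma> * (gb z - gb z0))" by (rule norm_triangle_ineq4)
  also have "\<dots> \<le> (norm ((exp w - 1 - w) * ga z) + norm ((1 + w) * (ga z - ga z0)) + norm (ga z0 * (w - \<mu>' * of_real L * (z - z0))))
      + norm (\<gamma> * (gb z - gb z0))"
    unfolding norm_mult[of U] U mult_1 by (intro add_right_mono) (meson add_right_mono norm_triangle_ineq order_trans)
  finally show ?thesis using t1 t2 t3 t4 by (simp add: algebra_simps)
qed

text \<open>If \<open>exp x * a\<close> and \<open>\<gamma> * b\<close> nearly agree, then so do
  their moduli, and \<open>exp (Re x)\<close> is confined between two positive constants that depend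
  only on \<open>a0\<close> and \<open>b0\<close>.\<close>

lemma Re_bound_of_model_zero:
  fixes a b x :: complex
  assumes small: "norm (exp x * a - \<gamma> * b) \<le> \<tau>" and \<gamma>: "norm \<gamma> = 1" and \<tau>: "\<tau> \<le> 1" "\<tau> \<le> b0 / 4"
    and a: "a0 / 2 \<le> norm a" "norm a \<le> 2 * a0" and b: "b0 / 2 \<le> norm b" "norm b \<le> 2 * b0"
    and pos: "a0 > 0" "b0 > 0"
  shows "\<bar>Re x\<bar> \<le> \<bar>ln ((4 * b0 + 2) / a0)\<bar> + \<bar>ln (b0 / (8 * a0))\<bar>"
proof -
  have n: "norm (exp x * a) = exp (Re x) * norm a" "norm (\<gamma> * b) = norm b"
    using \<gamma> by (simp_all add: norm_mult norm_exp_eq_Re)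
  have t: "norm (exp x * a) \<le> norm (\<gamma> * b) + \<tau>" "norm (\<gamma> * b) \<le> norm (exp x * a) + \<tau>"
    using small norm_triangle_sub[of "exp x * a" "\<gamma> * b"] norm_triangle_sub[of "\<gamma> * b" "exp x * a"]
      norm_minus_commute[of "exp x * a" "\<gamma> * b"] by linarith+
  have "exp (Re x) * (a0 / 2) \<le> exp (Re x) * norm a" using a by (intro mult_left_mono) auto
  also have "\<dots> \<le> 2 * b0 + 1" using t(1) n b \<tau> by linarith
  finally have "exp (Re x) * a0 \<le> 4 * b0 + 2" by simp
  then have "exp (Re x) \<le> (4 * b0 + 2) / a0" by (simp add: pos_le_divide_eq[OF pos(1)])
  then have "ln (exp (Re x)) \<le> ln ((4 * b0 + 2) / a0)" by (intro ln_mono) auto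
  then have u: "Re x \<le> ln ((4 * b0 + 2) / a0)" by simp
  have "b0 / 4 \<le> exp (Re x) * norm a" using t(2) n b \<tau> by linarith
  also have "\<dots> \<le> exp (Re x) * (2 * a0)" using a by (intro mult_left_mono) auto
  finally have "b0 \<le> exp (Re x) * (8 * a0)" by simp
  then have "b0 / (8 * a0) \<le> exp (Re x)" using pos(1) by (simp add: pos_divide_le_eq)
  then have "ln (b0 / (8 * a0)) \<le> ln (exp (Re x))" using pos by (intro ln_mono) auto
  then have l: "ln (b0 / (8 * a0)) \<le> Re x" by simp
  show ?thesis using u l by linarith
qed

text \<open>Collects every demand on the size of the period. With
  \<open>\<rho> = exp (- e * L)\<close> the last two compare the error with the model on the Rouche
  circle and with \<open>\<rho> ^ m\<close> outside it; they are the ones that restrict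
  \<open>e\<close>.\<close>

lemma eventually_scales:
  fixes \<eta>0 e C K1 \<delta> \<delta>k K5 G \<tau> X0 :: real and m :: nat
  assumes "e > 0" "(real m + 1) * e < \<eta>0" "C > 0" "\<delta> > 0" "\<delta>k > 0" "G > 0" "\<tau> > 0"
  shows "\<forall>\<^sub>F L in at_top. L \<ge> X0 \<and> L \<ge> 1 \<and> C / L < 1 / sqrt L \<and> 1 / sqrt L < \<delta> \<and> exp (- e * L) < C / L \<and>
    K1 * exp (- e * L) * L \<le> 1 \<and> L ^ 2 * exp (- e * L) \<le> 1 \<and> (pi + K1 * C) / L < \<delta>k \<and> K5 + 1 \<le> G * L / 4 \<and>
    exp (- \<eta>0 * L) < (exp (- e * L) / 4) ^ m * exp (- e * L) \<and>
    exp (- \<eta>0 * L) \<le> \<tau> * exp (- e * L) ^ m"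
proof (intro eventually_conj)
  show "\<forall>\<^sub>F L in at_top. L \<ge> X0" "\<forall>\<^sub>F L in at_top. L \<ge> (1::real)" by (rule eventually_ge_at_top)+
  show "\<forall>\<^sub>F L in at_top. C / L < 1 / sqrt L" using assms by real_asymp
  show "\<forall>\<^sub>F L in at_top. 1 / sqrt L < \<delta>" using assms by real_asymp
  show "\<forall>\<^sub>F L in at_top. exp (- e * L) < C / L" using assms by real_asymp
  have "((\<lambda>L. K1 * exp (- e * L) * L) \<longlongrightarrow> 0) at_top" using assms by real_asymp
  then show "\<forall>\<^sub>F L in at_top. K1 * exp (- e * L) * L \<le> 1"
    by (rule eventually_mono[OF order_tendstoD(2)[of _ 0 _ 1]]) auto
  have "((\<lambda>L. L ^ 2 * exp (- e * L)) \<longlongrightarrow> 0) at_top" using assms by real_asymp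
  then show "\<forall>\<^sub>F L in at_top. L ^ 2 * exp (- e * L) \<le> 1"
    by (rule eventually_mono[OF order_tendstoD(2)[of _ 0 _ 1]]) auto
  have "((\<lambda>L. (pi + K1 * C) / L) \<longlongrightarrow> 0) at_top" by real_asymp
  then show "\<forall>\<^sub>F L in at_top. (pi + K1 * C) / L < \<delta>k" using assms by (intro order_tendstoD(2)) auto
  have "filterlim (\<lambda>L. G * L / 4) at_top at_top" using assms by real_asymp
  then show "\<forall>\<^sub>F L in at_top. K5 + 1 \<le> G * L / 4" unfolding filterlim_at_top by blast
  \<comment> \<open>The margin that is left in the exponent; its exponential eventually beats the
    constant \<open>4 ^ m\<close> caused by the smaller circle.\<close>
  define a where "a = \<eta>0 - (real m + 1) * e"
  have a: "a > 0" using assms by (simp add: a_def)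
  have "filterlim (\<lambda>L. exp (a * L)) at_top at_top" using a by real_asymp
  then have "\<forall>\<^sub>F L in at_top. 4 ^ m < exp (a * L)" by (simp add: filterlim_at_top_dense)
  then show "\<forall>\<^sub>F L in at_top. exp (- \<eta>0 * L) < (exp (- e * L) / 4) ^ m * exp (- e * L)"
  proof eventually_elim
    case (elim L)
    have "exp (- \<eta>0 * L) = exp (- (real m * e * L)) * exp (- e * L) / exp (a * L)"
      by (simp add: exp_add[symmetric] exp_diff[symmetric] a_def algebra_simps)
    also have "\<dots> < exp (- (real m * e * L)) * exp (- e * L) / 4 ^ m"
      using elim by (intro divide_strict_left_mono) auto
    also have "\<dots> = (exp (- e * L) / 4) ^ m * exp (- e * L)"
      by (simp add: power_divide mult.assoc flip: exp_of_nat_mult)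
    finally show ?case .
  qed
  have "filterlim (\<lambda>L. exp ((a + e) * L)) at_top at_top" using a assms(1) by real_asymp
  then have "\<forall>\<^sub>F L in at_top. 1 / \<tau> < exp ((a + e) * L)" by (simp add: filterlim_at_top_dense)
  then show "\<forall>\<^sub>F L in at_top. exp (- \<eta>0 * L) \<le> \<tau> * exp (- e * L) ^ m"
  proof eventually_elim
    case (elim L)
    have "exp (- \<eta>0 * L) = exp (- (real m * e * L)) / exp ((a + e) * L)"
      by (simp add: exp_diff[symmetric] a_def algebra_simps)
    also have "\<dots> \<le> exp (- (real m * e * L)) / (1 / \<tau>)"
      using elim assms by (intro divide_left_mono) auto
    also have "\<dots> = \<tau> * exp (- e * L) ^ m"
      by (simp add: mult.assoc flip: exp_of_nat_mult)
    finally show ?case .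
  qed
qed

text \<open>The complex analytic half of the argument, with the differential equation reduced to the
  hypothesis \<open>main\<close>. Since the multiplier \<open>M\<close> is analytic and nonzero,
  \<open>f\<close> and \<open>M * f\<close> have the same zeros with the same orders.\<close>

lemma roots_near_arc:
  fixes \<mu> D1 D2 :: "complex \<Rightarrow> complex" and lamj :: "real \<Rightarrow> complex" and L :: "'s \<Rightarrow> real"
    and f M :: "'s \<Rightarrow> complex \<Rightarrow> complex \<Rightarrow> complex"
  assumes mu: "\<mu> analytic_on {z0}" "\<mu> z0 = \<i> * of_real k0" "deriv \<mu> z0 \<noteq> 0"
    and lamj: "isCont lamj k0" "lamj k0 = z0" "\<forall>\<^sub>F k in nhds k0. \<mu> (lamj k) = \<i> * of_real k"
    and m: "m \<ge> 1"
    and D1: "D1 analytic_on {z0}" "\<forall>\<^sub>F w in at z0. D1 w \<noteq> 0" "zorder D1 z0 = int m"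
    and D2: "D2 analytic_on {z0}" "\<forall>\<^sub>F w in at z0. D2 w \<noteq> 0" "zorder D2 z0 = int m"
    and \<eta>0: "\<eta>0 > 0"
    and main: "\<And>s \<gamma> z. S s \<Longrightarrow> L s \<ge> X1 \<Longrightarrow> norm \<gamma> = 1 \<Longrightarrow> norm (z - z0) \<le> 1 / sqrt (L s) \<Longrightarrow>
      f s \<gamma> analytic_on {z} \<and> M s \<gamma> analytic_on {z} \<and> M s \<gamma> z \<noteq> 0 \<and>
      norm (M s \<gamma> z * f s \<gamma> z - (exp (\<mu> z * of_real (L s)) * D1 z - \<gamma> * D2 z)) \<le> exp (- \<eta>0 * L s)"
  shows "\<exists>C1>0. \<exists>\<eta>>0. \<forall>C>0. \<forall>\<eta>'. 0 < \<eta>' \<and> \<eta>' < \<eta> \<longrightarrow>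
    (\<exists>X0. \<forall>s. S s \<and> L s \<ge> X0 \<longrightarrow> (\<forall>k::real.
      (\<exists>Z Z' :: complex multiset.
         set_mset (Z + Z') \<subseteq> ball z0 (C / L s) \<and>
         (\<forall>z\<in>ball z0 (C / L s).
            f s (exp (\<i> * of_real (k * L s))) analytic_on {z} \<and>
            (\<forall>\<^sub>F w in at z. f s (exp (\<i> * of_real (k * L s))) w \<noteq> 0) \<and>
            zorder (f s (exp (\<i> * of_real (k * L s)))) z = int (count (Z + Z') z)) \<and>
         (\<forall>z\<in>#Z. \<exists>\<kappa>::real. [\<kappa> = k] (rmod (2 * pi / L s)) \<and> dist z (lamj \<kappa>) \<le> C1 / L s) \<and>
         size Z' = m \<and>
         (\<forall>z\<in>#Z'. dist z z0 \<le> C1 * exp (- \<eta>' * L s / (2 * (real m + 1)))))))"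
proof -

  \<comment> \<open>Local expansions of the critical eigenvalue and the Evans functions\<close>
  define c where "c = norm (deriv \<mu> z0)"
  have c: "c > 0" using mu by (simp add: c_def)
  obtain r1 K1 where \<mu>: "r1 > 0" "K1 > 0" "\<mu> holomorphic_on ball z0 r1"
    "\<And>w. w \<in> ball z0 r1 \<Longrightarrow> norm (\<mu> w - \<mu> z0) \<le> K1 * norm (w - z0)"
    "\<And>w. w \<in> ball z0 r1 \<Longrightarrow> norm (\<mu> w - \<mu> z0 - deriv \<mu> z0 * (w - z0)) \<le> K1 * norm (w - z0) ^ 2"
    "\<And>w v. w \<in> ball z0 r1 \<Longrightarrow> v \<in> ball z0 r1 \<Longrightarrow> norm (\<mu> w - \<mu> v - deriv \<mu> z0 * (w - v)) \<le> c / 2 * norm (w - v)"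
    using holomorphic_local_bounds[OF mu(1), of "c / 2"] c by auto
  obtain ra ga where ga: "ra > 0" "ga holomorphic_on ball z0 ra" "ga z0 \<noteq> 0"
    "\<And>w. w \<in> ball z0 ra \<Longrightarrow> D1 w = (w - z0) ^ m * ga w" using zero_factorization[OF D1] by blast
  obtain rb gb where gb: "rb > 0" "gb holomorphic_on ball z0 rb" "gb z0 \<noteq> 0"
    "\<And>w. w \<in> ball z0 rb \<Longrightarrow> D2 w = (w - z0) ^ m * gb w" using zero_factorization[OF D2] by blast
  have "ga analytic_on {z0}" "gb analytic_on {z0}"
    using ga gb by (auto intro: holomorphic_on_imp_analytic_at)
  then obtain ra' Ka rb' Kb where ga': "ra' > 0" "Ka > 0" "\<And>w. w \<in> ball z0 ra' \<Longrightarrow> norm (ga w - ga z0) \<le> Ka * norm (w - z0)"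
    and gb': "rb' > 0" "Kb > 0" "\<And>w. w \<in> ball z0 rb' \<Longrightarrow> norm (gb w - gb z0) \<le> Kb * norm (w - z0)"
    using holomorphic_local_bounds[of ga z0 1] holomorphic_local_bounds[of gb z0 1] by (metis zero_less_one)
  define a0 where "a0 = norm (ga z0)"
  define b0 where "b0 = norm (gb z0)"
  have ab: "a0 > 0" "b0 > 0" using ga gb by (auto simp: a0_def b0_def)
  \<comment> \<open>The last two radii keep \<open>ga\<close> and \<open>gb\<close> within a factor
    2 of their values at \<open>z0\<close>.\<close>
  define \<delta> where "\<delta> = Min {r1, ra, rb, ra', rb', a0 / (2 * Ka), b0 / (2 * Kb)}"
  have \<delta>: "\<delta> > 0" using \<mu>(1) ga(1) gb(1) ga'(1,2) gb'(1,2) ab by (simp add: \<delta>_def)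
  have \<delta>le: "\<delta> \<le> r1" "\<delta> \<le> ra" "\<delta> \<le> rb" "\<delta> \<le> ra'" "\<delta> \<le> rb'" "\<delta> \<le> a0 / (2 * Ka)" "\<delta> \<le> b0 / (2 * Kb)"
    unfolding \<delta>_def by (rule Min_le; simp)+
  have sub: "ball z0 \<delta> \<subseteq> ball z0 r1" "ball z0 \<delta> \<subseteq> ball z0 ra" "ball z0 \<delta> \<subseteq> ball z0 rb"
      "ball z0 \<delta> \<subseteq> ball z0 ra'" "ball z0 \<delta> \<subseteq> ball z0 rb'"
    by (intro subset_ball \<delta>le)+
  have gbd: "a0 / 2 \<le> norm (ga z)" "norm (ga z) \<le> 2 * a0" "b0 / 2 \<le> norm (gb z)" "norm (gb z) \<le> 2 * b0"
    if z: "z \<in> ball z0 \<delta>" for z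
  proof -
    have n: "norm (z - z0) \<le> \<delta>" using z by (simp add: dist_norm norm_minus_commute)
    have "norm (ga z - ga z0) \<le> Ka * norm (z - z0)" using z sub by (intro ga') auto
    also have "\<dots> \<le> Ka * (a0 / (2 * Ka))" using n \<delta>le ga' by (intro mult_left_mono) auto
    also have "\<dots> = a0 / 2" using ga' by simp
    finally have A: "norm (ga z - ga z0) \<le> a0 / 2" .
    have "norm (gb z - gb z0) \<le> Kb * norm (z - z0)" using z sub by (intro gb') auto
    also have "\<dots> \<le> Kb * (b0 / (2 * Kb))" using n \<delta>le gb' by (intro mult_left_mono) auto
    also have "\<dots> = b0 / 2" using gb' by simp
    finally have B: "norm (gb z - gb z0) \<le> b0 / 2" .
    have "norm (ga z) \<le> norm (ga z0) + norm (ga z - ga z0)" "norm (ga z0) \<le> norm (ga z) + norm (ga z - ga z0)"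
      "norm (gb z) \<le> norm (gb z0) + norm (gb z - gb z0)" "norm (gb z0) \<le> norm (gb z) + norm (gb z - gb z0)"
      by norm+
    then show "a0 / 2 \<le> norm (ga z)" "norm (ga z) \<le> 2 * a0" "b0 / 2 \<le> norm (gb z)" "norm (gb z) \<le> 2 * b0"
      using A B ab unfolding a0_def[symmetric] b0_def[symmetric] by linarith+
  qed
  have "(lamj \<longlongrightarrow> z0) (nhds k0)"
    using lamj(1,2) by (metis isCont_def tendsto_at_iff_tendsto_nhds)
  then have "\<forall>\<^sub>F k in nhds k0. lamj k \<in> ball z0 \<delta>"
    by (rule topological_tendstoD[OF _ open_ball]) (use \<delta> in simp)
  then have "\<forall>\<^sub>F k in nhds k0. lamj k \<in> ball z0 \<delta> \<and> \<mu> (lamj k) = \<i> * of_real k"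
    using lamj(3) by eventually_elim simp
  then obtain \<delta>k where \<delta>k: "\<delta>k > 0" "\<And>k. dist k k0 < \<delta>k \<Longrightarrow> lamj k \<in> ball z0 \<delta> \<and> \<mu> (lamj k) = \<i> * of_real k"
    unfolding eventually_nhds_metric by blast
  \<comment> \<open>\<open>R / l\<close> will bound the real part of \<open>\<mu>\<close> at every
    zero: the logarithms serve the zeros outside the small disc, and the 1 those inside it.\<close>
  define R where "R = 1 + (\<bar>ln ((4 * b0 + 2) / a0)\<bar> + \<bar>ln (b0 / (8 * a0))\<bar>)"
  have R: "R \<ge> 1" by (simp add: R_def)
  \<comment> \<open>\<open>2 / c\<close> is a Lipschitz constant for the local inverse of
    \<open>\<mu>\<close>, and \<open>pi / l\<close> is the largest distance of
    \<open>Im \<mu>\<close> from an admissible \<open>\<kappa>\<close>. The added 1 gives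
    \<open>C1 \<ge> 1\<close>, as required for the disc of radius \<open>\<rho>\<close>.\<close>
  define C1 where "C1 = 1 + 2 / c * (R + pi)"
  have C1: "C1 \<ge> 1" using c R pi_ge_zero by (simp add: C1_def)
  define K5 where "K5 = 6 * a0 * K1 ^ 2 + 2 * Ka + a0 * K1 + Kb"
  define \<tau> where "\<tau> = min 1 (b0 / 4)"
  have \<tau>: "\<tau> > 0" "\<tau> \<le> 1" "\<tau> \<le> b0 / 4" using ab by (auto simp: \<tau>_def)
  show ?thesis
  proof (rule exI[of _ C1], rule conjI[rotated], rule exI[of _ "2 * \<eta>0"], rule conjI[rotated], intro allI impI)
    show "C1 > 0" using C1 by simp
    show "2 * \<eta>0 > 0" using \<eta>0 by simp

    \<comment> \<open>Choice of the scales\<close>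
    fix C \<eta>' :: real assume C: "C > 0" and \<eta>': "0 < \<eta>' \<and> \<eta>' < 2 * \<eta>0"
    \<comment> \<open>With this \<open>e\<close> the radius \<open>\<rho>\<close> below is the one
      of the statement, and \<open>(m + 1) * e = \<eta>' / 2\<close> stays below
      \<open>\<eta>0\<close>.\<close>
    define e where "e = \<eta>' / (2 * (real m + 1))"
    have "x * (\<eta>' / (2 * x)) = \<eta>' / 2" if "x > 0" for x :: real using that by simp
    from this[of "real m + 1"] have "(real m + 1) * e = \<eta>' / 2" unfolding e_def by linarith
    then have "(real m + 1) * e < \<eta>0" using \<eta>' by linarith
    moreover have "e > 0" using \<eta>' by (simp add: e_def)
    ultimately have e: "e > 0" "(real m + 1) * e < \<eta>0" by blast+
    have "\<forall>\<^sub>F L in at_top. L \<ge> X1 \<and> L \<ge> 1 \<and> C / L < 1 / sqrt L \<and> 1 / sqrt L < \<delta> \<and> exp (- e * L) < C / L \<and>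
      K1 * exp (- e * L) * L \<le> 1 \<and> L ^ 2 * exp (- e * L) \<le> 1 \<and> (pi + K1 * C) / L < \<delta>k \<and> K5 + 1 \<le> (c * a0) * L / 4 \<and>
      exp (- \<eta>0 * L) < (exp (- e * L) / 4) ^ m * exp (- e * L) \<and> exp (- \<eta>0 * L) \<le> \<tau> * exp (- e * L) ^ m"
      by (rule eventually_scales) (use e C \<delta> \<delta>k \<tau> c ab in auto)
    then obtain X0 where X0: "\<And>L. L \<ge> X0 \<Longrightarrow> L \<ge> X1 \<and> L \<ge> 1 \<and> C / L < 1 / sqrt L \<and> 1 / sqrt L < \<delta> \<and> exp (- e * L) < C / L \<and>
      K1 * exp (- e * L) * L \<le> 1 \<and> L ^ 2 * exp (- e * L) \<le> 1 \<and> (pi + K1 * C) / L < \<delta>k \<and> K5 + 1 \<le> (c * a0) * L / 4 \<and>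
      exp (- \<eta>0 * L) < (exp (- e * L) / 4) ^ m * exp (- e * L) \<and> exp (- \<eta>0 * L) \<le> \<tau> * exp (- e * L) ^ m"
      unfolding eventually_at_top_linorder by blast
    show "\<exists>X0. \<forall>s. S s \<and> L s \<ge> X0 \<longrightarrow> (\<forall>k::real.
      (\<exists>Z Z' :: complex multiset.
         set_mset (Z + Z') \<subseteq> ball z0 (C / L s) \<and>
         (\<forall>z\<in>ball z0 (C / L s).
            f s (exp (\<i> * of_real (k * L s))) analytic_on {z} \<and>
            (\<forall>\<^sub>F w in at z. f s (exp (\<i> * of_real (k * L s))) w \<noteq> 0) \<and>
            zorder (f s (exp (\<i> * of_real (k * L s)))) z = int (count (Z + Z') z)) \<and>
         (\<forall>z\<in>#Z. \<exists>\<kappa>::real. [\<kappa> = k] (rmod (2 * pi / L s)) \<and> dist z (lamj \<kappa>) \<le> C1 / L s) \<and>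
         size Z' = m \<and>
         (\<forall>z\<in>#Z'. dist z z0 \<le> C1 * exp (- \<eta>' * L s / (2 * (real m + 1))))))"
    proof (rule exI[of _ X0], intro allI impI)
      fix s k assume s: "S s \<and> L s \<ge> X0"
      define l where "l = L s"
      define \<rho> where "\<rho> = exp (- e * l)"
      define \<gamma> where "\<gamma> = exp (\<i> * of_real (k * l))"
      have \<gamma>: "norm \<gamma> = 1" by (simp add: \<gamma>_def)
      have l: "l \<ge> X1" "l \<ge> 1" "C / l < 1 / sqrt l" "1 / sqrt l < \<delta>" "\<rho> < C / l" "K1 * \<rho> * l \<le> 1" "l ^ 2 * \<rho> \<le> 1"
        "(pi + K1 * C) / l < \<delta>k" "K5 + 1 \<le> (c * a0) * l / 4"
        "exp (- \<eta>0 * l) < (\<rho> / 4) ^ m * \<rho>" "exp (- \<eta>0 * l) \<le> \<tau> * \<rho> ^ m"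
        using X0[of "L s"] s unfolding l_def[symmetric] \<rho>_def[symmetric] by auto
      have \<rho>: "\<rho> > 0" by (simp add: \<rho>_def)
      define f' where "f' = f s \<gamma>"
      define M' where "M' = M s \<gamma>"
      define F where "F z = M' z * f' z" for z
      define g where "g z = exp (\<mu> z * of_real l) * ga z - \<gamma> * gb z" for z
      define Q where "Q = 1 / sqrt l"
      have Q: "C / l < Q" "Q < \<delta>" "\<rho> < Q" using l by (auto simp: Q_def)
      have near: "f' analytic_on {z}" "M' analytic_on {z}" "M' z \<noteq> 0"
        "norm (F z - (z - z0) ^ m * g z) \<le> exp (- \<eta>0 * l)" if z: "z \<in> ball z0 Q" for z
      proof -
        have n: "norm (z - z0) \<le> 1 / sqrt (L s)" using z by (simp add: Q_def l_def dist_norm norm_minus_commute)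
        have ml: "S s" "X1 \<le> L s" using s l by (auto simp: l_def)
        have zd: "z \<in> ball z0 \<delta>" using z Q by auto
        have "exp (\<mu> z * of_real (L s)) * D1 z - \<gamma> * D2 z = (z - z0) ^ m * g z"
          using ga(4)[OF subsetD[OF sub(2) zd]] gb(4)[OF subsetD[OF sub(3) zd]] by (simp add: g_def l_def algebra_simps)
        with main[OF ml \<gamma> n] show "f' analytic_on {z}" "M' analytic_on {z}" "M' z \<noteq> 0"
          "norm (F z - (z - z0) ^ m * g z) \<le> exp (- \<eta>0 * l)"
          by (auto simp: f'_def M'_def F_def l_def)
      qed

      \<comment> \<open>Zeros in the small disc\<close>
      have Fhol: "F holomorphic_on ball z0 Q"
        unfolding F_def using near(1,2)
        by (intro holomorphic_on_mult analytic_imp_holomorphic) (metis analytic_on_analytic_at)+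
      have subQ: "ball z0 Q \<subseteq> ball z0 \<delta>" using Q by auto
      have ghol: "g holomorphic_on ball z0 Q"
        unfolding g_def using sub subQ
        by (intro holomorphic_intros holomorphic_on_subset[OF \<mu>(3)] holomorphic_on_subset[OF ga(2)]
            holomorphic_on_subset[OF gb(2)]) auto
      obtain r where r: "r = \<rho> \<or> r = \<rho> / 4" and rg: "\<And>z. norm (z - z0) = r \<Longrightarrow> \<rho> \<le> norm (g z)"
      proof (rule affine_lower_bound[OF \<rho>])
        show "K5 + 1 \<le> (c * a0 * l) / 4" using l by simp
        show "norm (exp (\<mu> z0 * of_real l) * ga z0 * deriv \<mu> z0 * of_real l) = c * a0 * l"
          using l by (simp add: norm_mult mu(2) c_def a0_def)
        fix z assume z: "norm (z - z0) \<le> \<rho>"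
        then have "norm (z0 - z) < \<delta>" using Q by (simp add: norm_minus_commute)
        then have zd: "z \<in> ball z0 \<delta>" by (simp add: dist_norm)
        show "norm (g z - g z0 - exp (\<mu> z0 * of_real l) * ga z0 * deriv \<mu> z0 * of_real l * (z - z0)) \<le> K5 * \<rho>"
          unfolding g_def K5_def a0_def
          by (rule model_affine[where \<mu> = \<mu> and ?z0.0 = z0 and z = z and ga = ga and gb = gb and ?K1.0 = K1 and Ka = Ka
              and Kb = Kb and L = l and \<rho> = \<rho> and \<mu>' = "deriv \<mu> z0" and \<gamma> = \<gamma>, OF mu(2) z]) (use zd sub \<mu> ga' gb' gbd(2) l \<rho> \<gamma> in \<open>auto simp: a0_def\<close>)
      qed blast
      have r0: "0 < r" "r \<le> \<rho>" "r < Q" "\<rho> / 4 \<le> r" using r \<rho> Q by auto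
      \<comment> \<open>Either radius is at least \<open>\<rho> / 4\<close>, and
        \<open>norm (g z) \<ge> \<rho>\<close> on the chosen circle, so the model is at least
        \<open>(\<rho> / 4) ^ m * \<rho>\<close> there, more than the error.\<close>
      have less: "norm (F z - (z - z0) ^ m * g z) < norm ((z - z0) ^ m * g z)" if z: "z \<in> sphere z0 r" for z
      proof -
        have nz: "norm (z - z0) = r" using z by (simp add: dist_norm norm_minus_commute)
        have "z \<in> ball z0 Q" using z r0 by auto
        then have "norm (F z - (z - z0) ^ m * g z) \<le> exp (- \<eta>0 * l)" by (rule near)
        also have "\<dots> < (\<rho> / 4) ^ m * \<rho>" by (rule l)
        also have "\<dots> \<le> r ^ m * norm (g z)" using r0 \<rho> rg[OF nz] by (intro mult_mono power_mono) auto
        finally show ?thesis using nz by (simp add: norm_mult norm_power)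
      qed
      have cnt: "m \<le> (\<Sum>z | z \<in> ball z0 r \<and> F z = 0. nat (zorder F z))"
        by (rule rouche_count[OF r0(1,3) Fhol ghol m less])
      define w0 where "w0 = z0 + of_real r"
      have w0s: "w0 \<in> sphere z0 r" using r0 by (simp add: w0_def dist_norm)
      have w0: "w0 \<in> ball z0 Q" "F w0 \<noteq> 0" using less[OF w0s] w0s r0 by auto
      note iso = holomorphic_zeros_isolated[OF Fhol w0]

      \<comment> \<open>Zeros with multiplicity as multisets\<close>
      have fF: "f' z = 0 \<longleftrightarrow> F z = 0" if "z \<in> ball z0 Q" for z using near(3)[OF that] by (simp add: F_def)
      have fnz: "\<forall>\<^sub>F w in at z. f' w \<noteq> 0" if "z \<in> ball z0 Q" for z
        using iso(1)[OF that] by eventually_elim (auto simp: F_def)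
      have ord: "zorder F z = zorder f' z" if z: "z \<in> ball z0 Q" for z
      proof -
        have "zorder F z = zorder M' z + zorder f' z" unfolding F_def
          by (rule zorder_times_analytic) (use near[OF z] iso(1)[OF z] in \<open>auto simp: F_def\<close>)
        moreover have "zorder M' z = 0" using near[OF z] by (intro zorder_eq_0I) auto
        ultimately show ?thesis by simp
      qed
      have ord0: "zorder f' z \<ge> 0" if z: "z \<in> ball z0 Q" for z
        using near(1)[OF z] fnz[OF z] by (intro zorder_ge_0 eventually_frequently) auto
      define n where "n z = nat (zorder f' z)" for z
      define Sz where "Sz = {z \<in> ball z0 (C / l). F z = 0}"
      define Si where "Si = {z. z \<in> ball z0 r \<and> F z = 0}"
      have finS: "finite Sz" by (rule finite_subset[OF _ iso(2)[OF Q(1)]]) (auto simp: Sz_def)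
      have SiS: "Si \<subseteq> Sz" using r0 l by (auto simp: Si_def Sz_def)
      have finSi: "finite Si" using SiS finS by (rule finite_subset)
      have SQ: "z \<in> ball z0 Q" if "z \<in> Sz" for z using that Q by (auto simp: Sz_def)
      define T where "T = (\<Sum>z\<in>Sz. replicate_mset (n z) z)"
      define Ti where "Ti = (\<Sum>z\<in>Si. replicate_mset (n z) z)"
      have cT: "count T z = (if z \<in> Sz then n z else 0)" "count Ti z = (if z \<in> Si then n z else 0)" for z
        unfolding T_def Ti_def by (rule size_zero_multiset finS finSi)+
      have "size Ti = (\<Sum>z\<in>Si. n z)" unfolding Ti_def by (rule size_zero_multiset[OF finSi])
      also have "\<dots> = (\<Sum>z\<in>Si. nat (zorder F z))"
        by (intro sum.cong refl) (use ord SQ SiS in \<open>auto simp: n_def\<close>)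
      finally have "m \<le> size Ti" using cnt by (simp add: Si_def)
      \<comment> \<open>The disc may hold more than \<open>m\<close> zeros, because \<open>g\<close>
        can vanish there too. Exactly \<open>m\<close> are selected, and any surplus remains in
        \<open>Z\<close>.\<close>
      then obtain Z' where Z': "Z' \<subseteq># Ti" "size Z' = m" by (rule submultiset_of_size)
      have "Ti \<subseteq># T" using SiS by (auto simp: subseteq_mset_def cT)
      then have Z'T: "Z' \<subseteq># T" using Z'(1) by simp
      define Z where "Z = T - Z'"
      have ZZ: "Z + Z' = T" using Z'T by (simp add: Z_def)
      have setT: "z \<in> Sz" if "z \<in># T" for z using that by (metis cT(1) count_eq_zero_iff)
      have setTi: "z \<in> Si" if "z \<in># Ti" for z using that by (metis cT(2) count_eq_zero_iff)
      show "\<exists>Z Z' :: complex multiset.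
         set_mset (Z + Z') \<subseteq> ball z0 (C / L s) \<and>
         (\<forall>z\<in>ball z0 (C / L s).
            f s (exp (\<i> * of_real (k * L s))) analytic_on {z} \<and>
            (\<forall>\<^sub>F w in at z. f s (exp (\<i> * of_real (k * L s))) w \<noteq> 0) \<and>
            zorder (f s (exp (\<i> * of_real (k * L s)))) z = int (count (Z + Z') z)) \<and>
         (\<forall>z\<in>#Z. \<exists>\<kappa>::real. [\<kappa> = k] (rmod (2 * pi / L s)) \<and> dist z (lamj \<kappa>) \<le> C1 / L s) \<and>
         size Z' = m \<and>
         (\<forall>z\<in>#Z'. dist z z0 \<le> C1 * exp (- \<eta>' * L s / (2 * (real m + 1))))"
        unfolding l_def[symmetric] \<gamma>_def[symmetric] f'_def[symmetric]
      proof (rule exI[of _ Z], rule exI[of _ Z'], intro conjI ballI)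
        show "set_mset (Z + Z') \<subseteq> ball z0 (C / l)" unfolding ZZ using setT by (auto simp: Sz_def)
        show "size Z' = m" by fact
      next
        fix z assume z: "z \<in> ball z0 (C / l)"
        then have zQ: "z \<in> ball z0 Q" using Q by auto
        show "f' analytic_on {z}" by (rule near[OF zQ])
        show "\<forall>\<^sub>F w in at z. f' w \<noteq> 0" by (rule fnz[OF zQ])
        show "zorder f' z = int (count (Z + Z') z)"
        proof (cases "F z = 0")
          case True
          then show ?thesis unfolding ZZ cT using z ord0[OF zQ] by (simp add: Sz_def n_def)
        next
          case False
          then have "zorder f' z = 0" using fF[OF zQ] near[OF zQ] by (intro zorder_eq_0I) auto
          then show ?thesis unfolding ZZ cT using False by (simp add: Sz_def)
        qed
      next
        fix z assume "z \<in># Z'"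
        then have "z \<in># Ti" using Z'(1) by (rule mset_subset_eqD[rotated])
        then have "z \<in> Si" by (rule setTi)
        then have "dist z z0 \<le> 1 * \<rho>" using r0 by (simp add: Si_def dist_commute)
        also have "\<dots> \<le> C1 * \<rho>" using C1 \<rho> by (intro mult_right_mono) auto
        also have "\<rho> = exp (- \<eta>' * l / (2 * (real m + 1)))" by (simp add: \<rho>_def e_def)
        finally show "dist z z0 \<le> C1 * exp (- \<eta>' * l / (2 * (real m + 1)))" .
      next

        \<comment> \<open>Distance of the remaining zeros from the arc\<close>
        fix z assume "z \<in># Z"
        then have "z \<in> Sz" using setT by (auto simp: Z_def dest: in_diffD)
        then have z: "z \<in> ball z0 (C / l)" "F z = 0" "z \<in> ball z0 Q" using SQ by (auto simp: Sz_def)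
        then have zd: "z \<in> ball z0 \<delta>" using subQ by blast
        have nz: "norm (z - z0) \<le> C / l" using z by (simp add: dist_norm norm_minus_commute)
        have \<mu>z: "norm (\<mu> z - \<mu> z0) \<le> K1 * norm (z - z0)" using zd sub by (intro \<mu>) auto
        \<comment> \<open>A surplus zero may lie close to \<open>z0\<close>, so both positions are
          treated. Near \<open>z0\<close> the bound holds simply because the real part of
          \<open>\<mu>\<close> vanishes at \<open>z0\<close>.\<close>
        have Rez: "\<bar>Re (\<mu> z)\<bar> \<le> R / l"
        proof (cases "norm (z - z0) \<le> \<rho>")
          case True
          have "\<bar>Re (\<mu> z)\<bar> = \<bar>Re (\<mu> z - \<mu> z0)\<bar>" by (simp add: mu(2))
          also have "\<dots> \<le> K1 * \<rho>"
            using abs_Re_le_cmod[of "\<mu> z - \<mu> z0"] \<mu>z mult_left_mono[OF True, of K1] \<mu>(2) by linarith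
          also have "\<dots> \<le> R / l" using l R by (simp add: field_simps)
          finally show ?thesis .
        next
          case False
          then have "norm (z - z0) ^ m \<ge> \<rho> ^ m" using \<rho> by (intro power_mono) auto
          \<comment> \<open>At a zero of \<open>F\<close> the model is as small as the error.
            Division by \<open>(z - z0) ^ m\<close>, which is at least \<open>\<rho> ^ m\<close> in
            size here, leaves \<open>g\<close> at most \<open>\<tau>\<close>.\<close>
          have "norm (z - z0) ^ m * norm (g z) \<le> exp (- \<eta>0 * l)"
            using near(4)[OF z(3)] z(2) by (simp add: norm_mult norm_power)
          also have "\<dots> \<le> \<tau> * \<rho> ^ m" by (rule l)
          also have "\<dots> \<le> \<tau> * norm (z - z0) ^ m" using \<tau> \<open>norm (z - z0) ^ m \<ge> \<rho> ^ m\<close> by (intro mult_left_mono) auto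
          finally have "norm (z - z0) ^ m * norm (g z) \<le> norm (z - z0) ^ m * \<tau>" by (simp add: mult.commute)
          moreover have "norm (z - z0) ^ m > 0" using False \<rho> by (intro zero_less_power) linarith
          ultimately have "norm (g z) \<le> \<tau>" by (rule mult_left_le_imp_le)
          then have "norm (exp (\<mu> z * of_real l) * ga z - \<gamma> * gb z) \<le> \<tau>" by (simp add: g_def)
          then have "\<bar>Re (\<mu> z * of_real l)\<bar> \<le> \<bar>ln ((4 * b0 + 2) / a0)\<bar> + \<bar>ln (b0 / (8 * a0))\<bar>"
            by (rule Re_bound_of_model_zero[OF _ \<gamma> \<tau>(2,3) gbd[OF zd] ab])
          then have "\<bar>Re (\<mu> z)\<bar> * l \<le> R" using l by (simp add: R_def abs_mult)
          then show ?thesis using l by (simp add: field_simps)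
        qed
        obtain \<kappa> where \<kappa>: "[\<kappa> = k] (rmod (2 * pi / l))" "\<bar>\<kappa> - Im (\<mu> z)\<bar> \<le> (2 * pi / l) / 2"
          using nearest_congruent[of "2 * pi / l" k "Im (\<mu> z)"] l by auto
        have \<kappa>2: "\<bar>\<kappa> - Im (\<mu> z)\<bar> \<le> pi / l" using \<kappa>(2) by simp
        \<comment> \<open>The nearest admissible \<open>\<kappa>\<close> must be close to
          \<open>k0\<close>, since only there is \<open>lamj\<close> known to invert
          \<open>\<mu>\<close>.\<close>
        have "\<bar>Im (\<mu> z) - k0\<bar> = \<bar>Im (\<mu> z - \<mu> z0)\<bar>" by (simp add: mu(2))
        also have "\<dots> \<le> K1 * (C / l)"
          using abs_Im_le_cmod[of "\<mu> z - \<mu> z0"] \<mu>z mult_left_mono[OF nz, of K1] \<mu>(2) by linarith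
        finally have "\<bar>\<kappa> - k0\<bar> \<le> pi / l + K1 * C / l" using \<kappa>2 by simp
        also have "\<dots> < \<delta>k" using l(8) by (simp add: add_divide_distrib)
        finally have \<kappa>n: "lamj \<kappa> \<in> ball z0 \<delta>" "\<mu> (lamj \<kappa>) = \<i> * of_real \<kappa>" using \<delta>k(2)[of \<kappa>] by (auto simp: dist_real_def)
        define v where "v = lamj \<kappa>"
        \<comment> \<open>The error slope \<open>c / 2\<close> against the derivative of size
          \<open>c\<close> shows that \<open>\<mu>\<close> shrinks distances by a factor of
          \<open>c / 2\<close> at worst.\<close>
        have "norm (\<mu> z - \<mu> v - deriv \<mu> z0 * (z - v)) \<le> c / 2 * norm (z - v)"
          using zd \<kappa>n sub by (intro \<mu>) (auto simp: v_def)
        moreover have "norm (deriv \<mu> z0 * (z - v)) \<le> norm (\<mu> z - \<mu> v) + norm (\<mu> z - \<mu> v - deriv \<mu> z0 * (z - v))"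
          by norm
        ultimately have "c / 2 * norm (z - v) \<le> norm (\<mu> z - \<mu> v)" by (simp add: norm_mult c_def)
        also have "\<dots> \<le> \<bar>Re (\<mu> z - \<mu> v)\<bar> + \<bar>Im (\<mu> z - \<mu> v)\<bar>" by (rule cmod_le)
        also have "\<dots> = \<bar>Re (\<mu> z)\<bar> + \<bar>\<kappa> - Im (\<mu> z)\<bar>" using \<kappa>n(2) by (simp add: v_def abs_minus_commute)
        also have "\<dots> \<le> R / l + pi / l" using Rez \<kappa>2 by linarith
        finally have "norm (z - v) \<le> 2 / c * (R / l + pi / l)" using c by (simp add: field_simps)
        also have "\<dots> = 2 / c * (R + pi) / l" by (simp add: add_divide_distrib algebra_simps)
        also have "\<dots> \<le> C1 / l" using l by (intro divide_right_mono) (auto simp: C1_def)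
        finally have "dist z (lamj \<kappa>) \<le> C1 / l" by (simp add: v_def dist_norm)
        then show "\<exists>\<kappa>. [\<kappa> = k] (rmod (2 * pi / l)) \<and> dist z (lamj \<kappa>) \<le> C1 / l" using \<kappa>(1) by blast
      qed
    qed
  qed
qed

theorem corollary5p2:
  fixes A :: "real \<Rightarrow> real \<Rightarrow> complex \<Rightarrow> complex^'n^'n"
    and X :: "real \<Rightarrow> real"
    and Ainf :: "complex \<Rightarrow> complex^'n^'n"
    and \<Psi> :: "real \<Rightarrow> real \<Rightarrow> complex \<Rightarrow> complex^'n^'n"
    and \<nu> \<theta> \<beta> :: real
    and J j m :: nat
    and lam :: "nat \<Rightarrow> real \<Rightarrow> complex"
    and k\<^sub>0 :: real
    and \<zeta>\<^sub>0 :: complex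
    and muc :: "complex \<Rightarrow> complex"
    and \<Pi>c \<Pi>ss \<Pi>su :: "complex \<Rightarrow> complex^'n^'n"
    and Pm Pp :: "real \<Rightarrow> complex \<Rightarrow> complex^'n^'n"
  assumes family: "wave_family A X"
    and H1: "filterlim X at_top (at_right 0)"
    and rates: "\<nu> > 0" "\<theta> > 0"
    and H2: "\<forall>M>0. \<exists>C>0. \<forall>x \<zeta>. norm \<zeta> \<le> M \<longrightarrow>
               norm (A 0 x \<zeta> - Ainf \<zeta>) \<le> C * exp (- \<nu> * \<bar>x\<bar>)"
    and H3: "\<forall>M>0. \<exists>C>0. \<forall>\<epsilon>>0. \<forall>x \<zeta>. norm \<zeta> \<le> M \<and> \<bar>x\<bar> \<le> X \<epsilon> / 2 \<longrightarrow>
               norm (A \<epsilon> x \<zeta> - A 0 x \<zeta>) \<le> C * exp (- \<theta> * X \<epsilon> / 2)"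
    and solution: "\<forall>\<epsilon>>0. solution_operator (A \<epsilon>) (\<Psi> \<epsilon>)"
    and curves: "ess_spectrum_curves Ainf J lam"
    and point: "\<zeta>\<^sub>0 = lam j k\<^sub>0"
    and arc: "isolated_arc Ainf J lam j k\<^sub>0 muc"
    and projections: "critical_projections Ainf muc \<zeta>\<^sub>0 \<Pi>c \<Pi>ss \<Pi>su"
    and \<beta>: "0 < \<beta>" "\<beta> < min \<theta> \<nu>"
    and conjugators: "conjugator (A 0) Ainf \<zeta>\<^sub>0 \<beta> {0..} Pp" "conjugator (A 0) Ainf \<zeta>\<^sub>0 \<beta> {..0} Pm"
    and m: "m \<ge> 1"
    and zero1: "zero_of_degree (hom_evans_1 Pm Pp \<Pi>c \<Pi>ss \<Pi>su) \<zeta>\<^sub>0 m"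
    and zero2: "zero_of_degree (hom_evans_2 Pm Pp \<Pi>c \<Pi>ss \<Pi>su) \<zeta>\<^sub>0 m"
  shows "\<exists>C1>0. \<exists>\<eta>>0. \<forall>C>0. \<forall>\<eta>'. 0 < \<eta>' \<and> \<eta>' < \<eta> \<longrightarrow>
    (\<exists>X0. \<forall>\<epsilon>>0. X \<epsilon> \<ge> X0 \<longrightarrow> (\<forall>k::real.
      (\<exists>Z Z' :: complex multiset.
         set_mset (Z + Z') \<subseteq> ball \<zeta>\<^sub>0 (C / X \<epsilon>) \<and>
         (\<forall>\<zeta>\<in>ball \<zeta>\<^sub>0 (C / X \<epsilon>).
            zero_of_degree (periodic_evans (\<Psi> \<epsilon>) (X \<epsilon>) (exp (\<i> * of_real (k * X \<epsilon>)))) \<zeta>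
              (count (Z + Z') \<zeta>)) \<and>
         (\<forall>z\<in>#Z. \<exists>\<kappa>::real. [\<kappa> = k] (rmod (2 * pi / X \<epsilon>)) \<and> dist z (lam j \<kappa>) \<le> C1 / X \<epsilon>) \<and>
         size Z' = m \<and>
         (\<forall>z\<in>#Z'. dist z \<zeta>\<^sub>0 \<le> C1 * exp (- \<eta>' * X \<epsilon> / (2 * (real m + 1)))))))"
proof -

  \<comment> \<open>The filter of large periods over shrinking discs and unimodular
    multipliers\<close>
  define F :: "(real \<times> complex \<times> complex) filter" where
    "F = inf (filtercomap (\<lambda>t. X (fst t)) at_top)
      (principal {t. fst t > 0 \<and> norm (snd (snd t)) = 1 \<and> norm (fst (snd t) - \<zeta>\<^sub>0) \<le> 1 / sqrt (X (fst t))})"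
  define L where "L t = X (fst t)" for t :: "real \<times> complex \<times> complex"
  \<comment> \<open>Unfolded, a statement along \<open>F\<close> holds for all admissible triples
    whose period exceeds a single bound \<open>N\<close>. This is the uniformity in
    \<open>\<epsilon>\<close>, \<open>\<zeta>\<close> and \<open>\<gamma>\<close> that the theorem
    needs.\<close>
  have evF: "eventually Q F \<longleftrightarrow> (\<exists>N. \<forall>t. N \<le> X (fst t) \<longrightarrow> fst t > 0 \<and> norm (snd (snd t)) = 1 \<and>
      norm (fst (snd t) - \<zeta>\<^sub>0) \<le> 1 / sqrt (X (fst t)) \<longrightarrow> Q t)" for Q
    unfolding F_def eventually_inf_principal eventually_filtercomap_at_top_linorder by simp
  interpret growth_scale F L
  proof
    have "\<forall>\<^sub>F t in F. Z \<le> L t" for Z unfolding evF L_def by (intro exI[of _ Z]) simp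
    then show "filterlim L at_top F" by (simp add: filterlim_at_top)
  qed
  have base: "\<forall>\<^sub>F t in F. fst t > 0 \<and> norm (snd (snd t)) = 1 \<and> norm (fst (snd t) - \<zeta>\<^sub>0) \<le> 1 / sqrt (L t)"
    unfolding evF L_def by (intro exI[of _ 0]) simp
  \<comment> \<open>The discs shrink to the arc point, so whatever holds in some neighbourhood of it
    holds along the filter.\<close>
  have near: "\<forall>\<^sub>F t in F. Q (fst (snd t))" if "\<forall>\<^sub>F z in nhds \<zeta>\<^sub>0. Q z" for Q
  proof -
    obtain d where d: "d > 0" "\<And>z. dist z \<zeta>\<^sub>0 < d \<Longrightarrow> Q z" using \<open>\<forall>\<^sub>F z in nhds \<zeta>\<^sub>0. Q z\<close> unfolding eventually_nhds_metric by blast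
    from base eventually_L_ge[of "max 1 ((2 / d)\<^sup>2)"] show ?thesis
    proof eventually_elim
      case (elim t)
      have L: "L t \<ge> 1" "(2 / d)\<^sup>2 \<le> L t" using elim(2) by auto
      have "2 / d \<le> sqrt (L t)" using L(2) by (rule real_le_rsqrt)
      then have "1 / sqrt (L t) \<le> d / 2" using d(1) L(1) by (simp add: field_simps)
      then have "norm (fst (snd t) - \<zeta>\<^sub>0) < d" using elim(1) d(1) by linarith
      then show ?case by (intro d(2)) (simp add: dist_norm)
    qed
  qed
  have radius: "\<forall>\<^sub>F z in nhds \<zeta>\<^sub>0. norm (z - \<zeta>\<^sub>0) < r" if "r > 0" for r
    using that unfolding eventually_nhds_metric dist_norm by blast

  \<comment> \<open>Uniform constants and the conjugators in the matrix algebra\<close>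
  define N where "N = real CARD('n) * real CARD('n)"
  have N: "N \<ge> 0" unfolding N_def by simp
  have cm: "norm (cmat D) \<le> N * k" if "norm D \<le> k" for D :: "complex^'n^'n" and k
    by (rule order_trans[OF norm_cmat_le[of D, folded N_def] mult_left_mono[OF that N]])
  obtain C where C: "\<forall>\<epsilon>>0. \<forall>x z. \<bar>x\<bar> \<le> X \<epsilon> / 2 \<longrightarrow> norm (z - \<zeta>\<^sub>0) < 3 \<longrightarrow> norm (cmat (A \<epsilon> x z)) \<le> C"
    using system_bound[OF family rates H2 H3] by (rule exE)
  have M: "norm \<zeta>\<^sub>0 + 3 > 0" using norm_ge_zero[of \<zeta>\<^sub>0] by linarith
  obtain C3 where C3': "C3 > 0 \<and> (\<forall>\<epsilon>>0. \<forall>x z. norm z \<le> norm \<zeta>\<^sub>0 + 3 \<and> \<bar>x\<bar> \<le> X \<epsilon> / 2 \<longrightarrow>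
      norm (A \<epsilon> x z - A 0 x z) \<le> C3 * exp (- \<theta> * X \<epsilon> / 2))"
    using H3[rule_format, OF M] by (rule exE)
  note C3 = C3'[THEN conjunct1] C3'[THEN conjunct2, rule_format]
  obtain \<alpha> K1 where \<alpha>: "\<alpha> > 0" and K1: "K1 > 0" and split: "\<forall>\<^sub>F z in nhds \<zeta>\<^sub>0.
      splitting (cmat (\<Pi>su z)) (cmat (\<Pi>c z)) (cmat (\<Pi>ss z)) \<and>
      cmat (Ainf z) * cmat (\<Pi>su z) = cmat (\<Pi>su z) * cmat (Ainf z) \<and>
      cmat (Ainf z) * cmat (\<Pi>c z) = sc (muc z) * cmat (\<Pi>c z) \<and>
      cmat (Ainf z) * cmat (\<Pi>c z) = cmat (\<Pi>c z) * cmat (Ainf z) \<and>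
      cmat (Ainf z) * cmat (\<Pi>ss z) = cmat (\<Pi>ss z) * cmat (Ainf z) \<and>
      (\<exists>u w. \<forall>i j. ent (cmat (\<Pi>c z)) i j = u i * w j) \<and> cmat (\<Pi>c z) \<noteq> 0 \<and>
      norm (cmat (\<Pi>su z)) \<le> K1 \<and> norm (cmat (\<Pi>c z)) \<le> K1 \<and> norm (cmat (\<Pi>ss z)) \<le> K1 \<and> norm (cmat (Ainf z)) \<le> K1 \<and>
      (\<forall>x\<ge>0. norm (exp ((- x) *\<^sub>R cmat (Ainf z)) * cmat (\<Pi>su z)) \<le> K1 * exp (- \<alpha> * x) \<and>
             norm (exp (x *\<^sub>R cmat (Ainf z)) * cmat (\<Pi>ss z)) \<le> K1 * exp (- \<alpha> * x))"
    using critical_splitting[OF limit_matrix_continuous[OF family rates(1) H2] point arc projections]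
    by (elim exE conjE) (rule that, assumption+)
  have arc': "j < J" "muc analytic_on {\<zeta>\<^sub>0}" "muc \<zeta>\<^sub>0 = \<i> * of_real k\<^sub>0" "deriv muc \<zeta>\<^sub>0 \<noteq> 0"
    "\<forall>\<^sub>F k in nhds k\<^sub>0. muc (lam j k) = \<i> * of_real k"
    using arc unfolding isolated_arc_def point by blast+
  obtain K2 where K2: "K2 \<ge> 0" "\<forall>\<^sub>F z in nhds \<zeta>\<^sub>0. \<bar>Re (muc z)\<bar> \<le> K2 * norm (z - \<zeta>\<^sub>0)"
    using Re_critical_eigenvalue_bound[OF arc'(2)] arc'(3) by auto
  have Pan: "matrix_analytic_on \<Pi>c {\<zeta>\<^sub>0}" "matrix_analytic_on \<Pi>ss {\<zeta>\<^sub>0}" "matrix_analytic_on \<Pi>su {\<zeta>\<^sub>0}"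
    using projections unfolding critical_projections_def by blast+
  obtain rp Kp where rp: "rp > 0" and cp: "(\<forall>x\<in>{0..}. matrix_analytic_on (Pp x) (ball \<zeta>\<^sub>0 rp)) \<and>
        (\<forall>x\<in>{0..}. \<forall>z\<in>ball \<zeta>\<^sub>0 rp.
           ((\<lambda>y. Pp y z) has_vector_derivative A 0 x z ** Pp x z - Pp x z ** Ainf z) (at x within {0..}) \<and>
           norm (Pp x z) \<le> Kp \<and> invertible (Pp x z) \<and> norm (matrix_inv (Pp x z)) \<le> Kp \<and>
           norm (Pp x z - mat 1) \<le> Kp * exp (- \<beta> * \<bar>x\<bar>))"
    using conjugators(1) unfolding conjugator_def by (elim exE conjE) (rule that, assumption, intro conjI, assumption+)
  obtain rm Km where rm: "rm > 0" and cm': "(\<forall>x\<in>{..0}. matrix_analytic_on (Pm x) (ball \<zeta>\<^sub>0 rm)) \<and>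
        (\<forall>x\<in>{..0}. \<forall>z\<in>ball \<zeta>\<^sub>0 rm.
           ((\<lambda>y. Pm y z) has_vector_derivative A 0 x z ** Pm x z - Pm x z ** Ainf z) (at x within {..0}) \<and>
           norm (Pm x z) \<le> Km \<and> invertible (Pm x z) \<and> norm (matrix_inv (Pm x z)) \<le> Km \<and>
           norm (Pm x z - mat 1) \<le> Km * exp (- \<beta> * \<bar>x\<bar>))"
    using conjugators(2) unfolding conjugator_def by (elim exE conjE) (rule that, assumption, intro conjI, assumption+)
  have Ppf: "((\<lambda>y. cmat (Pp y z)) has_vector_derivative cmat (A 0 x z) * cmat (Pp x z) - cmat (Pp x z) * cmat (Ainf z)) (at x within {0..l})"
      "norm (cmat (Pp x z)) \<le> N * Kp" "norm (cmat (matrix_inv (Pp x z))) \<le> N * Kp"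
      "cmat (matrix_inv (Pp x z)) * cmat (Pp x z) = 1" "cmat (Pp x z) * cmat (matrix_inv (Pp x z)) = 1"
      "norm (cmat (Pp x z) - 1) \<le> N * (Kp * exp (- \<beta> * x))"
    if x: "0 \<le> x" and z: "norm (z - \<zeta>\<^sub>0) < rp" for x z l
  proof -
    have "x \<in> {0..}" "z \<in> ball \<zeta>\<^sub>0 rp" using x z by (auto simp: dist_norm norm_minus_commute)
    note P = cp[THEN conjunct2, rule_format, OF this]
    have "((\<lambda>y. Pp y z) has_vector_derivative A 0 x z ** Pp x z - Pp x z ** Ainf z) (at x within {0..l})"
      by (rule has_vector_derivative_within_subset[OF P[THEN conjunct1]]) auto
    from cmat_has_vector_derivative[OF this]
    show "((\<lambda>y. cmat (Pp y z)) has_vector_derivative cmat (A 0 x z) * cmat (Pp x z) - cmat (Pp x z) * cmat (Ainf z)) (at x within {0..l})"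
      unfolding cmat_simps(2,3) .
    show "norm (cmat (Pp x z)) \<le> N * Kp" "norm (cmat (matrix_inv (Pp x z))) \<le> N * Kp"
      by (rule cm; use P in blast)+
    have i: "invertible (Pp x z)" using P by blast
    show "cmat (matrix_inv (Pp x z)) * cmat (Pp x z) = 1" "cmat (Pp x z) * cmat (matrix_inv (Pp x z)) = 1"
      unfolding cmat_simps(3)[symmetric] matrix_inv_mult[OF i] cmat_simps(5) by (rule refl)+
    have "norm (Pp x z - mat 1) \<le> Kp * exp (- \<beta> * x)" using P x by simp
    from cm[OF this] show "norm (cmat (Pp x z) - 1) \<le> N * (Kp * exp (- \<beta> * x))" unfolding cmat_simps(2,5) .
  qed
  \<comment> \<open>The conjugator for negative \<open>x\<close> is read in the variable
    \<open>- x\<close>; reflection changes the sign of both \<open>A 0\<close> and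
    \<open>Ainf\<close> in its equation.\<close>
  have Pmf: "((\<lambda>y. cmat (Pm (- y) z)) has_vector_derivative (- cmat (A 0 (- x) z)) * cmat (Pm (- x) z) - cmat (Pm (- x) z) * (- cmat (Ainf z))) (at x within {0..l})"
      "norm (cmat (Pm (- x) z)) \<le> N * Km" "norm (cmat (matrix_inv (Pm (- x) z))) \<le> N * Km"
      "cmat (matrix_inv (Pm (- x) z)) * cmat (Pm (- x) z) = 1" "cmat (Pm (- x) z) * cmat (matrix_inv (Pm (- x) z)) = 1"
      "norm (cmat (Pm (- x) z) - 1) \<le> N * (Km * exp (- \<beta> * x))"
    if x: "0 \<le> x" and z: "norm (z - \<zeta>\<^sub>0) < rm" for x z l
  proof -
    have "- x \<in> {..0}" "z \<in> ball \<zeta>\<^sub>0 rm" using x z by (auto simp: dist_norm norm_minus_commute)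
    note P = cm'[THEN conjunct2, rule_format, OF this]
    have "((\<lambda>y. cmat (Pm y z)) has_vector_derivative cmat (A 0 (0 - x) z) * cmat (Pm (0 - x) z) - cmat (Pm (0 - x) z) * cmat (Ainf z)) (at (0 - x) within {..0})"
      using cmat_has_vector_derivative[OF P[THEN conjunct1]] unfolding cmat_simps(2,3) by simp
    from has_vector_derivative_reflect[OF this, of "{0..l}"]
    show "((\<lambda>y. cmat (Pm (- y) z)) has_vector_derivative (- cmat (A 0 (- x) z)) * cmat (Pm (- x) z) - cmat (Pm (- x) z) * (- cmat (Ainf z))) (at x within {0..l})"
      by simp
    show "norm (cmat (Pm (- x) z)) \<le> N * Km" "norm (cmat (matrix_inv (Pm (- x) z))) \<le> N * Km"
      by (rule cm; use P in blast)+
    have i: "invertible (Pm (- x) z)" using P by blast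
    show "cmat (matrix_inv (Pm (- x) z)) * cmat (Pm (- x) z) = 1" "cmat (Pm (- x) z) * cmat (matrix_inv (Pm (- x) z)) = 1"
      unfolding cmat_simps(3)[symmetric] matrix_inv_mult[OF i] cmat_simps(5) by (rule refl)+
    have "norm (Pm (- x) z - mat 1) \<le> Km * exp (- \<beta> * x)" using P x by simp
    from cm[OF this] show "norm (cmat (Pm (- x) z) - 1) \<le> N * (Km * exp (- \<beta> * x))" unfolding cmat_simps(2,5) .
  qed
  define K where "K = K1 + N * \<bar>Kp\<bar> + N * \<bar>Km\<bar> + K2 + N * C3"
  have nn: "0 \<le> N * \<bar>Kp\<bar>" "0 \<le> N * \<bar>Km\<bar>" "0 \<le> N * C3" using N C3(1) by auto
  have K: "K1 \<le> K" "N * Kp \<le> K" "N * Km \<le> K" "K2 \<le> K" "N * C3 \<le> K"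
    using nn K1 K2(1) mult_left_mono[OF abs_ge_self[of Kp] N] mult_left_mono[OF abs_ge_self[of Km] N] unfolding K_def by linarith+
  have close: "norm (cmat (A s x z) - cmat (A 0 x z)) \<le> K * exp (- \<theta> * X s / 2)"
    if "s > 0" "\<bar>x\<bar> \<le> X s / 2" "norm (z - \<zeta>\<^sub>0) < 1" for s x z
  proof -
    have "norm z \<le> norm \<zeta>\<^sub>0 + 3" using norm_triangle_ineq[of "z - \<zeta>\<^sub>0" "\<zeta>\<^sub>0"] that(3) by simp
    from cm[OF C3(2)[OF that(1) conjI[OF this that(2)]]]
    have "norm (cmat (A s x z) - cmat (A 0 x z)) \<le> N * (C3 * exp (- \<theta> * X s / 2))" unfolding cmat_simps(2) .
    also have "\<dots> = (N * C3) * exp (- \<theta> * X s / 2)" by simp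
    also have "\<dots> \<le> K * exp (- \<theta> * X s / 2)" by (rule mult_right_mono[OF K(5)]) simp
    finally show ?thesis .
  qed
  have Xpos: "X s > 0" and Aan: "matrix_analytic_on (A s x) UNIV" and per: "A s (x + X s) z = A s x z" if "s > 0" for s x z
    using family that unfolding wave_family_def by auto
  have sol: "solution_operator (A s) (\<Psi> s)" and X2: "X s / 2 \<ge> 0" if "s > 0" for s
    using solution Xpos[OF that] that by auto
  have Cs: "\<forall>x z. \<bar>x\<bar> \<le> X s / 2 \<longrightarrow> norm (z - \<zeta>\<^sub>0) < 3 \<longrightarrow> norm (cmat (A s x z)) \<le> C" if "s > 0" for s using C that by blast
  note \<Psi>0 = solution_operator_zero[OF sol Aan X2 Cs]
    and \<Psi>fw = solution_operator_forward[OF sol Aan X2 Cs]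
    and \<Psi>bw = solution_operator_backward[OF sol Aan X2 Cs, where a = 0, simplified]
    and \<Psi>inv = solution_operator_inverse[OF sol Aan X2 Cs]
    and \<Psi>an = solution_operator_analytic[OF sol Aan X2 Cs]

  \<comment> \<open>The hypotheses of the determinant asymptotics along the filter\<close>
  define p where "p t = cmat (\<Pi>su (fst (snd t)))" for t :: "real \<times> complex \<times> complex"
  define c where "c t = cmat (\<Pi>c (fst (snd t)))" for t :: "real \<times> complex \<times> complex"
  define q where "q t = cmat (\<Pi>ss (fst (snd t)))" for t :: "real \<times> complex \<times> complex"
  define a where "a t = cmat (Ainf (fst (snd t)))" for t :: "real \<times> complex \<times> complex"
  define \<mu> where "\<mu> t = muc (fst (snd t))" for t :: "real \<times> complex \<times> complex"
  define \<gamma> where "\<gamma> t = snd (snd t)" for t :: "real \<times> complex \<times> complex"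
  define Yp where "Yp t x = cmat (\<Psi> (fst t) x (fst (snd t)))" for t :: "real \<times> complex \<times> complex" and x
  define Ym where "Ym t x = cmat (\<Psi> (fst t) (- x) (fst (snd t)))" for t :: "real \<times> complex \<times> complex" and x
  define Qp where "Qp t x = cmat (Pp x (fst (snd t)))" for t :: "real \<times> complex \<times> complex" and x
  define Qm where "Qm t x = cmat (Pm (- x) (fst (snd t)))" for t :: "real \<times> complex \<times> complex" and x
  note defs = p_def c_def q_def a_def \<mu>_def \<gamma>_def Yp_def Ym_def Qp_def Qm_def
  note split' = near[OF split]
  have sp: "\<forall>\<^sub>F t in F. splitting (p t) (c t) (q t)" unfolding defs using split' by eventually_elim blast
  have com: "\<forall>\<^sub>F t in F. a t * p t = p t * a t \<and> a t * c t = sc (\<mu> t) * c t \<and> a t * c t = c t * a t \<and> a t * q t = q t * a t"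
    unfolding defs using split' by eventually_elim blast
  have bd: "\<forall>\<^sub>F t in F. norm (p t) \<le> K \<and> norm (c t) \<le> K \<and> norm (q t) \<le> K \<and> norm (a t) \<le> K"
    unfolding defs using split' by eventually_elim (use K(1) in \<open>blast intro: order_trans\<close>)
  have rank: "\<forall>\<^sub>F t in F. (\<exists>u w. \<forall>i j. ent (c t) i j = u i * w j) \<and> c t \<noteq> 0"
    unfolding defs using split' by eventually_elim blast
  have mu: "\<forall>\<^sub>F t in F. \<bar>Re (\<mu> t)\<bar> \<le> K / sqrt (L t)"
    using near[OF K2(2)] base eventually_L_ge[of 1]
  proof eventually_elim
    case (elim t)
    have "\<bar>Re (\<mu> t)\<bar> \<le> K2 * norm (fst (snd t) - \<zeta>\<^sub>0)" unfolding defs by (rule elim(1))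
    also have "\<dots> \<le> K * (1 / sqrt (L t))" using elim K(4) K2(1) by (intro mult_mono) auto
    finally show ?case by simp
  qed
  have gam: "\<forall>\<^sub>F t in F. norm (\<gamma> t) = 1" unfolding defs using base by eventually_elim blast
  have decay: "\<forall>\<^sub>F t in F. \<forall>x\<ge>0. norm (exp ((- x) *\<^sub>R a t) * p t) \<le> K * exp (- \<alpha> * x) \<and>
        norm (exp (x *\<^sub>R a t) * q t) \<le> K * exp (- \<alpha> * x)"
    using split'
  proof eventually_elim
    case (elim t)
    have "K1 * exp (- \<alpha> * x) \<le> K * exp (- \<alpha> * x)" for x by (rule mult_right_mono[OF K(1)]) simp
    then show ?case unfolding defs using elim by (blast intro: order_trans)
  qed
  have odep: "\<forall>\<^sub>F t in F. Yp t 0 = 1 \<and> (\<forall>x\<in>{0..L t / 2}.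
        (Yp t has_vector_derivative cmat (A (fst t) x (fst (snd t))) * Yp t x) (at x within {0..L t / 2}) \<and>
        (Qp t has_vector_derivative cmat (A 0 x (fst (snd t))) * Qp t x - Qp t x * a t) (at x within {0..L t / 2}) \<and>
        has_inverse (Yp t x) \<and> cmat (matrix_inv (Pp x (fst (snd t)))) * Qp t x = 1 \<and> Qp t x * cmat (matrix_inv (Pp x (fst (snd t)))) = 1 \<and>
        norm (Qp t x) \<le> K \<and> norm (cmat (matrix_inv (Pp x (fst (snd t))))) \<le> K \<and>
        norm (cmat (A (fst t) x (fst (snd t))) - cmat (A 0 x (fst (snd t)))) \<le> K * exp (- \<theta> * L t / 2))"
    using base near[OF radius[OF rp]] near[OF radius[OF zero_less_one]]
  proof eventually_elim
    case (elim t)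
    have s: "fst t > 0" and z3: "norm (fst (snd t) - \<zeta>\<^sub>0) < 3" using elim(1,3) by auto
    show ?case
    proof (intro conjI ballI)
      show "Yp t 0 = 1" unfolding defs by (rule \<Psi>0[OF s s s s])
      fix x assume x: "x \<in> {0..L t / 2}"
      then have x0: "0 \<le> x" and xl: "\<bar>x\<bar> \<le> X (fst t) / 2" and xm: "x \<in> {0..X (fst t) / 2}" by (auto simp: L_def)
      note P = Ppf[OF x0 elim(2)]
      show "(Yp t has_vector_derivative cmat (A (fst t) x (fst (snd t))) * Yp t x) (at x within {0..L t / 2})"
        unfolding defs by (rule \<Psi>fw[OF s s s s])
      show "(Qp t has_vector_derivative cmat (A 0 x (fst (snd t))) * Qp t x - Qp t x * a t) (at x within {0..L t / 2})"
        unfolding defs by (rule P(1))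
      show "has_inverse (Yp t x)" unfolding defs using \<Psi>inv[OF s s s s xm z3] by (rule conjunct1)
      show "cmat (matrix_inv (Pp x (fst (snd t)))) * Qp t x = 1" "Qp t x * cmat (matrix_inv (Pp x (fst (snd t)))) = 1"
        unfolding defs by (rule P)+
      show "norm (Qp t x) \<le> K" "norm (cmat (matrix_inv (Pp x (fst (snd t))))) \<le> K"
        unfolding defs by (rule order_trans[OF P(2) K(2)] order_trans[OF P(3) K(2)])+
      show "norm (cmat (A (fst t) x (fst (snd t))) - cmat (A 0 x (fst (snd t)))) \<le> K * exp (- \<theta> * L t / 2)"
        unfolding L_def by (rule close[OF s xl elim(3)])
    qed
  qed
  have odem: "\<forall>\<^sub>F t in F. Ym t 0 = 1 \<and> (\<forall>x\<in>{0..L t / 2}.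
        (Ym t has_vector_derivative (- cmat (A (fst t) (- x) (fst (snd t)))) * Ym t x) (at x within {0..L t / 2}) \<and>
        (Qm t has_vector_derivative (- cmat (A 0 (- x) (fst (snd t)))) * Qm t x - Qm t x * (- a t)) (at x within {0..L t / 2}) \<and>
        has_inverse (Ym t x) \<and> cmat (matrix_inv (Pm (- x) (fst (snd t)))) * Qm t x = 1 \<and> Qm t x * cmat (matrix_inv (Pm (- x) (fst (snd t)))) = 1 \<and>
        norm (Qm t x) \<le> K \<and> norm (cmat (matrix_inv (Pm (- x) (fst (snd t))))) \<le> K \<and>
        norm (- cmat (A (fst t) (- x) (fst (snd t))) - (- cmat (A 0 (- x) (fst (snd t))))) \<le> K * exp (- \<theta> * L t / 2))"
    using base near[OF radius[OF rm]] near[OF radius[OF zero_less_one]]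
  proof eventually_elim
    case (elim t)
    have s: "fst t > 0" and z3: "norm (fst (snd t) - \<zeta>\<^sub>0) < 3" using elim(1,3) by auto
    show ?case
    proof (intro conjI ballI)
      show "Ym t 0 = 1" unfolding defs using \<Psi>0[OF s s s s] by simp
      fix x assume x: "x \<in> {0..L t / 2}"
      then have x0: "0 \<le> x" and xl: "\<bar>- x\<bar> \<le> X (fst t) / 2" and xm: "x \<in> {0..X (fst t) / 2}" by (auto simp: L_def)
      note P = Pmf[OF x0 elim(2)]
      show "(Ym t has_vector_derivative (- cmat (A (fst t) (- x) (fst (snd t)))) * Ym t x) (at x within {0..L t / 2})"
        unfolding defs using \<Psi>bw[OF s s s s] by simp
      show "(Qm t has_vector_derivative (- cmat (A 0 (- x) (fst (snd t)))) * Qm t x - Qm t x * (- a t)) (at x within {0..L t / 2})"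
        unfolding defs by (rule P(1))
      show "has_inverse (Ym t x)" unfolding defs using \<Psi>inv[OF s s s s xm z3] by (rule conjunct2)
      show "cmat (matrix_inv (Pm (- x) (fst (snd t)))) * Qm t x = 1" "Qm t x * cmat (matrix_inv (Pm (- x) (fst (snd t)))) = 1"
        unfolding defs by (rule P)+
      show "norm (Qm t x) \<le> K" "norm (cmat (matrix_inv (Pm (- x) (fst (snd t))))) \<le> K"
        unfolding defs by (rule order_trans[OF P(2) K(3)] order_trans[OF P(3) K(3)])+
      have "norm (- cmat (A (fst t) (- x) (fst (snd t))) - (- cmat (A 0 (- x) (fst (snd t))))) =
          norm (cmat (A (fst t) (- x) (fst (snd t))) - cmat (A 0 (- x) (fst (snd t))))"
        by (simp add: norm_minus_commute)
      also have "\<dots> \<le> K * exp (- \<theta> * L t / 2)" unfolding L_def by (rule close[OF s xl elim(3)])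
      finally show "norm (- cmat (A (fst t) (- x) (fst (snd t))) - (- cmat (A 0 (- x) (fst (snd t))))) \<le> K * exp (- \<theta> * L t / 2)" .
    qed
  qed
  \<comment> \<open>The conjugators are evaluated at distance \<open>L / 2\<close>, so their decay
    rate \<open>\<beta>\<close> counts only half.\<close>
  have \<beta>2: "\<beta> / 2 > 0" using \<beta> by simp
  have Ps: "small (\<lambda>t. Qp t (L t / 2) - 1)"
  proof (rule small_bound_K[OF \<beta>2])
    show "\<forall>\<^sub>F t in F. norm (Qp t (L t / 2) - 1) \<le> (N * Kp) * exp (- (\<beta> / 2) * L t)"
      using eventually_L_ge[of 0] near[OF radius[OF rp]]
    proof eventually_elim
      case (elim t)
      then have "0 \<le> L t / 2" by simp
      from Ppf(6)[OF this elim(2)] show ?case unfolding defs by (simp add: mult.assoc)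
    qed
  qed
  have Ms: "small (\<lambda>t. Qm t (L t / 2) - 1)"
  proof (rule small_bound_K[OF \<beta>2])
    show "\<forall>\<^sub>F t in F. norm (Qm t (L t / 2) - 1) \<le> (N * Km) * exp (- (\<beta> / 2) * L t)"
      using eventually_L_ge[of 0] near[OF radius[OF rm]]
    proof eventually_elim
      case (elim t)
      then have "0 \<le> L t / 2" by simp
      from Pmf(6)[OF this elim(2)] show ?case unfolding defs by (simp add: mult.assoc)
    qed
  qed
  note det = asymptotic_determinant[OF rates(2) \<alpha> sp com bd rank mu gam decay odep odem Ps Ms]
  obtain \<eta>0 where \<eta>0: "\<eta>0 > 0" and det2: "\<forall>\<^sub>F t in F.
      norm (exp (of_real (L t / 2) * \<mu> t) * cdet (Qp t 0) * cdet (Qm t 0) /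
        (cdet (p t * (Yp t (L t / 2) * Qp t 0) * p t + 1 - p t) * cdet (q t * (Ym t (L t / 2) * Qm t 0) * q t + 1 - q t) *
          cdet (p t + c t - sc (\<gamma> t) * q t)) * cdet (Yp t (L t / 2) - sc (\<gamma> t) * Ym t (L t / 2)) -
        (exp (\<mu> t * of_real (L t)) * cdet (Qm t 0 * (p t + c t) + Qp t 0 * q t) - \<gamma> t * cdet (Qm t 0 * p t + Qp t 0 * (c t + q t))))
      \<le> exp (- \<eta>0 * L t)"
    using det(2) unfolding small_def by (elim exE conjE) (rule that, assumption+)

  \<comment> \<open>Analyticity of the multiplier and of the periodic Evans function\<close>
  define hp where "hp s z = cdet (cmat (\<Pi>su z) * (cmat (\<Psi> s (X s / 2) z) * cmat (Pp 0 z)) * cmat (\<Pi>su z) + 1 - cmat (\<Pi>su z))" for s z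
  define hm where "hm s z = cdet (cmat (\<Pi>ss z) * (cmat (\<Psi> s (- (X s / 2)) z) * cmat (Pm 0 z)) * cmat (\<Pi>ss z) + 1 - cmat (\<Pi>ss z))" for s z
  define S where "S g z = cdet (cmat (\<Pi>su z) + cmat (\<Pi>c z) - sc g * cmat (\<Pi>ss z))" for g z
  \<comment> \<open>The last factor converts the periodic Evans function into the determinant of
    \<open>\<Psi> (X / 2) - \<gamma> \<Psi> (- X / 2)\<close>, by
    \<open>periodic_evans_factor\<close>.\<close>
  define mult where "mult s g z = exp (of_real (X s / 2) * muc z) * cdet (cmat (Pp 0 z)) * cdet (cmat (Pm 0 z)) /
      (hp s z * hm s z * S g z) * cdet (cmat (\<Psi> s (- (X s / 2)) z))" for s g z
  \<comment> \<open>Analytic dependence is available for \<open>\<Psi>\<close> at the two half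
    periods only, so the periodic Evans function is expressed as a quotient of determinants formed
    there.\<close>
  have fan: "periodic_evans (\<Psi> s) (X s) g analytic_on ball \<zeta>\<^sub>0 1" if s: "s > 0" for s g
  proof -
    have nz: "cdet (cmat (\<Psi> s (- (X s / 2)) z)) \<noteq> 0" if "z \<in> ball \<zeta>\<^sub>0 1" for z
    proof -
      have "norm (z - \<zeta>\<^sub>0) < 3" "X s / 2 \<in> {0..X s / 2}" using that X2[OF s] by (auto simp: dist_norm norm_minus_commute)
      from \<Psi>inv[OF s s s s this(2,1)] show ?thesis by (simp add: has_inverse_iff_cdet)
    qed
    have "(\<lambda>z. cdet (cmat (\<Psi> s (X s / 2) z) - sc g * cmat (\<Psi> s (- (X s / 2)) z)) / cdet (cmat (\<Psi> s (- (X s / 2)) z))) analytic_on ball \<zeta>\<^sub>0 1"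
    proof (intro analytic_on_divide cdet_analytic)
      show "(\<lambda>z. ent (cmat (\<Psi> s (X s / 2) z) - sc g * cmat (\<Psi> s (- (X s / 2)) z)) i j) analytic_on ball \<zeta>\<^sub>0 1" for i j
        unfolding ent_simps ent_sc_mult by (intro analytic_on_diff analytic_on_mult analytic_on_const \<Psi>an[OF s s s s])
    qed (use nz \<Psi>an[OF s s s s] in auto)
    then have "(\<lambda>z. cdet (cmat (\<Psi> s (X s / 2) z) - sc g * cmat (\<Psi> s (- (X s / 2)) z)) / cdet (cmat (\<Psi> s (- (X s / 2)) z))) holomorphic_on ball \<zeta>\<^sub>0 1"
      by (rule analytic_imp_holomorphic)
    then have "periodic_evans (\<Psi> s) (X s) g holomorphic_on ball \<zeta>\<^sub>0 1"
    proof (rule holomorphic_transform)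
      fix z assume z: "z \<in> ball \<zeta>\<^sub>0 1"
      have "norm (z - \<zeta>\<^sub>0) < 3" using z by (simp add: dist_norm norm_minus_commute)
      from periodic_evans_factor[OF sol Aan X2 Cs per this, OF s s s s s] nz[OF z]
      show "cdet (cmat (\<Psi> s (X s / 2) z) - sc g * cmat (\<Psi> s (- (X s / 2)) z)) / cdet (cmat (\<Psi> s (- (X s / 2)) z)) = periodic_evans (\<Psi> s) (X s) g z"
        by simp
    qed
    then show ?thesis by (simp add: analytic_on_open)
  qed

  \<comment> \<open>Uniform comparison with the model\<close>
  have Pan': "\<forall>\<^sub>F z in nhds \<zeta>\<^sub>0. \<forall>i j. (\<lambda>z. ent (cmat (Q z)) i j) analytic_on {z}" if "matrix_analytic_on Q {\<zeta>\<^sub>0}" for Q :: "complex \<Rightarrow> complex^'n^'n"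
    unfolding cmat_simps using that by (intro eventually_all_finite eventually_analytic_at) (simp add: matrix_analytic_on_def)
  have "\<forall>\<^sub>F t in F. periodic_evans (\<Psi> (fst t)) (X (fst t)) (\<gamma> t) analytic_on {fst (snd t)} \<and>
      mult (fst t) (\<gamma> t) analytic_on {fst (snd t)} \<and> mult (fst t) (\<gamma> t) (fst (snd t)) \<noteq> 0 \<and>
      norm (mult (fst t) (\<gamma> t) (fst (snd t)) * periodic_evans (\<Psi> (fst t)) (X (fst t)) (\<gamma> t) (fst (snd t)) -
        (exp (muc (fst (snd t)) * of_real (X (fst t))) * hom_evans_1 Pm Pp \<Pi>c \<Pi>ss \<Pi>su (fst (snd t)) -
          \<gamma> t * hom_evans_2 Pm Pp \<Pi>c \<Pi>ss \<Pi>su (fst (snd t)))) \<le> exp (- \<eta>0 * X (fst t))"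
    using det(1) det2 base sp near[OF radius[OF rp]] near[OF radius[OF rm]] near[OF radius[OF zero_less_one]]
      near[OF Pan'[OF Pan(1)]] near[OF Pan'[OF Pan(2)]] near[OF Pan'[OF Pan(3)]] near[OF eventually_analytic_at[OF arc'(2)]]
  proof eventually_elim
    case (elim t)
    obtain s z g where t: "t = (s, z, g)" by (cases t) auto
    have s: "s > 0" using elim(3) t by simp
    have z: "norm (z - \<zeta>\<^sub>0) < rp" "norm (z - \<zeta>\<^sub>0) < rm" "norm (z - \<zeta>\<^sub>0) < 1" using elim(5-7) t by auto
    then have zb: "z \<in> ball \<zeta>\<^sub>0 rp" "z \<in> ball \<zeta>\<^sub>0 rm" "z \<in> ball \<zeta>\<^sub>0 1" and z3: "norm (z - \<zeta>\<^sub>0) < 3"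
      by (auto simp: dist_norm norm_minus_commute)
    have nz: "hp s z \<noteq> 0" "hm s z \<noteq> 0" "S g z \<noteq> 0" "cdet (cmat (Pp 0 z)) \<noteq> 0" "cdet (cmat (Pm 0 z)) \<noteq> 0"
      using elim(1) unfolding defs L_def t hp_def hm_def S_def by simp_all
    have "X s / 2 \<in> {0..X s / 2}" using X2[OF s] by simp
    from \<Psi>inv[OF s s s s this z3] have nz\<Psi>: "cdet (cmat (\<Psi> s (- (X s / 2)) z)) \<noteq> 0" by (simp add: has_inverse_iff_cdet)
    have an\<Pi>: "(\<lambda>z. ent (cmat (\<Pi>c z)) i j) analytic_on {z}" "(\<lambda>z. ent (cmat (\<Pi>ss z)) i j) analytic_on {z}"
      "(\<lambda>z. ent (cmat (\<Pi>su z)) i j) analytic_on {z}" and anmu: "muc analytic_on {z}" for i j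
      using elim(8-11) t by auto
    have anP: "(\<lambda>z. ent (cmat (Pp 0 z)) i j) analytic_on {z}" "(\<lambda>z. ent (cmat (Pm 0 z)) i j) analytic_on {z}" for i j
      unfolding cmat_simps
      by (rule analytic_on_subset[of _ "ball \<zeta>\<^sub>0 rp"], use cp zb in \<open>simp add: matrix_analytic_on_def\<close>, use zb in simp)
         (rule analytic_on_subset[of _ "ball \<zeta>\<^sub>0 rm"], use cm' zb in \<open>simp add: matrix_analytic_on_def\<close>, use zb in simp)
    have an\<Psi>: "(\<lambda>z. ent (cmat (\<Psi> s (X s / 2) z)) i j) analytic_on {z}" "(\<lambda>z. ent (cmat (\<Psi> s (- (X s / 2)) z)) i j) analytic_on {z}" for i j
      by (rule analytic_on_subset[OF \<Psi>an(1)[OF s s s s]] analytic_on_subset[OF \<Psi>an(2)[OF s s s s]], use zb in simp)+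
    have anh: "hp s analytic_on {z}" "hm s analytic_on {z}" "S g analytic_on {z}"
      unfolding hp_def hm_def S_def
      by (rule cdet_analytic, unfold ent_simps ent_sc_mult,
          intro analytic_on_diff analytic_on_add analytic_on_mult analytic_on_const ent_mult_analytic an\<Pi> anP an\<Psi>)+
    have "mult s g analytic_on {z}"
      unfolding mult_def
    proof (intro analytic_on_mult analytic_on_divide cdet_analytic anP an\<Psi> anh)
      show "(\<lambda>z. exp (of_real (X s / 2) * muc z)) analytic_on {z}"
        by (intro analytic_intros anmu)
      show "hp s w * hm s w * S g w \<noteq> 0" if "w \<in> {z}" for w using nz that by simp
    qed
    moreover have "mult s g z \<noteq> 0" unfolding mult_def using nz nz\<Psi> by simp
    moreover have "periodic_evans (\<Psi> s) (X s) g analytic_on {z}"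
      by (rule analytic_on_subset[OF fan[OF s]]) (use zb in simp)
    moreover have "norm (mult s g z * periodic_evans (\<Psi> s) (X s) g z -
        (exp (muc z * of_real (X s)) * hom_evans_1 Pm Pp \<Pi>c \<Pi>ss \<Pi>su z - g * hom_evans_2 Pm Pp \<Pi>c \<Pi>ss \<Pi>su z)) \<le> exp (- \<eta>0 * X s)"
    proof -
      have sp': "splitting (cmat (\<Pi>su z)) (cmat (\<Pi>c z)) (cmat (\<Pi>ss z))" using elim(4) unfolding defs t by simp
      have e: "mult s g z * periodic_evans (\<Psi> s) (X s) g z = exp (of_real (X s / 2) * muc z) * cdet (cmat (Pp 0 z)) * cdet (cmat (Pm 0 z)) /
          (hp s z * hm s z * S g z) * cdet (cmat (\<Psi> s (X s / 2) z) - sc g * cmat (\<Psi> s (- (X s / 2)) z))"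
        unfolding mult_def periodic_evans_factor[OF sol Aan X2 Cs per z3, OF s s s s s] by (simp only: mult.assoc)
      show ?thesis
        using elim(2) unfolding e hom_evans_as_det[where \<Pi>su = \<Pi>su and \<Pi>c = \<Pi>c and \<Pi>ss = \<Pi>ss and z = z, OF sp'] unfolding defs L_def t hp_def hm_def S_def by simp
    qed
    ultimately show ?case unfolding t \<gamma>_def by simp
  qed
  then obtain X1 where X1: "\<forall>t. X1 \<le> X (fst t) \<longrightarrow> fst t > 0 \<and> norm (snd (snd t)) = 1 \<and>
      norm (fst (snd t) - \<zeta>\<^sub>0) \<le> 1 / sqrt (X (fst t)) \<longrightarrow>
      periodic_evans (\<Psi> (fst t)) (X (fst t)) (\<gamma> t) analytic_on {fst (snd t)} \<and>
      mult (fst t) (\<gamma> t) analytic_on {fst (snd t)} \<and> mult (fst t) (\<gamma> t) (fst (snd t)) \<noteq> 0 \<and>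
      norm (mult (fst t) (\<gamma> t) (fst (snd t)) * periodic_evans (\<Psi> (fst t)) (X (fst t)) (\<gamma> t) (fst (snd t)) -
        (exp (muc (fst (snd t)) * of_real (X (fst t))) * hom_evans_1 Pm Pp \<Pi>c \<Pi>ss \<Pi>su (fst (snd t)) -
          \<gamma> t * hom_evans_2 Pm Pp \<Pi>c \<Pi>ss \<Pi>su (fst (snd t)))) \<le> exp (- \<eta>0 * X (fst t))"
    unfolding evF by (rule exE)
  have main: "periodic_evans (\<Psi> s) (X s) g analytic_on {z} \<and> mult s g analytic_on {z} \<and> mult s g z \<noteq> 0 \<and>
      norm (mult s g z * periodic_evans (\<Psi> s) (X s) g z -
        (exp (muc z * of_real (X s)) * hom_evans_1 Pm Pp \<Pi>c \<Pi>ss \<Pi>su z - g * hom_evans_2 Pm Pp \<Pi>c \<Pi>ss \<Pi>su z)) \<le> exp (- \<eta>0 * X s)"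
    if "s > 0" "X s \<ge> X1" "norm g = 1" "norm (z - \<zeta>\<^sub>0) \<le> 1 / sqrt (X s)" for s g z
    using X1[rule_format, of "(s, z, g)"] that unfolding \<gamma>_def by simp

  \<comment> \<open>Transfer to the zeros of the periodic Evans function\<close>
  have cont: "isCont (lam j) k\<^sub>0"
    using curves arc'(1) by (auto simp: ess_spectrum_curves_def continuous_on_eq_continuous_at)
  note z1 = zero1[unfolded zero_of_degree_def] and z2 = zero2[unfolded zero_of_degree_def]
  show ?thesis
    using roots_near_arc[where S = "\<lambda>s. s > 0" and L = X and f = "\<lambda>s. periodic_evans (\<Psi> s) (X s)" and M = mult,
      OF arc'(2-4) cont point[symmetric] arc'(5) m z1[THEN conjunct1] z1[THEN conjunct2, THEN conjunct1] z1[THEN conjunct2, THEN conjunct2]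
        z2[THEN conjunct1] z2[THEN conjunct2, THEN conjunct1] z2[THEN conjunct2, THEN conjunct2] \<eta>0 main]
    unfolding zero_of_degree_def imp_conjL .
qed

end
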